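(* Let $k\ge1$, $w=k(k+1)/2$, $n=w(2w+1)$ and $\tau=\rho(2w-1)$. Then for any pair of partitions $\lambda,\mu$ with $c(\rho(k),\lambda,\mu^T)>0$ we have $$g(\rho(2w),\rho(2w),\tau^\lambda_\mu)\;\ge\; c(\rho(k),\lambda,\mu^T)\;>\;0 .$$
   Context: $\rho(j)=(j,j-1,\dots,2,1)$. For partitions, ${}^T$ denotes conjugation and sums are part by part. For $\tau=\rho(j)$ and partitions $\lambda,\mu$ with $\lambda^T_1+\mu_1\le j+1$, $\tau^\lambda_\mu=(\rho(j)+2\mu^T)^T+2\lambda$; here $j=2w-1$, and $\tau^\lambda_\mu$ is a partition of $n$. $c(\nu,\lambda,\mu)$ is the Littlewood--Richardson coefficient, the coefficient of the Schur function $s_\nu$ in $s_\lambda s_\mu$. The Kronecker coefficient $g(\lambda,\mu,\nu)$, for partitions of $n$, is the multiplicity of the irreducible complex character $\chi^\nu$ of $\mathfrak S_n$ in $\chi^\lambda\chi^\mu$. *)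

theory Defs
  imports
    Complex_Main
    "HOL-Library.FuncSet"
    "HOL-Library.More_List"
    "HOL-Library.Poly_Mapping"
    "HOL-Combinatorics.Permutations"
begin

section \<open>Partitions\<close>

text \<open>
  A partition is the list of its positive parts in weakly decreasing order.  Parts are indexed
  from 0; \<^term>\<open>nth_default 0 lam i\<close> is the part with index \<open>i\<close>, read as 0 beyond the last part.
\<close>

definition is_partition :: "nat list \<Rightarrow> bool" where
  "is_partition lam \<longleftrightarrow> sorted_wrt (\<ge>) lam \<and> 0 \<notin> set lam"

definition partitions_of :: "nat \<Rightarrow> nat list set" where
  "partitions_of n = {lam. is_partition lam \<and> sum_list lam = n}"

definition conjugate :: "nat list \<Rightarrow> nat list" where
  "conjugate lam = map (\<lambda>j. length (filter (\<lambda>p. j < p) lam)) [0..<nth_default 0 lam 0]"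

definition part_sum :: "nat list \<Rightarrow> nat list \<Rightarrow> nat list" where
  "part_sum lam mu =
     map (\<lambda>i. nth_default 0 lam i + nth_default 0 mu i) [0..<max (length lam) (length mu)]"

definition double_parts :: "nat list \<Rightarrow> nat list" where
  "double_parts lam = map ((*) 2) lam"

definition staircase :: "nat \<Rightarrow> nat list" where
  "staircase j = rev [1..<Suc j]"

text \<open>
  The partition written $\tau^\lambda_\mu = (\tau + 2\mu^T)^T + 2\lambda$.
\<close>

definition domino_extension :: "nat list \<Rightarrow> nat list \<Rightarrow> nat list \<Rightarrow> nat list" where
  "domino_extension tau lam mu = part_sum (conjugate (part_sum tau (double_parts (conjugate mu)))) (double_parts lam)"

definition cells :: "nat list \<Rightarrow> (nat \<times> nat) set" where
  "cells lam = {(i, j). i < length lam \<and> j < lam ! i}"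


section \<open>Schur functions and Littlewood--Richardson coefficients\<close>

text \<open>
  A formal power series with integer coefficients in variables $x_0, x_1, \dots$ is given by its
  coefficients, indexed by the exponent vectors of monomials.
\<close>

type_synonym series = "(nat \<Rightarrow>\<^sub>0 nat) \<Rightarrow> int"

definition series_mult :: "series \<Rightarrow> series \<Rightarrow> series" where
  "series_mult f g = (\<lambda>\<gamma>. \<Sum>(\<alpha>, \<beta>) | \<alpha> + \<beta> = \<gamma>. f \<alpha> * g \<beta>)"

definition semistandard :: "nat list \<Rightarrow> (nat \<times> nat \<Rightarrow> nat) set" where
  "semistandard lam = {T \<in> cells lam \<rightarrow>\<^sub>E UNIV.
     (\<forall>i j j'. j < j' \<and> (i, j) \<in> cells lam \<and> (i, j') \<in> cells lam \<longrightarrow> T (i, j) \<le> T (i, j')) \<and>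
     (\<forall>i i' j. i < i' \<and> (i, j) \<in> cells lam \<and> (i', j) \<in> cells lam \<longrightarrow> T (i, j) < T (i', j))}"

definition schur :: "nat list \<Rightarrow> series" where
  "schur lam = (\<lambda>\<alpha>. int (card {T \<in> semistandard lam.
     \<forall>i. card {x \<in> cells lam. T x = i} = Poly_Mapping.lookup \<alpha> i}))"

text \<open>
  The Schur functions are linearly independent over the integers and span a subring, so exactly
  one finitely supported family \<open>c\<close> satisfies the description.
\<close>

definition lr_coeff :: "nat list \<Rightarrow> nat list \<Rightarrow> nat list \<Rightarrow> int" where
  "lr_coeff nu lam mu =
     Poly_Mapping.lookup (THE c :: nat list \<Rightarrow>\<^sub>0 int.
       Poly_Mapping.keys c \<subseteq> {kappa. is_partition kappa} \<and>
       series_mult (schur lam) (schur mu) =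
         (\<lambda>\<gamma>. \<Sum>kappa\<in>Poly_Mapping.keys c. Poly_Mapping.lookup c kappa * schur kappa \<gamma>)) nu"


section \<open>Specht modules and Kronecker coefficients\<close>

text \<open>
  The symmetric group on \<open>n\<close> letters consists of the \<open>\<pi>\<close> with \<open>\<pi> permutes {..<n}\<close>.
  A tabloid is the list of the row sets of a tableau, and the permutation module
  is the complex vector space with the tabloids as basis.
\<close>

type_synonym tabloid = "nat set list"

type_synonym perm_module = "tabloid \<Rightarrow>\<^sub>0 complex"

definition scale_pm :: "complex \<Rightarrow> perm_module \<Rightarrow> perm_module" where
  "scale_pm c v = Poly_Mapping.map ((*) c) v"

lemma lookup_scale_pm [simp]:
  "Poly_Mapping.lookup (scale_pm c v) X = c * Poly_Mapping.lookup v X"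
  by (simp add: scale_pm_def map.rep_eq when_def)

interpretation pm: vector_space scale_pm
  by unfold_locales (auto intro!: poly_mapping_eqI simp: lookup_add algebra_simps)

definition perm_act :: "(nat \<Rightarrow> nat) \<Rightarrow> perm_module \<Rightarrow> perm_module" where
  "perm_act \<pi> v = (\<Sum>X\<in>Poly_Mapping.keys v. Poly_Mapping.single (map ((`) \<pi>) X) (Poly_Mapping.lookup v X))"

definition tableaux :: "nat list \<Rightarrow> (nat \<times> nat \<Rightarrow> nat) set" where
  "tableaux lam = {t \<in> extensional (cells lam). bij_betw t (cells lam) {..<sum_list lam}}"

definition tabloid_of :: "nat list \<Rightarrow> (nat \<times> nat \<Rightarrow> nat) \<Rightarrow> tabloid" where
  "tabloid_of lam t = map (\<lambda>i. {t (i, j) | j. (i, j) \<in> cells lam}) [0..<length lam]"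

definition column_stabilizer :: "nat list \<Rightarrow> (nat \<times> nat \<Rightarrow> nat) \<Rightarrow> (nat \<Rightarrow> nat) set" where
  "column_stabilizer lam t = {\<pi>. \<pi> permutes {..<sum_list lam} \<and>
     (\<forall>j. \<pi> ` {t (i, j) | i. (i, j) \<in> cells lam} = {t (i, j) | i. (i, j) \<in> cells lam})}"

definition polytabloid :: "nat list \<Rightarrow> (nat \<times> nat \<Rightarrow> nat) \<Rightarrow> perm_module" where
  "polytabloid lam t = (\<Sum>\<pi>\<in>column_stabilizer lam t.
     Poly_Mapping.single (map ((`) \<pi>) (tabloid_of lam t)) (of_int (sign \<pi>)))"

definition specht :: "nat list \<Rightarrow> perm_module set" where
  "specht lam = pm.span (polytabloid lam ` tableaux lam)"

text \<open>
  The trace of a linear map preserving the finite-dimensional subspace \<open>V\<close>; it does not depend on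
  the chosen basis.
\<close>

definition trace_on :: "perm_module set \<Rightarrow> (perm_module \<Rightarrow> perm_module) \<Rightarrow> complex" where
  "trace_on V f = (let B = (SOME B. pm.independent B \<and> pm.span B = V)
     in \<Sum>b\<in>B. pm.representation B (f b) b)"

definition irr_char :: "nat list \<Rightarrow> (nat \<Rightarrow> nat) \<Rightarrow> complex" where
  "irr_char lam \<pi> = trace_on (specht lam) (perm_act \<pi>)"

text \<open>
  For partitions \<open>lam\<close> and \<open>mu\<close> of \<open>n\<close>, the multiplicities \<open>m\<close> are those in the decomposition of
  the product of the two characters into irreducible characters; they exist because the product is
  a character, and are unique because irreducible characters are linearly independent.
\<close>

definition kronecker :: "nat \<Rightarrow> nat list \<Rightarrow> nat list \<Rightarrow> nat list \<Rightarrow> nat" where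
  "kronecker n lam mu nu =
     (THE m :: nat list \<Rightarrow> nat.
       (\<forall>kappa. kappa \<notin> partitions_of n \<longrightarrow> m kappa = 0) \<and>
       (\<forall>\<pi>. \<pi> permutes {..<n} \<longrightarrow>
         irr_char lam \<pi> * irr_char mu \<pi> =
           (\<Sum>kappa\<in>partitions_of n. of_nat (m kappa) * irr_char kappa \<pi>))) nu"

end

(*
  The irreducible characters are identified with the Jacobi-Trudi sums of permutation characters:
  both are class functions of norm 1 with the same pairing with a Young symmetrizer. Let F be the
  square of the character of the staircase rho(2w). By the Murnaghan-Nakayama rule F vanishes on all
  permutations with an even cycle, since a staircase has no even rim hooks. Hence adding 2r-hooks in
  all possible ways to the beads of a partition and pairing with F gives 0, so up to sign 2r-hooks can
  be moved from the even beads to the odd beads. The beads of the domino extension of tau by lambda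
  and mu are the beads of mu (even) and of lambda (odd), so moving all of mu expresses its Kronecker
  coefficient as the sum over alpha of c(alpha, lambda, mu^T) times the Kronecker coefficient of the
  domino extension of tau by alpha and the empty partition. All terms are nonnegative. For
  alpha = rho(k) the last coefficient is positive: for two explicit tableaux of shapes rho(2w) and
  rho(2w - 1) + 2 rho(k) the product of the squared first and the second polytabloid is a sum without
  cancellation, and the Kronecker coefficient is the norm of a projection of a vector pairing to it.
*)

theory Submission imports Defs "HOL-Combinatorics.Combinatorics" begin

section \<open>Permutation characters\<close>

text \<open>All characters are handled as integer-valued functions of an integer vector, one entry
  per bead. On such vectors antisymmetry replaces sorting, a repeated or negative entry gives 0, and
  a rim hook changes a single entry. No denominators appear: multiplicities are carried multiplied
  by factorials, and positivity comes from kernels that are sums of squares up to a positive factor.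
  Littlewood-Richardson coefficients enter because hooks are moved in families. All cycles of a
  permutation \<open>t\<close> of \<open>b\<close> points move together; averaging against the
  character of \<open>mu\<close> selects \<open>mu\<close> on the even beads, while the sign
  collected by the cycles of \<open>t\<close> conjugates \<open>mu\<close> on the odd side. The
  overall sign of the resulting identity is never computed: both sides are nonnegative, so they
  agree. There are \<open>2 * w - 1\<close> more odd than even beads, which encodes the 2-core
  \<open>tau\<close>. The squares in the explicit tableau are sums of consecutive odd numbers:
  compressing the \<open>t\<close>-th of the last \<open>k\<close> columns empties
  \<open>2 * t + 1\<close> rows, and these gaps must tile the lower rows.\<close>

definition cnt :: "'s set \<Rightarrow> ('s \<Rightarrow> 'l) \<Rightarrow> 'l \<Rightarrow> int" where
  "cnt S f l = int (card {s \<in> S. f s = l})"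

definition fixfun :: "'s set \<Rightarrow> 'l set \<Rightarrow> ('s \<Rightarrow> 's) \<Rightarrow> ('s \<Rightarrow> 'l) set" where
  "fixfun S J p = {f \<in> S \<rightarrow>\<^sub>E J. \<forall>s\<in>S. f (p s) = f s}"

text \<open>The character of the permutation module on the words of content \<open>\<gamma>\<close>.\<close>

definition phi :: "'s set \<Rightarrow> 'l set \<Rightarrow> ('l \<Rightarrow> int) \<Rightarrow> ('s \<Rightarrow> 's) \<Rightarrow> int" where
  "phi S J \<gamma> p = int (card {f \<in> fixfun S J p. \<forall>l\<in>J. cnt S f l = \<gamma> l})"

lemma finite_fixfun [simp]: "finite S \<Longrightarrow> finite J \<Longrightarrow> finite (fixfun S J p)"
  unfolding fixfun_def by (rule finite_subset[of _ "S \<rightarrow>\<^sub>E J"]) (auto intro: finite_PiE)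

lemma sum_cnt:
  assumes "finite S" "finite J" "f \<in> S \<rightarrow> J"
  shows "(\<Sum>l\<in>J. cnt S f l) = int (card S)"
proof -
  have "card S = (\<Sum>l\<in>J. card {s \<in> S. f s = l})"
    using assms by (subst card_eq_sum, subst sum.group[symmetric, of S J f]) auto
  then show ?thesis by (simp add: cnt_def)
qed

lemma phi_eq_0:
  assumes "finite S" "finite J" "(\<Sum>l\<in>J. \<gamma> l) \<noteq> int (card S)"
  shows "phi S J \<gamma> p = 0"
proof -
  have "{f \<in> fixfun S J p. \<forall>l\<in>J. cnt S f l = \<gamma> l} = {}"
  proof -
    have False if "f \<in> fixfun S J p" "\<forall>l\<in>J. cnt S f l = \<gamma> l" for f
      using sum_cnt[of S J f] that assms by (auto simp: fixfun_def PiE_def)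
    then show ?thesis by blast
  qed
  then show ?thesis unfolding phi_def by (metis card.empty of_nat_0)
qed

lemma phi_neg: "l \<in> J \<Longrightarrow> \<gamma> l < 0 \<Longrightarrow> phi S J \<gamma> p = 0"
  unfolding phi_def cnt_def by (smt (verit) card.empty empty_Collect_eq of_nat_0 of_nat_0_le_iff)

lemma phi_cong: "(\<And>l. l \<in> J \<Longrightarrow> \<gamma> l = \<gamma>' l) \<Longrightarrow> phi S J \<gamma> p = phi S J \<gamma>' p"
  unfolding phi_def by (intro arg_cong[where f="\<lambda>x. int (card x)"]) auto

lemma cnt_insert:
  assumes "finite S" "a \<notin> S"
  shows "cnt (insert a S) f l = cnt S f l + (if f a = l then 1 else 0)"
proof -
  have "{s \<in> insert a S. f s = l} = (if f a = l then insert a {s \<in> S. f s = l} else {s \<in> S. f s = l})"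
    by auto
  then show ?thesis using assms by (auto simp: cnt_def)
qed

lemma cnt_cong: "(\<And>s. s \<in> S \<Longrightarrow> f s = g s) \<Longrightarrow> cnt S f l = cnt S g l"
  unfolding cnt_def by (intro arg_cong[where f="\<lambda>x. int (card x)"]) auto

text \<open>Every permutation of \<open>insert a S\<close> has the form
  \<open>transpose a b \<circ> q\<close>, with \<open>a\<close> spliced into the cycle of
  \<open>b\<close>. A word fixed by it is a word fixed by \<open>q\<close> with the letter of
  \<open>b\<close> repeated at \<open>a\<close>; for \<open>b = a\<close> the letter at
  \<open>a\<close> is free. This is the induction step of \<open>sum_permutes_phi\<close>.\<close>

lemma phi_insert_transpose:
  assumes "finite S" "finite J" "a \<notin> S" "b \<in> insert a S" "q permutes S"
  shows "phi (insert a S) J \<gamma> (transpose a b \<circ> q) =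
    (\<Sum>l\<in>J. int (card {g \<in> fixfun S J q. (b \<noteq> a \<longrightarrow> g b = l) \<and>
        (\<forall>l'\<in>J. cnt S g l' = \<gamma> l' - (if l' = l then 1 else 0))}))"
proof -
  let ?X = "{f \<in> fixfun (insert a S) J (transpose a b \<circ> q). \<forall>l\<in>J. cnt (insert a S) f l = \<gamma> l}"
  let ?Y = "\<lambda>l. {g \<in> fixfun S J q. (b \<noteq> a \<longrightarrow> g b = l) \<and>
        (\<forall>l'\<in>J. cnt S g l' = \<gamma> l' - (if l' = l then 1 else 0))}"
  have qa: "q a = a" using assms by (meson permutes_not_in)
  have qS: "q s \<in> S" if "s \<in> S" for s using that assms by (simp add: permutes_in_image)
  have fixed: "(\<forall>s\<in>insert a S. f ((transpose a b \<circ> q) s) = f s) \<longleftrightarrow> f b = f a \<and> (\<forall>s\<in>S. f (q s) = f s)"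
    for f :: "'a \<Rightarrow> 'b"
  proof -
    have *: "f (transpose a b (q s)) = (if q s = b then f a else f (q s))" if "s \<in> S" for s
      using qS[OF that] assms(3) by (auto simp: transpose_def)
    have 1: "\<exists>s\<in>S. q s = b" if "b \<noteq> a" using that assms(4,5) by (metis permutes_image imageE insertE)
    have 2: "(f ((transpose a b \<circ> q) a) = f a) \<longleftrightarrow> f b = f a" by (simp add: qa)
    have "(\<forall>s\<in>insert a S. f ((transpose a b \<circ> q) s) = f s) \<longleftrightarrow>
        f b = f a \<and> (\<forall>s\<in>S. (if q s = b then f a else f (q s)) = f s)"
      using 2 * by simp
    also have "\<dots> \<longleftrightarrow> f b = f a \<and> (\<forall>s\<in>S. f (q s) = f s)"
      by (metis)
    finally show ?thesis .
  qed
  have "bij_betw (\<lambda>(l, g). g(a := l)) (Sigma J ?Y) ?X"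
  proof (rule bij_betw_byWitness[where f' = "\<lambda>f. (f a, restrict f S)"])
    show "\<forall>x\<in>Sigma J ?Y. (\<lambda>f. (f a, restrict f S)) ((\<lambda>(l, g). g(a := l)) x) = x"
    proof (clarsimp)
      fix l g assume "g \<in> fixfun S J q"
      then have "g \<in> extensional S" by (auto simp: fixfun_def PiE_def)
      then show "restrict (g(a := l)) S = g" using assms(3)
        by (auto simp: restrict_def extensional_def fun_eq_iff)
    qed
    show "\<forall>x\<in>?X. (\<lambda>(l, g). g(a := l)) ((\<lambda>f. (f a, restrict f S)) x) = x"
      by (auto simp: fixfun_def PiE_def extensional_def fun_eq_iff)
    show "(\<lambda>(l, g). g(a := l)) ` Sigma J ?Y \<subseteq> ?X"
    proof (rule subsetI)
      fix h assume "h \<in> (\<lambda>(l, g). g(a := l)) ` Sigma J ?Y"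
      then obtain l g where h: "h = g(a := l)" and l: "l \<in> J" and g: "g \<in> fixfun S J q" "b \<noteq> a \<longrightarrow> g b = l"
        "\<forall>l'\<in>J. cnt S g l' = \<gamma> l' - (if l' = l then 1 else 0)" by fastforce
      have gE: "g \<in> S \<rightarrow>\<^sub>E J" using g by (simp add: fixfun_def)
      have "g(a := l) \<in> insert a S \<rightarrow>\<^sub>E J" using gE l by (auto simp: PiE_iff extensional_def)
      moreover have "\<forall>s\<in>insert a S. (g(a := l)) ((transpose a b \<circ> q) s) = (g(a := l)) s"
        unfolding fixed using g assms(3,4) qS by (auto simp: fixfun_def)
      moreover have "cnt (insert a S) (g(a := l)) l' = \<gamma> l'" if "l' \<in> J" for l'
      proof -
        have "cnt S (g(a := l)) l' = cnt S g l'" by (rule cnt_cong) (use assms in auto)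
        then show ?thesis using g(3) that assms by (auto simp: cnt_insert)
      qed
      ultimately show "h \<in> ?X" unfolding h by (simp add: fixfun_def)
    qed
    show "(\<lambda>f. (f a, restrict f S)) ` ?X \<subseteq> Sigma J ?Y"
    proof (rule subsetI)
      fix h assume "h \<in> (\<lambda>f. (f a, restrict f S)) ` ?X"
      then obtain f where h: "h = (f a, restrict f S)"
        and f: "f \<in> fixfun (insert a S) J (transpose a b \<circ> q)" "\<forall>l\<in>J. cnt (insert a S) f l = \<gamma> l"
        by blast
      have f1: "f \<in> insert a S \<rightarrow>\<^sub>E J" and f2: "f b = f a" "\<forall>s\<in>S. f (q s) = f s"
        using f(1) fixed by (auto simp: fixfun_def simp del: o_apply)
      have "cnt S (restrict f S) l' = \<gamma> l' - (if l' = f a then 1 else 0)" if "l' \<in> J" for l'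
      proof -
        have "cnt S (restrict f S) l' = cnt S f l'" by (rule cnt_cong) auto
        then show ?thesis using f(2) that assms by (auto simp: cnt_insert)
      qed
      moreover have "f a \<in> J" using f1 by auto
      moreover have "restrict f S \<in> fixfun S J q" using f1 f2(2) qS by (auto simp: fixfun_def)
      moreover have "b \<noteq> a \<longrightarrow> restrict f S b = f a" using f2(1) assms(4) by (metis insertE restrict_apply)
      ultimately show "h \<in> Sigma J ?Y" unfolding h by simp
    qed
  qed
  then have "card ?X = card (Sigma J ?Y)" by (rule bij_betw_same_card[symmetric])
  also have "\<dots> = (\<Sum>l\<in>J. card (?Y l))"
    using assms by (intro card_SigmaI) auto
  finally show ?thesis by (simp add: phi_def)
qed

text \<open>Burnside's lemma for the action on the words of one content, which has a single orbit.
  The induction removes one point; its letter \<open>l\<close> is counted with weight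
  \<open>\<gamma> l\<close>, and these weights add up to the number of points.\<close>

lemma sum_permutes_phi:
  assumes "finite S" "finite J" "\<And>l. l \<in> J \<Longrightarrow> \<gamma> l \<ge> 0" "(\<Sum>l\<in>J. \<gamma> l) = int (card S)"
  shows "(\<Sum>p | p permutes S. phi S J \<gamma> p) = fact (card S)"
  using assms(1,3,4)
proof (induction S arbitrary: \<gamma> rule: finite_induct)
  case empty
  then have "\<gamma> l = 0" if "l \<in> J" for l
    using that assms(2) sum_nonneg_eq_0_iff[of J \<gamma>] by auto
  then have "{f \<in> fixfun {} J id. \<forall>l\<in>J. cnt {} f l = \<gamma> l} = {\<lambda>x. undefined}"
    by (auto simp: fixfun_def cnt_def)
  then have "phi {} J \<gamma> id = 1" unfolding phi_def by (metis card_1_singleton_iff One_nat_def of_nat_1)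
  then show ?case by (simp add: id_def)
next
  case (insert a S)
  let ?g = "\<lambda>l l'. \<gamma> l' - (if l' = l then 1 else 0)"
  let ?Y = "\<lambda>q l b. {g \<in> fixfun S J q. (b \<noteq> a \<longrightarrow> g b = l) \<and> (\<forall>l'\<in>J. cnt S g l' = ?g l l')}"
  \<comment> \<open>Summed over \<open>b\<close> in \<open>S\<close>, the condition
    \<open>g b = l\<close> counts the \<open>\<gamma> l - 1\<close> positions of \<open>l\<close> in
    \<open>g\<close>; the case \<open>b = a\<close> adds one.\<close>
  have step: "(\<Sum>b\<in>insert a S. int (card (?Y q l b))) = \<gamma> l * phi S J (?g l) q"
    if q: "q permutes S" and l: "l \<in> J" for q l
  proof -
    let ?Z = "{g \<in> fixfun S J q. \<forall>l'\<in>J. cnt S g l' = ?g l l'}"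
    have fz: "finite ?Z" using insert assms by auto
    have "(\<Sum>b\<in>S. int (card (?Y q l b))) = (\<Sum>b\<in>S. \<Sum>g\<in>?Z. if g b = l then 1 else 0)"
    proof (rule sum.cong[OF refl])
      fix b assume "b \<in> S"
      then have "?Y q l b = {g \<in> ?Z. g b = l}" using insert by auto
      then show "int (card (?Y q l b)) = (\<Sum>g\<in>?Z. if g b = l then 1 else 0)"
        using fz by (simp add: sum.If_cases Int_def)
    qed
    also have "\<dots> = (\<Sum>g\<in>?Z. \<Sum>b\<in>S. if g b = l then 1 else 0)" by (rule sum.swap)
    also have "\<dots> = (\<Sum>g\<in>?Z. \<gamma> l - 1)"
    proof (rule sum.cong[OF refl])
      fix g assume "g \<in> ?Z"
      then have "cnt S g l = \<gamma> l - 1" using l by simp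
      then show "(\<Sum>b\<in>S. if g b = l then 1 else 0) = \<gamma> l - 1"
        using insert(1) by (simp add: cnt_def sum.If_cases Int_def)
    qed
    also have "\<dots> = (\<gamma> l - 1) * phi S J (?g l) q" by (simp add: phi_def)
    finally have "(\<Sum>b\<in>S. int (card (?Y q l b))) = (\<gamma> l - 1) * phi S J (?g l) q" .
    moreover have "?Y q l a = ?Z" by auto
    ultimately show ?thesis using insert by (simp add: phi_def algebra_simps)
  qed
  have "(\<Sum>p | p permutes insert a S. phi (insert a S) J \<gamma> p) =
    (\<Sum>b\<in>insert a S. \<Sum>q | q permutes S. \<Sum>l\<in>J. int (card (?Y q l b)))"
    unfolding sum_over_permutations_insert[OF insert(1,2)]
    by (intro sum.cong refl phi_insert_transpose) (use insert assms in auto)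
  also have "\<dots> = (\<Sum>q | q permutes S. \<Sum>l\<in>J. \<Sum>b\<in>insert a S. int (card (?Y q l b)))"
    by (subst sum.swap, rule sum.cong[OF refl], rule sum.swap)
  also have "\<dots> = (\<Sum>q | q permutes S. \<Sum>l\<in>J. \<gamma> l * phi S J (?g l) q)"
    by (intro sum.cong refl step) auto
  also have "\<dots> = (\<Sum>l\<in>J. \<gamma> l * (\<Sum>q | q permutes S. phi S J (?g l) q))"
    by (subst sum.swap) (simp add: sum_distrib_left)
  also have "\<dots> = (\<Sum>l\<in>J. \<gamma> l * fact (card S))"
  proof (rule sum.cong[OF refl])
    fix l assume l: "l \<in> J"
    show "\<gamma> l * (\<Sum>q | q permutes S. phi S J (?g l) q) = \<gamma> l * fact (card S)"
    proof (cases "\<gamma> l = 0")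
      case False
      then have "\<gamma> l \<ge> 1" using insert(4)[OF l] by simp
      then have "(\<Sum>q | q permutes S. phi S J (?g l) q) = fact (card S)"
      proof (intro insert.IH)
        show "(\<Sum>l'\<in>J. ?g l l') = int (card S)"
          using insert(1,2,5) assms(2) l by (simp add: sum_subtractf)
      qed (use insert(4) in auto)
      then show ?thesis by simp
    qed simp
  qed
  also have "\<dots> = fact (card (insert a S))"
    using insert by (simp flip: sum_distrib_right)
  finally show ?case .
qed

section \<open>Contingency matrices and products of permutation characters\<close>

definition Mset :: "'i set \<Rightarrow> 'j set \<Rightarrow> ('i \<Rightarrow> int) \<Rightarrow> ('j \<Rightarrow> int) \<Rightarrow> ('i \<times> 'j \<Rightarrow> nat) set" where
  "Mset I J \<alpha> \<gamma> = {A \<in> (I \<times> J) \<rightarrow>\<^sub>E UNIV. (\<forall>i\<in>I. (\<Sum>j\<in>J. int (A (i, j))) = \<alpha> i) \<and>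
     (\<forall>j\<in>J. (\<Sum>i\<in>I. int (A (i, j))) = \<gamma> j)}"

lemma Mset_le:
  assumes "finite J" "A \<in> Mset I J \<alpha> \<gamma>" "i \<in> I" "j \<in> J"
  shows "int (A (i, j)) \<le> \<alpha> i"
proof -
  have "int (A (i, j)) \<le> (\<Sum>j\<in>J. int (A (i, j)))"
    using assms by (intro member_le_sum) auto
  then show ?thesis using assms by (auto simp: Mset_def)
qed

lemma finite_Mset [simp]:
  assumes "finite I" "finite J"
  shows "finite (Mset I J \<alpha> \<gamma>)"
proof (rule finite_subset)
  show "Mset I J \<alpha> \<gamma> \<subseteq> (I \<times> J) \<rightarrow>\<^sub>E {..nat (Max (\<alpha> ` I))}"
  proof
    fix A assume A: "A \<in> Mset I J \<alpha> \<gamma>"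
    have "A (i, j) \<le> nat (Max (\<alpha> ` I))" if "i \<in> I" "j \<in> J" for i j
    proof -
      have "\<alpha> i \<le> Max (\<alpha> ` I)" using that assms(1) by simp
      then show ?thesis using Mset_le[OF assms(2) A that] by linarith
    qed
    then show "A \<in> (I \<times> J) \<rightarrow>\<^sub>E {..nat (Max (\<alpha> ` I))}"
      using A by (auto simp: Mset_def PiE_iff)
  qed
qed (use assms in \<open>auto intro!: finite_PiE\<close>)

lemma Mset_cong:
  "(\<And>i. i \<in> I \<Longrightarrow> \<alpha> i = \<alpha>' i) \<Longrightarrow> (\<And>j. j \<in> J \<Longrightarrow> \<gamma> j = \<gamma>' j) \<Longrightarrow> Mset I J \<alpha> \<gamma> = Mset I J \<alpha>' \<gamma>'"
  unfolding Mset_def by auto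

lemma Mset_neg: "i \<in> I \<Longrightarrow> \<alpha> i < 0 \<Longrightarrow> Mset I J \<alpha> \<gamma> = {}"
  unfolding Mset_def by (auto, metis (mono_tags, lifting) linorder_not_le of_nat_0_le_iff sum_nonneg)

lemma Mset_total:
  assumes "finite I" "finite J" "A \<in> Mset I J \<alpha> \<gamma>"
  shows "(\<Sum>x\<in>I \<times> J. int (A x)) = (\<Sum>i\<in>I. \<alpha> i)" "(\<Sum>x\<in>I \<times> J. int (A x)) = (\<Sum>j\<in>J. \<gamma> j)"
proof -
  have e: "(\<Sum>x\<in>I \<times> J. int (A x)) = (\<Sum>i\<in>I. \<Sum>j\<in>J. int (A (i, j)))"
    using assms by (simp add: sum.cartesian_product)
  show "(\<Sum>x\<in>I \<times> J. int (A x)) = (\<Sum>i\<in>I. \<alpha> i)"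
    unfolding e using assms by (intro sum.cong) (auto simp: Mset_def)
  show "(\<Sum>x\<in>I \<times> J. int (A x)) = (\<Sum>j\<in>J. \<gamma> j)"
    unfolding e using assms by (subst sum.swap, intro sum.cong) (auto simp: Mset_def)
qed

lemma cnt_fst:
  assumes "finite S" "finite J" "h \<in> S \<rightarrow> I \<times> J"
  shows "cnt S (\<lambda>s. fst (h s)) i = (\<Sum>j\<in>J. cnt S h (i, j))"
proof -
  have "{s \<in> S. fst (h s) = i} = (\<Union>j\<in>J. {s \<in> S. h s = (i, j)})"
    using assms(3) by (auto simp: Pi_iff mem_Times_iff prod_eq_iff)
  moreover have "card (\<Union>j\<in>J. {s \<in> S. h s = (i, j)}) = (\<Sum>j\<in>J. card {s \<in> S. h s = (i, j)})"
    using assms by (intro card_UN_disjoint) auto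
  ultimately show ?thesis by (simp add: cnt_def)
qed

lemma cnt_snd:
  assumes "finite S" "finite I" "h \<in> S \<rightarrow> I \<times> J"
  shows "cnt S (\<lambda>s. snd (h s)) j = (\<Sum>i\<in>I. cnt S h (i, j))"
proof -
  have "{s \<in> S. snd (h s) = j} = (\<Union>i\<in>I. {s \<in> S. h s = (i, j)})"
    using assms(3) by (auto simp: Pi_iff mem_Times_iff prod_eq_iff)
  moreover have "card (\<Union>i\<in>I. {s \<in> S. h s = (i, j)}) = (\<Sum>i\<in>I. card {s \<in> S. h s = (i, j)})"
    using assms by (intro card_UN_disjoint) auto
  ultimately show ?thesis by (simp add: cnt_def)
qed

text \<open>A pair of words fixed by \<open>p\<close> is one fixed word in the letters
  \<open>I \<times> J\<close>. Its letter counts form a matrix whose margins are the two contents,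
  and sorting the pairs by this matrix is the double coset decomposition of the product.\<close>

lemma phi_mult:
  assumes S: "finite S" and I: "finite I" and J: "finite J" and p: "p permutes S"
  shows "phi S I \<alpha> p * phi S J \<gamma> p = (\<Sum>A\<in>Mset I J \<alpha> \<gamma>. phi S (I \<times> J) (\<lambda>x. int (A x)) p)"
proof -
  let ?X = "{f \<in> fixfun S I p. \<forall>l\<in>I. cnt S f l = \<alpha> l}"
  let ?Y = "{f \<in> fixfun S J p. \<forall>l\<in>J. cnt S f l = \<gamma> l}"
  let ?Z = "{h \<in> fixfun S (I \<times> J) p. (\<forall>i\<in>I. cnt S (\<lambda>s. fst (h s)) i = \<alpha> i) \<and> (\<forall>j\<in>J. cnt S (\<lambda>s. snd (h s)) j = \<gamma> j)}"
  have pS: "p s \<in> S" if "s \<in> S" for s using that p by (simp add: permutes_in_image)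
  have "bij_betw (\<lambda>h. (restrict (\<lambda>s. fst (h s)) S, restrict (\<lambda>s. snd (h s)) S)) ?Z (?X \<times> ?Y)"
  proof (rule bij_betw_byWitness[where f' = "\<lambda>(f, g). restrict (\<lambda>s. (f s, g s)) S"])
    show "\<forall>a\<in>?Z. (\<lambda>(f, g). restrict (\<lambda>s. (f s, g s)) S) (restrict (\<lambda>s. fst (a s)) S, restrict (\<lambda>s. snd (a s)) S) = a"
      by (auto simp: fixfun_def PiE_def extensional_def fun_eq_iff)
    show "\<forall>a\<in>?X \<times> ?Y. (restrict (\<lambda>s. fst ((case a of (f, g) \<Rightarrow> restrict (\<lambda>s. (f s, g s)) S) s)) S,
          restrict (\<lambda>s. snd ((case a of (f, g) \<Rightarrow> restrict (\<lambda>s. (f s, g s)) S) s)) S) = a"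
      by (auto simp: fixfun_def PiE_def extensional_def fun_eq_iff)
    have c1: "cnt S (restrict (\<lambda>s. fst (h s)) S) i = cnt S (\<lambda>s. fst (h s)) i"
      "cnt S (restrict (\<lambda>s. snd (h s)) S) j = cnt S (\<lambda>s. snd (h s)) j" for h i j
      by (auto intro!: cnt_cong)
    show "(\<lambda>h. (restrict (\<lambda>s. fst (h s)) S, restrict (\<lambda>s. snd (h s)) S)) ` ?Z \<subseteq> ?X \<times> ?Y"
      using pS by (auto simp: fixfun_def c1 PiE_iff mem_Times_iff)
    have c2: "cnt S (\<lambda>s. fst (restrict (\<lambda>s. (f s, g s)) S s)) i = cnt S f i"
      "cnt S (\<lambda>s. snd (restrict (\<lambda>s. (f s, g s)) S s)) j = cnt S g j" for f g i j
      by (auto intro!: cnt_cong)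
    show "(\<lambda>(f, g). restrict (\<lambda>s. (f s, g s)) S) ` (?X \<times> ?Y) \<subseteq> ?Z"
      unfolding image_subset_iff by (clarsimp simp only: mem_Times_iff split_paired_all mem_Collect_eq fst_conv snd_conv c2)
        (use pS in \<open>auto simp: fixfun_def PiE_iff\<close>)
  qed
  then have "card ?Z = card ?X * card ?Y" by (simp add: bij_betw_same_card card_cartesian_product)
  moreover have "card ?Z = (\<Sum>A\<in>Mset I J \<alpha> \<gamma>. card {h \<in> fixfun S (I \<times> J) p. \<forall>l\<in>I \<times> J. cnt S h l = int (A l)})"
  proof -
    let ?c = "\<lambda>h. restrict (\<lambda>x. card {s \<in> S. h s = x}) (I \<times> J)"
    have m: "?c h \<in> Mset I J \<alpha> \<gamma>" if "h \<in> ?Z" for h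
    proof -
      have "h \<in> S \<rightarrow> I \<times> J" using that by (auto simp: fixfun_def)
      then show ?thesis using that cnt_fst[OF S J, of h I] cnt_snd[OF S I, of h J]
        by (auto simp: Mset_def cnt_def)
    qed
    have "card ?Z = (\<Sum>A\<in>Mset I J \<alpha> \<gamma>. card {h \<in> ?Z. ?c h = A})"
      using S I J m by (subst card_eq_sum, subst sum.group[symmetric, of ?Z "Mset I J \<alpha> \<gamma>" ?c]) auto
    also have "\<dots> = (\<Sum>A\<in>Mset I J \<alpha> \<gamma>. card {h \<in> fixfun S (I \<times> J) p. \<forall>l\<in>I \<times> J. cnt S h l = int (A l)})"
    proof (rule sum.cong[OF refl])
      fix A assume A: "A \<in> Mset I J \<alpha> \<gamma>"
      have "h \<in> ?Z \<and> ?c h = A \<longleftrightarrow> h \<in> fixfun S (I \<times> J) p \<and> (\<forall>l\<in>I \<times> J. cnt S h l = int (A l))" for h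
      proof (cases "h \<in> fixfun S (I \<times> J) p")
        case True
        have h: "h \<in> S \<rightarrow> I \<times> J" using True by (auto simp: fixfun_def)
        have ce: "?c h = A \<longleftrightarrow> (\<forall>l\<in>I \<times> J. cnt S h l = int (A l))"
          using A by (force simp: Mset_def cnt_def PiE_def extensional_def fun_eq_iff)
        show ?thesis
          using True A cnt_fst[OF S J h] cnt_snd[OF S I h] unfolding ce by (auto simp: Mset_def)
      qed auto
      then show "card {h \<in> ?Z. ?c h = A} = card {h \<in> fixfun S (I \<times> J) p. \<forall>l\<in>I \<times> J. cnt S h l = int (A l)}"
        by (intro arg_cong[where f=card]) blast
    qed
    finally show ?thesis .
  qed
  ultimately show ?thesis unfolding phi_def by (metis (no_types, lifting) of_nat_mult of_nat_sum sum.cong)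
qed

lemma sum_phi_phi:
  assumes "finite S" "finite I" "finite J" "(\<Sum>i\<in>I. \<alpha> i) = int (card S)"
  shows "(\<Sum>p | p permutes S. phi S I \<alpha> p * phi S J \<gamma> p) = fact (card S) * int (card (Mset I J \<alpha> \<gamma>))"
proof -
  have "(\<Sum>p | p permutes S. phi S I \<alpha> p * phi S J \<gamma> p) =
    (\<Sum>A\<in>Mset I J \<alpha> \<gamma>. \<Sum>p | p permutes S. phi S (I \<times> J) (\<lambda>x. int (A x)) p)"
    by (subst sum.swap, intro sum.cong refl phi_mult) (use assms in auto)
  also have "\<dots> = (\<Sum>A\<in>Mset I J \<alpha> \<gamma>. fact (card S))"
  proof (intro sum.cong refl sum_permutes_phi)
    fix A assume "A \<in> Mset I J \<alpha> \<gamma>"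
    then show "(\<Sum>x\<in>I \<times> J. int (A x)) = int (card S)" using Mset_total(1)[OF assms(2,3)] assms(4) by simp
  qed (use assms in auto)
  finally show ?thesis by simp
qed

text \<open>Each unit of an entry of the matrix is removed together with the units below it.\<close>

lemma card_Mset_rec:
  assumes "finite I" "finite J" "(\<Sum>i\<in>I. \<alpha> i) \<le> int R"
  shows "(\<Sum>i\<in>I. \<alpha> i) * int (card (Mset I J \<alpha> \<gamma>)) =
    (\<Sum>i\<in>I. \<Sum>j\<in>J. \<Sum>r\<in>{1..R}.
       int (card (Mset I J (\<alpha>(i := \<alpha> i - int r)) (\<gamma>(j := \<gamma> j - int r)))))"
proof -
  let ?M = "Mset I J \<alpha> \<gamma>"
  have e: "int (card {A \<in> ?M. r \<le> A (i, j)}) = int (card (Mset I J (\<alpha>(i := \<alpha> i - int r)) (\<gamma>(j := \<gamma> j - int r))))"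
    if ij: "i \<in> I" "j \<in> J" for i j r
  proof -
    let ?R = "{A \<in> ?M. r \<le> A (i, j)}" and ?S = "Mset I J (\<alpha>(i := \<alpha> i - int r)) (\<gamma>(j := \<gamma> j - int r))"
    have s1: "(\<Sum>j'\<in>J. int ((A((i, j) := v)) (i', j'))) = (\<Sum>j'\<in>J. int (A (i', j'))) + (if i' = i then int v - int (A (i, j)) else 0)"
      for A :: "'a \<times> 'b \<Rightarrow> nat" and v i'
      using ij assms by (cases "i' = i") (auto simp: sum.remove[of J j])
    have s2: "(\<Sum>i'\<in>I. int ((A((i, j) := v)) (i', j'))) = (\<Sum>i'\<in>I. int (A (i', j'))) + (if j' = j then int v - int (A (i, j)) else 0)"
      for A :: "'a \<times> 'b \<Rightarrow> nat" and v j'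
      using ij assms by (cases "j' = j") (auto simp: sum.remove[of I i])
    have "bij_betw (\<lambda>A. A((i, j) := A (i, j) - r)) ?R
       (?S)"
    proof (rule bij_betw_byWitness[where f' = "\<lambda>A. A((i, j) := A (i, j) + r)"])
      show "(\<lambda>A. A((i, j) := A (i, j) - r)) ` ?R \<subseteq> ?S"
      proof (rule image_subsetI)
        fix A assume "A \<in> ?R"
        then show "A((i, j) := A (i, j) - r) \<in> ?S"
          unfolding Mset_def mem_Collect_eq s1 s2 using ij by (auto simp: PiE_iff extensional_def)
      qed
      show "(\<lambda>A. A((i, j) := A (i, j) + r)) ` ?S \<subseteq> ?R"
      proof (rule image_subsetI)
        fix A assume "A \<in> ?S"
        then show "A((i, j) := A (i, j) + r) \<in> ?R"
          unfolding Mset_def mem_Collect_eq s1 s2 using ij by (auto simp: PiE_iff extensional_def)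
      qed
    qed auto
    then show ?thesis by (simp add: bij_betw_same_card)
  qed
  have "(\<Sum>i\<in>I. \<Sum>j\<in>J. \<Sum>r\<in>{1..R}. int (card {A \<in> ?M. r \<le> A (i, j)})) =
    (\<Sum>i\<in>I. \<Sum>j\<in>J. \<Sum>r\<in>{1..R}. \<Sum>A\<in>?M. if r \<le> A (i, j) then 1 else 0)"
    using assms by (simp add: sum.If_cases Int_def)
  also have "\<dots> = (\<Sum>A\<in>?M. \<Sum>i\<in>I. \<Sum>j\<in>J. \<Sum>r\<in>{1..R}. if r \<le> A (i, j) then 1 else 0)"
    by (simp add: sum.swap[where B = ?M])
  also have "\<dots> = (\<Sum>A\<in>?M. \<Sum>i\<in>I. \<Sum>j\<in>J. int (A (i, j)))"
  proof (intro sum.cong refl)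
    fix A i j assume A: "A \<in> ?M" and ij: "i \<in> I" "j \<in> J"
    have nn: "\<alpha> i' \<ge> 0" if "i' \<in> I" for i' using Mset_neg[OF that, of \<alpha> J \<gamma>] A by (metis empty_iff not_le)
    have "int (A (i, j)) \<le> \<alpha> i" by (rule Mset_le[OF assms(2) A ij])
    also have "\<alpha> i \<le> (\<Sum>i\<in>I. \<alpha> i)" using ij nn assms by (intro member_le_sum) auto
    finally have "A (i, j) \<le> R" using assms(3) by simp
    then have "{r \<in> {1..R}. r \<le> A (i, j)} = {1..A (i, j)}" by auto
    then show "(\<Sum>r\<in>{1..R}. if r \<le> A (i, j) then 1 else 0) = int (A (i, j))"
      by (simp add: sum.If_cases Int_def)
  qed
  also have "\<dots> = (\<Sum>A\<in>?M. \<Sum>i\<in>I. \<alpha> i)"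
    by (intro sum.cong refl) (auto simp: Mset_def)
  finally have "(\<Sum>i\<in>I. \<Sum>j\<in>J. \<Sum>r\<in>{1..R}. int (card {A \<in> ?M. r \<le> A (i, j)})) = (\<Sum>i\<in>I. \<alpha> i) * int (card ?M)"
    by simp
  then show ?thesis using e by simp
qed

lemma phi_relabel:
  assumes "bij_betw v J J'" "p permutes S"
  shows "phi S J (\<lambda>l. \<gamma> (v l)) p = phi S J' \<gamma> p"
proof -
  let ?X = "{f \<in> fixfun S J p. \<forall>l\<in>J. cnt S f l = \<gamma> (v l)}"
  let ?Y = "{f \<in> fixfun S J' p. \<forall>l\<in>J'. cnt S f l = \<gamma> l}"
  have pS: "p s \<in> S" if "s \<in> S" for s using that assms by (simp add: permutes_in_image)
  have inj: "inj_on v J" and im: "v ` J = J'" using assms(1) by (auto simp: bij_betw_def)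
  have c: "cnt S (restrict (v \<circ> f) S) (v l) = cnt S f l" if "f \<in> S \<rightarrow> J" "l \<in> J" for f l
  proof -
    have "{s \<in> S. restrict (v \<circ> f) S s = v l} = {s \<in> S. f s = l}"
      using that inj by (auto simp: inj_on_eq_iff Pi_iff)
    then show ?thesis by (simp add: cnt_def)
  qed
  have "bij_betw (\<lambda>f. restrict (v \<circ> f) S) ?X ?Y"
  proof (rule bij_betw_byWitness[where f' = "\<lambda>f. restrict (inv_into J v \<circ> f) S"])
    show "\<forall>f\<in>?X. restrict (inv_into J v \<circ> restrict (v \<circ> f) S) S = f"
    proof
      fix f assume "f \<in> ?X"
      then have "f \<in> S \<rightarrow>\<^sub>E J" by (simp add: fixfun_def)
      then show "restrict (inv_into J v \<circ> restrict (v \<circ> f) S) S = f"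
        using inj by (auto simp: PiE_iff extensional_def fun_eq_iff)
    qed
    show "\<forall>f\<in>?Y. restrict (v \<circ> restrict (inv_into J v \<circ> f) S) S = f"
    proof
      fix f assume "f \<in> ?Y"
      then have "f \<in> S \<rightarrow>\<^sub>E J'" by (simp add: fixfun_def)
      then show "restrict (v \<circ> restrict (inv_into J v \<circ> f) S) S = f"
        using im by (auto simp: PiE_iff extensional_def fun_eq_iff f_inv_into_f)
    qed
    show "(\<lambda>f. restrict (v \<circ> f) S) ` ?X \<subseteq> ?Y"
    proof (rule image_subsetI)
      fix f assume f: "f \<in> ?X"
      then have fJ: "f \<in> S \<rightarrow> J" by (auto simp: fixfun_def)
      have "cnt S (restrict (v \<circ> f) S) l = \<gamma> l" if "l \<in> J'" for l
        using that im c[OF fJ] f by auto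
      then show "restrict (v \<circ> f) S \<in> ?Y" using f pS im by (auto simp: fixfun_def)
    qed
    show "(\<lambda>f. restrict (inv_into J v \<circ> f) S) ` ?Y \<subseteq> ?X"
    proof (rule image_subsetI)
      fix f assume f: "f \<in> ?Y"
      let ?g = "restrict (inv_into J v \<circ> f) S"
      have fJ: "f \<in> S \<rightarrow>\<^sub>E J'" using f by (auto simp: fixfun_def)
      have gJ: "?g \<in> S \<rightarrow> J" using fJ im by (auto simp: PiE_iff intro!: inv_into_into)
      have "restrict (v \<circ> ?g) S = f"
        using fJ im by (auto simp: PiE_iff extensional_def fun_eq_iff f_inv_into_f)
      then have "cnt S ?g l = \<gamma> (v l)" if "l \<in> J" for l
        using c[OF gJ that] f im that by auto
      moreover have "?g \<in> S \<rightarrow>\<^sub>E J" unfolding PiE_def using gJ by simp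
      then have "?g \<in> fixfun S J p" using f pS by (simp add: fixfun_def)
      ultimately show "?g \<in> ?X" by simp
    qed
  qed
  then show ?thesis by (simp add: phi_def bij_betw_same_card)
qed

section \<open>Jacobi-Trudi sums\<close>

definition dl :: "nat \<Rightarrow> nat \<Rightarrow> int" where
  "dl N i = int N - 1 - int i"

text \<open>The determinantal formula: if \<open>\<beta>\<close> is \<open>\<kappa> + dl N\<close> for a partition \<open>\<kappa>\<close> then \<open>psi S N \<beta>\<close> is \<open>\<chi>\<^sup>\<kappa>\<close>;
  the other \<open>\<beta>\<close> give \<open>0\<close> or a signed irreducible character.\<close>

definition psi :: "'s set \<Rightarrow> nat \<Rightarrow> (nat \<Rightarrow> int) \<Rightarrow> ('s \<Rightarrow> 's) \<Rightarrow> int" where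
  "psi S N \<beta> p = (\<Sum>w | w permutes {..<N}. sign w * phi S {..<N} (\<lambda>i. \<beta> i - dl N (w i)) p)"

text \<open>The value of the normalized pairing of two sums \<open>psi\<close>, see
  \<open>psi_orthonormal\<close>: the sign of the rearrangement that relates two vectors with
  distinct entries, and 0 if an entry repeats or the vectors are not rearrangements of each other.
  It is also the coefficient of a monomial in the determinant of the 1 / (1 - x_i y_j).\<close>

definition alt :: "nat \<Rightarrow> (nat \<Rightarrow> int) \<Rightarrow> (nat \<Rightarrow> int) \<Rightarrow> int" where
  "alt N \<alpha> \<beta> = (\<Sum>w | w permutes {..<N}. sign w * (if \<forall>i<N. \<alpha> i = \<beta> (w i) then 1 else 0))"

lemma fin_perm_N [simp]: "finite {w. w permutes {..<N::nat}}"
  by (rule finite_permutations) simp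

lemma permutation_N: "w permutes {..<N::nat} \<Longrightarrow> permutation w"
  using permutation_permutes by blast

lemma permutes_less: "w permutes {..<N::nat} \<Longrightarrow> i < N \<Longrightarrow> w i < N"
  using permutes_in_image[of w "{..<N}" i] by simp

lemma all_permutes: "w permutes {..<N::nat} \<Longrightarrow> (\<forall>i<N. P (w i)) \<longleftrightarrow> (\<forall>i<N. P i)"
  by (metis permutes_less permutes_inv permutes_inverses(1))

lemma sum_permutes_N: "w permutes {..<N::nat} \<Longrightarrow> (\<Sum>i<N. f (w i)) = (\<Sum>i<N. f i)"
  using sum.permute[of w "{..<N}" f] by (simp add: o_def)

lemma alt_cong:
  "(\<And>i. i < N \<Longrightarrow> \<alpha> i = \<alpha>' i) \<Longrightarrow> (\<And>i. i < N \<Longrightarrow> \<beta> i = \<beta>' i) \<Longrightarrow> alt N \<alpha> \<beta> = alt N \<alpha>' \<beta>'"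
  unfolding alt_def by (intro sum.cong refl) (auto simp: permutes_less)

lemma psi_cong:
  "(\<And>i. i < N \<Longrightarrow> \<beta> i = \<beta>' i) \<Longrightarrow> psi S N \<beta> p = psi S N \<beta>' p"
  unfolding psi_def by (intro sum.cong refl arg_cong[where f="times _"] phi_cong) auto

lemma alt_permute:
  assumes v: "v permutes {..<N}"
  shows "alt N (\<lambda>i. \<alpha> (v i)) \<beta> = sign v * alt N \<alpha> \<beta>"
proof -
  have "alt N (\<lambda>i. \<alpha> (v i)) \<beta> =
    (\<Sum>w | w permutes {..<N}. sign (w \<circ> v) * (if \<forall>i<N. \<alpha> (v i) = \<beta> ((w \<circ> v) i) then 1 else 0))"
    unfolding alt_def by (rule sum_permutations_compose_right[OF v])
  also have "\<dots> = (\<Sum>w | w permutes {..<N}. sign v * (sign w * (if \<forall>i<N. \<alpha> i = \<beta> (w i) then 1 else 0)))"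
  proof (intro sum.cong refl)
    fix w assume "w \<in> {w. w permutes {..<N}}"
    then show "sign (w \<circ> v) * (if \<forall>i<N. \<alpha> (v i) = \<beta> ((w \<circ> v) i) then 1 else 0) =
      sign v * (sign w * (if \<forall>i<N. \<alpha> i = \<beta> (w i) then 1 else 0))"
      using all_permutes[OF v, of "\<lambda>i. \<alpha> i = \<beta> (w i)"] v
      by (simp add: sign_compose permutation_N)
  qed
  finally show ?thesis by (simp add: alt_def sum_distrib_left)
qed

lemma alt_sym: "alt N \<alpha> \<beta> = alt N \<beta> \<alpha>"
proof -
  have "alt N \<alpha> \<beta> = (\<Sum>w | w permutes {..<N}. sign (inv w) * (if \<forall>i<N. \<alpha> i = \<beta> (inv w i) then 1 else 0))"
    unfolding alt_def by (rule sum_permutations_inverse)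
  also have "\<dots> = alt N \<beta> \<alpha>"
    unfolding alt_def
  proof (intro sum.cong refl)
    fix w assume "w \<in> {w. w permutes {..<N}}"
    then have w: "w permutes {..<N}" by simp
    have "(\<forall>i<N. \<alpha> i = \<beta> (inv w i)) \<longleftrightarrow> (\<forall>i<N. \<alpha> (w i) = \<beta> (inv w (w i)))"
      using all_permutes[OF w, of "\<lambda>i. \<alpha> i = \<beta> (inv w i)"] by simp
    then have "(\<forall>i<N. \<alpha> i = \<beta> (inv w i)) \<longleftrightarrow> (\<forall>i<N. \<beta> i = \<alpha> (w i))"
      using permutes_inverses(2)[OF w] by auto
    then show "sign (inv w) * (if \<forall>i<N. \<alpha> i = \<beta> (inv w i) then 1 else 0) =
      sign w * (if \<forall>i<N. \<beta> i = \<alpha> (w i) then 1 else 0)"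
      using w by (simp add: sign_inverse permutation_N)
  qed
  finally show ?thesis .
qed

lemma alt_repeat:
  assumes "i < N" "j < N" "i \<noteq> j" "\<alpha> i = \<alpha> j"
  shows "alt N \<alpha> \<beta> = 0"
proof -
  have "transpose i j permutes {..<N}" using assms by (intro permutes_swap_id) auto
  from alt_permute[OF this, of \<alpha> \<beta>] have "alt N (\<lambda>k. \<alpha> (transpose i j k)) \<beta> = - alt N \<alpha> \<beta>"
    using assms by (simp add: sign_swap_id)
  moreover have "(\<lambda>k. \<alpha> (transpose i j k)) = \<alpha>" using assms by (auto simp: transpose_def fun_eq_iff)
  ultimately show ?thesis by simp
qed

lemma psi_permute:
  assumes v: "v permutes {..<N}" and p: "p permutes S"
  shows "psi S N (\<lambda>i. \<beta> (v i)) p = sign v * psi S N \<beta> p"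
proof -
  have "psi S N (\<lambda>i. \<beta> (v i)) p =
    (\<Sum>w | w permutes {..<N}. sign (w \<circ> v) * phi S {..<N} (\<lambda>i. \<beta> (v i) - dl N ((w \<circ> v) i)) p)"
    unfolding psi_def by (rule sum_permutations_compose_right[OF v])
  also have "\<dots> = (\<Sum>w | w permutes {..<N}. sign v * (sign w * phi S {..<N} (\<lambda>i. \<beta> i - dl N (w i)) p))"
  proof (intro sum.cong refl)
    fix w assume w: "w \<in> {w. w permutes {..<N}}"
    have "phi S {..<N} (\<lambda>i. \<beta> (v i) - dl N ((w \<circ> v) i)) p = phi S {..<N} (\<lambda>i. \<beta> i - dl N (w i)) p"
      using phi_relabel[OF permutes_imp_bij[OF v] p, of "\<lambda>i. \<beta> i - dl N (w i)"] by simp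
    then show "sign (w \<circ> v) * phi S {..<N} (\<lambda>i. \<beta> (v i) - dl N ((w \<circ> v) i)) p =
      sign v * (sign w * phi S {..<N} (\<lambda>i. \<beta> i - dl N (w i)) p)"
      using v w by (simp add: sign_compose permutation_N)
  qed
  finally show ?thesis by (simp add: psi_def sum_distrib_left)
qed

lemma psi_repeat:
  assumes "i < N" "j < N" "i \<noteq> j" "\<beta> i = \<beta> j" "p permutes S"
  shows "psi S N \<beta> p = 0"
proof -
  have "transpose i j permutes {..<N}" using assms by (intro permutes_swap_id) auto
  from psi_permute[OF this assms(5), of \<beta>] have "psi S N (\<lambda>k. \<beta> (transpose i j k)) p = - psi S N \<beta> p"
    using assms by (simp add: sign_swap_id)
  moreover have "(\<lambda>k. \<beta> (transpose i j k)) = \<beta>" using assms by (auto simp: transpose_def fun_eq_iff)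
  ultimately show ?thesis by simp
qed

text \<open>Since \<open>dl N\<close> is nonnegative below \<open>N\<close>, a negative entry of
  \<open>\<beta>\<close> stays negative in every term of the determinant, and \<open>phi_neg\<close>
  removes them all.\<close>

lemma psi_neg: "i < N \<Longrightarrow> \<beta> i < 0 \<Longrightarrow> psi S N \<beta> p = 0"
  unfolding psi_def
proof (intro sum.neutral ballI)
  fix w assume i: "i < N" "\<beta> i < 0" and "w \<in> {w. w permutes {..<N}}"
  then have "w i < N" by (simp add: permutes_less)
  then have "\<beta> i - dl N (w i) < 0" using i by (simp add: dl_def)
  then show "sign w * phi S {..<N} (\<lambda>i. \<beta> i - dl N (w i)) p = 0"
    using phi_neg[of i "{..<N}" "\<lambda>i. \<beta> i - dl N (w i)"] i by simp
qed

lemma alt_total: "alt N \<alpha> \<beta> \<noteq> 0 \<Longrightarrow> (\<Sum>i<N. \<alpha> i) = (\<Sum>i<N. \<beta> i)"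
proof -
  assume "alt N \<alpha> \<beta> \<noteq> 0"
  then obtain w where w: "w permutes {..<N}" "\<forall>i<N. \<alpha> i = \<beta> (w i)"
    unfolding alt_def by (rule sum.not_neutral_contains_not_neutral) (auto split: if_splits)
  then show ?thesis using sum_permutes_N[OF w(1), of \<beta>] by simp
qed

lemma alt_dl_dl: "alt N (dl N) (dl N) = 1"
proof -
  have "(if \<forall>i<N. dl N i = dl N (w i) then 1 else 0) = (if w = id then 1 else (0::int))"
    if "w permutes {..<N}" for w
  proof -
    have "w = id" if "\<forall>i<N. dl N i = dl N (w i)"
    proof
      fix i show "w i = id i"
        using that \<open>w permutes {..<N}\<close> by (cases "i < N") (auto simp: dl_def permutes_def)
    qed
    then show ?thesis by auto
  qed
  then have "alt N (dl N) (dl N) = (\<Sum>w | w permutes {..<N}. sign w * (if w = id then 1 else 0))"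
    unfolding alt_def by (intro sum.cong) auto
  also have "\<dots> = (\<Sum>w | w permutes {..<N}. if w = id then 1 else 0)"
    by (intro sum.cong) auto
  also have "\<dots> = 1" using permutes_id by (subst sum.delta) auto
  finally show ?thesis by simp
qed

section \<open>Cauchy's determinant and the orthonormality of the Jacobi-Trudi sums\<close>

lemma sum_distinct_nat:
  fixes A :: "nat set"
  assumes "finite A"
  shows "\<Sum>{..<card A} \<le> \<Sum>A \<and> (\<Sum>A = \<Sum>{..<card A} \<longrightarrow> A = {..<card A})"
  using assms
proof (induction "card A" arbitrary: A)
  case (Suc n)
  let ?m = "Max A"
  have ne: "A \<noteq> {}" using Suc by auto
  have mA: "?m \<in> A" using Suc ne by simp
  have c: "card (A - {?m}) = n" using Suc mA by simp
  have ih: "\<Sum>{..<n} \<le> \<Sum>(A - {?m})" using Suc(1)[of "A - {?m}"] c Suc by simp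
  have s: "\<Sum>A = ?m + \<Sum>(A - {?m})" using Suc mA by (simp add: sum.remove)
  have sub: "A \<subseteq> {..?m}" using Suc by auto
  then have "card A \<le> Suc ?m" by (metis card_atMost card_mono finite_atMost)
  then have m: "n \<le> ?m" using Suc(2) by simp
  have "A = {..<Suc n}" if "\<Sum>A = \<Sum>{..<Suc n}"
  proof -
    have "?m = n" using that ih s m by simp
    then have "A \<subseteq> {..<Suc n}" using sub by auto
    then show ?thesis using Suc(2) by (metis card_lessThan card_subset_eq finite_lessThan)
  qed
  then show ?case using ih s m unfolding Suc(2)[symmetric] by simp
qed simp

text \<open>A nonzero \<open>alt\<close> forces distinct entries, and \<open>N\<close> distinct
  nonnegative integers have at least the total of \<open>dl N\<close>, with equality only for its
  rearrangements. This settles the start of the induction in \<open>Dm_eq_alt\<close>.\<close>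

lemma alt_nonneg_total:
  assumes nn: "\<And>i. i < N \<Longrightarrow> \<alpha> i \<ge> 0" and z: "alt N \<alpha> \<beta> \<noteq> 0"
  shows "(\<Sum>i<N. dl N i) \<le> (\<Sum>i<N. \<alpha> i)"
    and "(\<Sum>i<N. dl N i) = (\<Sum>i<N. \<alpha> i) \<Longrightarrow> \<exists>v. v permutes {..<N} \<and> (\<forall>i<N. \<alpha> i = dl N (v i))"
proof -
  have inj: "inj_on \<alpha> {..<N}" using alt_repeat[of _ N _ \<alpha> \<beta>] z by (auto simp: inj_on_def)
  let ?A = "(\<lambda>i. nat (\<alpha> i)) ` {..<N}"
  have inj': "inj_on (\<lambda>i. nat (\<alpha> i)) {..<N}" using inj nn by (auto simp: inj_on_def eq_nat_nat_iff)
  have c: "card ?A = N" using inj' by (simp add: card_image)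
  have s: "int (\<Sum>?A) = (\<Sum>i<N. \<alpha> i)" using inj' nn by (simp add: sum.reindex)
  have d: "(\<Sum>i<N. dl N i) = int (\<Sum>{..<N})"
  proof -
    have "(\<Sum>i<N. dl N i) = (\<Sum>i<N. int (N - Suc i))" by (intro sum.cong) (auto simp: dl_def)
    also have "\<dots> = int (\<Sum>i<N. i)" using sum.nat_diff_reindex[of int N] by simp
    finally show ?thesis by simp
  qed
  have fA: "finite ?A" by simp
  show "(\<Sum>i<N. dl N i) \<le> (\<Sum>i<N. \<alpha> i)"
    using conjunct1[OF sum_distinct_nat[OF fA]] unfolding c d s[symmetric] by (simp only: of_nat_le_iff)
  assume "(\<Sum>i<N. dl N i) = (\<Sum>i<N. \<alpha> i)"
  then have "\<Sum>?A = \<Sum>{..<card ?A}" unfolding c d s[symmetric] by (simp only: of_nat_eq_iff)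
  then have A: "?A = {..<N}" using sum_distinct_nat[OF fA] c by argo
  \<comment> \<open>Once the entries are exactly the numbers below \<open>N\<close>, the entry
    \<open>\<alpha> i\<close> occurs in the decreasing vector \<open>dl N\<close> at the place
    \<open>N - 1 - \<alpha> i\<close>.\<close>
  let ?v = "\<lambda>i. if i < N then N - 1 - nat (\<alpha> i) else i"
  have lt: "nat (\<alpha> i) < N" if "i < N" for i using A that by blast
  have "?v permutes {..<N}"
  proof (rule inj_imp_permutes)
    show "inj_on ?v {..<N}"
    proof (rule inj_onI)
      fix i j assume ij: "i \<in> {..<N}" "j \<in> {..<N}" "?v i = ?v j"
      then have "nat (\<alpha> i) = nat (\<alpha> j)" using lt[of i] lt[of j] by auto
      then show "i = j" using inj' ij by (auto simp: inj_on_def)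
    qed
  qed (use lt in auto)
  moreover have "\<alpha> i = dl N (?v i)" if "i < N" for i
    using lt[OF that] nn[OF that] that by (simp add: dl_def)
  ultimately show "\<exists>v. v permutes {..<N} \<and> (\<forall>i<N. \<alpha> i = dl N (v i))" by blast
qed

text \<open>The pairing of two Jacobi-Trudi sums divided by \<open>fact (card S)\<close>, with the
  points eliminated through \<open>sum_phi_phi\<close>. As a generating function it is the product
  of the alternants of \<open>dl N\<close> in two sets of variables with the Cauchy kernel, the
  product of all 1 / (1 - x_i y_j).\<close>

definition Dm :: "nat \<Rightarrow> (nat \<Rightarrow> int) \<Rightarrow> (nat \<Rightarrow> int) \<Rightarrow> int" where
  "Dm N \<alpha> \<beta> = (\<Sum>w | w permutes {..<N}. \<Sum>w' | w' permutes {..<N}. sign w * sign w' *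
     int (card (Mset {..<N} {..<N} (\<lambda>i. \<alpha> i - dl N (w i)) (\<lambda>i. \<beta> i - dl N (w' i)))))"

lemma Dm_neg: "i < N \<Longrightarrow> \<alpha> i < 0 \<Longrightarrow> Dm N \<alpha> \<beta> = 0"
proof -
  assume i: "i < N" "\<alpha> i < 0"
  have "Mset {..<N} {..<N} (\<lambda>i. \<alpha> i - dl N (w i)) \<gamma> = {}" if "w permutes {..<N}" for w \<gamma>
    using i permutes_less[OF that i(1)] by (intro Mset_neg[of i]) (auto simp: dl_def)
  then show ?thesis by (simp add: Dm_def)
qed

lemma Mset_swap: "card (Mset I J \<alpha> \<gamma>) = card (Mset J I \<gamma> \<alpha>)"
proof -
  have "bij_betw (\<lambda>A. restrict (\<lambda>(j, i). A (i, j)) (J \<times> I)) (Mset I J \<alpha> \<gamma>) (Mset J I \<gamma> \<alpha>)"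
    by (rule bij_betw_byWitness[where f' = "\<lambda>A. restrict (\<lambda>(i, j). A (j, i)) (I \<times> J)"])
      (auto simp: Mset_def PiE_iff extensional_def fun_eq_iff)
  then show ?thesis by (rule bij_betw_same_card)
qed

lemma Dm_neg2: "i < N \<Longrightarrow> \<beta> i < 0 \<Longrightarrow> Dm N \<alpha> \<beta> = 0"
proof -
  assume i: "i < N" "\<beta> i < 0"
  have "Dm N \<alpha> \<beta> = Dm N \<beta> \<alpha>"
    unfolding Dm_def by (subst sum.swap, subst Mset_swap) (simp add: mult.commute)
  then show ?thesis using Dm_neg i by simp
qed

lemma sum_swap_23:
  "(\<Sum>w\<in>P. \<Sum>w'\<in>Q. \<Sum>i\<in>A. \<Sum>j\<in>B. \<Sum>r\<in>C. f w w' i j r) =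
   (\<Sum>i\<in>A. \<Sum>j\<in>B. \<Sum>r\<in>C. \<Sum>w\<in>P. \<Sum>w'\<in>Q. f w w' i j r)"
proof -
  have 1: "(\<Sum>w'\<in>Q. \<Sum>i\<in>A. \<Sum>j\<in>B. \<Sum>r\<in>C. g w' i j r) = (\<Sum>i\<in>A. \<Sum>j\<in>B. \<Sum>r\<in>C. \<Sum>w'\<in>Q. g w' i j r)"
    for g and Q :: "'z set"
    by (subst sum.swap, rule sum.cong[OF refl], subst sum.swap, rule sum.cong[OF refl], rule sum.swap)
  show ?thesis unfolding 1 by (rule refl)
qed

text \<open>The degree operator multiplies the Cauchy kernel by the sum over \<open>r\<close> of the
  products of the two \<open>r\<close>-th power sums. This is the coefficient form of that fact,
  inherited from \<open>card_Mset_rec\<close>; subtracting the total of \<open>dl N\<close> takes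
  off the degree of the alternant.\<close>

lemma Dm_rec:
  assumes "(\<Sum>i<N. \<alpha> i) - (\<Sum>i<N. dl N i) \<le> int R"
  shows "((\<Sum>i<N. \<alpha> i) - (\<Sum>i<N. dl N i)) * Dm N \<alpha> \<beta> =
    (\<Sum>i<N. \<Sum>j<N. \<Sum>r\<in>{1..R}. Dm N (\<alpha>(i := \<alpha> i - int r)) (\<beta>(j := \<beta> j - int r)))"
proof -
  let ?n = "(\<Sum>i<N. \<alpha> i) - (\<Sum>i<N. dl N i)"
  let ?P = "{w. w permutes {..<N}}"
  let ?M = "\<lambda>\<alpha> \<beta> w w'. int (card (Mset {..<N} {..<N} (\<lambda>i. \<alpha> i - dl N (w i)) (\<lambda>i. \<beta> i - dl N (w' i))))"
  have 1: "?n * ?M \<alpha> \<beta> w w' =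
      (\<Sum>i<N. \<Sum>j<N. \<Sum>r\<in>{1..R}. ?M (\<alpha>(i := \<alpha> i - int r)) (\<beta>(j := \<beta> j - int r)) w w')"
    if "w \<in> ?P" for w w'
  proof -
    have t: "(\<Sum>i<N. \<alpha> i - dl N (w i)) = ?n"
      using that sum_permutes_N[of w N "dl N"] by (simp add: sum_subtractf)
    have u: "(\<lambda>k. \<alpha> k - dl N (w k))(i := \<alpha> i - dl N (w i) - int r) = (\<lambda>k. (\<alpha>(i := \<alpha> i - int r)) k - dl N (w k))"
      for \<alpha> w i r by auto
    show ?thesis
      using card_Mset_rec[of "{..<N}" "{..<N}" "\<lambda>i. \<alpha> i - dl N (w i)" R "\<lambda>i. \<beta> i - dl N (w' i)"] assms
      unfolding t u by simp
  qed
  have "?n * Dm N \<alpha> \<beta> = (\<Sum>w\<in>?P. \<Sum>w'\<in>?P. sign w * sign w' * (?n * ?M \<alpha> \<beta> w w'))"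
    unfolding Dm_def by (simp add: sum_distrib_left mult_ac)
  also have "\<dots> = (\<Sum>w\<in>?P. \<Sum>w'\<in>?P. \<Sum>i<N. \<Sum>j<N. \<Sum>r\<in>{1..R}.
      sign w * sign w' * ?M (\<alpha>(i := \<alpha> i - int r)) (\<beta>(j := \<beta> j - int r)) w w')"
    by (intro sum.cong refl) (simp only: 1 sum_distrib_left)
  also have "\<dots> = (\<Sum>i<N. \<Sum>j<N. \<Sum>r\<in>{1..R}. \<Sum>w\<in>?P. \<Sum>w'\<in>?P.
      sign w * sign w' * ?M (\<alpha>(i := \<alpha> i - int r)) (\<beta>(j := \<beta> j - int r)) w w')"
    by (rule sum_swap_23)
  finally show ?thesis by (simp only: Dm_def)
qed

lemma Dm_total:
  assumes "(\<Sum>i<N. \<alpha> i) < (\<Sum>i<N. dl N i)"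
  shows "Dm N \<alpha> \<beta> = 0"
  unfolding Dm_def
proof (intro sum.neutral ballI)
  fix w w' assume w: "w \<in> {w. w permutes {..<N}}"
  have "Mset {..<N} {..<N} (\<lambda>i. \<alpha> i - dl N (w i)) (\<lambda>i. \<beta> i - dl N (w' i)) = {}"
  proof (rule ccontr)
    assume "Mset {..<N} {..<N} (\<lambda>i. \<alpha> i - dl N (w i)) (\<lambda>i. \<beta> i - dl N (w' i)) \<noteq> {}"
    then obtain A where "A \<in> Mset {..<N} {..<N} (\<lambda>i. \<alpha> i - dl N (w i)) (\<lambda>i. \<beta> i - dl N (w' i))" by blast
    from Mset_total(1)[OF _ _ this] have "(\<Sum>x\<in>{..<N} \<times> {..<N}. int (A x)) < 0"
      using assms w sum_permutes_N[of w N "dl N"] by (simp add: sum_subtractf)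
    moreover have "(\<Sum>x\<in>{..<N} \<times> {..<N}. int (A x)) \<ge> 0" by (intro sum_nonneg) auto
    ultimately show False by simp
  qed
  then show "sign w * sign w' * int (card (Mset {..<N} {..<N} (\<lambda>i. \<alpha> i - dl N (w i)) (\<lambda>i. \<beta> i - dl N (w' i)))) = 0"
    by simp
qed

lemma Dm_base:
  assumes "(\<Sum>i<N. \<alpha> i) = (\<Sum>i<N. dl N i)"
  shows "Dm N \<alpha> \<beta> = alt N \<alpha> (dl N) * alt N \<beta> (dl N)"
proof -
  let ?P = "{w. w permutes {..<N}}"
  have "int (card (Mset {..<N} {..<N} (\<lambda>i. \<alpha> i - dl N (w i)) (\<lambda>i. \<beta> i - dl N (w' i)))) =
      (if \<forall>i<N. \<alpha> i = dl N (w i) then 1 else 0) * (if \<forall>i<N. \<beta> i = dl N (w' i) then 1 else 0)"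
    if w: "w \<in> ?P" for w w'
  proof -
    let ?M = "Mset {..<N} {..<N} (\<lambda>i. \<alpha> i - dl N (w i)) (\<lambda>i. \<beta> i - dl N (w' i))"
    let ?z = "restrict (\<lambda>_. 0) ({..<N} \<times> {..<N}) :: nat \<times> nat \<Rightarrow> nat"
    have sub: "A = ?z" if A: "A \<in> ?M" for A
    proof -
      have "(\<Sum>x\<in>{..<N} \<times> {..<N}. int (A x)) = 0"
        using Mset_total(1)[OF _ _ A] assms w sum_permutes_N[of w N "dl N"] by (simp add: sum_subtractf)
      then have "\<forall>x\<in>{..<N} \<times> {..<N}. A x = 0" by (subst (asm) sum_nonneg_eq_0_iff) auto
      moreover have "A \<in> extensional ({..<N} \<times> {..<N})" using A by (auto simp: Mset_def PiE_def)
      ultimately show ?thesis by (auto simp: fun_eq_iff extensional_def)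
    qed
    have iff: "?z \<in> ?M \<longleftrightarrow> (\<forall>i<N. \<alpha> i = dl N (w i)) \<and> (\<forall>i<N. \<beta> i = dl N (w' i))"
      by (auto simp: Mset_def)
    have "?M = (if (\<forall>i<N. \<alpha> i = dl N (w i)) \<and> (\<forall>i<N. \<beta> i = dl N (w' i)) then {?z} else {})"
    proof (cases "?z \<in> ?M")
      case True
      then have "?M = {?z}" using sub by blast
      then show ?thesis using True iff by simp
    next
      case False
      then have "?M = {}" using sub by blast
      then show ?thesis using False iff by simp
    qed
    moreover have "card (if c then {?z} else {}) = (if c then 1 else 0)" for c by simp
    ultimately have "card ?M = (if (\<forall>i<N. \<alpha> i = dl N (w i)) \<and> (\<forall>i<N. \<beta> i = dl N (w' i)) then 1 else 0)"
      by (simp only:)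
    moreover have "int (if a \<and> b then 1 else 0) = (if a then 1 else 0) * (if b then 1 else 0)" for a b by simp
    ultimately show ?thesis by (simp only:)
  qed
  then have "Dm N \<alpha> \<beta> = (\<Sum>w\<in>?P. \<Sum>w'\<in>?P. (sign w * (if \<forall>i<N. \<alpha> i = dl N (w i) then 1 else 0)) *
      (sign w' * (if \<forall>i<N. \<beta> i = dl N (w' i) then 1 else 0)))"
    unfolding Dm_def by (intro sum.cong refl) (simp only: mult_ac)
  then show ?thesis by (simp only: alt_def sum_product)
qed

text \<open>In the sum over \<open>i\<close> and \<open>j\<close> the terms \<open>w i = j\<close> give \<open>\<Sum>i. \<alpha> i\<close>;
  the remaining ones cancel in pairs \<open>w\<close>, \<open>w \<circ> transpose i i'\<close> except where the removed
  strips restore the original vectors.\<close>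

lemma alt_rec:
  assumes nn: "\<And>i. i < N \<Longrightarrow> \<alpha> i \<ge> 0" "\<And>i. i < N \<Longrightarrow> \<beta> i \<ge> 0"
    and R: "\<And>i. i < N \<Longrightarrow> \<alpha> i \<le> int R"
  shows "2 * (\<Sum>i<N. \<Sum>j<N. \<Sum>r\<in>{1..R}. if int r \<le> \<alpha> i \<and> int r \<le> \<beta> j
      then alt N (\<alpha>(i := \<alpha> i - int r)) (\<beta>(j := \<beta> j - int r)) else 0) =
    (2 * (\<Sum>i<N. \<alpha> i) - int N * (int N - 1)) * alt N \<alpha> \<beta>"
proof -
  let ?P = "{w. w permutes {..<N}}"
  let ?E = "\<lambda>w. if \<forall>l<N. \<alpha> l = \<beta> (w l) then 1 else (0::int)"
  define T where "T w i j = (\<Sum>r\<in>{1..R}. if int r \<le> \<alpha> i \<and> int r \<le> \<beta> j \<and>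
      (\<forall>l<N. (\<alpha>(i := \<alpha> i - int r)) l = (\<beta>(j := \<beta> j - int r)) (w l)) then 1 else (0::int))" for w i j
  define U where "U w i i' = (if \<alpha> i > \<beta> (w i) \<and> \<alpha> i + \<alpha> i' = \<beta> (w i) + \<beta> (w i') \<and>
      (\<forall>l<N. l \<noteq> i \<and> l \<noteq> i' \<longrightarrow> \<alpha> l = \<beta> (w l)) then 1 else (0::int))" for w i i'
  define V where "V w i i' = (if \<alpha> i + \<alpha> i' = \<beta> (w i) + \<beta> (w i') \<and>
      (\<forall>l<N. l \<noteq> i \<and> l \<noteq> i' \<longrightarrow> \<alpha> l = \<beta> (w l)) then 1 else (0::int))" for w i i'
  have count: "(\<Sum>r\<in>{1..R}. if int r = x then 1 else (0::int)) = (if x \<ge> 1 then 1 else 0)"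
    if "x \<le> int R" for x :: int
  proof (cases "x \<ge> 1")
    case True
    then have "(\<Sum>r\<in>{1..R}. if int r = x then 1 else (0::int)) = (\<Sum>r\<in>{1..R}. if r = nat x then 1 else 0)"
      by (intro sum.cong) auto
    also have "\<dots> = 1" using True that by (subst sum.delta) auto
    finally show ?thesis using True by simp
  next
    case False
    then show ?thesis by (auto intro!: sum.neutral)
  qed
  have Tdiag: "T w i (w i) = \<alpha> i * ?E w" if w: "w \<in> ?P" and i: "i < N" for w i
  proof -
    have "(\<forall>l<N. (\<alpha>(i := \<alpha> i - int r)) l = (\<beta>(w i := \<beta> (w i) - int r)) (w l)) \<longleftrightarrow> (\<forall>l<N. \<alpha> l = \<beta> (w l))" for r
    proof -
      have "w l = w i \<longleftrightarrow> l = i" for l using w by (auto dest: permutes_inj simp: inj_eq)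
      then show ?thesis by auto
    qed
    then have "T w i (w i) = (\<Sum>r\<in>{1..R}. (if int r \<le> \<alpha> i then 1 else 0) * ?E w)"
      unfolding T_def by (intro sum.cong refl) (use i in auto)
    also have "\<dots> = (\<Sum>r\<in>{1..R}. if int r \<le> \<alpha> i then 1 else 0) * ?E w" by (simp add: sum_distrib_right)
    also have "(\<Sum>r\<in>{1..R}. if int r \<le> \<alpha> i then 1 else (0::int)) = \<alpha> i"
    proof -
      have "{r \<in> {1..R}. int r \<le> \<alpha> i} = {1..nat (\<alpha> i)}" using R[OF i] nn(1)[OF i] by auto
      then show ?thesis using nn(1)[OF i] by (simp add: sum.If_cases Int_def)
    qed
    finally show ?thesis .
  qed
  have Toff: "T w i (w i') = U w i i'" if w: "w \<in> ?P" and i: "i < N" and i': "i' < N" and ne: "i \<noteq> i'" for w i i'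
  proof -
    have wi: "w l = w i' \<longleftrightarrow> l = i'" for l using w by (auto dest: permutes_inj simp: inj_eq)
    have wN: "w i < N" "w i' < N" using w i i' permutes_less by auto
    have "(int r \<le> \<alpha> i \<and> int r \<le> \<beta> (w i') \<and>
        (\<forall>l<N. (\<alpha>(i := \<alpha> i - int r)) l = (\<beta>(w i' := \<beta> (w i') - int r)) (w l))) \<longleftrightarrow>
      int r = \<alpha> i - \<beta> (w i) \<and> V w i i' = 1" for r
    proof -
      have "(\<forall>l<N. (\<alpha>(i := \<alpha> i - int r)) l = (\<beta>(w i' := \<beta> (w i') - int r)) (w l)) \<longleftrightarrow>
        \<alpha> i - int r = \<beta> (w i) \<and> \<alpha> i' = \<beta> (w i') - int r \<and> (\<forall>l<N. l \<noteq> i \<and> l \<noteq> i' \<longrightarrow> \<alpha> l = \<beta> (w l))"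
        using i i' ne wi by auto
      then show ?thesis using nn(1)[OF i'] nn(2)[OF wN(1)] by (auto simp: V_def)
    qed
    then have "T w i (w i') = (\<Sum>r\<in>{1..R}. (if int r = \<alpha> i - \<beta> (w i) then 1 else 0) * V w i i')"
      unfolding T_def by (intro sum.cong refl) (auto simp: V_def)
    also have "\<dots> = (if \<alpha> i - \<beta> (w i) \<ge> 1 then 1 else 0) * V w i i'"
      unfolding sum_distrib_right[symmetric] using R[OF i] nn(2)[OF wN(1)] by (subst count) auto
    also have "\<dots> = U w i i'" by (auto simp: U_def V_def)
    finally show ?thesis .
  qed
  have UV: "U w i i' + U w i' i = V w i i' - ?E w" if "i < N" "i' < N" "i \<noteq> i'" for w i i'
  proof -
    have "?E w = (if \<alpha> i = \<beta> (w i) \<and> \<alpha> i' = \<beta> (w i') \<and> (\<forall>l<N. l \<noteq> i \<and> l \<noteq> i' \<longrightarrow> \<alpha> l = \<beta> (w l)) then 1 else 0)"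
      using that by (intro if_cong refl) auto
    then show ?thesis unfolding U_def V_def by auto
  qed
  have V0: "(\<Sum>w\<in>?P. sign w * V w i i') = 0" if "i < N" "i' < N" "i \<noteq> i'" for i i'
  proof -
    have tr: "transpose i i' permutes {..<N}" using that by (intro permutes_swap_id) auto
    have "(\<Sum>w\<in>?P. sign w * V w i i') = (\<Sum>w\<in>?P. sign (w \<circ> transpose i i') * V (w \<circ> transpose i i') i i')"
      by (rule sum_permutations_compose_right[OF tr])
    also have "\<dots> = (\<Sum>w\<in>?P. - (sign w * V w i i'))"
    proof (intro sum.cong refl)
      fix w assume "w \<in> ?P"
      moreover have "V (w \<circ> transpose i i') i i' = V w i i'"
        unfolding V_def by (intro if_cong refl) (auto simp: transpose_def add.commute)
      ultimately show "sign (w \<circ> transpose i i') * V (w \<circ> transpose i i') i i' = - (sign w * V w i i')"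
        using that tr by (simp add: sign_compose permutation_N sign_swap_id)
    qed
    finally show ?thesis by (simp add: sum_negf)
  qed
  have "(\<Sum>i<N. \<Sum>j<N. \<Sum>r\<in>{1..R}. if int r \<le> \<alpha> i \<and> int r \<le> \<beta> j
      then alt N (\<alpha>(i := \<alpha> i - int r)) (\<beta>(j := \<beta> j - int r)) else 0) =
    (\<Sum>i<N. \<Sum>j<N. \<Sum>r\<in>{1..R}. \<Sum>w\<in>?P. sign w * (if int r \<le> \<alpha> i \<and> int r \<le> \<beta> j \<and>
      (\<forall>l<N. (\<alpha>(i := \<alpha> i - int r)) l = (\<beta>(j := \<beta> j - int r)) (w l)) then 1 else 0))"
    unfolding alt_def by (intro sum.cong refl) auto
  also have "\<dots> = (\<Sum>w\<in>?P. \<Sum>i<N. \<Sum>j<N. sign w * T w i j)"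
    unfolding T_def by (simp only: sum.swap[where B = ?P] sum_distrib_left)
  also have "\<dots> = (\<Sum>w\<in>?P. sign w * (\<Sum>i<N. \<Sum>i'<N. T w i (w i')))"
  proof (intro sum.cong refl)
    fix w assume "w \<in> ?P"
    then have "(\<Sum>j<N. T w i j) = (\<Sum>i'<N. T w i (w i'))" for i
      using sum_permutes_N[of w N "\<lambda>j. T w i j"] by simp
    then show "(\<Sum>i<N. \<Sum>j<N. sign w * T w i j) = sign w * (\<Sum>i<N. \<Sum>i'<N. T w i (w i'))"
      by (simp add: sum_distrib_left[symmetric])
  qed
  also have "\<dots> = (\<Sum>w\<in>?P. sign w * (\<Sum>i<N. \<alpha> i * ?E w + (\<Sum>i'\<in>{..<N} - {i}. U w i i')))"
  proof (intro sum.cong refl arg_cong[where f="times _"])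
    fix w i assume w: "w \<in> ?P" and i: "i \<in> {..<N}"
    have "(\<Sum>i'<N. T w i (w i')) = T w i (w i) + (\<Sum>i'\<in>{..<N} - {i}. T w i (w i'))"
      using i by (simp add: sum.remove)
    also have "\<dots> = \<alpha> i * ?E w + (\<Sum>i'\<in>{..<N} - {i}. U w i i')"
      using Tdiag[OF w, of i] Toff[OF w, of i] i by (intro arg_cong2[where f="(+)"] sum.cong) auto
    finally show "(\<Sum>i'<N. T w i (w i')) = \<alpha> i * ?E w + (\<Sum>i'\<in>{..<N} - {i}. U w i i')" .
  qed
  also have "\<dots> = (\<Sum>i<N. \<alpha> i) * alt N \<alpha> \<beta> + (\<Sum>i<N. \<Sum>i'\<in>{..<N} - {i}. \<Sum>w\<in>?P. sign w * U w i i')"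
  proof -
    have "(\<Sum>w\<in>?P. sign w * (\<Sum>i<N. \<alpha> i * ?E w + (\<Sum>i'\<in>{..<N} - {i}. U w i i'))) =
      (\<Sum>w\<in>?P. (\<Sum>i<N. \<alpha> i) * (sign w * ?E w)) + (\<Sum>w\<in>?P. \<Sum>i<N. \<Sum>i'\<in>{..<N} - {i}. sign w * U w i i')"
      by (simp only: sum.distrib[symmetric] distrib_left sum_distrib_left sum_distrib_right mult_ac)
    also have "(\<Sum>w\<in>?P. \<Sum>i<N. \<Sum>i'\<in>{..<N} - {i}. sign w * U w i i') =
      (\<Sum>i<N. \<Sum>i'\<in>{..<N} - {i}. \<Sum>w\<in>?P. sign w * U w i i')"
      by (simp only: sum.swap[where A = ?P])
    finally show ?thesis by (simp only: alt_def sum_distrib_left)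
  qed
  finally have main: "(\<Sum>i<N. \<Sum>j<N. \<Sum>r\<in>{1..R}. if int r \<le> \<alpha> i \<and> int r \<le> \<beta> j
      then alt N (\<alpha>(i := \<alpha> i - int r)) (\<beta>(j := \<beta> j - int r)) else 0) =
    (\<Sum>i<N. \<alpha> i) * alt N \<alpha> \<beta> + (\<Sum>i<N. \<Sum>i'\<in>{..<N} - {i}. \<Sum>w\<in>?P. sign w * U w i i')" .
  let ?u = "\<lambda>i i'. \<Sum>w\<in>?P. sign w * U w i i'"
  have pr: "?u i i' + ?u i' i = - alt N \<alpha> \<beta>" if "i < N" "i' < N" "i \<noteq> i'" for i i'
  proof -
    have "?u i i' + ?u i' i = (\<Sum>w\<in>?P. sign w * V w i i') - (\<Sum>w\<in>?P. sign w * ?E w)"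
      unfolding sum.distrib[symmetric] distrib_left[symmetric] UV[OF that]
      by (simp only: right_diff_distrib sum_subtractf)
    then show ?thesis using V0[OF that] by (simp only: alt_def)
  qed
  have "2 * (\<Sum>i<N. \<Sum>i'\<in>{..<N} - {i}. ?u i i') =
      (\<Sum>i<N. \<Sum>i'\<in>{..<N} - {i}. ?u i i') + (\<Sum>i<N. \<Sum>i'\<in>{..<N} - {i}. ?u i' i)"
  proof -
    have sw: "(\<Sum>i<N. \<Sum>i'\<in>{..<N} - {i}. f i i') = (\<Sum>i<N. \<Sum>i'\<in>{..<N} - {i}. f i' i)" for f :: "nat \<Rightarrow> nat \<Rightarrow> int"
    proof -
      have "(\<Sum>i<N. \<Sum>i'\<in>{..<N} - {i}. f i i') = (\<Sum>i<N. \<Sum>i'<N. if i' \<noteq> i then f i i' else 0)" for f :: "nat \<Rightarrow> nat \<Rightarrow> int"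
        by (intro sum.cong refl sum.mono_neutral_cong_left) auto
      note e = this
      show ?thesis unfolding e by (subst sum.swap) (intro sum.cong refl, auto)
    qed
    show ?thesis using sw[of ?u] by linarith
  qed
  also have "\<dots> = (\<Sum>i<N. \<Sum>i'\<in>{..<N} - {i}. - alt N \<alpha> \<beta>)"
  proof -
    have "(\<Sum>i<N. \<Sum>i'\<in>{..<N} - {i}. ?u i i' + ?u i' i) = (\<Sum>i<N. \<Sum>i'\<in>{..<N} - {i}. - alt N \<alpha> \<beta>)"
      by (intro sum.cong refl pr) auto
    then show ?thesis by (simp only: sum.distrib)
  qed
  also have "\<dots> = - (int N * (int N - 1)) * alt N \<alpha> \<beta>"
    by (cases N) (auto simp: algebra_simps)
  finally show ?thesis using main by (simp add: algebra_simps)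
qed

text \<open>Cauchy's determinant identity, coefficient by coefficient. By \<open>Dm_rec\<close> and
  \<open>alt_rec\<close> both sides satisfy the same recursion, along which the total of
  \<open>\<alpha>\<close> drops. Its factor \<open>?n\<close> can be cancelled when positive; it is
  0 in the case decided by \<open>Dm_base\<close>, and when it is negative both sides
  vanish.\<close>

lemma Dm_eq_alt:
  assumes "\<And>i. i < N \<Longrightarrow> \<alpha> i \<ge> 0" "\<And>i. i < N \<Longrightarrow> \<beta> i \<ge> 0"
  shows "Dm N \<alpha> \<beta> = alt N \<alpha> \<beta>"
  using assms
proof (induction "nat (\<Sum>i<N. \<alpha> i)" arbitrary: \<alpha> \<beta> rule: less_induct)
  case less
  let ?n = "(\<Sum>i<N. \<alpha> i) - (\<Sum>i<N. dl N i)"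
  consider "?n < 0" | "?n = 0" | "?n > 0" by linarith
  then show ?case
  proof cases
    case 1
    then show ?thesis using Dm_total[of \<alpha> N \<beta>] alt_nonneg_total(1)[of N \<alpha> \<beta>] less.prems(1) by fastforce
  next
    case 2
    then have eq: "(\<Sum>i<N. dl N i) = (\<Sum>i<N. \<alpha> i)" by simp
    show ?thesis
    proof (cases "\<exists>v. v permutes {..<N} \<and> (\<forall>i<N. \<alpha> i = dl N (v i))")
      case True
      then obtain v where v: "v permutes {..<N}" "\<And>i. i < N \<Longrightarrow> \<alpha> i = dl N (v i)" by blast
      have "alt N \<alpha> \<gamma> = sign v * alt N (dl N) \<gamma>" for \<gamma>
        using alt_permute[OF v(1), of "dl N" \<gamma>] alt_cong[of N \<alpha> "\<lambda>i. dl N (v i)" \<gamma> \<gamma>] v(2) by simp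
      then show ?thesis using Dm_base[of \<alpha> N \<beta>] eq alt_dl_dl alt_sym[of N \<beta> "dl N"] by simp
    next
      case False
      then have "alt N \<alpha> \<gamma> = 0" for \<gamma>
        using alt_nonneg_total(2)[of N \<alpha> \<gamma>] less.prems(1) eq by blast
      then show ?thesis using Dm_base[of \<alpha> N \<beta>] eq by simp
    qed
  next
    case 3
    define R where "R = nat (\<Sum>i<N. \<alpha> i)"
    have aR: "\<alpha> i \<le> int R" if "i < N" for i
      unfolding R_def using member_le_sum[of i "{..<N}" \<alpha>] less.prems(1) that by force
    have dnn: "(\<Sum>i<N. dl N i) \<ge> 0" by (intro sum_nonneg) (auto simp: dl_def)
    have gauss: "2 * (\<Sum>i<N. dl N i) = int N * (int N - 1)"
    proof -
      have "2 * (\<Sum>i<M. x - int i) = int M * (2 * x - int M + 1)" for M x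
        by (induction M) (auto simp: algebra_simps)
      from this[where x="int N - 1" and M=N] show ?thesis by (simp add: dl_def algebra_simps)
    qed
    have "?n * Dm N \<alpha> \<beta> =
      (\<Sum>i<N. \<Sum>j<N. \<Sum>r\<in>{1..R}. Dm N (\<alpha>(i := \<alpha> i - int r)) (\<beta>(j := \<beta> j - int r)))"
      using dnn by (intro Dm_rec) (simp add: R_def)
    also have "\<dots> = (\<Sum>i<N. \<Sum>j<N. \<Sum>r\<in>{1..R}. if int r \<le> \<alpha> i \<and> int r \<le> \<beta> j
      then alt N (\<alpha>(i := \<alpha> i - int r)) (\<beta>(j := \<beta> j - int r)) else 0)"
    proof (intro sum.cong refl)
      fix i j r assume i: "i \<in> {..<N}" and j: "j \<in> {..<N}" and r: "r \<in> {1..R}"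
      let ?a = "\<alpha>(i := \<alpha> i - int r)" and ?b = "\<beta>(j := \<beta> j - int r)"
      show "Dm N ?a ?b = (if int r \<le> \<alpha> i \<and> int r \<le> \<beta> j then alt N ?a ?b else 0)"
      proof (cases "int r \<le> \<alpha> i \<and> int r \<le> \<beta> j")
        case True
        have "(\<Sum>k<N. ?a k) = (\<Sum>k<N. \<alpha> k) - int r"
          using i by (simp add: sum.remove[of "{..<N}" i])
        moreover have "(\<Sum>k<N. \<alpha> k) > 0" using 3 dnn by linarith
        ultimately have "nat (\<Sum>k<N. ?a k) < nat (\<Sum>k<N. \<alpha> k)" using r by simp
        then have "Dm N ?a ?b = alt N ?a ?b"
          by (rule less.hyps) (use less.prems True in auto)
        then show ?thesis using True by simp
      next
        case False
        \<comment> \<open>\<open>Dm\<close> vanishes by itself once an entry is negative, whereas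
          \<open>alt\<close> need not; this is the origin of the guard in
          \<open>alt_rec\<close>.\<close>
        then show ?thesis using Dm_neg[of i N ?a ?b] Dm_neg2[of j N ?b ?a] i j by force
      qed
    qed
    finally have e: "?n * Dm N \<alpha> \<beta> = (\<Sum>i<N. \<Sum>j<N. \<Sum>r\<in>{1..R}. if int r \<le> \<alpha> i \<and> int r \<le> \<beta> j
      then alt N (\<alpha>(i := \<alpha> i - int r)) (\<beta>(j := \<beta> j - int r)) else 0)" .
    have "2 * (?n * Dm N \<alpha> \<beta>) = (2 * (\<Sum>i<N. \<alpha> i) - int N * (int N - 1)) * alt N \<alpha> \<beta>"
      unfolding e by (rule alt_rec) (use less.prems aR in auto)
    also have "\<dots> = 2 * (?n * alt N \<alpha> \<beta>)"
      unfolding gauss[symmetric] by (simp add: algebra_simps)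
    finally have "?n * Dm N \<alpha> \<beta> = ?n * alt N \<alpha> \<beta>" by simp
    then show ?thesis using 3 by simp
  qed
qed

theorem psi_orthonormal:
  assumes S: "finite S" and nn: "\<And>i. i < N \<Longrightarrow> \<alpha> i \<ge> 0" "\<And>i. i < N \<Longrightarrow> \<beta> i \<ge> 0"
    and tot: "(\<Sum>i<N. \<alpha> i) = int (card S) + (\<Sum>i<N. dl N i)"
  shows "(\<Sum>p | p permutes S. psi S N \<alpha> p * psi S N \<beta> p) = fact (card S) * alt N \<alpha> \<beta>"
proof -
  let ?P = "{w. w permutes {..<N}}"
  let ?f = "\<lambda>\<alpha> w. phi S {..<N} (\<lambda>i. \<alpha> i - dl N (w i))"
  have "(\<Sum>p | p permutes S. psi S N \<alpha> p * psi S N \<beta> p) =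
    (\<Sum>p | p permutes S. \<Sum>w\<in>?P. \<Sum>w'\<in>?P. sign w * sign w' * (?f \<alpha> w p * ?f \<beta> w' p))"
    unfolding psi_def sum_product by (intro sum.cong refl) (simp add: mult_ac)
  also have "\<dots> = (\<Sum>w\<in>?P. \<Sum>w'\<in>?P. sign w * sign w' * (\<Sum>p | p permutes S. ?f \<alpha> w p * ?f \<beta> w' p))"
    by (simp only: sum.swap[where A = "{p. p permutes S}"] sum_distrib_left)
  also have "\<dots> = (\<Sum>w\<in>?P. \<Sum>w'\<in>?P. sign w * sign w' * (fact (card S) *
      int (card (Mset {..<N} {..<N} (\<lambda>i. \<alpha> i - dl N (w i)) (\<lambda>i. \<beta> i - dl N (w' i))))))"
  proof (intro sum.cong refl arg_cong[where f="times _"] sum_phi_phi)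
    fix w assume "w \<in> ?P"
    then show "(\<Sum>i<N. \<alpha> i - dl N (w i)) = int (card S)"
      using tot sum_permutes_N[of w N "dl N"] by (simp add: sum_subtractf)
  qed (use S in auto)
  also have "\<dots> = fact (card S) * Dm N \<alpha> \<beta>"
    unfolding Dm_def by (simp add: sum_distrib_left mult_ac)
  finally show ?thesis using Dm_eq_alt[of N \<alpha> \<beta>] nn by simp
qed

section \<open>Partitions and their beads\<close>

abbreviation pt :: "nat list \<Rightarrow> nat \<Rightarrow> nat" where
  "pt lam \<equiv> nth_default 0 lam"

lemma pt_nth: "i < length lam \<Longrightarrow> pt lam i = lam ! i"
  by (simp add: nth_default_nth)

lemma pt_beyond: "length lam \<le> i \<Longrightarrow> pt lam i = 0"
  by (simp add: nth_default_beyond)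

lemma pt_antimono: "is_partition lam \<Longrightarrow> i \<le> j \<Longrightarrow> pt lam j \<le> pt lam i"
  by (cases "j < length lam"; cases "i = j")
    (auto simp: pt_nth pt_beyond is_partition_def sorted_wrt_iff_nth_less)

lemma pt_pos_iff: "is_partition lam \<Longrightarrow> pt lam i > 0 \<longleftrightarrow> i < length lam"
  by (cases "i < length lam") (auto simp: pt_nth pt_beyond is_partition_def in_set_conv_nth intro!: Nat.gr0I)

lemma sum_pt: "length lam \<le> N \<Longrightarrow> (\<Sum>i<N. pt lam i) = sum_list lam"
proof -
  assume "length lam \<le> N"
  then have "(\<Sum>i<N. pt lam i) = (\<Sum>i<length lam. pt lam i)"
    by (intro sum.mono_neutral_right) (auto simp: pt_beyond)
  then show ?thesis by (simp add: sum_list_sum_nth atLeast0LessThan pt_nth)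
qed

lemma partition_eqI:
  assumes "is_partition lam" "is_partition mu" "\<And>i. pt lam i = pt mu i"
  shows "lam = mu"
proof (rule nth_equalityI)
  have "i < length lam \<longleftrightarrow> i < length mu" for i
    using assms pt_pos_iff by metis
  then show "length lam = length mu" by (metis nat_neq_iff)
  then show "lam ! i = mu ! i" if "i < length lam" for i
    using assms(3)[of i] that by (simp add: pt_nth)
qed

lemma length_le_sum: "is_partition lam \<Longrightarrow> length lam \<le> sum_list lam"
proof -
  assume "is_partition lam"
  then have "0 \<notin> set lam" by (simp add: is_partition_def)
  then show ?thesis
  proof (induction lam)
    case (Cons a lam)
    then have "a \<ge> 1" "length lam \<le> sum_list lam" by auto
    then show ?case by simp
  qed simp
qed

lemma partition_of_fun:
  assumes "\<And>i j. i \<le> j \<Longrightarrow> f j \<le> f i" "\<And>i. N \<le> i \<Longrightarrow> f i = 0"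
  shows "\<exists>lam. is_partition lam \<and> (\<forall>i. pt lam i = f i) \<and> length lam \<le> N"
proof -
  define k where "k = (LEAST k. f k = 0)"
  have k: "f k = 0" "k \<le> N" using assms(2)[of N] unfolding k_def by (auto intro: LeastI Least_le)
  have pos: "f i > 0" if "i < k" for i using not_less_Least that unfolding k_def by blast
  have "is_partition (map f [0..<k])"
    using assms(1) pos by (fastforce simp: is_partition_def sorted_wrt_iff_nth_less)
  moreover have "pt (map f [0..<k]) i = f i" for i
    using assms(1)[of k i] k by (cases "i < k") (auto simp: nth_default_def)
  ultimately show ?thesis using k by (intro exI[of _ "map f [0..<k]"]) auto
qed

lemma finite_partitions_of [simp]: "finite (partitions_of n)"
proof (rule finite_subset)
  show "partitions_of n \<subseteq> {xs. set xs \<subseteq> {..n} \<and> length xs \<le> n}"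
    using length_le_sum member_le_sum_list by (auto simp: partitions_of_def)
qed (rule finite_lists_length_le, simp)

text \<open>The beta-numbers of the partition: the positions of \<open>N\<close> beads, strictly
  decreasing. \<open>N\<close> may exceed the number of parts, the missing parts being read as
  0.\<close>

definition bt :: "nat \<Rightarrow> nat list \<Rightarrow> nat \<Rightarrow> int" where
  "bt N lam i = int (pt lam i) + dl N i"

lemma bt_nonneg: "i < N \<Longrightarrow> bt N lam i \<ge> 0"
  by (simp add: bt_def dl_def)

lemma bt_less: "is_partition lam \<Longrightarrow> i < j \<Longrightarrow> bt N lam j < bt N lam i"
  using pt_antimono[of lam i j] by (simp add: bt_def dl_def)

lemma bt_inj: "is_partition lam \<Longrightarrow> inj_on (bt N lam) S"
  by (rule linorder_inj_onI') (metis bt_less less_irrefl)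

lemma sum_bt: "length lam \<le> N \<Longrightarrow> (\<Sum>i<N. bt N lam i) = int (sum_list lam) + (\<Sum>i<N. dl N i)"
  by (simp add: bt_def sum.distrib flip: sum_pt)

lemma mono_permutes_id:
  assumes w: "w permutes {..<N::nat}" and mono: "\<And>i j. i < j \<Longrightarrow> j < N \<Longrightarrow> w i < w j"
  shows "w = id"
proof -
  have "i \<le> w i" if "i < N" for i
    using that
  proof (induction i)
    case (Suc i)
    then have "i \<le> w i" by simp
    also have "w i < w (Suc i)" using mono[of i "Suc i"] Suc by simp
    finally show ?case by simp
  qed simp
  then show ?thesis using permutes_natset_ge[OF w] by simp
qed

lemma alt_decreasing:
  assumes "\<And>i j. i < j \<Longrightarrow> j < N \<Longrightarrow> \<alpha> j < \<alpha> i" "\<And>i j. i < j \<Longrightarrow> j < N \<Longrightarrow> \<beta> j < \<beta> i"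
  shows "alt N \<alpha> \<beta> = (if \<forall>i<N. \<alpha> i = \<beta> i then 1 else 0)"
proof -
  have "sign w * (if \<forall>i<N. \<alpha> i = \<beta> (w i) then 1 else 0) = (if w = id then if \<forall>i<N. \<alpha> i = \<beta> i then 1 else 0 else 0)"
    if w: "w \<in> {w. w permutes {..<N}}" for w
  proof -
    have "w = id" if e: "\<forall>i<N. \<alpha> i = \<beta> (w i)"
    proof (rule mono_permutes_id)
      fix i j assume ij: "i < j" "j < N"
      then have "\<beta> (w j) < \<beta> (w i)" using assms(1)[of i j] e by simp
      then have "\<not> w j < w i" "w i \<noteq> w j" using assms(2)[of "w j" "w i"] permutes_less[of w N i] w ij by auto
      then show "w i < w j" by simp
    qed (use w in auto)
    then show ?thesis by auto
  qed
  then have "alt N \<alpha> \<beta> = (\<Sum>w | w permutes {..<N}. if w = id then if \<forall>i<N. \<alpha> i = \<beta> i then 1 else 0 else 0)"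
    unfolding alt_def by (rule sum.cong[OF refl])
  also have "\<dots> = (if \<forall>i<N. \<alpha> i = \<beta> i then 1 else 0)"
    using permutes_id by (subst sum.delta) auto
  finally show ?thesis .
qed

lemma alt_bt:
  assumes "is_partition lam" "is_partition mu" "length lam \<le> N" "length mu \<le> N"
  shows "alt N (bt N lam) (bt N mu) = (if lam = mu then 1 else 0)"
proof -
  have "lam = mu" if e: "\<forall>i<N. bt N lam i = bt N mu i"
  proof (rule partition_eqI)
    show "pt lam i = pt mu i" for i
      using e assms(3,4) by (cases "i < N") (auto simp: bt_def pt_beyond)
  qed (use assms in auto)
  then show ?thesis by (subst alt_decreasing) (auto simp: bt_less assms)
qed

lemma partitions_ofD:
  assumes "lam \<in> partitions_of n"
  shows "is_partition lam" "sum_list lam = n" "length lam \<le> n"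
  using assms length_le_sum by (auto simp: partitions_of_def)

lemma psi_bt_orthonormal:
  assumes "finite S" "card S = n" "n \<le> N" "lam \<in> partitions_of n" "mu \<in> partitions_of n"
  shows "(\<Sum>p | p permutes S. psi S N (bt N lam) p * psi S N (bt N mu) p) = (if lam = mu then fact n else 0)"
proof -
  have l: "length lam \<le> N" "length mu \<le> N"
    using partitions_ofD(3)[OF assms(4)] partitions_ofD(3)[OF assms(5)] assms(3) by auto
  have "(\<Sum>i<N. bt N lam i) = int (card S) + (\<Sum>i<N. dl N i)"
    using sum_bt[OF l(1)] assms partitions_ofD(2) by simp
  then show ?thesis
    using assms l by (subst psi_orthonormal) (auto simp: bt_nonneg alt_bt partitions_ofD)
qed

section \<open>Integral spans of the Jacobi-Trudi sums\<close>

text \<open>Virtual characters, compared on the permutations of \<open>S\<close> only. Integrality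
  of the coefficients is what later makes Kronecker multiplicities natural numbers.\<close>

definition zspan :: "'s set \<Rightarrow> nat \<Rightarrow> (('s \<Rightarrow> 's) \<Rightarrow> int) \<Rightarrow> bool" where
  "zspan S N F \<longleftrightarrow> (\<exists>z. \<forall>p. p permutes S \<longrightarrow>
     F p = (\<Sum>\<kappa>\<in>partitions_of (card S). z \<kappa> * psi S N (bt N \<kappa>) p))"

lemma zspan_cong: "zspan S N F \<Longrightarrow> (\<And>p. p permutes S \<Longrightarrow> G p = F p) \<Longrightarrow> zspan S N G"
  unfolding zspan_def by simp

lemma zspan_psi: "\<kappa> \<in> partitions_of (card S) \<Longrightarrow> zspan S N (psi S N (bt N \<kappa>))"
  unfolding zspan_def by (intro exI[of _ "\<lambda>\<kappa>'. if \<kappa>' = \<kappa> then 1 else 0"]) (auto simp: if_distrib[of "\<lambda>x. x * _"] cong: if_cong)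

lemma zspan_0: "zspan S N (\<lambda>p. 0)"
  unfolding zspan_def by (intro exI[of _ "\<lambda>_. 0"]) simp

lemma zspan_add: "zspan S N F \<Longrightarrow> zspan S N G \<Longrightarrow> zspan S N (\<lambda>p. F p + G p)"
  unfolding zspan_def
proof (elim exE)
  fix z y
  assume "\<forall>p. p permutes S \<longrightarrow> F p = (\<Sum>\<kappa>\<in>partitions_of (card S). z \<kappa> * psi S N (bt N \<kappa>) p)"
    "\<forall>p. p permutes S \<longrightarrow> G p = (\<Sum>\<kappa>\<in>partitions_of (card S). y \<kappa> * psi S N (bt N \<kappa>) p)"
  then show "\<exists>z. \<forall>p. p permutes S \<longrightarrow> F p + G p = (\<Sum>\<kappa>\<in>partitions_of (card S). z \<kappa> * psi S N (bt N \<kappa>) p)"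
    by (intro exI[of _ "\<lambda>\<kappa>. z \<kappa> + y \<kappa>"]) (simp add: distrib_right sum.distrib)
qed

lemma zspan_scale: "zspan S N F \<Longrightarrow> zspan S N (\<lambda>p. c * F p)"
  unfolding zspan_def
proof (elim exE)
  fix z
  assume "\<forall>p. p permutes S \<longrightarrow> F p = (\<Sum>\<kappa>\<in>partitions_of (card S). z \<kappa> * psi S N (bt N \<kappa>) p)"
  then show "\<exists>z. \<forall>p. p permutes S \<longrightarrow> c * F p = (\<Sum>\<kappa>\<in>partitions_of (card S). z \<kappa> * psi S N (bt N \<kappa>) p)"
    by (intro exI[of _ "\<lambda>\<kappa>. c * z \<kappa>"]) (simp add: sum_distrib_left mult_ac)
qed

lemma zspan_sum: "(\<And>x. x \<in> X \<Longrightarrow> zspan S N (F x)) \<Longrightarrow> zspan S N (\<lambda>p. \<Sum>x\<in>X. F x p)"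
  by (induction X rule: infinite_finite_induct) (auto intro: zspan_0 zspan_add)

text \<open>A rearrangement inequality: the sum of the squares of \<open>i - w i\<close> is
  positive, and it expands to twice the difference of the two sides.\<close>

lemma permutes_inner_less:
  assumes "w permutes {..<N::nat}" "w \<noteq> id"
  shows "(\<Sum>i<N. int i * int (w i)) < (\<Sum>i<N. int i * int i)"
proof -
  obtain j where j: "w j \<noteq> j" using assms(2) by (auto simp: fun_eq_iff)
  then have jN: "j < N" using assms(1) by (metis lessThan_iff permutes_not_in)
  have "0 < (int j - int (w j))\<^sup>2" using j by simp
  also have "\<dots> \<le> (\<Sum>i<N. (int i - int (w i))\<^sup>2)" using jN by (intro member_le_sum) auto
  also have "\<dots> = (\<Sum>i<N. int i * int i) + (\<Sum>i<N. int (w i) * int (w i)) - 2 * (\<Sum>i<N. int i * int (w i))"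
    by (simp add: power2_eq_square algebra_simps sum.distrib sum_subtractf sum_distrib_left)
  also have "(\<Sum>i<N. int (w i) * int (w i)) = (\<Sum>i<N. int i * int i)"
    by (rule sum_permutes_N[OF assms(1)])
  finally show ?thesis by simp
qed

text \<open>The measure \<open>\<Sum>i. i * \<gamma> i\<close> drops both when two increasing neighbours of \<open>\<gamma>\<close> are exchanged and
  for all the terms of the determinant defining \<^const>\<open>psi\<close> but the diagonal one.\<close>

lemma zspan_phi:
  assumes "finite S" "card S \<le> N"
  shows "zspan S N (phi S {..<N} \<gamma>)"
proof (induction "nat (\<Sum>i<N. int i * \<gamma> i)" arbitrary: \<gamma> rule: less_induct)
  case less
  show ?case
  proof (cases "(\<forall>i<N. \<gamma> i \<ge> 0) \<and> (\<Sum>i<N. \<gamma> i) = int (card S)")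
    case False
    then have "phi S {..<N} \<gamma> p = 0" for p
      using phi_neg[of _ "{..<N}" \<gamma> S p] phi_eq_0[of S "{..<N}" \<gamma> p] assms by force
    then have "phi S {..<N} \<gamma> = (\<lambda>p. 0)" by auto
    then show ?thesis using zspan_0 by simp
  next
    case True
    then have nn: "\<And>i. i < N \<Longrightarrow> \<gamma> i \<ge> 0" and tot: "(\<Sum>i<N. \<gamma> i) = int (card S)" by auto
    show ?thesis
    proof (cases "\<exists>i. Suc i < N \<and> \<gamma> i < \<gamma> (Suc i)")
      case True
      then obtain i where i: "Suc i < N" "\<gamma> i < \<gamma> (Suc i)" by blast
      let ?t = "transpose i (Suc i)"
      have t: "?t permutes {..<N}" using i by (intro permutes_swap_id) auto
      let ?g = "\<lambda>k. \<gamma> (?t k)"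
      have split: "(\<Sum>k<N. int k * f k) = int i * f i + int (Suc i) * f (Suc i) + (\<Sum>k\<in>{..<N} - {i, Suc i}. int k * f k)"
        for f :: "nat \<Rightarrow> int"
      proof -
        have "(\<Sum>k<N. int k * f k) = (\<Sum>k\<in>insert i (insert (Suc i) ({..<N} - {i, Suc i})). int k * f k)"
          using i by (intro sum.cong) auto
        then show ?thesis by simp
      qed
      have "(\<Sum>k\<in>{..<N} - {i, Suc i}. int k * ?g k) = (\<Sum>k\<in>{..<N} - {i, Suc i}. int k * \<gamma> k)"
        by (intro sum.cong) (auto simp: transpose_def)
      then have "(\<Sum>k<N. int k * ?g k) < (\<Sum>k<N. int k * \<gamma> k)"
        unfolding split using i by (simp add: algebra_simps)
      moreover have "(\<Sum>k<N. int k * ?g k) \<ge> 0"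
        using nn permutes_less[OF t] by (intro sum_nonneg) auto
      ultimately have "zspan S N (phi S {..<N} ?g)" by (intro less.hyps) linarith
      then show ?thesis
        by (rule zspan_cong) (rule phi_relabel[OF permutes_imp_bij[OF t], symmetric])
    next
      case False
      have dec: "j < N \<Longrightarrow> \<gamma> j \<le> \<gamma> i" if "i \<le> j" for i j
        using that
      proof (induction rule: dec_induct)
        case (step k)
        then have "\<gamma> (Suc k) \<le> \<gamma> k" using False by (meson not_less)
        then show ?case using step by simp
      qed simp
      have "\<exists>lam. is_partition lam \<and> (\<forall>i. pt lam i = (if i < N then nat (\<gamma> i) else 0)) \<and> length lam \<le> N"
        using dec by (intro partition_of_fun) (auto simp: nat_mono)
      then obtain lam where lam: "is_partition lam" "\<And>i. i < N \<Longrightarrow> pt lam i = nat (\<gamma> i)" "length lam \<le> N"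
        by auto
      have "int (sum_list lam) = (\<Sum>i<N. \<gamma> i)"
        unfolding sum_pt[OF lam(3), symmetric] of_nat_sum using lam(2) nn by (intro sum.cong) auto
      then have lamn: "lam \<in> partitions_of (card S)" using tot lam(1) by (simp add: partitions_of_def)
      let ?P = "{w. w permutes {..<N}}"
      let ?h = "\<lambda>w i. \<gamma> i + dl N i - dl N (w i)"
      have "psi S N (bt N lam) p = (\<Sum>w\<in>?P. sign w * phi S {..<N} (?h w) p)" for p
        unfolding psi_def using lam(2) nn by (intro sum.cong refl arg_cong[where f="times _"] phi_cong) (auto simp: bt_def)
      also have "(\<Sum>w\<in>?P. sign w * phi S {..<N} (?h w) p) =
        phi S {..<N} \<gamma> p + (\<Sum>w\<in>?P - {id}. sign w * phi S {..<N} (?h w) p)" for p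
        using permutes_id by (subst sum.remove[of _ id]) auto
      finally have e: "phi S {..<N} \<gamma> p = psi S N (bt N lam) p + (-1) * (\<Sum>w\<in>?P - {id}. sign w * phi S {..<N} (?h w) p)" for p
        by (simp add: algebra_simps)
      have "zspan S N (phi S {..<N} (?h w))" if w: "w \<in> ?P - {id}" for w
      proof (cases "\<forall>i<N. ?h w i \<ge> 0")
        case True
        have "(\<Sum>i<N. int i * ?h w i) = (\<Sum>i<N. int i * \<gamma> i) + (\<Sum>i<N. int i * int (w i)) - (\<Sum>i<N. int i * int i)"
          by (simp add: dl_def algebra_simps sum.distrib sum_subtractf)
        also have "\<dots> < (\<Sum>i<N. int i * \<gamma> i)"
          using permutes_inner_less[of w N] w by simp
        moreover have "(\<Sum>i<N. int i * ?h w i) \<ge> 0" using True by (intro sum_nonneg) auto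
        ultimately show ?thesis by (intro less.hyps) linarith
      next
        case False
        then obtain i where "i < N" "?h w i < 0" by force
        then have "phi S {..<N} (?h w) = (\<lambda>p. 0)" using phi_neg[of i "{..<N}" "?h w"] by auto
        then show ?thesis using zspan_0 by simp
      qed
      then have "zspan S N (\<lambda>p. psi S N (bt N lam) p + (-1) * (\<Sum>w\<in>?P - {id}. sign w * phi S {..<N} (?h w) p))"
        by (intro zspan_add zspan_scale zspan_sum zspan_psi lamn)
      then show ?thesis unfolding e[symmetric] .
    qed
  qed
qed

lemma phi_superset:
  assumes "finite S" "J \<subseteq> J'" "\<And>l. l \<in> J' - J \<Longrightarrow> \<gamma> l = 0"
  shows "phi S J' \<gamma> p = phi S J \<gamma> p"
proof -
  have "{f \<in> fixfun S J' p. \<forall>l\<in>J'. cnt S f l = \<gamma> l} = {f \<in> fixfun S J p. \<forall>l\<in>J. cnt S f l = \<gamma> l}" (is "?X = ?Y")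
  proof (intro equalityI subsetI)
    fix f assume f: "f \<in> ?X"
    have "f s \<in> J" if s: "s \<in> S" for s
    proof (rule ccontr)
      assume "f s \<notin> J"
      moreover have "f s \<in> J'" using f s by (auto simp: fixfun_def)
      ultimately have "cnt S f (f s) = 0" using f assms(3) by auto
      then show False using s assms(1) by (auto simp: cnt_def)
    qed
    then show "f \<in> ?Y" using f assms(2) by (auto simp: fixfun_def PiE_iff)
  next
    fix f assume f: "f \<in> ?Y"
    have "cnt S f l = 0" if "l \<in> J' - J" for l
    proof -
      have "{s \<in> S. f s = l} = {}" using f that by (auto simp: fixfun_def PiE_iff)
      then show ?thesis unfolding cnt_def by (metis card.empty of_nat_0)
    qed
    then have "cnt S f l = \<gamma> l" if "l \<in> J'" for l
      using f assms(3) that by (cases "l \<in> J") auto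
    then show "f \<in> ?X" using f assms(2) by (auto simp: fixfun_def PiE_iff)
  qed
  then show ?thesis by (simp add: phi_def)
qed

lemma zspan_phi_gen:
  assumes S: "finite S" "card S \<le> N" and J: "finite J"
  shows "zspan S N (phi S J \<gamma>)"
proof (cases "(\<forall>l\<in>J. \<gamma> l \<ge> 0) \<and> (\<Sum>l\<in>J. \<gamma> l) = int (card S)")
  case False
  then have "phi S J \<gamma> p = 0" for p
    using phi_neg[of _ J \<gamma> S p] phi_eq_0[of S J \<gamma> p] S J by force
  then have "phi S J \<gamma> = (\<lambda>p. 0)" by auto
  then show ?thesis using zspan_0 by simp
next
  case True
  \<comment> \<open>At most \<open>card S\<close> letters really occur, so they can be renamed into
    \<open>{..<N}\<close>; the others have content 0 and drop out by
    \<open>phi_superset\<close>.\<close>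
  define K where "K = {l \<in> J. \<gamma> l > 0}"
  have K: "finite K" "K \<subseteq> J" using J by (auto simp: K_def)
  have "int (card K) = (\<Sum>l\<in>K. 1)" by simp
  also have "\<dots> \<le> (\<Sum>l\<in>K. \<gamma> l)" by (intro sum_mono) (auto simp: K_def)
  also have "\<dots> \<le> (\<Sum>l\<in>J. \<gamma> l)" using True J K by (intro sum_mono2) auto
  finally have "card K \<le> N" using True S by simp
  then obtain g where g: "inj_on g K" "g ` K \<subseteq> {..<N}"
    using K(1) by (metis card_le_inj card_lessThan finite_lessThan)
  define \<gamma>' where "\<gamma>' i = (if i \<in> g ` K then \<gamma> (inv_into K g i) else 0)" for i
  have "phi S J \<gamma> p = phi S {..<N} \<gamma>' p" if p: "p permutes S" for p
  proof -
    have "phi S J \<gamma> p = phi S K \<gamma> p"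
      using K True by (intro phi_superset S) (force simp: K_def)+
    also have "\<dots> = phi S K (\<lambda>l. \<gamma>' (g l)) p"
      using g by (intro phi_cong) (auto simp: \<gamma>'_def)
    also have "\<dots> = phi S (g ` K) \<gamma>' p"
      using g p by (intro phi_relabel) (auto simp: bij_betw_def)
    also have "\<dots> = phi S {..<N} \<gamma>' p"
      using g S by (intro phi_superset[symmetric]) (auto simp: \<gamma>'_def)
    finally show ?thesis .
  qed
  then show ?thesis by (rule zspan_cong[OF zspan_phi[OF S]])
qed

text \<open>Expanding both determinants leaves products of permutation characters, which are sums of
  permutation characters by \<open>phi_mult\<close>. For irreducible characters this is the
  expansion behind the Kronecker coefficients.\<close>

lemma zspan_psi_mult:
  assumes S: "finite S" "card S \<le> N"
  shows "zspan S N (\<lambda>p. psi S N' \<alpha> p * psi S N'' \<beta> p)"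
proof -
  let ?f = "\<lambda>N \<alpha> w p. phi S {..<N} (\<lambda>i. \<alpha> i - dl N (w i)) p"
  have "zspan S N (\<lambda>p. ?f N' \<alpha> w p * ?f N'' \<beta> w' p)" for w w'
  proof -
    let ?M = "Mset {..<N'} {..<N''} (\<lambda>i. \<alpha> i - dl N' (w i)) (\<lambda>i. \<beta> i - dl N'' (w' i))"
    have "zspan S N (\<lambda>p. \<Sum>A\<in>?M. phi S ({..<N'} \<times> {..<N''}) (\<lambda>x. int (A x)) p)"
      by (intro zspan_sum zspan_phi_gen S) auto
    moreover have "?f N' \<alpha> w p * ?f N'' \<beta> w' p = (\<Sum>A\<in>?M. phi S ({..<N'} \<times> {..<N''}) (\<lambda>x. int (A x)) p)"
      if "p permutes S" for p
      using S that by (intro phi_mult) auto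
    ultimately show ?thesis by (rule zspan_cong)
  qed
  then have "zspan S N (\<lambda>p. \<Sum>w | w permutes {..<N'}. \<Sum>w' | w' permutes {..<N''}.
      (sign w * sign w') * (?f N' \<alpha> w p * ?f N'' \<beta> w' p))"
    by (intro zspan_sum zspan_scale)
  moreover have "(\<Sum>w | w permutes {..<N'}. \<Sum>w' | w' permutes {..<N''}.
      (sign w * sign w') * (?f N' \<alpha> w p * ?f N'' \<beta> w' p)) = psi S N' \<alpha> p * psi S N'' \<beta> p" for p
    unfolding psi_def sum_product by (simp add: mult_ac)
  ultimately show ?thesis by simp
qed

lemma zspan_expand:
  assumes S: "finite S" "card S \<le> N" and F: "zspan S N F" and p: "p permutes S"
  shows "fact (card S) * F p = (\<Sum>\<kappa>\<in>partitions_of (card S).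
    (\<Sum>q | q permutes S. F q * psi S N (bt N \<kappa>) q) * psi S N (bt N \<kappa>) p)"
proof -
  obtain z where z: "\<And>p. p permutes S \<Longrightarrow> F p = (\<Sum>\<kappa>\<in>partitions_of (card S). z \<kappa> * psi S N (bt N \<kappa>) p)"
    using F by (auto simp: zspan_def)
  have "(\<Sum>q | q permutes S. F q * psi S N (bt N \<kappa>) q) = fact (card S) * z \<kappa>"
    if \<kappa>: "\<kappa> \<in> partitions_of (card S)" for \<kappa>
  proof -
    have "(\<Sum>q | q permutes S. F q * psi S N (bt N \<kappa>) q) =
      (\<Sum>q | q permutes S. \<Sum>\<kappa>'\<in>partitions_of (card S). z \<kappa>' * (psi S N (bt N \<kappa>') q * psi S N (bt N \<kappa>) q))"
      by (intro sum.cong refl) (simp add: z sum_distrib_right mult.assoc)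
    also have "\<dots> = (\<Sum>\<kappa>'\<in>partitions_of (card S). z \<kappa>' *
        (\<Sum>q | q permutes S. psi S N (bt N \<kappa>') q * psi S N (bt N \<kappa>) q))"
      by (subst sum.swap) (simp add: sum_distrib_left)
    also have "\<dots> = (\<Sum>\<kappa>'\<in>partitions_of (card S). z \<kappa>' * (if \<kappa>' = \<kappa> then fact (card S) else 0))"
      using S \<kappa> by (intro sum.cong refl) (simp add: psi_bt_orthonormal)
    also have "\<dots> = fact (card S) * z \<kappa>" using \<kappa> by (simp add: if_distrib cong: if_cong)
    finally show ?thesis .
  qed
  then show ?thesis using z[OF p] by (simp add: sum_distrib_left mult.assoc)
qed

section \<open>Young symmetrizers\<close>

definition Sym :: "nat \<Rightarrow> (nat \<Rightarrow> nat) set" where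
  "Sym n = {p. p permutes {..<n}}"

lemma finite_Sym [simp]: "finite (Sym n)"
  by (simp add: Sym_def)

lemma Sym_iff: "p \<in> Sym n \<longleftrightarrow> p permutes {..<n}"
  by (simp add: Sym_def)

lemma Sym_comp: "p \<in> Sym n \<Longrightarrow> q \<in> Sym n \<Longrightarrow> p \<circ> q \<in> Sym n"
  by (auto simp: Sym_iff intro: permutes_compose)

lemma Sym_inv: "p \<in> Sym n \<Longrightarrow> inv p \<in> Sym n"
  by (auto simp: Sym_iff intro: permutes_inv)

lemma Sym_id: "id \<in> Sym n"
  by (auto simp: Sym_iff intro: permutes_id)

lemma Sym_inv_inv: "p \<in> Sym n \<Longrightarrow> inv (inv p) = p"
  by (auto simp: Sym_iff intro: permutes_inv_inv)

lemma Sym_inv_comp: "p \<in> Sym n \<Longrightarrow> q \<in> Sym n \<Longrightarrow> inv (p \<circ> q) = inv q \<circ> inv p"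
  by (auto simp: Sym_iff intro!: o_inv_distrib dest: permutes_bij)

lemma Sym_cancel:
  assumes "p \<in> Sym n"
  shows "p \<circ> inv p = id" "inv p \<circ> p = id" "p \<circ> (inv p \<circ> x) = x" "inv p \<circ> (p \<circ> x) = x"
  using assms permutes_inv_o[of p "{..<n}"] by (auto simp: Sym_iff o_assoc)

lemma Sym_sign_comp: "p \<in> Sym n \<Longrightarrow> q \<in> Sym n \<Longrightarrow> sign (p \<circ> q) = sign p * sign q"
  by (simp add: Sym_iff sign_compose permutation_N)

lemma Sym_sign_inv: "p \<in> Sym n \<Longrightarrow> sign (inv p) = sign p"
  by (simp add: Sym_iff sign_inverse permutation_N)

lemma sum_Sym_left: "q \<in> Sym n \<Longrightarrow> (\<Sum>p\<in>Sym n. f (q \<circ> p)) = (\<Sum>p\<in>Sym n. f p)"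
  unfolding Sym_def by (rule setum_permutations_compose_left[symmetric]) simp

lemma sum_Sym_right: "q \<in> Sym n \<Longrightarrow> (\<Sum>p\<in>Sym n. f (p \<circ> q)) = (\<Sum>p\<in>Sym n. f p)"
  unfolding Sym_def by (rule sum_permutations_compose_right[symmetric]) simp

lemma sum_Sym_inv: "(\<Sum>p\<in>Sym n. f (inv p)) = (\<Sum>p\<in>Sym n. f p)"
  unfolding Sym_def by (rule sum_permutations_inverse[symmetric])

lemma card_Sym: "card (Sym n) = fact n"
  using card_permutations[of "{..<n}" n] by (simp add: Sym_def)

definition subgrp :: "nat \<Rightarrow> (nat \<Rightarrow> nat) set \<Rightarrow> bool" where
  "subgrp n H \<longleftrightarrow> H \<subseteq> Sym n \<and> id \<in> H \<and> (\<forall>x\<in>H. \<forall>y\<in>H. x \<circ> y \<in> H) \<and> (\<forall>x\<in>H. inv x \<in> H)"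

lemma subgrpD:
  assumes "subgrp n H"
  shows "x \<in> H \<Longrightarrow> x \<in> Sym n" "id \<in> H" "x \<in> H \<Longrightarrow> y \<in> H \<Longrightarrow> x \<circ> y \<in> H" "x \<in> H \<Longrightarrow> inv x \<in> H"
  using assms by (auto simp: subgrp_def)

lemma subgrp_finite: "subgrp n H \<Longrightarrow> finite H"
  unfolding subgrp_def by (meson finite_Sym finite_subset)

lemma sum_subgrp_left:
  assumes "subgrp n H" "q \<in> H"
  shows "(\<Sum>p\<in>H. f (q \<circ> p)) = (\<Sum>p\<in>H. f p)"
  by (rule sum.reindex_bij_witness[where i = "\<lambda>p. inv q \<circ> p" and j = "\<lambda>p. q \<circ> p"])
    (use assms in \<open>auto simp: subgrpD Sym_cancel[OF subgrpD(1)[OF assms]]\<close>)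

lemma sum_subgrp_right:
  assumes "subgrp n H" "q \<in> H"
  shows "(\<Sum>p\<in>H. f (p \<circ> q)) = (\<Sum>p\<in>H. f p)"
  by (rule sum.reindex_bij_witness[where i = "\<lambda>p. p \<circ> inv q" and j = "\<lambda>p. p \<circ> q"])
    (use assms in \<open>auto simp: subgrpD o_assoc[symmetric] Sym_cancel[OF subgrpD(1)[OF assms]]\<close>)

lemma sum_subgrp_inv:
  assumes "subgrp n H"
  shows "(\<Sum>p\<in>H. f (inv p)) = (\<Sum>p\<in>H. f p)"
  by (rule sum.reindex_bij_witness[where i = inv and j = inv])
    (use assms in \<open>auto simp: subgrpD Sym_inv_inv[OF subgrpD(1)[OF assms]]\<close>)

lemma subgrp_mem_left: "subgrp n H \<Longrightarrow> h \<in> H \<Longrightarrow> g \<in> Sym n \<Longrightarrow> h \<circ> g \<in> H \<longleftrightarrow> g \<in> H"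
proof
  assume H: "subgrp n H" "h \<in> H" and "h \<circ> g \<in> H"
  then have "inv h \<circ> (h \<circ> g) \<in> H" by (intro subgrpD(3)[OF H(1) subgrpD(4)[OF H]])
  then show "g \<in> H" by (simp add: Sym_cancel(4)[OF subgrpD(1)[OF H]])
qed (rule subgrpD(3))

lemma subgrp_mem_right: "subgrp n H \<Longrightarrow> h \<in> H \<Longrightarrow> g \<in> Sym n \<Longrightarrow> g \<circ> h \<in> H \<longleftrightarrow> g \<in> H"
proof
  assume H: "subgrp n H" "h \<in> H" and "g \<circ> h \<in> H"
  then have "(g \<circ> h) \<circ> inv h \<in> H" by (intro subgrpD(3)[OF H(1) _ subgrpD(4)[OF H]])
  then show "g \<in> H" using Sym_cancel(1)[OF subgrpD(1)[OF H]] by (simp add: comp_assoc)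
qed (rule subgrpD(3))

lemma subgrp_mem_inv: "subgrp n H \<Longrightarrow> g \<in> Sym n \<Longrightarrow> inv g \<in> H \<longleftrightarrow> g \<in> H"
  using Sym_inv_inv[of g n] subgrpD(4)[of n H g] subgrpD(4)[of n H "inv g"] by auto

text \<open>\<open>R\<close> and \<open>C\<close> are the row and the column group of a tableau.\<close>

locale young =
  fixes n :: nat and R C :: "(nat \<Rightarrow> nat) set"
  assumes R: "subgrp n R" and C: "subgrp n C"
    and RC: "x \<in> R \<Longrightarrow> x \<in> C \<Longrightarrow> x = id"
    and von_Neumann: "g \<in> Sym n \<Longrightarrow> (\<exists>c\<in>C. inv c \<circ> g \<in> R) \<or> (\<exists>\<tau>\<in>C. sign \<tau> = -1 \<and> inv g \<circ> \<tau> \<circ> g \<in> R)"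
begin

lemmas R_Sym = subgrpD(1)[OF R] and C_Sym = subgrpD(1)[OF C]

lemmas ss = comp_assoc Sym_cancel[where n=n] Sym_inv_comp[where n=n] Sym_inv_inv[where n=n] Sym_comp Sym_inv
  Sym_id Sym_sign_comp[where n=n] Sym_sign_inv[where n=n] R_Sym C_Sym

text \<open>The coefficient in the polytabloid of the tabloid moved by \<open>g\<close>.\<close>

definition eps :: "(nat \<Rightarrow> nat) \<Rightarrow> int" where
  "eps g = (\<Sum>c\<in>C. if inv c \<circ> g \<in> R then sign c else 0)"

lemma eps_left:
  assumes c: "c \<in> C" and g: "g \<in> Sym n"
  shows "eps (c \<circ> g) = sign c * eps g"
proof -
  have "eps (c \<circ> g) = (\<Sum>d\<in>C. if inv (c \<circ> d) \<circ> (c \<circ> g) \<in> R then sign (c \<circ> d) else 0)"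
    unfolding eps_def by (rule sum_subgrp_left[OF C c, symmetric])
  also have "\<dots> = (\<Sum>d\<in>C. sign c * (if inv d \<circ> g \<in> R then sign d else 0))"
  proof (intro sum.cong refl)
    fix d assume d: "d \<in> C"
    have "inv (c \<circ> d) \<circ> (c \<circ> g) = inv d \<circ> g"
      using c d by (simp add: ss)
    then show "(if inv (c \<circ> d) \<circ> (c \<circ> g) \<in> R then sign (c \<circ> d) else 0) = sign c * (if inv d \<circ> g \<in> R then sign d else 0)"
      using c d by (simp add: ss)
  qed
  finally show ?thesis by (simp add: eps_def sum_distrib_left)
qed

lemma eps_right:
  assumes r: "r \<in> R" and g: "g \<in> Sym n"
  shows "eps (g \<circ> r) = eps g"
  unfolding eps_def
proof (intro sum.cong refl)
  fix c assume "c \<in> C"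
  then have "inv c \<circ> g \<in> Sym n" using g C_Sym by (intro Sym_comp Sym_inv) auto
  then show "(if inv c \<circ> (g \<circ> r) \<in> R then sign c else 0) = (if inv c \<circ> g \<in> R then sign c else 0)"
    using subgrp_mem_right[OF R r] by (simp add: o_assoc)
qed

lemma eps_right2: "r \<in> R \<Longrightarrow> h \<in> Sym n \<Longrightarrow> g \<in> Sym n \<Longrightarrow> eps (h \<circ> (g \<circ> r)) = eps (h \<circ> g)"
  using eps_right[of r "h \<circ> g"] by (simp add: ss)

lemma sum_if_R:
  assumes c: "c \<in> C"
  shows "(\<Sum>g\<in>Sym n. (if inv c \<circ> g \<in> R then x else 0) * f g) = (\<Sum>r\<in>R. x * (f (c \<circ> r) :: int))"
proof -
  have "(\<Sum>g\<in>Sym n. (if inv c \<circ> g \<in> R then x else 0) * f g) =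
      (\<Sum>g\<in>Sym n. (if inv c \<circ> (c \<circ> g) \<in> R then x else 0) * f (c \<circ> g))"
    by (rule sum_Sym_left[OF C_Sym[OF c], of "\<lambda>g. (if inv c \<circ> g \<in> R then x else 0) * f g", symmetric])
  also have "\<dots> = (\<Sum>g\<in>Sym n. if g \<in> R then x * f (c \<circ> g) else 0)"
    using c by (intro sum.cong refl) (simp add: ss)
  also have "\<dots> = (\<Sum>r\<in>R. x * f (c \<circ> r))"
    using R_Sym by (intro sum.mono_neutral_cong_right) auto
  finally show ?thesis .
qed

lemma eps_id: "eps id = 1"
proof -
  have "eps id = (\<Sum>c\<in>C. if c = id then 1 else 0)"
    unfolding eps_def
  proof (intro sum.cong refl)
    fix c assume c: "c \<in> C"
    have "inv c \<circ> id \<in> R \<longleftrightarrow> c = id"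
      using RC[of c] subgrp_mem_inv[OF R C_Sym[OF c]] c subgrpD(2)[OF R] by auto
    then show "(if inv c \<circ> id \<in> R then sign c else 0) = (if c = id then 1 else 0)" by auto
  qed
  then show ?thesis using subgrpD(2)[OF C] subgrp_finite[OF C] by simp
qed

text \<open>On the products of elements of \<open>C\<close> and \<open>R\<close> the two symmetries
  determine \<open>v\<close> from \<open>v id\<close>. Elsewhere an odd \<open>\<tau>\<close> in
  \<open>C\<close> acts on the left as an element of \<open>R\<close> acts on the right, which
  forces \<open>v g = - v g\<close>. This takes the place of Schur's lemma in what follows.\<close>

lemma anti_invariant:
  assumes l: "\<And>c g. c \<in> C \<Longrightarrow> g \<in> Sym n \<Longrightarrow> v (c \<circ> g) = sign c * v g"
    and r: "\<And>r g. r \<in> R \<Longrightarrow> g \<in> Sym n \<Longrightarrow> v (g \<circ> r) = (v g :: int)"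
    and g: "g \<in> Sym n"
  shows "v g = v id * eps g"
  using von_Neumann[OF g]
proof
  assume "\<exists>c\<in>C. inv c \<circ> g \<in> R"
  then obtain c where c: "c \<in> C" "inv c \<circ> g \<in> R" by blast
  have e: "g = c \<circ> (id \<circ> (inv c \<circ> g))" using c by (simp add: ss)
  have m: "id \<circ> (inv c \<circ> g) \<in> Sym n" using R_Sym[OF c(2)] by simp
  have "v g = sign c * v id"
    by (subst e, subst l[OF c(1) m], subst r[OF c(2) Sym_id]) simp
  moreover have "eps g = sign c"
    by (subst e, subst eps_left[OF c(1) m], subst eps_right[OF c(2) Sym_id]) (simp add: eps_id)
  ultimately show ?thesis by simp
next
  assume "\<exists>\<tau>\<in>C. sign \<tau> = -1 \<and> inv g \<circ> \<tau> \<circ> g \<in> R"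
  then obtain \<tau> where \<tau>: "\<tau> \<in> C" "sign \<tau> = -1" "inv g \<circ> \<tau> \<circ> g \<in> R" by blast
  have e: "\<tau> \<circ> g = g \<circ> (inv g \<circ> \<tau> \<circ> g)" using g by (simp add: ss)
  have "v g = - v g" using l[OF \<tau>(1) g] r[OF \<tau>(3) g] \<tau>(2) e by simp
  moreover have "eps g = - eps g" using eps_left[OF \<tau>(1) g] eps_right[OF \<tau>(3) g] \<tau>(2) e by simp
  ultimately show ?thesis by simp
qed

text \<open>\<open>eps\<close> records a polytabloid on the orbit of its tabloid, so this is a
  matrix coefficient: the inner product of the polytabloid with its translate by \<open>p\<close>,
  each tabloid being counted \<open>card R\<close> times.\<close>

definition m :: "(nat \<Rightarrow> nat) \<Rightarrow> int" where
  "m p = (\<Sum>g\<in>Sym n. eps g * eps (inv p \<circ> g))"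

text \<open>The eigenvalue with which the group algebra element with coefficients \<open>m\<close>
  acts on the polytabloid, see \<open>proj\<close>.\<close>

definition c0 :: int where
  "c0 = (\<Sum>s\<in>Sym n. m s * eps (inv s))"

text \<open>\<open>c0\<close> times the character of the Specht module, see \<open>trace\<close>,
  written without a basis.\<close>

definition chi :: "(nat \<Rightarrow> nat) \<Rightarrow> int" where
  "chi p = (\<Sum>s\<in>Sym n. m (inv s \<circ> p \<circ> s))"

text \<open>The pairing of \<open>f\<close> with the Young symmetrizer. For a class function it
  determines the pairing with \<open>chi\<close>, see \<open>sum_chi\<close>.\<close>

definition K :: "((nat \<Rightarrow> nat) \<Rightarrow> int) \<Rightarrow> int" where
  "K f = (\<Sum>c\<in>C. \<Sum>r\<in>R. sign c * f (r \<circ> c))"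

definition M :: int where
  "M = (\<Sum>r\<in>R. m r)"

lemma sum_eps:
  assumes "\<And>r g. r \<in> R \<Longrightarrow> g \<in> Sym n \<Longrightarrow> f (g \<circ> r) = (f g :: int)"
  shows "(\<Sum>g\<in>Sym n. eps g * f g) = int (card R) * (\<Sum>c\<in>C. sign c * f c)"
proof -
  have "(\<Sum>g\<in>Sym n. eps g * f g) = (\<Sum>c\<in>C. \<Sum>g\<in>Sym n. (if inv c \<circ> g \<in> R then sign c else 0) * f g)"
    unfolding eps_def sum_distrib_right by (rule sum.swap)
  also have "\<dots> = (\<Sum>c\<in>C. \<Sum>r\<in>R. sign c * f c)"
    by (rule sum.cong[OF refl], subst sum_if_R) (simp_all add: assms C_Sym)
  finally show ?thesis by (simp add: sum_distrib_left)
qed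

lemma m_eq: "p \<in> Sym n \<Longrightarrow> m p = int (card R) * (\<Sum>c\<in>C. sign c * eps (inv p \<circ> c))"
  unfolding m_def
  by (rule sum_eps) (simp add: eps_right2 Sym_inv)

lemma m_conj:
  assumes "p \<in> Sym n" "s \<in> Sym n"
  shows "m (inv s \<circ> p \<circ> s) = (\<Sum>g\<in>Sym n. eps (inv s \<circ> g) * eps (inv s \<circ> (inv p \<circ> g)))"
proof -
  have i: "inv (inv s \<circ> p \<circ> s) = inv s \<circ> inv p \<circ> s"
    using assms by (simp add: ss)
  have "m (inv s \<circ> p \<circ> s) = (\<Sum>g\<in>Sym n. eps (inv s \<circ> g) * eps (inv s \<circ> inv p \<circ> s \<circ> (inv s \<circ> g)))"
    unfolding m_def i by (rule sum_Sym_left[OF Sym_inv[OF assms(2)], symmetric])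
  then show ?thesis using assms by (simp add: ss)
qed

lemma m_right: "c \<in> C \<Longrightarrow> p \<in> Sym n \<Longrightarrow> m (p \<circ> c) = sign c * m p"
proof -
  assume c: "c \<in> C" and p: "p \<in> Sym n"
  have "eps (inv (p \<circ> c) \<circ> g) = sign c * eps (inv p \<circ> g)" if "g \<in> Sym n" for g
    using eps_left[OF subgrpD(4)[OF C c] Sym_comp[OF Sym_inv[OF p] that]]
    using p c by (simp add: ss)
  then show ?thesis unfolding m_def by (simp add: sum_distrib_left mult_ac)
qed

lemma m_inv: "p \<in> Sym n \<Longrightarrow> m (inv p) = m p"
proof -
  assume p: "p \<in> Sym n"
  have "m (inv p) = (\<Sum>g\<in>Sym n. eps (inv p \<circ> g) * eps (inv (inv p) \<circ> (inv p \<circ> g)))"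
    unfolding m_def by (rule sum_Sym_left[OF Sym_inv[OF p], symmetric])
  then show ?thesis using p by (simp add: m_def mult.commute ss)
qed

lemma m_left: "c \<in> C \<Longrightarrow> p \<in> Sym n \<Longrightarrow> m (c \<circ> p) = sign c * m p"
  using m_right[OF subgrpD(4)[OF C], of c "inv p"] m_inv[of p] m_inv[of "c \<circ> p"] C_Sym[of c]
  by (simp add: ss)

lemma m_id: "m id > 0"
proof -
  have "m id = (\<Sum>g\<in>Sym n. (eps g)\<^sup>2)" by (simp add: m_def power2_eq_square)
  also have "\<dots> \<ge> (eps id)\<^sup>2" by (rule member_le_sum[OF Sym_id]) auto
  ultimately show ?thesis using eps_id by simp
qed

text \<open>The left side transforms under \<open>C\<close> and \<open>R\<close> as
  \<open>eps\<close> does, so \<open>anti_invariant\<close> makes it a multiple of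
  \<open>eps\<close>, and the factor is its value at \<open>id\<close>.\<close>

lemma proj:
  assumes "x \<in> Sym n"
  shows "(\<Sum>s\<in>Sym n. m s * eps (inv s \<circ> x)) = c0 * eps x"
proof -
  let ?v = "\<lambda>x. \<Sum>s\<in>Sym n. m s * eps (inv s \<circ> x)"
  have "?v x = ?v id * eps x"
  proof (rule anti_invariant[OF _ _ assms])
    fix c g assume c: "c \<in> C" and g: "g \<in> Sym n"
    have "?v (c \<circ> g) = (\<Sum>s\<in>Sym n. m (c \<circ> s) * eps (inv (c \<circ> s) \<circ> (c \<circ> g)))"
      by (rule sum_Sym_left[OF C_Sym[OF c], symmetric])
    also have "\<dots> = (\<Sum>s\<in>Sym n. sign c * (m s * eps (inv s \<circ> g)))"
    proof (intro sum.cong refl)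
      fix s assume s: "s \<in> Sym n"
      have "inv (c \<circ> s) \<circ> (c \<circ> g) = inv s \<circ> g"
        using c s by (simp add: ss)
      then show "m (c \<circ> s) * eps (inv (c \<circ> s) \<circ> (c \<circ> g)) = sign c * (m s * eps (inv s \<circ> g))"
        using m_left[OF c s] by simp
    qed
    finally show "?v (c \<circ> g) = sign c * ?v g" by (simp add: sum_distrib_left)
  next
    fix r g assume "r \<in> R" "g \<in> Sym n"
    then show "?v (g \<circ> r) = ?v g"
      by (intro sum.cong refl) (simp add: o_assoc eps_right Sym_comp Sym_inv)
  qed
  then show ?thesis by (simp add: c0_def)
qed

text \<open>Pairing \<open>proj\<close> with \<open>eps\<close> turns \<open>c0 * m id\<close> into
  the sum of the squares of all \<open>m s\<close>.\<close>

lemma c0_pos: "c0 > 0"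
proof -
  have "c0 * m id = (\<Sum>x\<in>Sym n. (\<Sum>s\<in>Sym n. m s * eps (inv s \<circ> x)) * eps x)"
    by (simp add: proj) (simp add: m_def sum_distrib_left mult_ac)
  also have "\<dots> = (\<Sum>s\<in>Sym n. m s * (\<Sum>x\<in>Sym n. eps x * eps (inv s \<circ> x)))"
    by (subst sum_distrib_right, subst sum.swap) (simp add: sum_distrib_left mult_ac)
  also have "\<dots> = (\<Sum>s\<in>Sym n. (m s)\<^sup>2)" by (simp add: power2_eq_square flip: m_def)
  also have "\<dots> \<ge> (m id)\<^sup>2" by (rule member_le_sum[OF Sym_id]) auto
  ultimately have "c0 * m id > 0" using m_id by (smt (verit) zero_less_power)
  then show ?thesis using m_id by (simp add: zero_less_mult_iff)
qed

lemma c0_eq: "c0 = int (card C) * M"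
proof -
  have "c0 = (\<Sum>s\<in>Sym n. m (inv s) * eps (inv (inv s)))"
    unfolding c0_def by (rule sum_Sym_inv[symmetric])
  also have "\<dots> = (\<Sum>s\<in>Sym n. eps s * m s)"
    by (intro sum.cong refl) (simp add: m_inv ss)
  also have "\<dots> = (\<Sum>c\<in>C. \<Sum>g\<in>Sym n. (if inv c \<circ> g \<in> R then sign c else 0) * m g)"
    unfolding eps_def sum_distrib_right by (rule sum.swap)
  also have "\<dots> = (\<Sum>c\<in>C. M)"
    by (rule sum.cong[OF refl], subst sum_if_R) (simp_all add: m_left R_Sym M_def mult.assoc[symmetric])
  finally show ?thesis by simp
qed

text \<open>Both occurrences of \<open>eps\<close> in \<open>m\<close> are expanded over cosets of
  \<open>R\<close>. The class function absorbs a conjugation by \<open>C\<close>, so the two signed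
  sums over \<open>C\<close> collapse into one and a factor \<open>card C\<close>.\<close>

lemma sum_m:
  assumes f: "\<And>p s. p \<in> Sym n \<Longrightarrow> s \<in> Sym n \<Longrightarrow> f (inv s \<circ> p \<circ> s) = (f p :: int)"
  shows "(\<Sum>p\<in>Sym n. m p * f p) = int (card R) * int (card C) * K f"
proof -
  have "(\<Sum>p\<in>Sym n. m p * f p) = (\<Sum>p\<in>Sym n. m (inv p) * f (inv p))"
    by (rule sum_Sym_inv[of "\<lambda>p. m p * f p", symmetric])
  also have "\<dots> = (\<Sum>p\<in>Sym n. int (card R) * (\<Sum>c\<in>C. sign c * eps (p \<circ> c)) * f (inv p))"
    by (intro sum.cong refl) (simp add: m_eq ss)
  also have "\<dots> = (\<Sum>p\<in>Sym n. \<Sum>c\<in>C. int (card R) * (sign c * (eps (p \<circ> c) * f (inv p))))"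
    by (simp only: sum_distrib_left sum_distrib_right mult.assoc)
  also have "\<dots> = (\<Sum>c\<in>C. \<Sum>p\<in>Sym n. int (card R) * (sign c * (eps (p \<circ> c) * f (inv p))))"
    by (rule sum.swap)
  also have "\<dots> = int (card R) * (\<Sum>c\<in>C. \<Sum>p\<in>Sym n. sign c * (eps (p \<circ> c) * f (inv p)))"
    by (simp only: sum_distrib_left)
  also have "(\<Sum>c\<in>C. \<Sum>p\<in>Sym n. sign c * (eps (p \<circ> c) * f (inv p))) =
      (\<Sum>c\<in>C. sign c * (\<Sum>p\<in>Sym n. eps p * f (c \<circ> inv p)))"
  proof (intro sum.cong refl)
    fix c assume c: "c \<in> C"
    have "(\<Sum>p\<in>Sym n. eps p * f (c \<circ> inv p)) = (\<Sum>p\<in>Sym n. eps (p \<circ> c) * f (c \<circ> inv (p \<circ> c)))"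
      by (rule sum_Sym_right[OF C_Sym[OF c], of "\<lambda>p. eps p * f (c \<circ> inv p)", symmetric])
    also have "\<dots> = (\<Sum>p\<in>Sym n. eps (p \<circ> c) * f (inv p))"
      by (intro sum.cong refl) (use c in \<open>simp add: ss\<close>)
    finally show "(\<Sum>p\<in>Sym n. sign c * (eps (p \<circ> c) * f (inv p))) = sign c * (\<Sum>p\<in>Sym n. eps p * f (c \<circ> inv p))"
      by (simp add: sum_distrib_left)
  qed
  also have "\<dots> = (\<Sum>c\<in>C. sign c * (\<Sum>d\<in>C. \<Sum>r\<in>R. sign d * f (c \<circ> inv (d \<circ> r))))"
  proof (rule sum.cong[OF refl], rule arg_cong[where f="times _"])
    fix c assume c: "c \<in> C"
    have "(\<Sum>p\<in>Sym n. eps p * f (c \<circ> inv p)) = (\<Sum>d\<in>C. \<Sum>p\<in>Sym n. (if inv d \<circ> p \<in> R then sign d else 0) * f (c \<circ> inv p))"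
      unfolding eps_def sum_distrib_right by (rule sum.swap)
    also have "\<dots> = (\<Sum>d\<in>C. \<Sum>r\<in>R. sign d * f (c \<circ> inv (d \<circ> r)))"
      by (rule sum.cong[OF refl], rule sum_if_R)
    finally show "(\<Sum>p\<in>Sym n. eps p * f (c \<circ> inv p)) = (\<Sum>d\<in>C. \<Sum>r\<in>R. sign d * f (c \<circ> inv (d \<circ> r)))" .
  qed
  also have "\<dots> = (\<Sum>c\<in>C. \<Sum>d\<in>C. \<Sum>r\<in>R. sign (inv d \<circ> c) * f (r \<circ> (inv d \<circ> c)))"
    unfolding sum_distrib_left
  proof (rule sum.cong[OF refl], rule sum.cong[OF refl])
    fix c d assume c: "c \<in> C" and d: "d \<in> C"
    have "(\<Sum>r\<in>R. sign c * (sign d * f (c \<circ> inv (d \<circ> r)))) = (\<Sum>r\<in>R. sign c * (sign d * f (c \<circ> inv (d \<circ> inv r))))"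
      by (rule sum_subgrp_inv[OF R, of "\<lambda>r. sign c * (sign d * f (c \<circ> inv (d \<circ> r)))", symmetric])
    also have "\<dots> = (\<Sum>r\<in>R. sign (inv d \<circ> c) * f (r \<circ> (inv d \<circ> c)))"
    proof (intro sum.cong refl)
      fix r assume r: "r \<in> R"
      have i: "inv (d \<circ> inv r) = r \<circ> inv d"
        using d r by (simp add: ss)
      have "r \<circ> (inv d \<circ> c) = inv c \<circ> (c \<circ> (r \<circ> inv d)) \<circ> c"
        using c by (simp add: ss)
      moreover have "f (inv c \<circ> (c \<circ> (r \<circ> inv d)) \<circ> c) = f (c \<circ> (r \<circ> inv d))"
        using c d r by (intro f) (simp_all add: ss)
      ultimately have "f (r \<circ> (inv d \<circ> c)) = f (c \<circ> inv (d \<circ> inv r))" unfolding i by simp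
      then show "sign c * (sign d * f (c \<circ> inv (d \<circ> inv r))) = sign (inv d \<circ> c) * f (r \<circ> (inv d \<circ> c))"
        using c d by (simp add: ss)
    qed
    finally show "(\<Sum>r\<in>R. sign c * (sign d * f (c \<circ> inv (d \<circ> r)))) = (\<Sum>r\<in>R. sign (inv d \<circ> c) * f (r \<circ> (inv d \<circ> c)))" .
  qed
  also have "\<dots> = (\<Sum>d\<in>C. \<Sum>c\<in>C. \<Sum>r\<in>R. sign (inv d \<circ> c) * f (r \<circ> (inv d \<circ> c)))"
    by (rule sum.swap)
  also have "\<dots> = (\<Sum>d\<in>C. K f)"
    unfolding K_def by (intro sum.cong refl sum_subgrp_left[OF C]) (rule subgrpD(4)[OF C])
  finally show ?thesis by simp
qed

lemma sum_chi:
  assumes f: "\<And>p s. p \<in> Sym n \<Longrightarrow> s \<in> Sym n \<Longrightarrow> f (inv s \<circ> p \<circ> s) = (f p :: int)"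
  shows "(\<Sum>p\<in>Sym n. chi p * f p) = fact n * int (card R) * int (card C) * K f"
proof -
  have "(\<Sum>p\<in>Sym n. chi p * f p) = (\<Sum>s\<in>Sym n. \<Sum>p\<in>Sym n. m (inv s \<circ> p \<circ> s) * f p)"
    unfolding chi_def sum_distrib_right by (rule sum.swap)
  also have "\<dots> = (\<Sum>s\<in>Sym n. \<Sum>p\<in>Sym n. m p * f p)"
  proof (rule sum.cong[OF refl])
    fix s assume s: "s \<in> Sym n"
    have "(\<Sum>p\<in>Sym n. m (inv s \<circ> p \<circ> s) * f p) = (\<Sum>p\<in>Sym n. m (inv s \<circ> p \<circ> s) * f (inv s \<circ> p \<circ> s))"
      using f[OF _ s] by (intro sum.cong refl) simp
    also have "\<dots> = (\<Sum>p\<in>Sym n. m (inv s \<circ> p) * f (inv s \<circ> p))"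
      using sum_Sym_right[OF s, of "\<lambda>p. m (inv s \<circ> p) * f (inv s \<circ> p)"] by (simp add: o_assoc)
    also have "\<dots> = (\<Sum>p\<in>Sym n. m p * f p)"
      by (rule sum_Sym_left[OF Sym_inv[OF s]])
    finally show "(\<Sum>p\<in>Sym n. m (inv s \<circ> p \<circ> s) * f p) = (\<Sum>p\<in>Sym n. m p * f p)" .
  qed
  also have "\<dots> = fact n * (int (card R) * int (card C) * K f)"
    using sum_m[of f, OF f] card_Sym[of n] by simp
  finally show ?thesis by simp
qed

lemma chi_conj:
  assumes "p \<in> Sym n" "s \<in> Sym n"
  shows "chi (inv s \<circ> p \<circ> s) = chi p"
proof -
  have "chi (inv s \<circ> p \<circ> s) = (\<Sum>u\<in>Sym n. m (inv (s \<circ> u) \<circ> p \<circ> (s \<circ> u)))"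
    unfolding chi_def by (intro sum.cong refl) (use assms in \<open>simp add: ss\<close>)
  also have "\<dots> = chi p" unfolding chi_def by (rule sum_Sym_left[OF assms(2)])
  finally show ?thesis .
qed

text \<open>The column antisymmetrizer sends every translate of the polytabloid to a multiple of the
  polytabloid; the multiple is read off at \<open>id\<close>, where it is \<open>m s\<close> divided
  by \<open>card R\<close>.\<close>

lemma C_sum_eps:
  assumes "s \<in> Sym n" "h \<in> Sym n"
  shows "int (card R) * (\<Sum>c\<in>C. sign c * eps (inv s \<circ> (inv c \<circ> h))) = m s * eps h"
proof -
  let ?v = "\<lambda>h. \<Sum>c\<in>C. sign c * eps (inv s \<circ> (c \<circ> h))"
  have e: "(\<Sum>c\<in>C. sign c * eps (inv s \<circ> (inv c \<circ> h))) = ?v h"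
    using sum_subgrp_inv[OF C, of "\<lambda>c. sign c * eps (inv s \<circ> (c \<circ> h))"]
    by (simp add: ss)
  have "?v h = ?v id * eps h"
  proof (rule anti_invariant[OF _ _ assms(2)])
    fix c g assume c: "c \<in> C" and g: "g \<in> Sym n"
    have "sign c * ?v g = (\<Sum>d\<in>C. sign c * (sign (d \<circ> c) * eps (inv s \<circ> ((d \<circ> c) \<circ> g))))"
      unfolding sum_distrib_left using sum_subgrp_right[OF C c, of "\<lambda>d. sign c * (sign d * eps (inv s \<circ> (d \<circ> g)))"] by simp
    also have "\<dots> = ?v (c \<circ> g)"
      by (intro sum.cong refl) (use c in \<open>simp add: ss\<close>)
    finally show "?v (c \<circ> g) = sign c * ?v g" by simp
  next
    fix r g assume "r \<in> R" "g \<in> Sym n"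
    then show "?v (g \<circ> r) = ?v g"
      using C_Sym assms(1)
      by (intro sum.cong refl) (simp add: o_assoc eps_right Sym_comp Sym_inv)
  qed
  then show ?thesis unfolding e m_eq[OF assms(1)] by simp
qed

text \<open>Irreducibility in numerical form: \<open>chi\<close> divided by \<open>c0\<close> has
  norm 1. After \<open>sum_chi\<close> only \<open>K chi\<close> is left. There the sum over
  \<open>C\<close> is evaluated by \<open>C_sum_eps\<close>, the sum over translates by
  \<open>proj\<close>, and the sum over \<open>R\<close> gives \<open>M\<close>, which
  \<open>c0_eq\<close> relates to \<open>c0\<close>.\<close>

lemma chi_norm: "(\<Sum>p\<in>Sym n. chi p * chi p) = fact n * c0\<^sup>2"
proof -
  have "int (card R) * K chi = (\<Sum>c\<in>C. \<Sum>r\<in>R. \<Sum>s\<in>Sym n. \<Sum>g\<in>Sym n.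
      int (card R) * (sign c * (eps (inv s \<circ> g) * eps (inv s \<circ> (inv c \<circ> (inv r \<circ> g))))))"
    unfolding K_def chi_def sum_distrib_left
    by (intro sum.cong refl, subst m_conj) (simp_all add: ss sum_distrib_left)
  also have "\<dots> = (\<Sum>r\<in>R. \<Sum>s\<in>Sym n. \<Sum>g\<in>Sym n. \<Sum>c\<in>C.
      int (card R) * (sign c * (eps (inv s \<circ> g) * eps (inv s \<circ> (inv c \<circ> (inv r \<circ> g))))))"
    by (subst sum.swap, rule sum.cong[OF refl], subst sum.swap, rule sum.cong[OF refl], rule sum.swap)
  also have "\<dots> = (\<Sum>r\<in>R. \<Sum>s\<in>Sym n. \<Sum>g\<in>Sym n. eps (inv s \<circ> g) * (m s * eps (inv r \<circ> g)))"
  proof (intro sum.cong refl)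
    fix r s g assume r: "r \<in> R" and s: "s \<in> Sym n" and g: "g \<in> Sym n"
    have "(\<Sum>c\<in>C. int (card R) * (sign c * (eps (inv s \<circ> g) * eps (inv s \<circ> (inv c \<circ> (inv r \<circ> g)))))) =
      eps (inv s \<circ> g) * (int (card R) * (\<Sum>c\<in>C. sign c * eps (inv s \<circ> (inv c \<circ> (inv r \<circ> g)))))"
      by (simp add: sum_distrib_left mult_ac)
    also have "\<dots> = eps (inv s \<circ> g) * (m s * eps (inv r \<circ> g))"
      using C_sum_eps[OF s Sym_comp[OF Sym_inv[OF R_Sym[OF r]] g]] by simp
    finally show "(\<Sum>c\<in>C. int (card R) * (sign c * (eps (inv s \<circ> g) * eps (inv s \<circ> (inv c \<circ> (inv r \<circ> g)))))) =
      eps (inv s \<circ> g) * (m s * eps (inv r \<circ> g))" .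
  qed
  also have "\<dots> = (\<Sum>r\<in>R. \<Sum>g\<in>Sym n. (\<Sum>s\<in>Sym n. m s * eps (inv s \<circ> g)) * eps (inv r \<circ> g))"
    unfolding sum_distrib_right by (rule sum.cong[OF refl], subst sum.swap) (simp add: mult_ac)
  also have "\<dots> = (\<Sum>r\<in>R. c0 * m r)"
    by (intro sum.cong refl) (simp add: proj, simp add: m_def sum_distrib_left mult_ac)
  also have "\<dots> = c0 * M" by (simp add: M_def sum_distrib_left)
  finally have "int (card R) * K chi = c0 * M" .
  then have "int (card R) * int (card C) * K chi = c0 * c0" unfolding c0_eq by (simp add: mult_ac)
  moreover have "(\<Sum>p\<in>Sym n. chi p * chi p) = fact n * (int (card R) * int (card C) * K chi)"
    using sum_chi[of chi, OF chi_conj] by (simp add: mult_ac)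
  ultimately show ?thesis by (simp add: power2_eq_square)
qed

text \<open>The equality case of the Cauchy-Schwarz inequality: the assumption on \<open>K f\<close> gives the pairing of \<open>f\<close> with \<open>chi\<close>.\<close>

lemma chi_eqI:
  assumes f: "\<And>p s. p \<in> Sym n \<Longrightarrow> s \<in> Sym n \<Longrightarrow> f (inv s \<circ> p \<circ> s) = (f p :: int)"
    and norm: "(\<Sum>p\<in>Sym n. f p * f p) = fact n"
    and K: "int (card R) * K f = M"
    and p: "p \<in> Sym n"
  shows "chi p = c0 * f p"
proof -
  have "fact n * int (card R) * int (card C) * K f = fact n * c0"
    unfolding c0_eq K[symmetric] by simp
  then have 1: "(\<Sum>p\<in>Sym n. chi p * f p) = fact n * c0" using sum_chi[of f, OF f] by simp
  have "(\<Sum>p\<in>Sym n. (chi p - c0 * f p)\<^sup>2) =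
    (\<Sum>p\<in>Sym n. chi p * chi p) - 2 * c0 * (\<Sum>p\<in>Sym n. chi p * f p) + c0\<^sup>2 * (\<Sum>p\<in>Sym n. f p * f p)"
    by (simp add: power2_eq_square algebra_simps sum.distrib sum_subtractf sum_distrib_left)
  also have "\<dots> = 0" unfolding chi_norm 1 norm by (simp add: power2_eq_square algebra_simps)
  finally have "\<forall>p\<in>Sym n. (chi p - c0 * f p)\<^sup>2 = 0"
    by (subst (asm) sum_nonneg_eq_0_iff) auto
  then show ?thesis using p by simp
qed

text \<open>\<open>chi\<close> up to a positive factor, in a form where \<open>R\<close> and
  \<open>C\<close> can be exchanged at the cost of a sign. This is how a diagram is compared with
  its conjugate in \<open>W_flip\<close>.\<close>

definition W :: "(nat \<Rightarrow> nat) \<Rightarrow> int" where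
  "W p = (\<Sum>s\<in>Sym n. \<Sum>c\<in>C. \<Sum>r\<in>R. if inv s \<circ> p \<circ> s = r \<circ> c then sign c else 0)"

text \<open>Pair \<open>m\<close> with the indicator function of the conjugacy class of \<open>p\<close>.\<close>

lemma chi_eq_W:
  assumes p: "p \<in> Sym n"
  shows "chi p = int (card R) * int (card C) * W p"
proof -
  define f where "f q = int (card {s \<in> Sym n. inv s \<circ> p \<circ> s = q})" for q
  have f: "f (inv s \<circ> q \<circ> s) = f q" if q: "q \<in> Sym n" and s: "s \<in> Sym n" for q s
  proof -
    let ?U = "\<lambda>q. {u \<in> Sym n. inv u \<circ> p \<circ> u = q}"
    have "bij_betw (\<lambda>u. u \<circ> s) (?U q) (?U (inv s \<circ> q \<circ> s))"
    proof (rule bij_betw_byWitness[where f' = "\<lambda>u. u \<circ> inv s"])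
      show "(\<lambda>u. u \<circ> s) ` ?U q \<subseteq> ?U (inv s \<circ> q \<circ> s)"
        using s by (auto simp: ss)
      show "(\<lambda>u. u \<circ> inv s) ` ?U (inv s \<circ> q \<circ> s) \<subseteq> ?U q"
      proof (rule image_subsetI)
        fix u assume u: "u \<in> ?U (inv s \<circ> q \<circ> s)"
        then have uS: "u \<in> Sym n" by blast
        have "inv (u \<circ> inv s) \<circ> p \<circ> (u \<circ> inv s) = s \<circ> (inv u \<circ> p \<circ> u) \<circ> inv s"
          using uS s by (simp add: ss)
        also have "\<dots> = s \<circ> (inv s \<circ> q \<circ> s) \<circ> inv s" using u by simp
        also have "\<dots> = q" using q s by (simp add: ss)
        finally have "inv (u \<circ> inv s) \<circ> p \<circ> (u \<circ> inv s) = q" .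
        moreover have "u \<circ> inv s \<in> Sym n" using uS s by (simp add: ss)
        ultimately show "u \<circ> inv s \<in> ?U q" by blast
      qed
    qed (use s in \<open>auto simp: ss\<close>)
    then show ?thesis by (simp add: f_def bij_betw_same_card)
  qed
  have "chi p = (\<Sum>q\<in>Sym n. m q * f q)"
  proof -
    have "(\<Sum>q\<in>Sym n. m q * f q) = (\<Sum>q\<in>Sym n. \<Sum>s\<in>Sym n. if inv s \<circ> p \<circ> s = q then m q else 0)"
      by (intro sum.cong refl) (simp add: f_def sum.If_cases Int_def)
    also have "\<dots> = (\<Sum>s\<in>Sym n. \<Sum>q\<in>Sym n. if inv s \<circ> p \<circ> s = q then m q else 0)"
      by (rule sum.swap)
    also have "\<dots> = (\<Sum>s\<in>Sym n. m (inv s \<circ> p \<circ> s))"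
    proof (intro sum.cong refl)
      fix s assume s: "s \<in> Sym n"
      have "inv s \<circ> p \<circ> s \<in> Sym n" using p s by (intro Sym_comp Sym_inv)
      then show "(\<Sum>q\<in>Sym n. if inv s \<circ> p \<circ> s = q then m q else 0) = m (inv s \<circ> p \<circ> s)"
        by (subst sum.delta') auto
    qed
    finally show ?thesis by (simp add: chi_def)
  qed
  also have "\<dots> = int (card R) * int (card C) * K f" by (rule sum_m[OF f])
  also have "K f = W p"
  proof -
    have "K f = (\<Sum>c\<in>C. \<Sum>r\<in>R. \<Sum>s\<in>Sym n. if inv s \<circ> p \<circ> s = r \<circ> c then sign c else 0)"
      unfolding K_def by (intro sum.cong refl) (simp add: f_def sum.If_cases Int_def)
    also have "\<dots> = W p"
      unfolding W_def by (subst (3) sum.swap, subst (2) sum.swap) (rule refl)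
    finally show ?thesis .
  qed
  finally show ?thesis .
qed

end

text \<open>The assumption describes the character induced from the trivial character of
  \<open>R\<close>. The identity holds for each conjugating \<open>g\<close> separately: if
  \<open>g\<close> is a column element times a row element, a substitution identifies the two sides;
  otherwise an odd element of \<open>C\<close> cancels one side and \<open>eps g = 0\<close> kills
  the other.\<close>

lemma (in young) K_conj_count:
  assumes f: "\<And>p. p \<in> Sym n \<Longrightarrow> int (card R) * f p = int (card {g \<in> Sym n. inv g \<circ> p \<circ> g \<in> R})"
  shows "int (card R) * K f = M"
proof -
  have F: "(\<Sum>c\<in>C. \<Sum>r\<in>R. if inv g \<circ> (r \<circ> c) \<circ> g \<in> R then sign c else 0) = (\<Sum>r\<in>R. eps g * eps (inv r \<circ> g))"
    if g: "g \<in> Sym n" for g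
    using von_Neumann[OF g]
  proof
    assume "\<exists>d\<in>C. inv d \<circ> g \<in> R"
    then obtain d where d: "d \<in> C" "inv d \<circ> g \<in> R" by blast
    define r' where "r' = inv d \<circ> g"
    have gd: "g = d \<circ> r'" and r': "r' \<in> R" using d by (simp_all add: r'_def ss)
    have e: "eps g = sign d"
      using eps_left[OF d(1), of r'] eps_right[OF r' Sym_id] R_Sym[OF r'] by (simp add: gd eps_id)
    have "(\<Sum>r\<in>R. eps g * eps (inv r \<circ> g)) = (\<Sum>r\<in>R. \<Sum>c\<in>C. if inv c \<circ> (inv r \<circ> d) \<in> R then sign d * sign c else 0)"
    proof (rule sum.cong[OF refl])
      fix r assume r: "r \<in> R"
      have "eps (inv r \<circ> g) = eps (inv r \<circ> d)"
        using eps_right2[OF r', of "inv r" d] r d by (simp add: gd ss)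
      then show "eps g * eps (inv r \<circ> g) = (\<Sum>c\<in>C. if inv c \<circ> (inv r \<circ> d) \<in> R then sign d * sign c else 0)"
        unfolding e by (simp add: eps_def sum_distrib_left if_distrib cong: if_cong)
    qed
    also have "\<dots> = (\<Sum>c\<in>C. \<Sum>r\<in>R. if inv c \<circ> (inv r \<circ> d) \<in> R then sign d * sign c else 0)"
      by (rule sum.swap)
    also have "\<dots> = (\<Sum>c\<in>C. \<Sum>r\<in>R. if inv (c \<circ> d) \<circ> (inv r \<circ> d) \<in> R then sign d * sign (c \<circ> d) else 0)"
      by (rule sum_subgrp_right[OF C d(1), symmetric])
    also have "\<dots> = (\<Sum>c\<in>C. \<Sum>r\<in>R. if inv g \<circ> (r \<circ> c) \<circ> g \<in> R then sign c else 0)"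
    proof (rule sum.cong[OF refl], rule sum.cong[OF refl])
      fix c r assume c: "c \<in> C" and r: "r \<in> R"
      let ?x = "inv (c \<circ> d) \<circ> (inv r \<circ> d)"
      have x: "?x \<in> Sym n" using c r d by (simp add: ss)
      have "inv g \<circ> (r \<circ> c) \<circ> g = inv r' \<circ> (inv ?x \<circ> r')"
        using c r d R_Sym[OF r'] by (simp add: gd ss)
      then have "inv g \<circ> (r \<circ> c) \<circ> g \<in> R \<longleftrightarrow> inv ?x \<in> R"
        using subgrp_mem_left[OF R subgrpD(4)[OF R r'], of "inv ?x \<circ> r'"]
          subgrp_mem_right[OF R r', of "inv ?x"] R_Sym[OF r'] x
        by (simp add: Sym_inv Sym_comp)
      also have "\<dots> \<longleftrightarrow> ?x \<in> R" by (rule subgrp_mem_inv[OF R x])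
      finally show "(if ?x \<in> R then sign d * sign (c \<circ> d) else 0) = (if inv g \<circ> (r \<circ> c) \<circ> g \<in> R then sign c else 0)"
        using c d by (simp add: ss)
    qed
    finally show ?thesis by simp
  next
    assume "\<exists>\<tau>\<in>C. sign \<tau> = -1 \<and> inv g \<circ> \<tau> \<circ> g \<in> R"
    then obtain \<tau> where \<tau>: "\<tau> \<in> C" "sign \<tau> = -1" "inv g \<circ> \<tau> \<circ> g \<in> R" by blast
    have e: "\<tau> \<circ> g = g \<circ> (inv g \<circ> \<tau> \<circ> g)" using g by (simp add: ss)
    have "eps g = - eps g" using eps_left[OF \<tau>(1) g] eps_right[OF \<tau>(3) g] \<tau>(2) e by simp
    then have e0: "eps g = 0" by simp
    let ?F = "\<lambda>c. \<Sum>r\<in>R. if inv g \<circ> (r \<circ> c) \<circ> g \<in> R then sign c else 0"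
    have "(\<Sum>c\<in>C. ?F c) = (\<Sum>c\<in>C. ?F (c \<circ> \<tau>))"
      by (rule sum_subgrp_right[OF C \<tau>(1), symmetric])
    also have "\<dots> = (\<Sum>c\<in>C. - ?F c)"
      unfolding sum_negf[symmetric]
    proof (rule sum.cong[OF refl], rule sum.cong[OF refl])
      fix c r assume c: "c \<in> C" and r: "r \<in> R"
      have "inv g \<circ> (r \<circ> (c \<circ> \<tau>)) \<circ> g = (inv g \<circ> (r \<circ> c) \<circ> g) \<circ> (inv g \<circ> \<tau> \<circ> g)"
        using g c r \<tau> by (simp add: ss)
      moreover have "inv g \<circ> (r \<circ> c) \<circ> g \<in> Sym n" using g c r by (simp add: ss)
      ultimately have "inv g \<circ> (r \<circ> (c \<circ> \<tau>)) \<circ> g \<in> R \<longleftrightarrow> inv g \<circ> (r \<circ> c) \<circ> g \<in> R"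
        using subgrp_mem_right[OF R \<tau>(3)] by metis
      then show "(if inv g \<circ> (r \<circ> (c \<circ> \<tau>)) \<circ> g \<in> R then sign (c \<circ> \<tau>) else 0) =
          - (if inv g \<circ> (r \<circ> c) \<circ> g \<in> R then sign c else 0)"
        using Sym_sign_comp[OF C_Sym[OF c] C_Sym[OF \<tau>(1)]] \<tau>(2) by simp
    qed
    finally have "(\<Sum>c\<in>C. ?F c) = 0" by (simp add: sum_negf)
    then show ?thesis using e0 by simp
  qed
  have "int (card R) * K f = (\<Sum>c\<in>C. \<Sum>r\<in>R. sign c * (int (card R) * f (r \<circ> c)))"
    by (simp add: K_def sum_distrib_left mult_ac)
  also have "\<dots> = (\<Sum>c\<in>C. \<Sum>r\<in>R. \<Sum>g\<in>Sym n. if inv g \<circ> (r \<circ> c) \<circ> g \<in> R then sign c else 0)"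
  proof (rule sum.cong[OF refl], rule sum.cong[OF refl])
    fix c r assume c: "c \<in> C" and r: "r \<in> R"
    then have "r \<circ> c \<in> Sym n" by (simp add: ss)
    from f[OF this] show "sign c * (int (card R) * f (r \<circ> c)) =
        (\<Sum>g\<in>Sym n. if inv g \<circ> (r \<circ> c) \<circ> g \<in> R then sign c else 0)"
      by (simp add: sum.If_cases Int_def)
  qed
  also have "\<dots> = (\<Sum>g\<in>Sym n. \<Sum>c\<in>C. \<Sum>r\<in>R. if inv g \<circ> (r \<circ> c) \<circ> g \<in> R then sign c else 0)"
    by (subst (2) sum.swap, subst sum.swap) (rule refl)
  also have "\<dots> = (\<Sum>g\<in>Sym n. \<Sum>r\<in>R. eps g * eps (inv r \<circ> g))"
    by (intro sum.cong refl F)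
  also have "\<dots> = M" unfolding M_def m_def by (rule sum.swap)
  finally show ?thesis .
qed

section \<open>Row and column groups of a Young diagram\<close>

definition stab :: "nat \<Rightarrow> (nat \<Rightarrow> 'a) \<Rightarrow> (nat \<Rightarrow> nat) set" where
  "stab n f = {p \<in> Sym n. \<forall>x<n. f (p x) = f x}"

lemma Sym_less: "p \<in> Sym n \<Longrightarrow> x < n \<Longrightarrow> p x < n"
  by (simp add: Sym_iff permutes_less)

lemma Sym_inv_apply: "p \<in> Sym n \<Longrightarrow> p (inv p x) = x" "p \<in> Sym n \<Longrightarrow> inv p (p x) = x"
  by (auto simp: Sym_iff permutes_inverses)

lemma subgrp_stab: "subgrp n (stab n f)"
  unfolding subgrp_def
proof (intro conjI ballI)
  fix x assume x: "x \<in> stab n f"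
  have "f (inv x y) = f y" if "y < n" for y
  proof -
    have "inv x y < n" using x Sym_less[OF Sym_inv that, of x] by (simp add: stab_def)
    then have "f (x (inv x y)) = f (inv x y)" using x by (auto simp: stab_def)
    then show ?thesis using x Sym_inv_apply(1)[of x n y] by (simp add: stab_def)
  qed
  then show "inv x \<in> stab n f" using x by (auto simp: stab_def Sym_inv)
qed (auto simp: stab_def Sym_id Sym_comp Sym_less)

lemma transpose_stab:
  assumes "x < n" "y < n" "f x = f y"
  shows "transpose x y \<in> stab n f"
proof -
  have "transpose x y permutes {..<n}" using assms by (intro permutes_swap_id) auto
  then show ?thesis using assms by (auto simp: stab_def Sym_iff transpose_def)
qed

lemma card_by: "card {x \<in> {..<n :: nat}. P x} = (\<Sum>j\<in>f ` {..<n}. card {x \<in> {..<n}. f x = j \<and> P x})"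
proof -
  have "card {x \<in> {..<n}. P x} = card (\<Union>j\<in>f ` {..<n}. {x \<in> {..<n}. f x = j \<and> P x})"
    by (rule arg_cong[where f=card]) auto
  also have "\<dots> = (\<Sum>j\<in>f ` {..<n}. card {x \<in> {..<n}. f x = j \<and> P x})"
    by (rule card_UN_disjoint) auto
  finally show ?thesis .
qed

text \<open>The points \<open>x < n\<close> fill a Young diagram with row lengths \<open>a\<close> and column lengths \<open>b\<close>.\<close>

locale diagram =
  fixes n :: nat and rw cl :: "nat \<Rightarrow> nat" and a b :: "nat \<Rightarrow> nat"
  assumes inj: "\<And>x y. x < n \<Longrightarrow> y < n \<Longrightarrow> rw x = rw y \<Longrightarrow> cl x = cl y \<Longrightarrow> x = y"
    and mem: "\<And>i j. (\<exists>x<n. rw x = i \<and> cl x = j) \<longleftrightarrow> j < a i"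
    and ab: "\<And>i j. j < a i \<longleftrightarrow> i < b j"
begin

lemma flip: "diagram n cl rw b a"
  using inj mem ab by unfold_locales (metis, metis, metis)

lemma a_anti: "i \<le> j \<Longrightarrow> a j \<le> a i"
  by (metis ab dual_order.strict_trans2 leI order_less_irrefl)

lemma card_row: "card {x \<in> {..<n}. rw x = i} = a i"
proof -
  have "bij_betw cl {x \<in> {..<n}. rw x = i} {..<a i}"
  proof (rule bij_betw_imageI)
    show "inj_on cl {x \<in> {..<n}. rw x = i}" by (rule inj_onI) (auto intro: inj)
    show "cl ` {x \<in> {..<n}. rw x = i} = {..<a i}" unfolding set_eq_iff image_iff using mem[of i] by (auto simp: eq_commute)
  qed
  then show ?thesis by (simp add: bij_betw_same_card)
qed

lemma card_col_less: "card {x \<in> {..<n}. cl x = j \<and> rw x < s} = min s (b j)"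
proof -
  have "bij_betw rw {x \<in> {..<n}. cl x = j \<and> rw x < s} {..<min s (b j)}"
  proof (rule bij_betw_imageI)
    show "inj_on rw {x \<in> {..<n}. cl x = j \<and> rw x < s}" by (rule inj_onI) (auto intro: inj)
    have "(\<exists>x\<in>{x \<in> {..<n}. cl x = j \<and> rw x < s}. i = rw x) \<longleftrightarrow> i < s \<and> i < b j" for i
      using mem[of i j] ab[of j i] by auto
    then show "rw ` {x \<in> {..<n}. cl x = j \<and> rw x < s} = {..<min s (b j)}"
      unfolding set_eq_iff image_iff by simp
  qed
  then show ?thesis by (simp add: bij_betw_same_card)
qed

text \<open>A labelling without repetitions in columns has at most \<open>min s (b j)\<close> labels
  below \<open>s\<close> in column \<open>j\<close>, the number attained by the row labels; this is
  a dominance statement. If the totals agree for every \<open>s\<close>, each column attains its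
  bound, so its labels stay below its length.\<close>

lemma col_inj:
  assumes f: "\<And>x y. x < n \<Longrightarrow> y < n \<Longrightarrow> cl x = cl y \<Longrightarrow> f x = (f y :: nat) \<Longrightarrow> x = y"
  shows col_inj_less: "card {x \<in> {..<n}. cl x = j \<and> f x < s} \<le> min s (b j)"
    and col_inj_sum: "card {x \<in> {..<n}. f x < s} \<le> card {x \<in> {..<n}. rw x < s}"
    and col_inj_row: "(\<And>s. card {x \<in> {..<n}. f x < s} = card {x \<in> {..<n}. rw x < s}) \<Longrightarrow> x < n \<Longrightarrow> f x < b (cl x)"
proof -
  show l: "card {x \<in> {..<n}. cl x = j \<and> f x < s} \<le> min s (b j)" for j s
  proof -
    let ?A = "{x \<in> {..<n}. cl x = j \<and> f x < s}"
    have "card ?A = card (f ` ?A)"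
      by (rule card_image[symmetric], rule inj_onI, rule f) auto
    also have "\<dots> \<le> card {..<s}" by (rule card_mono) auto
    finally have 1: "card ?A \<le> s" by simp
    have "card ?A \<le> card {x \<in> {..<n}. cl x = j \<and> rw x < b j}"
      by (rule card_mono) (use mem ab in auto)
    then show ?thesis using 1 card_col_less[of j "b j"] by simp
  qed
  show "card {x \<in> {..<n}. f x < s} \<le> card {x \<in> {..<n}. rw x < s}" for s
    unfolding card_by[of _ "\<lambda>x. f x < s" cl] card_by[of _ "\<lambda>x. rw x < s" cl] card_col_less
    by (rule sum_mono) (rule l)
  show "f x < b (cl x)" if e: "\<And>s. card {x \<in> {..<n}. f x < s} = card {x \<in> {..<n}. rw x < s}" and x: "x < n"
  proof -
    define s where "s = b (cl x)"
    let ?A = "{y \<in> {..<n}. cl y = cl x \<and> f y < s}" and ?B = "{y \<in> {..<n}. cl y = cl x}"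
    have "card ?A = min s (b (cl x))"
    proof (rule ccontr)
      assume "card ?A \<noteq> min s (b (cl x))"
      then have "card ?A < min s (b (cl x))" using l[of "cl x" s] by linarith
      then have "(\<Sum>j\<in>cl ` {..<n}. card {y \<in> {..<n}. cl y = j \<and> f y < s}) < (\<Sum>j\<in>cl ` {..<n}. min s (b j))"
        using x l by (intro sum_strict_mono_ex1) auto
      then show False
        using e[of s] unfolding card_by[of _ "\<lambda>x. f x < s" cl] card_by[of _ "\<lambda>x. rw x < s" cl] card_col_less by simp
    qed
    then have c: "card ?A = card {y \<in> {..<n}. cl y = cl x \<and> rw y < s}"
      using card_col_less by simp
    have "?A \<subseteq> ?B" by auto
    moreover have "{y \<in> {..<n}. cl y = cl x \<and> rw y < s} = ?B"
      using mem ab by (auto simp: s_def)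
    ultimately have "?A = ?B"
      using c by (intro card_subset_eq) auto
    then show ?thesis using x by (auto simp: s_def)
  qed
qed

lemma stab_RC: "x \<in> stab n rw \<Longrightarrow> x \<in> stab n cl \<Longrightarrow> x = id"
proof (rule ext)
  fix y assume x: "x \<in> stab n rw" "x \<in> stab n cl"
  show "x y = id y"
  proof (cases "y < n")
    case True
    then show ?thesis using x Sym_less[of x n y] inj[of "x y" y] by (simp add: stab_def)
  next
    case False
    then show ?thesis using x by (auto simp: stab_def Sym_iff permutes_def)
  qed
qed

lemma transpose_stab_conj:
  assumes g: "g \<in> Sym n" and xy: "x < n" "y < n" "x \<noteq> y" "cl x = cl y" "rw (inv g x) = rw (inv g y)"
  shows "\<exists>\<tau>\<in>stab n cl. sign \<tau> = -1 \<and> inv g \<circ> \<tau> \<circ> g \<in> stab n rw"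
proof (intro bexI conjI)
  show "transpose x y \<in> stab n cl" using xy by (intro transpose_stab)
  show "sign (transpose x y) = - 1" using xy by (simp add: sign_swap_id)
  have "inv g \<circ> transpose x y \<circ> g = transpose (inv g x) (inv g y)"
    using g by (auto simp: fun_eq_iff transpose_def Sym_inv_apply)
  then show "inv g \<circ> transpose x y \<circ> g \<in> stab n rw"
    using xy transpose_stab[of "inv g x" n "inv g y" rw] Sym_less[OF Sym_inv[OF g]] by simp
qed

text \<open>\<open>f\<close> gives the rows of the moved tableau. If two points of a column share
  such a row, their transposition is the odd element. Otherwise \<open>f\<close> has no repetitions
  in columns and the same counts as \<open>rw\<close>, so by \<open>col_inj_row\<close> it fits into
  the columns, and a column permutation \<open>h\<close> carries every point to the row that
  \<open>f\<close> prescribes.\<close>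

lemma von_Neumann_stab:
  assumes g: "g \<in> Sym n"
  shows "(\<exists>c\<in>stab n cl. inv c \<circ> g \<in> stab n rw) \<or> (\<exists>\<tau>\<in>stab n cl. sign \<tau> = -1 \<and> inv g \<circ> \<tau> \<circ> g \<in> stab n rw)"
proof (cases "\<exists>x y. x < n \<and> y < n \<and> x \<noteq> y \<and> cl x = cl y \<and> rw (inv g x) = rw (inv g y)")
  case True
  then show ?thesis using transpose_stab_conj[OF g] by blast
next
  case False
  define f where "f x = rw (inv g x)" for x
  have finj: "x = y" if "x < n" "y < n" "cl x = cl y" "f x = f y" for x y
    using False that by (auto simp: f_def)
  have "card {x \<in> {..<n}. f x < s} = card {x \<in> {..<n}. rw x < s}" for s
  proof (rule bij_betw_same_card[of "inv g"])
    show "bij_betw (inv g) {x \<in> {..<n}. f x < s} {x \<in> {..<n}. rw x < s}"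
      by (rule bij_betw_byWitness[where f' = g])
        (use g Sym_less[OF g] Sym_less[OF Sym_inv[OF g]] in \<open>auto simp: f_def Sym_inv_apply[OF g]\<close>)
  qed
  then have fb: "f x < b (cl x)" if "x < n" for x
    using col_inj_row[of f, OF finj] that by blast
  define h where "h x = (if x < n then SOME y. y < n \<and> rw y = f x \<and> cl y = cl x else x)" for x
  have h: "h x < n \<and> rw (h x) = f x \<and> cl (h x) = cl x" if "x < n" for x
    using someI_ex[of "\<lambda>y. y < n \<and> rw y = f x \<and> cl y = cl x"] mem[of "f x" "cl x"] ab fb[OF that] that
    by (simp add: h_def)
  have hinj: "inj_on h {..<n}"
    by (rule inj_onI) (metis finj h lessThan_iff)
  have "h permutes {..<n}"
  proof (rule bij_imp_permutes)
    show "bij_betw h {..<n} {..<n}"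
      unfolding bij_betw_def using hinj by (intro conjI endo_inj_surj) (auto simp: h)
  qed (simp add: h_def)
  then have hS: "h \<in> stab n cl" using h by (simp add: stab_def Sym_iff)
  have "inv (inv h) \<circ> g \<in> stab n rw"
    using hS g h Sym_less[OF g] by (simp add: stab_def Sym_inv_inv Sym_comp f_def Sym_inv_apply)
  then show ?thesis using subgrpD(4)[OF subgrp_stab hS] by blast
qed

sublocale young n "stab n rw" "stab n cl"
  by (rule young.intro[OF subgrp_stab subgrp_stab stab_RC von_Neumann_stab])

end

lemma cnt_compose_permutes:
  assumes "s permutes S"
  shows "cnt S (\<lambda>x. f (s x)) l = cnt S f l"
proof -
  have "bij_betw s {x \<in> S. f (s x) = l} {x \<in> S. f x = l}"
    by (rule bij_betw_byWitness[where f' = "inv s"])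
      (use assms in \<open>auto simp: permutes_inverses permutes_in_image permutes_in_image[OF permutes_inv]\<close>)
  then show ?thesis by (simp add: cnt_def bij_betw_same_card)
qed

lemma phi_conj:
  assumes p: "p permutes S" and s: "s permutes S"
  shows "phi S J \<gamma> (inv s \<circ> p \<circ> s) = phi S J \<gamma> p"
proof -
  let ?X = "\<lambda>p. {f \<in> fixfun S J p. \<forall>l\<in>J. cnt S f l = \<gamma> l}"
  have *: "restrict (\<lambda>x. f (u x)) S \<in> ?X (inv u \<circ> q \<circ> u)" if "f \<in> ?X q" "u permutes S" "q permutes S" for f u q
  proof -
    have c: "cnt S (restrict (\<lambda>x. f (u x)) S) l = cnt S f l" for l
      using cnt_compose_permutes[OF that(2), of f l] by (simp cong: cnt_cong)
    have "inv u (q (u x)) \<in> S" "u x \<in> S" if "x \<in> S" for x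
      using that \<open>u permutes S\<close> \<open>q permutes S\<close>
      by (simp_all add: permutes_in_image permutes_in_image[OF permutes_inv])
    then show ?thesis
      using that unfolding fixfun_def by (auto simp: c permutes_inverses)
  qed
  have "bij_betw (\<lambda>f. restrict (\<lambda>x. f (s x)) S) (?X p) (?X (inv s \<circ> p \<circ> s))"
  proof (rule bij_betw_byWitness[where f' = "\<lambda>f. restrict (\<lambda>x. f (inv s x)) S"])
    show "\<forall>f\<in>?X p. restrict (\<lambda>x. restrict (\<lambda>x. f (s x)) S (inv s x)) S = f"
      using s by (auto simp: fixfun_def fun_eq_iff PiE_iff extensional_def permutes_inverses permutes_in_image[OF permutes_inv])
    show "\<forall>f\<in>?X (inv s \<circ> p \<circ> s). restrict (\<lambda>x. restrict (\<lambda>x. f (inv s x)) S (s x)) S = f"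
      using s by (auto simp: fixfun_def fun_eq_iff PiE_iff extensional_def permutes_inverses permutes_in_image)
    show "(\<lambda>f. restrict (\<lambda>x. f (s x)) S) ` ?X p \<subseteq> ?X (inv s \<circ> p \<circ> s)"
      using *[OF _ s p] by blast
    have e: "inv (inv s) \<circ> (inv s \<circ> p \<circ> s) \<circ> inv s = p"
      using s by (simp add: fun_eq_iff permutes_inverses permutes_inv_inv)
    have "inv s \<circ> p \<circ> s permutes S" using p s by (intro permutes_compose permutes_inv)
    from *[OF _ permutes_inv[OF s] this] e
    show "(\<lambda>f. restrict (\<lambda>x. f (inv s x)) S) ` ?X (inv s \<circ> p \<circ> s) \<subseteq> ?X p" by auto
  qed
  then show ?thesis by (simp add: phi_def bij_betw_same_card)
qed

lemma psi_conj:
  assumes "p permutes S" "s permutes S"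
  shows "psi S N \<beta> (inv s \<circ> p \<circ> s) = psi S N \<beta> p"
  unfolding psi_def phi_conj[OF assms] ..

lemma fixfun_inv:
  fixes p :: "'a \<Rightarrow> 'a" and J :: "'b set"
  assumes "p permutes S"
  shows "fixfun S J (inv p) = fixfun S J p"
proof -
  have "(\<forall>x\<in>S. f (inv p x) = f x) \<longleftrightarrow> (\<forall>x\<in>S. f (p x) = f x)" for f :: "'a \<Rightarrow> 'b"
  proof (intro iffI ballI)
    fix x assume "\<forall>x\<in>S. f (inv p x) = f x" "x \<in> S"
    then have "f (inv p (p x)) = f (p x)" using permutes_in_image[OF assms] by blast
    then show "f (p x) = f x" by (simp add: permutes_inverses[OF assms])
  next
    fix x assume "\<forall>x\<in>S. f (p x) = f x" "x \<in> S"
    then have "f (p (inv p x)) = f (inv p x)" using permutes_in_image[OF permutes_inv[OF assms]] by blast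
    then show "f (inv p x) = f x" by (simp add: permutes_inverses[OF assms])
  qed
  then show ?thesis unfolding fixfun_def by blast
qed

lemma psi_inv: "p permutes S \<Longrightarrow> psi S N \<beta> (inv p) = psi S N \<beta> p"
  by (simp add: psi_def phi_def fixfun_inv)

section \<open>The character of a diagram as a Jacobi-Trudi sum\<close>

context diagram
begin

lemma a_beyond: "x < n \<Longrightarrow> a (rw x) > 0"
  using mem[of "rw x" "cl x"] by auto

lemma cnt_row: "cnt {..<n} rw l = int (a l)"
  unfolding cnt_def by (rule arg_cong[OF card_row])

lemma mset_fibres:
  fixes f f' :: "nat \<Rightarrow> 'a"
  assumes "\<And>l. cnt {..<n} f l = cnt {..<n} f' l"
  shows "image_mset f (mset_set {..<n}) = image_mset f' (mset_set {..<n})"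
proof (rule multiset_eqI)
  fix l
  have "count (image_mset h (mset_set {..<n})) l = card {x \<in> {..<n}. h x = l}" for h :: "nat \<Rightarrow> 'a"
    by (simp add: count_image_mset' vimage_def Int_def conj_commute eq_commute)
  then show "count (image_mset f (mset_set {..<n})) l = count (image_mset f' (mset_set {..<n})) l"
    using assms[of l] by (simp add: cnt_def)
qed

lemma card_fibre:
  assumes g0: "g0 \<in> Sym n"
  shows "card {g \<in> Sym n. \<forall>x<n. rw (inv g x) = rw (inv g0 x)} = card (stab n rw)"
proof -
  let ?F = "{g \<in> Sym n. \<forall>x<n. rw (inv g x) = rw (inv g0 x)}"
  have "bij_betw (\<lambda>r. g0 \<circ> r) (stab n rw) ?F"
  proof (rule bij_betw_byWitness[where f' = "\<lambda>g. inv g0 \<circ> g"])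
    show "(\<lambda>r. g0 \<circ> r) ` stab n rw \<subseteq> ?F"
    proof (rule image_subsetI)
      fix r assume r: "r \<in> stab n rw"
      then have "inv r \<in> stab n rw" by (rule subgrpD(4)[OF subgrp_stab])
      moreover have "inv (g0 \<circ> r) = inv r \<circ> inv g0" using g0 R_Sym[OF r] by (simp add: ss)
      ultimately show "g0 \<circ> r \<in> ?F"
        using g0 R_Sym[OF r] Sym_less[OF Sym_inv[OF g0]] by (simp add: Sym_comp stab_def)
    qed
    show "(\<lambda>g. inv g0 \<circ> g) ` ?F \<subseteq> stab n rw"
    proof (rule image_subsetI)
      fix g assume "g \<in> ?F"
      then have g: "g \<in> Sym n" and h: "\<And>x. x < n \<Longrightarrow> rw (inv g x) = rw (inv g0 x)" by auto
      show "inv g0 \<circ> g \<in> stab n rw"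
        using g g0 h[OF Sym_less[OF g]] by (simp add: stab_def Sym_comp Sym_inv Sym_inv_apply[OF g])
    qed
  qed (use g0 in \<open>auto simp: ss\<close>)
  then show ?thesis by (simp add: bij_betw_same_card)
qed

text \<open>The words of content \<open>a\<close> are the rearrangements of the row labelling, hence
  correspond to the cosets of the row group. Each arises from \<open>card (stab n rw)\<close>
  permutations \<open>g\<close>, and \<open>p\<close> fixes it iff
  \<open>inv g \<circ> p \<circ> g\<close> preserves the rows.\<close>

lemma phi_content:
  assumes N: "\<And>i. N \<le> i \<Longrightarrow> a i = 0" and p: "p \<in> Sym n"
  shows "int (card (stab n rw)) * phi {..<n} {..<N} (\<lambda>i. int (a i)) p = int (card {g \<in> Sym n. inv g \<circ> p \<circ> g \<in> stab n rw})"
proof -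
  let ?X = "{g \<in> Sym n. inv g \<circ> p \<circ> g \<in> stab n rw}"
  let ?Y = "{f \<in> fixfun {..<n} {..<N} p. \<forall>l\<in>{..<N}. cnt {..<n} f l = int (a l)}"
  let ?h = "\<lambda>g. restrict (\<lambda>x. rw (inv g x)) {..<n}"
  have rwN: "rw x < N" if "x < n" for x
    using a_beyond[OF that] N[of "rw x"] by (cases "rw x < N") auto
  have X: "inv g \<circ> p \<circ> g \<in> stab n rw \<longleftrightarrow> (\<forall>x<n. rw (inv g (p x)) = rw (inv g x))" if g: "g \<in> Sym n" for g
  proof -
    have "inv g \<circ> p \<circ> g \<in> stab n rw \<longleftrightarrow> (\<forall>x<n. rw (inv g (p (g x))) = rw x)"
      using g p by (simp add: stab_def Sym_comp Sym_inv)
    also have "\<dots> \<longleftrightarrow> (\<forall>x<n. rw (inv g (p (g x))) = rw (inv g (g x)))"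
      using g by (simp add: Sym_inv_apply)
    also have "\<dots> \<longleftrightarrow> (\<forall>x<n. rw (inv g (p x)) = rw (inv g x))"
      using all_permutes[of g n "\<lambda>x. rw (inv g (p x)) = rw (inv g x)"] g by (simp add: Sym_iff)
    finally show ?thesis .
  qed
  have hY: "?h g \<in> ?Y" if g: "g \<in> Sym n" "inv g \<circ> p \<circ> g \<in> stab n rw" for g
  proof -
    have "cnt {..<n} (?h g) l = int (a l)" for l
    proof -
      have "cnt {..<n} (?h g) l = cnt {..<n} (\<lambda>x. rw (inv g x)) l" by (rule cnt_cong) simp
      also have "\<dots> = cnt {..<n} rw l" using g by (intro cnt_compose_permutes permutes_inv) (simp add: Sym_iff)
      finally show ?thesis by (simp only: cnt_row)
    qed
    moreover have "?h g \<in> {..<n} \<rightarrow>\<^sub>E {..<N}" using rwN Sym_less[OF Sym_inv[OF g(1)]] by simp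
    moreover have "?h g (p x) = ?h g x" if "x < n" for x
      using X[OF g(1)] g(2) that Sym_less[OF p that] by simp
    ultimately show ?thesis by (simp add: fixfun_def)
  qed
  have fib: "card {g \<in> ?X. ?h g = f} = card (stab n rw)" if f: "f \<in> ?Y" for f
  proof -
    have fS: "f \<in> {..<n} \<rightarrow>\<^sub>E {..<N}" and fp: "\<And>x. x < n \<Longrightarrow> f (p x) = f x" using f by (auto simp: fixfun_def)
    have "cnt {..<n} f l = cnt {..<n} rw l" for l
    proof (cases "l < N")
      case True
      then show ?thesis using f by (simp add: cnt_row)
    next
      case False
      then have "{x \<in> {..<n}. f x = l} = {}" using fS by (auto simp: PiE_iff)
      then have "cnt {..<n} f l = 0" by (simp only: cnt_def card.empty of_nat_0)
      then show ?thesis using False N by (simp add: cnt_row)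
    qed
    then obtain h where h: "h permutes {..<n}" "\<forall>x\<in>{..<n}. f x = rw (h x)"
      using image_mset_eq_implies_permutes[OF _ mset_fibres, of f rw] by auto
    define g0 where "g0 = inv h"
    have g0: "g0 \<in> Sym n" "inv g0 = h" using h by (simp_all add: g0_def Sym_iff permutes_inv permutes_inv_inv)
    have fh: "f = ?h g" if "\<forall>x<n. rw (inv g x) = rw (inv g0 x)" for g
      using that fS h(2) by (auto simp: g0 fun_eq_iff PiE_iff extensional_def)
    have "{g \<in> ?X. ?h g = f} = {g \<in> Sym n. \<forall>x<n. rw (inv g x) = rw (inv g0 x)}"
    proof (intro equalityI subsetI)
      fix g assume "g \<in> {g \<in> ?X. ?h g = f}"
      then have g: "g \<in> Sym n" "f = ?h g" by auto
      have "rw (inv g x) = rw (inv g0 x)" if "x < n" for x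
        using h(2) that fun_cong[OF g(2), of x] by (simp add: g0)
      then show "g \<in> {g \<in> Sym n. \<forall>x<n. rw (inv g x) = rw (inv g0 x)}" using g by simp
    next
      fix g assume "g \<in> {g \<in> Sym n. \<forall>x<n. rw (inv g x) = rw (inv g0 x)}"
      then have g: "g \<in> Sym n" "\<forall>x<n. rw (inv g x) = rw (inv g0 x)" by auto
      have "rw (inv g (p x)) = rw (inv g x)" if "x < n" for x
        using fp[OF that] fun_cong[OF fh[OF g(2)], of x] fun_cong[OF fh[OF g(2)], of "p x"] that Sym_less[OF p] by simp
      then show "g \<in> {g \<in> ?X. ?h g = f}" using g X[OF g(1)] fh[OF g(2)] by simp
    qed
    then show ?thesis using card_fibre[OF g0(1)] by simp
  qed
  have "card ?X = (\<Sum>f\<in>?Y. \<Sum>g\<in>{g \<in> ?X. ?h g = f}. 1)"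
    by (subst sum.group) (use hY in auto)
  also have "\<dots> = card ?Y * card (stab n rw)"
  proof -
    have "(\<Sum>g\<in>{g \<in> ?X. ?h g = f}. 1) = card (stab n rw)" if "f \<in> ?Y" for f
      using fib[OF that] by simp
    then show ?thesis by simp
  qed
  finally show ?thesis by (simp add: phi_def mult.commute)
qed

text \<open>The symmetrizer is applied word by word. A letter repeated in a column yields a
  transposition in the column group that fixes the word, and it pairs the column permutations off
  with opposite signs.\<close>

lemma K_phi_zero:
  fixes N :: nat
  assumes "\<And>f. f \<in> {..<n} \<rightarrow>\<^sub>E {..<N} \<Longrightarrow> (\<And>l. l < N \<Longrightarrow> cnt {..<n} f l = \<gamma> l) \<Longrightarrow>
      \<exists>x y. x < n \<and> y < n \<and> x \<noteq> y \<and> cl x = cl y \<and> f x = f y"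
  shows "K (phi {..<n} {..<N} \<gamma>) = 0"
proof -
  let ?Y = "{f \<in> {..<n} \<rightarrow>\<^sub>E {..<N}. \<forall>l<N. cnt {..<n} f l = \<gamma> l}"
  have "finite ({..<n} \<rightarrow>\<^sub>E {..<N})" by (intro finite_PiE finite_lessThan)
  then have fin: "finite ?Y" by simp
  have "K (phi {..<n} {..<N} \<gamma>) = (\<Sum>c\<in>stab n cl. \<Sum>r\<in>stab n rw. \<Sum>f\<in>?Y. if \<forall>x<n. f (r (c x)) = f x then sign c else 0)"
    unfolding K_def
  proof (rule sum.cong[OF refl], rule sum.cong[OF refl])
    fix c r :: "nat \<Rightarrow> nat"
    have "phi {..<n} {..<N} \<gamma> (r \<circ> c) = int (card {f \<in> ?Y. \<forall>x<n. f (r (c x)) = f x})"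
      unfolding phi_def fixfun_def by (intro arg_cong[where f=int] arg_cong[where f=card]) auto
    then show "sign c * phi {..<n} {..<N} \<gamma> (r \<circ> c) = (\<Sum>f\<in>?Y. if \<forall>x<n. f (r (c x)) = f x then sign c else 0)"
      using fin by (simp add: sum.If_cases Int_def)
  qed
  also have "\<dots> = (\<Sum>f\<in>?Y. \<Sum>r\<in>stab n rw. \<Sum>c\<in>stab n cl. if \<forall>x<n. f (r (c x)) = f x then sign c else 0)"
    by (subst (2) sum.swap, subst sum.swap, rule sum.cong[OF refl], rule sum.swap)
  also have "\<dots> = (\<Sum>f\<in>?Y. \<Sum>r\<in>stab n rw. 0)"
  proof (rule sum.cong[OF refl], rule sum.cong[OF refl])
    fix f r assume f: "f \<in> ?Y" and r: "r \<in> stab n rw"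
    from f assms[of f] obtain x y where xy: "x < n" "y < n" "x \<noteq> y" "cl x = cl y" "f x = f y" by blast
    let ?\<tau> = "transpose x y"
    have \<tau>: "?\<tau> \<in> stab n cl" using xy by (intro transpose_stab)
    have f\<tau>: "f (?\<tau> z) = f z" for z using xy by (auto simp: transpose_def)
    let ?F = "\<lambda>c. if \<forall>x<n. f (r (c x)) = f x then sign c else 0"
    have "(\<Sum>c\<in>stab n cl. ?F c) = (\<Sum>c\<in>stab n cl. ?F (c \<circ> ?\<tau>))"
      by (rule sum_subgrp_right[OF C \<tau>, symmetric])
    also have "\<dots> = (\<Sum>c\<in>stab n cl. - ?F c)"
    proof (rule sum.cong[OF refl])
      fix c assume c: "c \<in> stab n cl"
      have "(\<forall>z<n. f (r ((c \<circ> ?\<tau>) z)) = f z) \<longleftrightarrow> (\<forall>z<n. f (r (c (?\<tau> z))) = f (?\<tau> z))" by (simp add: f\<tau>)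
      also have "\<dots> \<longleftrightarrow> (\<forall>z<n. f (r (c z)) = f z)"
        using all_permutes[of ?\<tau> n "\<lambda>z. f (r (c z)) = f z"] C_Sym[OF \<tau>] by (simp add: Sym_iff)
      finally show "?F (c \<circ> ?\<tau>) = - ?F c"
        using Sym_sign_comp[OF C_Sym[OF c] C_Sym[OF \<tau>]] xy by (simp add: sign_swap_id)
    qed
    finally show "(\<Sum>c\<in>stab n cl. ?F c) = 0" by (simp add: sum_negf)
  qed
  finally show ?thesis by simp
qed

text \<open>By \<open>chi_eqI\<close> only the pairing with the Young symmetrizer must be compared.
  The diagonal term of the determinant is the permutation character covered by
  \<open>K_conj_count\<close>. In every other term some partial sum of the content exceeds that of
  the row lengths, so a column must contain a repeated letter and \<open>K_phi_zero\<close>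
  applies.\<close>

lemma chi_eq_psi:
  assumes N: "\<And>i. N \<le> i \<Longrightarrow> a i = 0" and p: "p \<in> Sym n"
  shows "chi p = c0 * psi {..<n} N (\<lambda>i. int (a i) + dl N i) p"
proof (rule chi_eqI[OF _ _ _ p])
  let ?\<beta> = "\<lambda>i. int (a i) + dl N i"
  show "psi {..<n} N ?\<beta> (inv s \<circ> p \<circ> s) = psi {..<n} N ?\<beta> p" if "p \<in> Sym n" "s \<in> Sym n" for p s
    using that by (intro psi_conj) (simp_all add: Sym_iff)
  have tot: "(\<Sum>i<N. int (a i)) = int n"
  proof -
    have "rw x < N" if "x < n" for x
      using a_beyond[OF that] N[of "rw x"] by (cases "rw x < N") auto
    then have "(\<Sum>l\<in>{..<N}. cnt {..<n} rw l) = int (card {..<n})" by (intro sum_cnt) auto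
    then show ?thesis by (simp add: cnt_row)
  qed
  have "(\<Sum>p | p permutes {..<n}. psi {..<n} N ?\<beta> p * psi {..<n} N ?\<beta> p) = fact (card {..<n}) * alt N ?\<beta> ?\<beta>"
    using tot by (intro psi_orthonormal) (auto simp: dl_def sum.distrib)
  moreover have "alt N ?\<beta> ?\<beta> = 1"
  proof -
    have "?\<beta> j < ?\<beta> i" if "i < j" for i j
      using that a_anti[of i j] by (simp add: dl_def)
    then show ?thesis by (subst alt_decreasing) auto
  qed
  ultimately show "(\<Sum>p\<in>Sym n. psi {..<n} N ?\<beta> p * psi {..<n} N ?\<beta> p) = fact n" by (simp add: Sym_def)
  have z: "K (phi {..<n} {..<N} (\<lambda>i. ?\<beta> i - dl N (w i))) = 0" if w: "w permutes {..<N}" "w \<noteq> id" for w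
  proof (rule K_phi_zero, rule ccontr)
    fix f assume f: "f \<in> {..<n} \<rightarrow>\<^sub>E {..<N}" "\<And>l. l < N \<Longrightarrow> cnt {..<n} f l = ?\<beta> l - dl N (w l)"
      and "\<not> (\<exists>x y. x < n \<and> y < n \<and> x \<noteq> y \<and> cl x = cl y \<and> f x = f y)"
    then have finj: "x = y" if "x < n" "y < n" "cl x = cl y" "f x = f y" for x y using that by blast
    have cs: "int (card {x \<in> {..<n}. h x < s}) = (\<Sum>i<s. cnt {..<n} h i)" for h :: "nat \<Rightarrow> nat" and s
    proof -
      have "card (\<Union>i<s. {x \<in> {..<n}. h x = i}) = (\<Sum>i<s. card {x \<in> {..<n}. h x = i})"
        by (rule card_UN_disjoint) auto
      moreover have "(\<Union>i<s. {x \<in> {..<n}. h x = i}) = {x \<in> {..<n}. h x < s}" by auto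
      ultimately show ?thesis by (simp add: cnt_def)
    qed
    have "w ` {..<s} = {..<s}" if "s \<le> N" for s
    proof -
      have "(\<Sum>i<s. cnt {..<n} f i) \<le> (\<Sum>i<s. cnt {..<n} rw i)"
        using col_inj_sum[of f s, OF finj] cs[of f s] cs[of rw s] by linarith
      also have "(\<Sum>i<s. cnt {..<n} rw i) = (\<Sum>i<s. int (a i))" by (simp only: cnt_row)
      \<comment> \<open>The content at \<open>i\<close> is \<open>a i + w i - i\<close>; so bounding
        the partial sums bounds those of \<open>w\<close>, and \<open>w\<close> maps every initial
        segment onto itself.\<close>
      also have "(\<Sum>i<s. cnt {..<n} f i) = (\<Sum>i<s. int (a i) + (int (w i) - int i))"
        using that f(2) by (intro sum.cong refl) (simp add: dl_def)
      finally have "(\<Sum>i<s. int (w i)) \<le> (\<Sum>i<s. int i)" by (simp add: sum.distrib sum_subtractf)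
      then have le: "(\<Sum>i<s. w i) \<le> \<Sum>{..<s}" by (simp flip: of_nat_sum)
      have inj: "inj_on w {..<s}" using w(1) permutes_inj_on by blast
      then have "card (w ` {..<s}) = s" by (simp add: card_image)
      moreover have "\<Sum>(w ` {..<s}) = (\<Sum>i<s. w i)" using inj by (simp add: sum.reindex)
      ultimately show ?thesis using sum_distinct_nat[of "w ` {..<s}"] le by simp
    qed note im = this
    have "w = id"
    proof (rule ext)
      fix i show "w i = id i"
      proof (cases "i < N")
        case True
        then have "w ` insert i {..<i} = insert i {..<i}" "w ` {..<i} = {..<i}"
          using im[of "Suc i"] im[of i] by (simp_all add: lessThan_Suc)
        moreover have "w i \<notin> w ` {..<i}" using permutes_inj[OF w(1)] by (auto dest: injD)
        ultimately show ?thesis by auto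
      next
        case False
        then show ?thesis using w(1) by (simp add: permutes_def)
      qed
    qed
    then show False using w(2) by simp
  qed
  have lin: "K (psi {..<n} N ?\<beta>) = (\<Sum>w | w permutes {..<N}. sign w * K (phi {..<n} {..<N} (\<lambda>i. ?\<beta> i - dl N (w i))))"
    unfolding K_def psi_def sum_distrib_left
    by (subst (2) sum.swap, subst sum.swap) (simp add: mult_ac)
  also have "\<dots> = (\<Sum>w\<in>{id}. sign w * K (phi {..<n} {..<N} (\<lambda>i. ?\<beta> i - dl N (w i))))"
    by (rule sum.mono_neutral_right) (auto simp: z permutes_id)
  also have "\<dots> = K (phi {..<n} {..<N} (\<lambda>i. int (a i)))" by simp
  finally show "int (card (stab n rw)) * K (psi {..<n} N ?\<beta>) = M"
    using K_conj_count[of "phi {..<n} {..<N} (\<lambda>i. int (a i))"] phi_content[OF N] by simp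
qed

text \<open>Inverting the group elements reverses the order of a row and a column factor; the sign
  of the row factor is then the sign of the column factor times \<open>sign p\<close>.\<close>

lemma W_flip:
  assumes p: "p \<in> Sym n"
  shows "young.W n (stab n cl) (stab n rw) p = sign p * W (inv p)"
proof -
  interpret F: diagram n cl rw b a by (rule flip)
  have "F.W p = (\<Sum>s\<in>Sym n. \<Sum>r\<in>stab n rw. \<Sum>c\<in>stab n cl. if inv s \<circ> p \<circ> s = inv c \<circ> inv r then sign r else 0)"
    unfolding F.W_def
  proof (rule sum.cong[OF refl])
    fix s
    let ?f = "\<lambda>r c :: nat \<Rightarrow> nat. if inv s \<circ> p \<circ> s = c \<circ> r then sign r else 0"
    have "(\<Sum>r\<in>stab n rw. \<Sum>c\<in>stab n cl. ?f r c) = (\<Sum>r\<in>stab n rw. \<Sum>c\<in>stab n cl. ?f (inv r) c)"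
      by (rule sum_subgrp_inv[OF R, symmetric])
    also have "\<dots> = (\<Sum>r\<in>stab n rw. \<Sum>c\<in>stab n cl. ?f (inv r) (inv c))"
      by (rule sum.cong[OF refl], rule sum_subgrp_inv[OF C, symmetric])
    also have "\<dots> = (\<Sum>r\<in>stab n rw. \<Sum>c\<in>stab n cl. if inv s \<circ> p \<circ> s = inv c \<circ> inv r then sign r else 0)"
      by (intro sum.cong refl) (simp add: ss)
    finally show "(\<Sum>r\<in>stab n rw. \<Sum>c\<in>stab n cl. ?f r c) =
        (\<Sum>r\<in>stab n rw. \<Sum>c\<in>stab n cl. if inv s \<circ> p \<circ> s = inv c \<circ> inv r then sign r else 0)" .
  qed
  also have "\<dots> = (\<Sum>s\<in>Sym n. \<Sum>r\<in>stab n rw. \<Sum>c\<in>stab n cl. sign p * (if inv s \<circ> inv p \<circ> s = r \<circ> c then sign c else 0))"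
  proof (rule sum.cong[OF refl], rule sum.cong[OF refl], rule sum.cong[OF refl])
    fix s r c assume s: "s \<in> Sym n" and r: "r \<in> stab n rw" and c: "c \<in> stab n cl"
    have x: "inv s \<circ> p \<circ> s \<in> Sym n" and y: "r \<circ> c \<in> Sym n" using s p r c by (simp_all add: ss)
    have 1: "inv s \<circ> inv p \<circ> s = inv (inv s \<circ> p \<circ> s)" using s p by (simp add: ss)
    have 2: "inv c \<circ> inv r = inv (r \<circ> c)" using r c by (simp add: ss)
    have eq: "inv s \<circ> p \<circ> s = inv c \<circ> inv r \<longleftrightarrow> inv s \<circ> inv p \<circ> s = r \<circ> c"
      unfolding 1 2 using Sym_inv_inv[OF x] Sym_inv_inv[OF y] by metis
    have "sign r = sign p * sign c" if "inv s \<circ> p \<circ> s = inv c \<circ> inv r"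
    proof -
      have "sign (inv s \<circ> p \<circ> s) = sign p" using s p by (simp add: ss sign_idempotent)
      moreover have "sign (inv c \<circ> inv r) = sign c * sign r" using r c by (simp add: ss)
      ultimately have "sign p = sign c * sign r" using that by simp
      then show ?thesis by (simp add: mult_ac sign_idempotent)
    qed
    then show "(if inv s \<circ> p \<circ> s = inv c \<circ> inv r then sign r else 0) =
        sign p * (if inv s \<circ> inv p \<circ> s = r \<circ> c then sign c else 0)"
      using eq by simp
  qed
  also have "\<dots> = sign p * W (inv p)"
    unfolding W_def sum_distrib_left by (rule sum.cong[OF refl], rule sum.swap)
  finally show ?thesis .
qed

text \<open>Exchanging rows and columns multiplies \<open>chi\<close> by the sign character. The two
  constants \<open>c0\<close> coincide, since both are positive and \<open>chi_norm\<close> gives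
  them the same square.\<close>

lemma psi_flip:
  assumes N: "\<And>i. N \<le> i \<Longrightarrow> a i = 0" and N': "\<And>i. N' \<le> i \<Longrightarrow> b i = 0" and p: "p permutes {..<n}"
  shows "psi {..<n} N' (\<lambda>i. int (b i) + dl N' i) p = sign p * psi {..<n} N (\<lambda>i. int (a i) + dl N i) p"
proof -
  interpret F: diagram n cl rw b a by (rule flip)
  have s1: "sign p * sign p = 1" for p :: "nat \<Rightarrow> nat" by (simp add: sign_idempotent)
  have pS: "p \<in> Sym n" using p by (simp add: Sym_iff)
  have F: "F.chi q = sign q * chi (inv q)" if "q \<in> Sym n" for q
    using F.chi_eq_W[OF that] chi_eq_W[OF Sym_inv[OF that]] W_flip[OF that] by (simp add: mult_ac)
  have "fact n * F.c0\<^sup>2 = (\<Sum>q\<in>Sym n. chi (inv q) * chi (inv q))"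
    unfolding F.chi_norm[symmetric]
  proof (rule sum.cong[OF refl])
    fix q assume "q \<in> Sym n"
    have "sign q * chi (inv q) * (sign q * chi (inv q)) = (sign q * sign q) * (chi (inv q) * chi (inv q))"
      by (simp only: mult_ac)
    then show "F.chi q * F.chi q = chi (inv q) * chi (inv q)"
      unfolding F[OF \<open>q \<in> Sym n\<close>] s1 by simp
  qed
  also have "\<dots> = fact n * c0\<^sup>2" by (subst sum_Sym_inv) (rule chi_norm)
  finally have c: "F.c0 = c0" using F.c0_pos c0_pos by (simp add: power2_eq_iff_nonneg)
  have "F.chi p = c0 * psi {..<n} N' (\<lambda>i. int (b i) + dl N' i) p"
    using F.chi_eq_psi[OF N' pS] unfolding c by blast
  moreover have "chi (inv p) = c0 * psi {..<n} N (\<lambda>i. int (a i) + dl N i) p"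
    using chi_eq_psi[OF N Sym_inv[OF pS]] unfolding psi_inv[OF p] by blast
  ultimately show ?thesis using F[OF pS] c0_pos by (auto simp: mult.left_commute)
qed

end

abbreviation (input) "lookup \<equiv> Poly_Mapping.lookup"

abbreviation (input) "keys \<equiv> Poly_Mapping.keys"

lemma lt_pt_iff:
  "is_partition lam \<Longrightarrow> j < pt lam i \<longleftrightarrow> i < length (filter (\<lambda>p. j < p) lam)"
proof (induction lam arbitrary: i)
  case (Cons x xs)
  then have xs: "is_partition xs" and le: "\<forall>y\<in>set xs. y \<le> x" by (auto simp: is_partition_def)
  show ?case
  proof (cases "j < x")
    case True
    then show ?thesis using Cons.IH[OF xs] by (cases i) auto
  next
    case False
    then have "filter (\<lambda>p. j < p) (x # xs) = []" using le by (auto simp: filter_empty_conv)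
    moreover have "pt (x # xs) i \<le> x" using pt_antimono[OF Cons.prems, of 0 i] by simp
    ultimately show ?thesis using False by simp
  qed
qed simp

lemma stab_image:
  assumes p: "p \<in> Sym n" and J: "f ` {..<n} \<subseteq> J"
  shows "(\<forall>j\<in>J. p ` {x \<in> {..<n}. f x = j} = {x \<in> {..<n}. f x = j}) \<longleftrightarrow> p \<in> stab n f"
    (is "(\<forall>j\<in>J. p ` ?A j = _) \<longleftrightarrow> _")
proof
  assume a: "\<forall>j\<in>J. p ` ?A j = ?A j"
  have "f (p x) = f x" if "x < n" for x
  proof -
    have "f x \<in> J" using J that by auto
    with a have "p ` ?A (f x) = ?A (f x)" by blast
    moreover have "p x \<in> p ` ?A (f x)" using that by blast
    ultimately show ?thesis by blast
  qed
  then show "p \<in> stab n f" using p by (simp add: stab_def)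
next
  assume s: "p \<in> stab n f"
  show "\<forall>j\<in>J. p ` ?A j = ?A j"
  proof
    fix j
    have "p ` ?A j \<subseteq> ?A j" if "p \<in> stab n f" for p
      using that Sym_less[of p n] by (auto simp: stab_def)
    then have "p ` ?A j \<subseteq> ?A j"
      "inv p ` ?A j \<subseteq> ?A j"
      using s subgrpD(4)[OF subgrp_stab s] by blast+
    moreover have "y = p (inv p y)" for y using Sym_inv_apply[OF p] by simp
    ultimately show "p ` ?A j = ?A j"
      by (intro subset_antisym subsetI) (blast, rule image_eqI, blast+)
  qed
qed

section \<open>Specht modules\<close>

definition act :: "(nat \<Rightarrow> nat) \<Rightarrow> tabloid \<Rightarrow> tabloid" where
  "act p X = map ((`) p) X"

lemma act_comp: "act p (act q X) = act (p \<circ> q) X"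
  by (simp add: act_def image_comp o_def)

lemma act_inv:
  assumes "p \<in> Sym n"
  shows "act p (act (inv p) X) = X" "act (inv p) (act p X) = X"
  unfolding act_comp Sym_cancel(1,2)[OF assms] by (simp_all add: act_def)

lemma act_eq_iff: "p \<in> Sym n \<Longrightarrow> act p Y = X \<longleftrightarrow> Y = act (inv p) X"
  using act_inv[of p n] by metis

lemma lookup_perm_act:
  assumes p: "p \<in> Sym n"
  shows "lookup (perm_act p v) X = lookup v (act (inv p) X)"
proof -
  have "lookup (perm_act p v) X =
      (\<Sum>Y\<in>keys v. if Y = act (inv p) X then lookup v Y else 0)"
    unfolding perm_act_def act_def[symmetric] lookup_sum
    by (intro sum.cong refl) (simp add: lookup_single when_def act_eq_iff[OF p])
  then show ?thesis by (simp add: in_keys_iff)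
qed

locale tableau =
  fixes lam :: "nat list" and t :: "nat \<times> nat \<Rightarrow> nat"
  assumes part: "is_partition lam" and tab: "t \<in> tableaux lam"
begin

abbreviation "n \<equiv> sum_list lam"

definition rw :: "nat \<Rightarrow> nat" where "rw x = fst (inv_into (cells lam) t x)"

definition cl :: "nat \<Rightarrow> nat" where "cl x = snd (inv_into (cells lam) t x)"

lemma bij: "bij_betw t (cells lam) {..<n}"
  using tab by (simp add: tableaux_def)

lemma cells_iff: "(i, j) \<in> cells lam \<longleftrightarrow> j < pt lam i"
  by (cases "i < length lam") (auto simp: cells_def pt_nth pt_beyond)

lemma t_rw_cl: "(i, j) \<in> cells lam \<Longrightarrow> t (i, j) < n \<and> rw (t (i, j)) = i \<and> cl (t (i, j)) = j"
  using bij by (auto simp: bij_betw_def rw_def cl_def)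

lemma rw_cl_t: "x < n \<Longrightarrow> (rw x, cl x) \<in> cells lam \<and> t (rw x, cl x) = x"
  using bij inv_into_into[of x t "cells lam"] f_inv_into_f[of x t "cells lam"] by (auto simp: bij_betw_def rw_def cl_def)

sublocale diagram n rw cl "pt lam" "\<lambda>j. length (filter (\<lambda>p. j < p) lam)"
proof
  show "x = y" if "x < n" "y < n" "rw x = rw y" "cl x = cl y" for x y
    using rw_cl_t[OF that(1)] rw_cl_t[OF that(2)] unfolding that by metis
  show "(\<exists>x<n. rw x = i \<and> cl x = j) \<longleftrightarrow> j < pt lam i" for i j
  proof
    assume "\<exists>x<n. rw x = i \<and> cl x = j"
    then obtain x where "x < n" "rw x = i" "cl x = j" by blast
    then show "j < pt lam i" using rw_cl_t[of x] cells_iff by simp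
  next
    assume "j < pt lam i"
    then show "\<exists>x<n. rw x = i \<and> cl x = j" using t_rw_cl[of i j] cells_iff by blast
  qed
qed (rule lt_pt_iff[OF part])

definition T :: tabloid where "T = tabloid_of lam t"

lemma T_eq: "T = map (\<lambda>i. {x \<in> {..<n}. rw x = i}) [0..<length lam]"
proof -
  have "{t (i, j) |j. (i, j) \<in> cells lam} = {x \<in> {..<n}. rw x = i}" for i
  proof (intro equalityI subsetI)
    fix x assume "x \<in> {t (i, j) |j. (i, j) \<in> cells lam}"
    then show "x \<in> {x \<in> {..<n}. rw x = i}" using t_rw_cl by blast
  next
    fix x assume "x \<in> {x \<in> {..<n}. rw x = i}"
    then have "(i, cl x) \<in> cells lam" "t (i, cl x) = x" using rw_cl_t[of x] by auto
    then show "x \<in> {t (i, j) |j. (i, j) \<in> cells lam}" by (intro CollectI exI[of _ "cl x"]) simp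
  qed
  then show ?thesis by (simp add: T_def tabloid_of_def)
qed

lemma act_T: "p \<in> Sym n \<Longrightarrow> act p T = T \<longleftrightarrow> p \<in> stab n rw"
proof -
  assume p: "p \<in> Sym n"
  have "rw ` {..<n} \<subseteq> {..<length lam}" using rw_cl_t by (auto simp: cells_def)
  then have "p \<in> stab n rw \<longleftrightarrow> (\<forall>i\<in>{..<length lam}. p ` {x \<in> {..<n}. rw x = i} = {x \<in> {..<n}. rw x = i})"
    by (rule stab_image[OF p, symmetric])
  also have "\<dots> \<longleftrightarrow> act p T = T" unfolding act_def T_eq map_map map_eq_conv set_upt atLeast0LessThan o_apply ..
  finally show ?thesis by (rule sym)
qed

lemma column_set: "{t (i, j) |i. (i, j) \<in> cells lam} = {x \<in> {..<n}. cl x = j}"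
proof (intro equalityI subsetI)
  fix x assume "x \<in> {t (i, j) |i. (i, j) \<in> cells lam}"
  then show "x \<in> {x \<in> {..<n}. cl x = j}" using t_rw_cl by blast
next
  fix x assume "x \<in> {x \<in> {..<n}. cl x = j}"
  then have "(rw x, j) \<in> cells lam" "t (rw x, j) = x" using rw_cl_t[of x] by auto
  then show "x \<in> {t (i, j) |i. (i, j) \<in> cells lam}" by (intro CollectI exI[of _ "rw x"]) simp
qed

lemma column_stabilizer_eq: "column_stabilizer lam t = stab n cl"
proof (rule set_eqI)
  fix p show "p \<in> column_stabilizer lam t \<longleftrightarrow> p \<in> stab n cl"
  proof (cases "p \<in> Sym n")
    case True
    then show ?thesis using stab_image[OF True, of cl UNIV] by (simp add: column_stabilizer_def column_set Sym_iff)
  next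
    case False
    then show ?thesis by (simp add: column_stabilizer_def stab_def Sym_iff)
  qed
qed

lemma lookup_polytabloid:
  "lookup (polytabloid lam t) X = (\<Sum>c\<in>stab n cl. if act c T = X then of_int (sign c) else 0)"
  unfolding polytabloid_def column_stabilizer_eq lookup_sum T_def[symmetric] act_def[symmetric]
  by (intro sum.cong refl) (simp add: lookup_single when_def)

lemma lookup_polytabloid_orbit:
  assumes g: "g \<in> Sym n"
  shows "lookup (polytabloid lam t) (act g T) = of_int (eps g)"
  unfolding lookup_polytabloid eps_def of_int_sum
proof (rule sum.cong[OF refl])
  fix c assume "c \<in> stab n cl"
  then have c: "c \<in> Sym n" by (rule C_Sym)
  have "act c T = act g T \<longleftrightarrow> act (inv c) (act g T) = T"
    using act_eq_iff[OF c, of T "act g T"] by (auto simp: eq_commute)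
  also have "\<dots> \<longleftrightarrow> inv c \<circ> g \<in> stab n rw"
    using act_T[OF Sym_comp[OF Sym_inv[OF c] g]] by (simp only: act_comp)
  finally show "(if act c T = act g T then complex_of_int (sign c) else 0) =
      of_int (if inv c \<circ> g \<in> stab n rw then sign c else 0)" by simp
qed

definition e :: "(nat \<Rightarrow> nat) \<Rightarrow> perm_module" where
  "e s = perm_act s (polytabloid lam t)"

lemma lookup_e:
  assumes "s \<in> Sym n"
  shows "lookup (e s) X = lookup (polytabloid lam t) (act (inv s) X)"
  by (simp only: e_def lookup_perm_act[OF assms])

lemma lookup_e_orbit:
  assumes "s \<in> Sym n" "g \<in> Sym n"
  shows "lookup (e s) (act g T) = of_int (eps (inv s \<circ> g))"
  unfolding lookup_e[OF assms(1)] act_comp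
  by (rule lookup_polytabloid_orbit[OF Sym_comp[OF Sym_inv[OF assms(1)] assms(2)]])

lemma lookup_e_other:
  assumes s: "s \<in> Sym n" and X: "\<And>g. g \<in> Sym n \<Longrightarrow> X \<noteq> act g T"
  shows "lookup (e s) X = 0"
  unfolding lookup_e[OF s] lookup_polytabloid
proof (rule sum.neutral, rule ballI)
  fix c assume "c \<in> stab n cl"
  then have c: "c \<in> Sym n" by (rule C_Sym)
  have "X = act s (act c T)" if "act c T = act (inv s) X" unfolding that act_inv[OF s] ..
  then show "(if act c T = act (inv s) X then complex_of_int (sign c) else 0) = 0"
    using X[OF Sym_comp[OF s c]] unfolding act_comp by auto
qed

lemma perm_act_e:
  assumes "p \<in> Sym n" "s \<in> Sym n"
  shows "perm_act p (e s) = e (p \<circ> s)"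
  by (rule poly_mapping_eqI)
    (simp only: lookup_perm_act[OF assms(1)] lookup_e[OF assms(2)] lookup_e[OF Sym_comp[OF assms]]
      Sym_inv_comp[OF assms] act_comp)

text \<open>Moving the entries by \<open>s\<close> conjugates the column group and moves the
  tabloid. Hence the polytabloids of all tableaux of a shape form one orbit, see
  \<open>polytabloids\<close>.\<close>

lemma polytabloid_move:
  assumes s: "s \<in> Sym n"
  shows "polytabloid lam (restrict (s \<circ> t) (cells lam)) = e s"
proof (rule poly_mapping_eqI)
  fix X
  let ?t = "restrict (s \<circ> t) (cells lam)"
  have T': "tabloid_of lam ?t = act s T"
    unfolding T_def tabloid_of_def act_def by (auto simp: image_iff)
  have c': "{?t (i, j) |i. (i, j) \<in> cells lam} = s ` {x \<in> {..<n}. cl x = j}" for j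
    unfolding column_set[symmetric] by auto
  have C': "p \<in> column_stabilizer lam ?t \<longleftrightarrow> p \<in> Sym n \<and> inv s \<circ> p \<circ> s \<in> stab n cl" for p
  proof (cases "p \<in> Sym n")
    case True
    have x: "inv s \<circ> p \<circ> s \<in> Sym n" using s True by (intro Sym_comp Sym_inv)
    have "p ` s ` A = s ` A \<longleftrightarrow> (inv s \<circ> p \<circ> s) ` A = A" for A :: "nat set"
    proof -
      have "p ` s ` A = s ` (inv s \<circ> p \<circ> s) ` A"
        unfolding image_comp comp_assoc Sym_cancel(3)[OF s] ..
      moreover have "inj s" using s by (auto simp: Sym_iff permutes_inj)
      ultimately show ?thesis by (simp add: inj_image_eq_iff)
    qed
    then show ?thesis
      unfolding column_stabilizer_def c' using True stab_image[OF x, of cl UNIV] by (simp add: Sym_iff)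
  next
    case False
    then show ?thesis by (simp add: column_stabilizer_def Sym_iff)
  qed
  have "lookup (polytabloid lam ?t) X =
      (\<Sum>p\<in>column_stabilizer lam ?t. if act p (act s T) = X then of_int (sign p) else 0)"
    unfolding polytabloid_def lookup_sum act_def[symmetric] T' by (intro sum.cong refl) (simp add: lookup_single when_def)
  also have "\<dots> = (\<Sum>c\<in>stab n cl. if act c T = act (inv s) X then of_int (sign c) else 0)"
  proof (rule sum.reindex_bij_witness[where i = "\<lambda>c. s \<circ> c \<circ> inv s" and j = "\<lambda>p. inv s \<circ> p \<circ> s"])
    fix p assume "p \<in> column_stabilizer lam ?t"
    then have p: "p \<in> Sym n" "inv s \<circ> p \<circ> s \<in> stab n cl" by (auto simp: C')
    show "s \<circ> (inv s \<circ> p \<circ> s) \<circ> inv s = p" using s p(1) by (simp add: ss)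
    show "inv s \<circ> p \<circ> s \<in> stab n cl" by (rule p(2))
    have "act (inv s \<circ> p \<circ> s) T = act (inv s) (act p (act s T))" by (simp only: act_comp comp_assoc)
    then have "act (inv s \<circ> p \<circ> s) T = act (inv s) X \<longleftrightarrow> act p (act s T) = X"
      using act_eq_iff[OF Sym_inv[OF s], of "act p (act s T)" "act (inv s) X"] act_inv[OF s] Sym_inv_inv[OF s] by simp
    moreover have "sign (inv s \<circ> p \<circ> s) = sign p" using s p(1) by (simp add: ss sign_idempotent)
    ultimately show "(if act (inv s \<circ> p \<circ> s) T = act (inv s) X then complex_of_int (sign (inv s \<circ> p \<circ> s)) else 0) =
      (if act p (act s T) = X then of_int (sign p) else 0)" by (simp only:)
  next
    fix c assume c: "c \<in> stab n cl"
    then have cS: "c \<in> Sym n" by (rule C_Sym)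
    show eq: "inv s \<circ> (s \<circ> c \<circ> inv s) \<circ> s = c" using s cS by (simp add: ss)
    show "s \<circ> c \<circ> inv s \<in> column_stabilizer lam ?t"
      unfolding C' eq using c s cS by (simp add: ss)
  qed
  finally show "lookup (polytabloid lam ?t) X = lookup (e s) X"
    by (simp only: lookup_e[OF s] lookup_polytabloid)
qed

lemma polytabloids: "polytabloid lam ` tableaux lam = e ` Sym n"
proof (intro equalityI subsetI)
  fix v assume "v \<in> e ` Sym n"
  then obtain s where s: "s \<in> Sym n" and v: "v = e s" by blast
  have "bij_betw (s \<circ> t) (cells lam) {..<n}"
    using bij s by (intro bij_betw_trans) (auto simp: Sym_iff permutes_imp_bij)
  then have "bij_betw (restrict (s \<circ> t) (cells lam)) (cells lam) {..<n}"
    by (rule bij_betw_cong[THEN iffD1, rotated]) simp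
  then have "restrict (s \<circ> t) (cells lam) \<in> tableaux lam" by (simp add: tableaux_def)
  then show "v \<in> polytabloid lam ` tableaux lam" unfolding v polytabloid_move[OF s, symmetric] by blast
next
  fix v assume "v \<in> polytabloid lam ` tableaux lam"
  then obtain t' where t': "t' \<in> tableaux lam" and v: "v = polytabloid lam t'" by blast
  define s where "s x = (if x < n then t' (inv_into (cells lam) t x) else x)" for x
  have "bij_betw (t' \<circ> inv_into (cells lam) t) {..<n} {..<n}"
    using bij t' by (intro bij_betw_trans[OF bij_betw_inv_into]) (auto simp: tableaux_def)
  then have "bij_betw s {..<n} {..<n}"
    by (rule bij_betw_cong[THEN iffD1, rotated]) (simp add: s_def)
  then have s: "s \<in> Sym n" unfolding Sym_iff by (rule bij_imp_permutes) (simp add: s_def)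
  have "restrict (s \<circ> t) (cells lam) = t'"
  proof
    fix x show "restrict (s \<circ> t) (cells lam) x = t' x"
    proof (cases "x \<in> cells lam")
      case True
      then have "t x < n" "inv_into (cells lam) t (t x) = x" using bij by (auto simp: bij_betw_def)
      then show ?thesis using True by (simp add: s_def)
    next
      case False
      then show ?thesis using t' by (cases x) (simp add: tableaux_def extensional_def)
    qed
  qed
  then show "v \<in> e ` Sym n" unfolding v using polytabloid_move[OF s] s by blast
qed

text \<open>The inner product with the polytabloid moved by \<open>s\<close>, summed over
  permutations instead of tabloids; the resulting multiplicity is also built into \<open>m\<close>
  and \<open>c0\<close>.\<close>

definition L :: "(nat \<Rightarrow> nat) \<Rightarrow> perm_module \<Rightarrow> complex" where
  "L s v = (\<Sum>g\<in>Sym n. lookup v (act g T) * of_int (eps (inv s \<circ> g)))"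

lemma L_add: "L s (u + v) = L s u + L s v"
  by (simp add: L_def lookup_add algebra_simps sum.distrib)

lemma L_scale: "L s (scale_pm c v) = c * L s v"
  by (simp add: L_def sum_distrib_left mult_ac)

lemma L_sum: "L s (\<Sum>x\<in>X. f x) = (\<Sum>x\<in>X. L s (f x))"
proof -
  have "L s (\<Sum>x\<in>X. f x) = (\<Sum>g\<in>Sym n. \<Sum>x\<in>X. lookup (f x) (act g T) * of_int (eps (inv s \<circ> g)))"
    by (simp only: L_def lookup_sum sum_distrib_right)
  then show ?thesis unfolding L_def by (subst sum.swap) simp
qed

lemma L_e:
  assumes s: "s \<in> Sym n" and r: "r \<in> Sym n"
  shows "L s (e r) = of_int (m (inv r \<circ> s))"
proof -
  have "m (inv r \<circ> s) = (\<Sum>g\<in>Sym n. eps (inv r \<circ> g) * eps (inv (inv r \<circ> s) \<circ> (inv r \<circ> g)))"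
    unfolding m_def by (rule sum_Sym_left[OF Sym_inv[OF r], symmetric])
  also have "\<dots> = (\<Sum>g\<in>Sym n. eps (inv r \<circ> g) * eps (inv s \<circ> g))"
    by (intro sum.cong refl) (use s r in \<open>simp add: ss\<close>)
  finally have "complex_of_int (m (inv r \<circ> s)) = (\<Sum>g\<in>Sym n. of_int (eps (inv r \<circ> g)) * of_int (eps (inv s \<circ> g)))"
    by simp
  also have "\<dots> = L s (e r)"
    unfolding L_def by (intro sum.cong refl) (simp add: lookup_e_orbit[OF r])
  finally show ?thesis by simp
qed

text \<open>The translates of the polytabloid form a tight frame of the Specht module: this is
  \<open>proj\<close> on the generators, extended linearly.\<close>

lemma expand:
  assumes v: "v \<in> specht lam"
  shows "scale_pm (of_int c0) v = (\<Sum>s\<in>Sym n. scale_pm (L s v) (e s))"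
proof -
  have "v \<in> pm.span (e ` Sym n)" using v by (simp add: specht_def polytabloids)
  then show ?thesis
  proof (induction rule: pm.span_induct_alt)
    case base
    have "L s 0 = 0" for s by (simp add: L_def)
    then show ?case by simp
  next
    case (step c x y)
    then obtain r where r: "r \<in> Sym n" and x: "x = e r" by blast
    have "scale_pm (of_int c0) (e r) = (\<Sum>s\<in>Sym n. scale_pm (L s (e r)) (e s))"
    proof (rule poly_mapping_eqI)
      fix X
      have "lookup (\<Sum>s\<in>Sym n. scale_pm (L s (e r)) (e s)) X =
          (\<Sum>s\<in>Sym n. of_int (m (inv r \<circ> s)) * lookup (e s) X)"
        unfolding lookup_sum by (intro sum.cong refl) (simp add: L_e r)
      also have "\<dots> = of_int c0 * lookup (e r) X"
      proof (cases "\<exists>g\<in>Sym n. X = act g T")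
        case True
        then obtain g where g: "g \<in> Sym n" and X: "X = act g T" by blast
        have "(\<Sum>s\<in>Sym n. m (inv r \<circ> s) * eps (inv s \<circ> g)) = (\<Sum>s\<in>Sym n. m (inv r \<circ> (r \<circ> s)) * eps (inv (r \<circ> s) \<circ> g))"
          by (rule sum_Sym_left[OF r, symmetric])
        also have "\<dots> = (\<Sum>s\<in>Sym n. m s * eps (inv s \<circ> (inv r \<circ> g)))"
          by (intro sum.cong refl) (use r g in \<open>simp add: ss\<close>)
        also have "\<dots> = c0 * eps (inv r \<circ> g)" by (rule proj[OF Sym_comp[OF Sym_inv[OF r] g]])
        finally have *: "(\<Sum>s\<in>Sym n. m (inv r \<circ> s) * eps (inv s \<circ> g)) = c0 * eps (inv r \<circ> g)" .
        have "(\<Sum>s\<in>Sym n. of_int (m (inv r \<circ> s)) * lookup (e s) X) =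
            complex_of_int (\<Sum>s\<in>Sym n. m (inv r \<circ> s) * eps (inv s \<circ> g))"
          unfolding X of_int_sum of_int_mult by (rule sum.cong[OF refl]) (simp only: lookup_e_orbit g)
        then show ?thesis unfolding * X lookup_e_orbit[OF r g] by simp
      next
        case False
        then show ?thesis using lookup_e_other r by simp
      qed
      finally show "lookup (scale_pm (of_int c0) (e r)) X =
          lookup (\<Sum>s\<in>Sym n. scale_pm (L s (e r)) (e s)) X" by simp
    qed
    moreover have "scale_pm (of_int c0) (scale_pm c x + y) = scale_pm c (scale_pm (of_int c0) x) + scale_pm (of_int c0) y"
      by (rule poly_mapping_eqI) (simp add: lookup_add algebra_simps)
    ultimately show ?case using step unfolding x
      by (simp add: L_add L_scale pm.scale_left_distrib sum.distrib pm.scale_sum_right)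
  qed
qed

text \<open>With the frame expansion the trace is independent of the basis at hand: in any basis
  \<open>B\<close> the diagonal coefficients recombine to \<open>L s\<close> at the vectors
  \<open>e (p \<circ> s)\<close>, and these are values of \<open>m\<close>.\<close>

lemma trace:
  assumes p: "p \<in> Sym n"
  shows "of_int c0 * irr_char lam p = of_int (chi p)"
proof -
  let ?V = "specht lam"
  define B where "B = (SOME B. pm.independent B \<and> pm.span B = ?V)"
  have V: "?V = pm.span (e ` Sym n)" by (simp add: specht_def polytabloids)
  have "\<exists>B. pm.independent B \<and> pm.span B = ?V"
  proof -
    obtain B where "B \<subseteq> ?V" "pm.independent B" "?V \<subseteq> pm.span B" by (rule pm.basis_exists[of ?V])
    moreover have "pm.span B \<subseteq> ?V"
      using \<open>B \<subseteq> ?V\<close> unfolding V by (rule pm.span_minimal) (rule pm.subspace_span)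
    ultimately show ?thesis by blast
  qed
  from someI_ex[OF this] have B: "pm.independent B" "pm.span B = ?V" unfolding B_def[symmetric] by blast+
  have BV: "B \<subseteq> ?V" using pm.span_superset[of B] unfolding B(2) .
  have finB: "finite B"
    using pm.independent_span_bound[of "e ` Sym n" B] B(1) BV V by simp
  have eV: "e s \<in> ?V" if "s \<in> Sym n" for s using that unfolding V by (intro pm.span_base) blast
  have pact: "scale_pm (of_int c0) (perm_act p b) = (\<Sum>s\<in>Sym n. scale_pm (L s b) (e (p \<circ> s)))" if "b \<in> ?V" for b
  proof (rule poly_mapping_eqI)
    fix X
    have "lookup (scale_pm (of_int c0) (perm_act p b)) X = lookup (scale_pm (of_int c0) b) (act (inv p) X)"
      by (simp only: lookup_scale_pm lookup_perm_act[OF p])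
    also have "\<dots> = (\<Sum>s\<in>Sym n. L s b * lookup (perm_act p (e s)) X)"
      unfolding expand[OF that] lookup_sum lookup_scale_pm lookup_perm_act[OF p] ..
    also have "\<dots> = (\<Sum>s\<in>Sym n. L s b * lookup (e (p \<circ> s)) X)"
      by (intro sum.cong refl) (simp only: perm_act_e[OF p])
    finally show "lookup (scale_pm (of_int c0) (perm_act p b)) X =
        lookup (\<Sum>s\<in>Sym n. scale_pm (L s b) (e (p \<circ> s))) X"
      by (simp add: lookup_sum)
  qed
  \<comment> \<open>Invariance of the Specht module is read off from the expansion
    \<open>pact\<close> after dividing by the nonzero \<open>c0\<close>.\<close>
  have pV: "perm_act p b \<in> ?V" if "b \<in> ?V" for b
  proof -
    have "scale_pm (of_int c0) (perm_act p b) \<in> ?V"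
      unfolding pact[OF that] V
      by (intro pm.span_sum pm.span_scale pm.span_base imageI Sym_comp[OF p])
    then have "scale_pm (1 / of_int c0) (scale_pm (of_int c0) (perm_act p b)) \<in> ?V"
      unfolding V by (rule pm.span_scale)
    then show ?thesis using c0_pos by simp
  qed
  have rep: "of_int c0 * pm.representation B (perm_act p b) b' = (\<Sum>s\<in>Sym n. L s b * pm.representation B (e (p \<circ> s)) b')"
    if "b \<in> B" for b b'
  proof -
    have bV: "b \<in> ?V" using that BV by blast
    have "of_int c0 * pm.representation B (perm_act p b) b' = pm.representation B (scale_pm (of_int c0) (perm_act p b)) b'"
      using B pV[OF bV] by (simp add: pm.representation_scale)
    also have "\<dots> = (\<Sum>s\<in>Sym n. pm.representation B (scale_pm (L s b) (e (p \<circ> s))) b')"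
      unfolding pact[OF bV]
      by (subst pm.representation_sum[OF B(1)]) (simp_all add: B(2) V pm.span_scale pm.span_base Sym_comp[OF p])
    also have "\<dots> = (\<Sum>s\<in>Sym n. L s b * pm.representation B (e (p \<circ> s)) b')"
      by (intro sum.cong refl) (use B eV Sym_comp[OF p] in \<open>simp add: pm.representation_scale\<close>)
    finally show ?thesis .
  qed
  have "of_int c0 * irr_char lam p = (\<Sum>b\<in>B. of_int c0 * pm.representation B (perm_act p b) b)"
    by (simp add: irr_char_def trace_on_def Let_def B_def[symmetric] sum_distrib_left)
  also have "\<dots> = (\<Sum>b\<in>B. \<Sum>s\<in>Sym n. L s b * pm.representation B (e (p \<circ> s)) b)"
    by (intro sum.cong refl rep)
  also have "\<dots> = (\<Sum>s\<in>Sym n. \<Sum>b\<in>B. L s b * pm.representation B (e (p \<circ> s)) b)" by (rule sum.swap)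
  also have "\<dots> = (\<Sum>s\<in>Sym n. L s (e (p \<circ> s)))"
  proof (rule sum.cong[OF refl])
    fix s assume s: "s \<in> Sym n"
    have "e (p \<circ> s) = (\<Sum>b\<in>B. scale_pm (pm.representation B (e (p \<circ> s)) b) b)"
      using pm.sum_representation_eq[OF B(1) _ finB, of "e (p \<circ> s)"] B(2) eV[OF Sym_comp[OF p s]] by simp
    then have "L s (e (p \<circ> s)) = L s (\<Sum>b\<in>B. scale_pm (pm.representation B (e (p \<circ> s)) b) b)" by (rule arg_cong)
    then show "(\<Sum>b\<in>B. L s b * pm.representation B (e (p \<circ> s)) b) = L s (e (p \<circ> s))"
      by (simp add: L_sum L_scale mult.commute)
  qed
  also have "\<dots> = of_int (\<Sum>s\<in>Sym n. m (inv s \<circ> inv p \<circ> s))"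
    unfolding of_int_sum using p by (intro sum.cong refl) (simp add: L_e ss)
  also have "(\<Sum>s\<in>Sym n. m (inv s \<circ> inv p \<circ> s)) = chi p"
    unfolding chi_def
  proof (rule sum.cong[OF refl])
    fix s assume s: "s \<in> Sym n"
    have "inv s \<circ> inv p \<circ> s = inv (inv s \<circ> p \<circ> s)" using s p by (simp add: ss)
    then show "m (inv s \<circ> inv p \<circ> s) = m (inv s \<circ> p \<circ> s)" using m_inv[of "inv s \<circ> p \<circ> s"] s p by (simp add: ss)
  qed
  finally show ?thesis .
qed

lemma irr_char_psi:
  assumes N: "length lam \<le> N" and p: "p \<in> Sym n"
  shows "irr_char lam p = of_int (psi {..<n} N (bt N lam) p)"
proof -
  have "chi p = c0 * psi {..<n} N (bt N lam) p"
    using chi_eq_psi[of N, OF pt_beyond p] N by (simp add: bt_def[abs_def])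
  then have "of_int c0 * irr_char lam p = of_int c0 * of_int (psi {..<n} N (bt N lam) p)"
    using trace[OF p] by simp
  then show ?thesis using c0_pos by simp
qed

end

lemma finite_cells [simp]: "finite (cells lam)"
  by (rule finite_subset[of _ "\<Union>i<length lam. {i} \<times> {..<lam ! i}"]) (auto simp: cells_def)

lemma card_cells: "card (cells lam) = sum_list lam"
proof -
  have "cells lam = (SIGMA i:{..<length lam}. {..<lam ! i})" by (auto simp: cells_def)
  then show ?thesis by (simp add: sum_list_sum_nth atLeast0LessThan)
qed

lemma tableaux_nonempty: "\<exists>t. t \<in> tableaux lam"
proof -
  obtain h where h: "bij_betw h (cells lam) {..<sum_list lam}"
    using ex_bij_betw_finite_nat[OF finite_cells, of lam] by (auto simp: card_cells atLeast0LessThan)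
  then have "bij_betw (restrict h (cells lam)) (cells lam) {..<sum_list lam}"
    by (rule bij_betw_cong[THEN iffD1, rotated]) simp
  then show ?thesis by (auto simp: tableaux_def)
qed

theorem irr_char_psi:
  assumes lam: "is_partition lam" "length lam \<le> N" "sum_list lam = n" and p: "p permutes {..<n}"
  shows "irr_char lam p = of_int (psi {..<n} N (bt N lam) p)"
proof -
  obtain t where "t \<in> tableaux lam" using tableaux_nonempty by blast
  then interpret tableau lam t using lam by unfold_locales
  show ?thesis using irr_char_psi[OF lam(2)] p lam(3) by (auto simp: Sym_iff)
qed

lemma pt_conjugate:
  assumes "is_partition lam"
  shows "pt (conjugate lam) j = length (filter (\<lambda>p. j < p) lam)"
proof (cases "j < pt lam 0")
  case True
  then show ?thesis by (simp add: conjugate_def nth_default_nth)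
next
  case False
  then have "filter (\<lambda>p. j < p) lam = []" using lt_pt_iff[OF assms, of j 0] by simp
  then show ?thesis using False by (simp add: conjugate_def nth_default_beyond)
qed

lemma pt_conjugate_iff: "is_partition lam \<Longrightarrow> i < pt (conjugate lam) j \<longleftrightarrow> j < pt lam i"
  by (simp add: pt_conjugate lt_pt_iff)

theorem psi_conjugate:
  assumes lam: "is_partition lam" "length lam \<le> N" "pt lam 0 \<le> N'" "sum_list lam = n" and p: "p permutes {..<n}"
  shows "psi {..<n} N' (bt N' (conjugate lam)) p = sign p * psi {..<n} N (bt N lam) p"
proof -
  obtain t where "t \<in> tableaux lam" using tableaux_nonempty by blast
  then interpret tableau lam t using lam by unfold_locales
  have "length (filter (\<lambda>p. i < p) lam) = 0" if "N' \<le> i" for i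
    using lt_pt_iff[OF lam(1), of i 0] that lam(3) by simp
  from psi_flip[of N N' p, OF pt_beyond this] show ?thesis
    using lam p by (simp add: bt_def[abs_def] pt_conjugate)
qed

section \<open>Kronecker coefficients\<close>

text \<open>Positive semidefinite kernels, each with one distinguished vector \<open>a\<close> of a Gram decomposition.\<close>

definition gram :: "'g set \<Rightarrow> ('g \<Rightarrow> 'g \<Rightarrow> int) \<Rightarrow> ('g \<Rightarrow> int) \<Rightarrow> bool" where
  "gram G F a \<longleftrightarrow> (\<exists>c>0. \<exists>A. a \<in> set A \<and> (\<forall>g\<in>G. \<forall>h\<in>G. c * F g h = (\<Sum>v\<leftarrow>A. v g * v h)))"

lemma gram_family:
  assumes "finite I" "i \<in> I" "c > 0" "\<And>g h. g \<in> G \<Longrightarrow> h \<in> G \<Longrightarrow> c * F g h = (\<Sum>i\<in>I. v i g * v i h)"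
  shows "gram G F (v i)"
proof -
  obtain xs where xs: "set xs = I" "distinct xs" using finite_distinct_list[OF assms(1)] by blast
  have "(\<Sum>w\<leftarrow>map v xs. w g * w h) = (\<Sum>i\<in>I. v i g * v i h)" for g h
    using sum_list_distinct_conv_sum_set[OF xs(2), of "\<lambda>i. v i g * v i h"] by (simp add: xs(1) o_def)
  then show ?thesis unfolding gram_def using assms xs by (intro exI[of _ c] conjI exI[of _ "map v xs"]) auto
qed

lemma gram_pullback:
  assumes "gram G F a" "\<And>x. x \<in> G' \<Longrightarrow> f x \<in> G"
  shows "gram G' (\<lambda>x y. F (f x) (f y)) (\<lambda>x. a (f x))"
proof -
  obtain c A where c: "c > 0" "a \<in> set A" and A: "\<And>g h. g \<in> G \<Longrightarrow> h \<in> G \<Longrightarrow> c * F g h = (\<Sum>v\<leftarrow>A. v g * v h)"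
    using assms(1) by (auto simp: gram_def)
  show ?thesis
    unfolding gram_def
    by (intro exI[of _ c] conjI exI[of _ "map (\<lambda>v x. v (f x)) A"])
      (use c in \<open>auto simp: A[OF assms(2) assms(2)] o_def\<close>)
qed

lemma sum_list_product:
  "(\<Sum>v\<leftarrow>A. f v) * (\<Sum>w\<leftarrow>B. g w) = (\<Sum>x\<leftarrow>List.product A B. f (fst x) * (g (snd x) :: int))"
  by (induction A) (simp_all add: algebra_simps sum_list_const_mult o_def)

text \<open>Schur's product theorem: the pointwise products of Gram vectors are Gram vectors of the
  product kernel, in particular the product of the two distinguished ones.\<close>

lemma gram_mult:
  assumes "gram G F a" "gram G F' a'"
  shows "gram G (\<lambda>g h. F g h * F' g h) (\<lambda>g. a g * a' g)"
proof -
  obtain c A where c: "c > 0" "a \<in> set A" and A: "\<And>g h. g \<in> G \<Longrightarrow> h \<in> G \<Longrightarrow> c * F g h = (\<Sum>v\<leftarrow>A. v g * v h)"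
    using assms(1) by (auto simp: gram_def)
  obtain c' A' where c': "c' > 0" "a' \<in> set A'"
    and A': "\<And>g h. g \<in> G \<Longrightarrow> h \<in> G \<Longrightarrow> c' * F' g h = (\<Sum>v\<leftarrow>A'. v g * v h)"
    using assms(2) by (auto simp: gram_def)
  let ?B = "map (\<lambda>x g. fst x g * snd x g) (List.product A A')"
  show ?thesis
    unfolding gram_def
  proof (intro exI[of _ "c * c'"] conjI exI[of _ ?B] ballI)
    have "(a, a') \<in> set (List.product A A')" using c c' by simp
    then show "(\<lambda>g. a g * a' g) \<in> set ?B" by force
    fix g h assume gh: "g \<in> G" "h \<in> G"
    have "c * c' * (F g h * F' g h) = (c * F g h) * (c' * F' g h)" by (simp add: mult_ac)
    also have "\<dots> = (\<Sum>v\<leftarrow>?B. v g * v h)"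
      unfolding A[OF gh] A'[OF gh] sum_list_product by (simp add: o_def mult_ac)
    finally show "c * c' * (F g h * F' g h) = (\<Sum>v\<leftarrow>?B. v g * v h)" .
  qed (use c c' in simp)
qed

text \<open>The double sum is the quadratic form at the all-ones vector, a sum of squares up to a
  positive factor. A single Gram vector with nonzero sum makes it strictly positive.\<close>

lemma gram_sum:
  assumes "gram G F a"
  shows "(\<Sum>g\<in>G. \<Sum>h\<in>G. F g h) \<ge> 0" "(\<Sum>g\<in>G. a g) \<noteq> 0 \<Longrightarrow> (\<Sum>g\<in>G. \<Sum>h\<in>G. F g h) > 0"
proof -
  obtain c A where c: "c > 0" "a \<in> set A" and A: "\<And>g h. g \<in> G \<Longrightarrow> h \<in> G \<Longrightarrow> c * F g h = (\<Sum>v\<leftarrow>A. v g * v h)"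
    using assms by (auto simp: gram_def)
  have sl: "(\<Sum>x\<in>X. \<Sum>v\<leftarrow>A. f v x) = (\<Sum>v\<leftarrow>A. \<Sum>x\<in>X. f v x)" for X :: "'a set" and f :: "('a \<Rightarrow> int) \<Rightarrow> 'a \<Rightarrow> int"
    by (induction A) (simp_all add: sum.distrib)
  have "c * (\<Sum>g\<in>G. \<Sum>h\<in>G. F g h) = (\<Sum>g\<in>G. \<Sum>h\<in>G. \<Sum>v\<leftarrow>A. v g * v h)"
    unfolding sum_distrib_left by (rule sum.cong[OF refl], rule sum.cong[OF refl], rule A)
  also have "\<dots> = (\<Sum>v\<leftarrow>A. (\<Sum>g\<in>G. v g)\<^sup>2)"
    by (simp only: sl power2_eq_square sum_product)
  finally have e: "c * (\<Sum>g\<in>G. \<Sum>h\<in>G. F g h) = (\<Sum>v\<leftarrow>A. (\<Sum>g\<in>G. v g)\<^sup>2)" .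
  have "(\<Sum>v\<leftarrow>A. (\<Sum>g\<in>G. v g)\<^sup>2) \<ge> 0" by (intro sum_list_nonneg) auto
  then show "(\<Sum>g\<in>G. \<Sum>h\<in>G. F g h) \<ge> 0" using e c(1) by (metis zero_le_mult_iff not_less)
  assume "(\<Sum>g\<in>G. a g) \<noteq> 0"
  then have "(\<Sum>g\<in>G. a g)\<^sup>2 > 0" by simp
  moreover have "(\<Sum>v\<leftarrow>A. (\<Sum>g\<in>G. v g)\<^sup>2) \<ge> (\<Sum>g\<in>G. a g)\<^sup>2"
    using c(2) by (intro member_le_sum_list) auto
  ultimately have "c * (\<Sum>g\<in>G. \<Sum>h\<in>G. F g h) > 0" using e by linarith
  then show "(\<Sum>g\<in>G. \<Sum>h\<in>G. F g h) > 0" using c(1) by (simp add: zero_less_mult_iff)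
qed

section \<open>Irreducible characters as positive kernels\<close>

abbreviation irr :: "nat \<Rightarrow> nat list \<Rightarrow> (nat \<Rightarrow> nat) \<Rightarrow> int" where
  "irr n lam \<equiv> psi {..<n} n (bt n lam)"

lemma irr_orthonormal:
  assumes "lam \<in> partitions_of n" "mu \<in> partitions_of n"
  shows "(\<Sum>p\<in>Sym n. irr n lam p * irr n mu p) = (if lam = mu then fact n else 0)"
  using psi_bt_orthonormal[of "{..<n}" n n lam mu] assms by (simp add: Sym_def)

lemma (in young) chi_gram:
  assumes h: "h \<in> Sym n" "h' \<in> Sym n"
  shows "chi (inv h \<circ> h') = (\<Sum>(s, g)\<in>Sym n \<times> Sym n. eps (inv s \<circ> (inv h \<circ> g)) * eps (inv s \<circ> (inv h' \<circ> g)))"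
proof -
  have p: "inv h \<circ> h' \<in> Sym n" using h by (intro Sym_comp Sym_inv)
  have "chi (inv h \<circ> h') = (\<Sum>s\<in>Sym n. \<Sum>g\<in>Sym n. eps (inv s \<circ> g) * eps (inv s \<circ> (inv (inv h \<circ> h') \<circ> g)))"
    unfolding chi_def by (intro sum.cong refl m_conj[OF p])
  also have "\<dots> = (\<Sum>s\<in>Sym n. \<Sum>g\<in>Sym n. eps (inv s \<circ> (inv h \<circ> g)) * eps (inv s \<circ> (inv (inv h \<circ> h') \<circ> (inv h \<circ> g))))"
    by (rule sum.cong[OF refl], rule sum_Sym_left[OF Sym_inv[OF h(1)], symmetric])
  also have "\<dots> = (\<Sum>s\<in>Sym n. \<Sum>g\<in>Sym n. eps (inv s \<circ> (inv h \<circ> g)) * eps (inv s \<circ> (inv h' \<circ> g)))"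
    by (rule sum.cong[OF refl], rule sum.cong[OF refl]) (use h in \<open>simp add: ss\<close>)
  finally show ?thesis by (simp only: sum.cartesian_product)
qed

text \<open>The distinguished vector is kept explicit because \<open>psi_triple_pos\<close> needs a
  product of three such vectors whose sum is not 0.\<close>

lemma (in diagram) psi_gram:
  assumes "\<And>i. N \<le> i \<Longrightarrow> a i = 0" "s \<in> Sym n" "g \<in> Sym n"
  shows "gram (Sym n) (\<lambda>h h'. psi {..<n} N (\<lambda>i. int (a i) + dl N i) (inv h \<circ> h')) (\<lambda>h. eps (inv s \<circ> (inv h \<circ> g)))"
proof -
  let ?v = "\<lambda>(s, g) h. eps (inv s \<circ> (inv h \<circ> g))"
  have "gram (Sym n) (\<lambda>h h'. psi {..<n} N (\<lambda>i. int (a i) + dl N i) (inv h \<circ> h')) (?v (s, g))"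
  proof (rule gram_family[where I="Sym n \<times> Sym n" and c=c0])
    fix h h' assume h: "h \<in> Sym n" "h' \<in> Sym n"
    have "inv h \<circ> h' \<in> Sym n" using h by (intro Sym_comp Sym_inv)
    then have "chi (inv h \<circ> h') = c0 * psi {..<n} N (\<lambda>i. int (a i) + dl N i) (inv h \<circ> h')"
      using chi_eq_psi[OF assms(1)] by blast
    then show "c0 * psi {..<n} N (\<lambda>i. int (a i) + dl N i) (inv h \<circ> h') = (\<Sum>i\<in>Sym n \<times> Sym n. ?v i h * ?v i h')"
      using chi_gram[OF h] by (simp add: case_prod_beta)
  qed (use assms c0_pos in auto)
  then show ?thesis by simp
qed

lemma irr_gram_ex:
  assumes "lam \<in> partitions_of n"
  shows "\<exists>a. gram (Sym n) (\<lambda>h h'. irr n lam (inv h \<circ> h')) a"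
proof -
  obtain t where "t \<in> tableaux lam" using tableaux_nonempty by blast
  then interpret tableau lam t using partitions_ofD[OF assms] by unfold_locales
  have "pt lam i = 0" if "n \<le> i" for i using partitions_ofD[OF assms] that by (simp add: pt_beyond)
  from psi_gram[OF this Sym_id Sym_id] show ?thesis
    using partitions_ofD(2)[OF assms] by (auto simp: bt_def[abs_def])
qed

lemma sum_Sym_kernel: "(\<Sum>h\<in>Sym n. \<Sum>h'\<in>Sym n. F (inv h \<circ> h')) = fact n * (\<Sum>p\<in>Sym n. F p :: int)"
proof -
  have "(\<Sum>h\<in>Sym n. \<Sum>h'\<in>Sym n. F (inv h \<circ> h')) = (\<Sum>h\<in>Sym n. \<Sum>p\<in>Sym n. F p)"
    by (rule sum.cong[OF refl], rule sum_Sym_left[OF Sym_inv])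
  then show ?thesis by (simp add: card_Sym)
qed

lemma fact_mult_nonneg: "0 \<le> fact n * x \<Longrightarrow> 0 \<le> (x :: int)"
  using fact_gt_zero[of n, where 'a=int] by (auto simp: zero_le_mult_iff)

text \<open>\<open>fact n\<close> times the Kronecker coefficient, see
  \<open>kronecker_kron\<close>.\<close>

definition kron :: "nat \<Rightarrow> nat list \<Rightarrow> nat list \<Rightarrow> nat list \<Rightarrow> int" where
  "kron n lam mu kappa = (\<Sum>p\<in>Sym n. irr n lam p * irr n mu p * irr n kappa p)"

lemma kron_nonneg:
  assumes "lam \<in> partitions_of n" "mu \<in> partitions_of n" "kappa \<in> partitions_of n"
  shows "kron n lam mu kappa \<ge> 0"
proof -
  obtain a b c where "gram (Sym n) (\<lambda>h h'. irr n lam (inv h \<circ> h')) a" "gram (Sym n) (\<lambda>h h'. irr n mu (inv h \<circ> h')) b"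
    "gram (Sym n) (\<lambda>h h'. irr n kappa (inv h \<circ> h')) c"
    using assms irr_gram_ex by meson
  from gram_mult[OF gram_mult[OF this(1,2)] this(3)]
  have "0 \<le> fact n * kron n lam mu kappa"
    using gram_sum(1) unfolding kron_def sum_Sym_kernel[of "\<lambda>p. irr n lam p * irr n mu p * irr n kappa p" n, symmetric] by blast
  then show ?thesis by (rule fact_mult_nonneg)
qed

text \<open>The definite description has a solution because the integral expansion of the product
  has nonnegative coefficients, by \<open>kron_nonneg\<close>; the solution is unique because
  orthonormality recovers every coefficient, the content of \<open>coeff\<close>.\<close>

theorem kronecker_kron:
  assumes lam: "lam \<in> partitions_of n" and mu: "mu \<in> partitions_of n" and kappa: "kappa \<in> partitions_of n"
  shows "fact n * int (kronecker n lam mu kappa) = kron n lam mu kappa"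
proof -
  have irrc: "irr_char \<nu> p = of_int (irr n \<nu> p)" if "\<nu> \<in> partitions_of n" "p permutes {..<n}" for \<nu> p
    using partitions_ofD[OF that(1)] that(2) by (intro irr_char_psi) auto
  have coeff: "fact n * z \<nu> = kron n lam mu \<nu>"
    if z: "\<And>p. p \<in> Sym n \<Longrightarrow> irr n lam p * irr n mu p = (\<Sum>\<kappa>\<in>partitions_of n. z \<kappa> * irr n \<kappa> p)"
      and \<nu>: "\<nu> \<in> partitions_of n" for z \<nu>
  proof -
    have "kron n lam mu \<nu> = (\<Sum>p\<in>Sym n. \<Sum>\<kappa>\<in>partitions_of n. z \<kappa> * (irr n \<kappa> p * irr n \<nu> p))"
      unfolding kron_def by (intro sum.cong refl) (simp add: z sum_distrib_right mult.assoc)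
    also have "\<dots> = (\<Sum>\<kappa>\<in>partitions_of n. z \<kappa> * (\<Sum>p\<in>Sym n. irr n \<kappa> p * irr n \<nu> p))"
      by (subst sum.swap) (simp add: sum_distrib_left)
    also have "\<dots> = (\<Sum>\<kappa>\<in>partitions_of n. z \<kappa> * (if \<kappa> = \<nu> then fact n else 0))"
      using \<nu> by (intro sum.cong refl) (simp add: irr_orthonormal)
    also have "\<dots> = fact n * z \<nu>" using \<nu> by (simp add: if_distrib cong: if_cong)
    finally show ?thesis by simp
  qed
  obtain z where z: "\<And>p. p permutes {..<n} \<Longrightarrow> irr n lam p * irr n mu p = (\<Sum>\<kappa>\<in>partitions_of n. z \<kappa> * irr n \<kappa> p)"
    using zspan_psi_mult[of "{..<n}" n n "bt n lam" n "bt n mu"] by (auto simp: zspan_def)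
  have zpos: "z \<nu> \<ge> 0" if "\<nu> \<in> partitions_of n" for \<nu>
  proof -
    have "fact n * z \<nu> \<ge> 0"
      using coeff[of z \<nu>, OF _ that] z kron_nonneg[OF lam mu that] by (simp add: Sym_iff)
    then show ?thesis by (rule fact_mult_nonneg)
  qed
  let ?P = "\<lambda>m :: nat list \<Rightarrow> nat. (\<forall>kappa. kappa \<notin> partitions_of n \<longrightarrow> m kappa = 0) \<and>
       (\<forall>\<pi>. \<pi> permutes {..<n} \<longrightarrow>
         irr_char lam \<pi> * irr_char mu \<pi> =
           (\<Sum>kappa\<in>partitions_of n. of_nat (m kappa) * irr_char kappa \<pi>))"
  have P: "?P m \<longleftrightarrow> (\<forall>kappa. kappa \<notin> partitions_of n \<longrightarrow> m kappa = 0) \<and>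
      (\<forall>p. p permutes {..<n} \<longrightarrow> irr n lam p * irr n mu p = (\<Sum>\<kappa>\<in>partitions_of n. int (m \<kappa>) * irr n \<kappa> p))" for m
  proof -
    have "irr_char lam p * irr_char mu p = (\<Sum>kappa\<in>partitions_of n. of_nat (m kappa) * irr_char kappa p) \<longleftrightarrow>
      irr n lam p * irr n mu p = (\<Sum>\<kappa>\<in>partitions_of n. int (m \<kappa>) * irr n \<kappa> p)" if "p permutes {..<n}" for p
    proof -
      have "(\<Sum>kappa\<in>partitions_of n. of_nat (m kappa) * irr_char kappa p) =
          of_int (\<Sum>\<kappa>\<in>partitions_of n. int (m \<kappa>) * irr n \<kappa> p)"
        unfolding of_int_sum by (intro sum.cong refl) (simp add: irrc that)
      moreover have "irr_char lam p * irr_char mu p = of_int (irr n lam p * irr n mu p)"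
        by (simp add: irrc that lam mu)
      ultimately show ?thesis by (simp only: of_int_eq_iff)
    qed
    then show ?thesis by auto
  qed
  define m0 where "m0 \<nu> = (if \<nu> \<in> partitions_of n then nat (z \<nu>) else 0)" for \<nu>
  have m0: "?P m0" unfolding P using z zpos by (simp add: m0_def)
  have uniq: "m = m0" if "?P m" for m
  proof
    fix \<nu>
    show "m \<nu> = m0 \<nu>"
    proof (cases "\<nu> \<in> partitions_of n")
      case True
      have "fact n * int (m \<nu>) = kron n lam mu \<nu>"
        using that True unfolding P by (intro coeff[of "\<lambda>\<nu>. int (m \<nu>)"]) (auto simp: Sym_iff)
      moreover have "fact n * int (m0 \<nu>) = kron n lam mu \<nu>"
        using m0 True unfolding P by (intro coeff[of "\<lambda>\<nu>. int (m0 \<nu>)"]) (auto simp: Sym_iff)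
      ultimately have "(fact n :: int) * int (m \<nu>) = fact n * int (m0 \<nu>)" by simp
      then show ?thesis by simp
    next
      case False
      then show ?thesis using that by (simp add: m0_def)
    qed
  qed
  have "kronecker n lam mu kappa = m0 kappa"
    unfolding kronecker_def using the_equality[of ?P m0, OF m0 uniq] by simp
  moreover have "fact n * int (m0 kappa) = kron n lam mu kappa"
    using m0 kappa unfolding P by (intro coeff[of "\<lambda>\<nu>. int (m0 \<nu>)"]) (auto simp: Sym_iff)
  ultimately show ?thesis by simp
qed

section \<open>Kostka and Littlewood-Richardson coefficients\<close>

text \<open>The pairing of a permutation character with a Jacobi-Trudi sum; it counts semistandard tableaux, see \<open>card_SS\<close>.\<close>

definition Kc :: "nat \<Rightarrow> nat \<Rightarrow> (nat \<Rightarrow> int) \<Rightarrow> (nat \<Rightarrow> int) \<Rightarrow> int" where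
  "Kc N L \<alpha> \<beta> = (\<Sum>w | w permutes {..<N}. sign w * int (card (Mset {..<L} {..<N} \<alpha> (\<lambda>i. \<beta> i - dl N (w i)))))"

lemma Kc_cong:
  "(\<And>l. l < L \<Longrightarrow> \<alpha> l = \<alpha>' l) \<Longrightarrow> (\<And>i. i < N \<Longrightarrow> \<beta> i = \<beta>' i) \<Longrightarrow> Kc N L \<alpha> \<beta> = Kc N L \<alpha>' \<beta>'"
  unfolding Kc_def by (intro sum.cong refl arg_cong[where f="times _"] arg_cong[where f=int] arg_cong[where f=card] Mset_cong) auto

lemma card_Mset_permute:
  assumes "v permutes J" "finite J"
  shows "card (Mset I J \<alpha> (\<lambda>j. \<gamma> (v j))) = card (Mset I J \<alpha> \<gamma>)"
proof -
  have *: "(\<lambda>A. restrict (\<lambda>(i, j). A (i, v j)) (I \<times> J)) ` Mset I J \<alpha> \<gamma> \<subseteq> Mset I J \<alpha> (\<lambda>j. \<gamma> (v j))"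
    if v: "v permutes J" for v \<gamma>
  proof (rule image_subsetI)
    fix A assume A: "A \<in> Mset I J \<alpha> \<gamma>"
    have "(\<Sum>j\<in>J. int (A (i, v j))) = (\<Sum>j\<in>J. int (A (i, j)))" for i
      using sum.permute[OF v, of "\<lambda>j. int (A (i, j))"] by (simp add: o_def)
    then show "restrict (\<lambda>(i, j). A (i, v j)) (I \<times> J) \<in> Mset I J \<alpha> (\<lambda>j. \<gamma> (v j))"
      using A v by (auto simp: Mset_def permutes_in_image)
  qed
  have "bij_betw (\<lambda>A. restrict (\<lambda>(i, j). A (i, v j)) (I \<times> J)) (Mset I J \<alpha> \<gamma>) (Mset I J \<alpha> (\<lambda>j. \<gamma> (v j)))"
  proof (rule bij_betw_byWitness[where f' = "\<lambda>A. restrict (\<lambda>(i, j). A (i, inv v j)) (I \<times> J)"])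
    show "(\<lambda>A. restrict (\<lambda>(i, j). A (i, v j)) (I \<times> J)) ` Mset I J \<alpha> \<gamma> \<subseteq> Mset I J \<alpha> (\<lambda>j. \<gamma> (v j))"
      by (rule *[OF assms(1)])
    show "(\<lambda>A. restrict (\<lambda>(i, j). A (i, inv v j)) (I \<times> J)) ` Mset I J \<alpha> (\<lambda>j. \<gamma> (v j)) \<subseteq> Mset I J \<alpha> \<gamma>"
      using *[OF permutes_inv[OF assms(1)], of "\<lambda>j. \<gamma> (v j)"] by (simp add: permutes_inverses[OF assms(1)])
  qed (use assms in \<open>auto simp: Mset_def fun_eq_iff PiE_iff extensional_def permutes_inverses
        permutes_in_image permutes_in_image[OF permutes_inv]\<close>)
  then show ?thesis by (simp add: bij_betw_same_card)
qed

lemma Kc_permute: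
  assumes v: "v permutes {..<N}"
  shows "Kc N L \<alpha> (\<lambda>i. \<beta> (v i)) = sign v * Kc N L \<alpha> \<beta>"
proof -
  have "Kc N L \<alpha> (\<lambda>i. \<beta> (v i)) =
      (\<Sum>w | w permutes {..<N}. sign (w \<circ> v) * int (card (Mset {..<L} {..<N} \<alpha> (\<lambda>i. \<beta> (v i) - dl N ((w \<circ> v) i)))))"
    unfolding Kc_def using v by (rule sum_permutations_compose_right)
  also have "\<dots> = (\<Sum>w | w permutes {..<N}. sign v * (sign w * int (card (Mset {..<L} {..<N} \<alpha> (\<lambda>i. \<beta> i - dl N (w i))))))"
  proof (rule sum.cong[OF refl])
    fix w assume "w \<in> {w. w permutes {..<N}}"
    then have "sign (w \<circ> v) = sign w * sign v" using v by (simp add: sign_compose permutation_N)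
    then show "sign (w \<circ> v) * int (card (Mset {..<L} {..<N} \<alpha> (\<lambda>i. \<beta> (v i) - dl N ((w \<circ> v) i)))) =
        sign v * (sign w * int (card (Mset {..<L} {..<N} \<alpha> (\<lambda>i. \<beta> i - dl N (w i)))))"
      using card_Mset_permute[OF v, of "{..<L}" \<alpha> "\<lambda>i. \<beta> i - dl N (w i)"] by simp
  qed
  finally show ?thesis by (simp add: Kc_def sum_distrib_left)
qed

text \<open>What can be left of \<open>\<beta>\<close> after subtracting the last row of a matrix,
  where \<open>a\<close> is the sum of that row. The vectors are extensional so that they form a
  finite set.\<close>

definition below :: "nat \<Rightarrow> (nat \<Rightarrow> int) \<Rightarrow> int \<Rightarrow> (nat \<Rightarrow> int) set" where
  "below N \<beta> a = {\<gamma> \<in> extensional {..<N}. (\<forall>i<N. 0 \<le> \<gamma> i \<and> \<gamma> i \<le> \<beta> i) \<and> (\<Sum>i<N. \<beta> i - \<gamma> i) = a}"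

lemma finite_below [simp]: "finite (below N \<beta> a)"
proof (rule finite_subset)
  show "below N \<beta> a \<subseteq> {..<N} \<rightarrow>\<^sub>E {0..Max (insert 0 (\<beta> ` {..<N}))}"
  proof
    fix \<gamma> assume \<gamma>: "\<gamma> \<in> below N \<beta> a"
    have "\<gamma> i \<le> Max (insert 0 (\<beta> ` {..<N}))" if "i < N" for i
    proof -
      have "\<gamma> i \<le> \<beta> i" using \<gamma> that by (simp add: below_def)
      also have "\<beta> i \<le> Max (insert 0 (\<beta> ` {..<N}))" using that by (intro Max_ge) auto
      finally show ?thesis .
    qed
    then show "\<gamma> \<in> {..<N} \<rightarrow>\<^sub>E {0..Max (insert 0 (\<beta> ` {..<N}))}"
      using \<gamma> by (simp add: below_def PiE_iff)
  qed
qed (intro finite_PiE; simp)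

lemma card_Mset_Suc:
  assumes nn: "\<And>i. i < N \<Longrightarrow> 0 \<le> d i"
  shows "card (Mset {..<Suc L} {..<N} \<alpha> (\<lambda>i. \<beta> i - d i)) =
    (\<Sum>\<gamma>\<in>below N \<beta> (\<alpha> L). card (Mset {..<L} {..<N} \<alpha> (\<lambda>i. \<gamma> i - d i)))"
proof -
  let ?X = "Mset {..<Suc L} {..<N} \<alpha> (\<lambda>i. \<beta> i - d i)"
  let ?Y = "\<lambda>\<gamma>. Mset {..<L} {..<N} \<alpha> (\<lambda>i. \<gamma> i - d i)"
  let ?h = "\<lambda>A. restrict (\<lambda>i. \<beta> i - int (A (L, i))) {..<N}"
  have colA: "(\<Sum>l<L. int (A (l, i))) = \<beta> i - d i - int (A (L, i))" if "A \<in> ?X" "i < N" for A i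
  proof -
    have "(\<Sum>l<Suc L. int (A (l, i))) = \<beta> i - d i" using that by (auto simp: Mset_def)
    then show ?thesis by simp
  qed
  have hX: "?h A \<in> below N \<beta> (\<alpha> L)" if A: "A \<in> ?X" for A
  proof -
    have "0 \<le> \<beta> i - int (A (L, i))" if "i < N" for i
    proof -
      have "0 \<le> (\<Sum>l<L. int (A (l, i)))" by (intro sum_nonneg) simp
      then show ?thesis using colA[OF A that] nn[OF that] by linarith
    qed
    moreover have "(\<Sum>i<N. int (A (L, i))) = \<alpha> L" using A by (auto simp: Mset_def)
    ultimately show ?thesis by (simp add: below_def)
  qed
  have bij: "bij_betw (\<lambda>A. restrict A ({..<L} \<times> {..<N})) {A \<in> ?X. ?h A = \<gamma>} (?Y \<gamma>)"
    if \<gamma>: "\<gamma> \<in> below N \<beta> (\<alpha> L)" for \<gamma>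
  proof (rule bij_betw_byWitness[where f' =
        "\<lambda>B. restrict (\<lambda>(l, i). if l < L then B (l, i) else nat (\<beta> i - \<gamma> i)) ({..<Suc L} \<times> {..<N})"])
    have \<gamma>1: "0 \<le> \<gamma> i" "\<gamma> i \<le> \<beta> i" if "i < N" for i using \<gamma> that by (auto simp: below_def)
    have hA: "\<gamma> i = \<beta> i - int (A (L, i))" if "?h A = \<gamma>" "i < N" for A i
      using fun_cong[OF that(1), of i] that(2) by simp
    show "\<forall>A\<in>{A \<in> ?X. ?h A = \<gamma>}. restrict (\<lambda>(l, i). if l < L then restrict A ({..<L} \<times> {..<N}) (l, i) else nat (\<beta> i - \<gamma> i)) ({..<Suc L} \<times> {..<N}) = A"
    proof
      fix A assume "A \<in> {A \<in> ?X. ?h A = \<gamma>}"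
      then have A: "A \<in> ?X" "?h A = \<gamma>" by auto
      have e: "A x = undefined" if "x \<notin> {..<Suc L} \<times> {..<N}" for x
        using A(1) that by (cases x) (auto simp: Mset_def PiE_iff extensional_def)
      then show "restrict (\<lambda>(l, i). if l < L then restrict A ({..<L} \<times> {..<N}) (l, i) else nat (\<beta> i - \<gamma> i)) ({..<Suc L} \<times> {..<N}) = A"
        using hA[OF A(2)] e by (auto simp: fun_eq_iff restrict_def less_Suc_eq)
    qed
    show "\<forall>B\<in>?Y \<gamma>. restrict (restrict (\<lambda>(l, i). if l < L then B (l, i) else nat (\<beta> i - \<gamma> i)) ({..<Suc L} \<times> {..<N})) ({..<L} \<times> {..<N}) = B"
      by (auto simp: Mset_def PiE_iff extensional_def fun_eq_iff)
    show "(\<lambda>A. restrict A ({..<L} \<times> {..<N})) ` {A \<in> ?X. ?h A = \<gamma>} \<subseteq> ?Y \<gamma>"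
    proof (rule image_subsetI)
      fix A assume "A \<in> {A \<in> ?X. ?h A = \<gamma>}"
      then have A: "A \<in> ?X" "?h A = \<gamma>" by auto
      have "(\<Sum>l<L. int (A (l, i))) = \<gamma> i - d i" if "i < N" for i
        using colA[OF A(1) that] hA[OF A(2) that] by simp
      moreover have "(\<Sum>i<N. int (A (l, i))) = \<alpha> l" if "l < L" for l
        using A(1) that by (auto simp: Mset_def)
      ultimately show "restrict A ({..<L} \<times> {..<N}) \<in> ?Y \<gamma>" by (simp add: Mset_def)
    qed
    show "(\<lambda>B. restrict (\<lambda>(l, i). if l < L then B (l, i) else nat (\<beta> i - \<gamma> i)) ({..<Suc L} \<times> {..<N})) ` ?Y \<gamma> \<subseteq> {A \<in> ?X. ?h A = \<gamma>}"
    proof (rule image_subsetI)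
      fix B assume B: "B \<in> ?Y \<gamma>"
      let ?A = "restrict (\<lambda>(l, i). if l < L then B (l, i) else nat (\<beta> i - \<gamma> i)) ({..<Suc L} \<times> {..<N})"
      have r: "(\<Sum>i<N. int (?A (l, i))) = \<alpha> l" if "l < Suc L" for l
      proof (cases "l < L")
        case True
        then show ?thesis using B that by (simp add: Mset_def)
      next
        case False
        then have "(\<Sum>i<N. int (?A (l, i))) = (\<Sum>i<N. \<beta> i - \<gamma> i)"
          using that \<gamma>1 by (intro sum.cong refl) simp
        then show ?thesis using False that \<gamma> by (simp add: below_def less_Suc_eq)
      qed
      have c: "(\<Sum>l<Suc L. int (?A (l, i))) = \<beta> i - d i" if "i < N" for i
      proof -
        have "(\<Sum>l<Suc L. int (?A (l, i))) = (\<Sum>l<L. int (B (l, i))) + (\<beta> i - \<gamma> i)"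
          using that \<gamma>1[OF that] by simp
        then show ?thesis using B that by (simp add: Mset_def)
      qed
      have "?h ?A = \<gamma>" using \<gamma>1 \<gamma> by (auto simp: below_def fun_eq_iff extensional_def)
      moreover have "?A \<in> ?X"
        using r c unfolding Mset_def by (simp del: sum.lessThan_Suc)
      ultimately show "?A \<in> {A \<in> ?X. ?h A = \<gamma>}" by blast
    qed
  qed
  have "card ?X = (\<Sum>\<gamma>\<in>below N \<beta> (\<alpha> L). \<Sum>A\<in>{A \<in> ?X. ?h A = \<gamma>}. 1)"
    by (subst sum.group) (use hX in auto)
  also have "\<dots> = (\<Sum>\<gamma>\<in>below N \<beta> (\<alpha> L). card (?Y \<gamma>))"
    using bij_betw_same_card[OF bij] by (intro sum.cong refl) simp
  finally show ?thesis .
qed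

lemma Kc_Suc: "Kc N (Suc L) \<alpha> \<beta> = (\<Sum>\<gamma>\<in>below N \<beta> (\<alpha> L). Kc N L \<alpha> \<gamma>)"
proof -
  have "Kc N (Suc L) \<alpha> \<beta> = (\<Sum>w | w permutes {..<N}. \<Sum>\<gamma>\<in>below N \<beta> (\<alpha> L).
      sign w * int (card (Mset {..<L} {..<N} \<alpha> (\<lambda>i. \<gamma> i - dl N (w i)))))"
    unfolding Kc_def
  proof (rule sum.cong[OF refl])
    fix w assume "w \<in> {w. w permutes {..<N}}"
    then have "0 \<le> dl N (w i)" if "i < N" for i
      using permutes_less[of w N i] that by (simp add: dl_def)
    then show "sign w * int (card (Mset {..<Suc L} {..<N} \<alpha> (\<lambda>i. \<beta> i - dl N (w i)))) =
        (\<Sum>\<gamma>\<in>below N \<beta> (\<alpha> L). sign w * int (card (Mset {..<L} {..<N} \<alpha> (\<lambda>i. \<gamma> i - dl N (w i)))))"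
      by (subst card_Mset_Suc) (simp_all add: sum_distrib_left)
  qed
  also have "\<dots> = (\<Sum>\<gamma>\<in>below N \<beta> (\<alpha> L). Kc N L \<alpha> \<gamma>)"
    unfolding Kc_def by (rule sum.swap)
  finally show ?thesis .
qed

lemma Kc_0:
  "Kc N 0 \<alpha> \<beta> = alt N \<beta> (dl N)"
proof -
  have "card (Mset {..<0} {..<N} \<alpha> \<gamma>) = (if \<forall>i<N. \<gamma> i = 0 then 1 else 0)" for \<gamma>
  proof (cases "\<forall>i<N. \<gamma> i = 0")
    case True
    then have "Mset {..<0} {..<N} \<alpha> \<gamma> = {\<lambda>x. undefined}" by (auto simp: Mset_def)
    then show ?thesis using True by simp
  next
    case False
    then have "Mset {..<0} {..<N} \<alpha> \<gamma> = {}" by (auto simp: Mset_def)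
    then show ?thesis using False by simp
  qed
  then show ?thesis unfolding Kc_def alt_def by (intro sum.cong refl) simp
qed

lemma sum_involution_zero:
  fixes f :: "'a \<Rightarrow> int"
  assumes "finite X" "\<And>x. x \<in> X \<Longrightarrow> h x \<in> X" "\<And>x. x \<in> X \<Longrightarrow> h (h x) = x" "\<And>x. x \<in> X \<Longrightarrow> f (h x) = - f x"
  shows "sum f X = 0"
proof -
  have "sum f X = (\<Sum>x\<in>X. f (h x))"
    by (rule sum.reindex_bij_witness[where i=h and j=h]) (use assms in auto)
  also have "\<dots> = - sum f X" using assms(4) by (simp add: sum_negf)
  finally show ?thesis by simp
qed

text \<open>
  The Pieri rule: vectors violating the interlacing condition are paired off by exchanging the
  entries at the first violation.
\<close>

lemma Kc_pieri:
  assumes dec: "\<And>i. Suc i < N \<Longrightarrow> \<beta> (Suc i) < \<beta> i"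
  shows "Kc N (Suc L) \<alpha> \<beta> = (\<Sum>\<gamma> | \<gamma> \<in> below N \<beta> (\<alpha> L) \<and> (\<forall>i. Suc i < N \<longrightarrow> \<beta> (Suc i) < \<gamma> i). Kc N L \<alpha> \<gamma>)"
proof -
  let ?bad = "\<lambda>\<gamma> i. Suc i < N \<and> \<gamma> i \<le> \<beta> (Suc i)"
  define B where "B = {\<gamma> \<in> below N \<beta> (\<alpha> L). \<exists>i. ?bad \<gamma> i}"
  define k where "k \<gamma> = (LEAST i. ?bad \<gamma> i)" for \<gamma>
  define h where "h \<gamma> = \<gamma> \<circ> transpose (k \<gamma>) (Suc (k \<gamma>))" for \<gamma> :: "nat \<Rightarrow> int"
  have k: "?bad \<gamma> (k \<gamma>)" if "\<gamma> \<in> B" for \<gamma>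
  proof -
    obtain i where "?bad \<gamma> i" using \<open>\<gamma> \<in> B\<close> by (auto simp: B_def)
    then show ?thesis unfolding k_def by (rule LeastI)
  qed
  have kmin: "\<not> ?bad \<gamma> i" if "i < k \<gamma>" for \<gamma> i using that unfolding k_def by (rule not_less_Least)
  have tp: "transpose (k \<gamma>) (Suc (k \<gamma>)) permutes {..<N}" if "\<gamma> \<in> B" for \<gamma>
    using k[OF that] by (intro permutes_swap_id) auto
  have h1: "h \<gamma> (k \<gamma>) = \<gamma> (Suc (k \<gamma>))" "h \<gamma> (Suc (k \<gamma>)) = \<gamma> (k \<gamma>)" for \<gamma> by (simp_all add: h_def)
  have h2: "h \<gamma> i = \<gamma> i" if "i \<noteq> k \<gamma>" "i \<noteq> Suc (k \<gamma>)" for \<gamma> i using that by (simp add: h_def)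
  have hle: "h \<gamma> i \<le> \<beta> i" "0 \<le> h \<gamma> i" if "\<gamma> \<in> B" "i < N" for \<gamma> i
  proof -
    have le: "\<gamma> i \<le> \<beta> i" "0 \<le> \<gamma> i" if "i < N" for i using \<open>\<gamma> \<in> B\<close> that by (auto simp: B_def below_def)
    show "h \<gamma> i \<le> \<beta> i"
      using k[OF that(1)] le[OF that(2)] le[of "Suc (k \<gamma>)"] dec[of "k \<gamma>"] h1[of \<gamma>] h2[of i \<gamma>]
      by (cases "i = k \<gamma>"; cases "i = Suc (k \<gamma>)") auto
    show "0 \<le> h \<gamma> i"
      using k[OF that(1)] le[OF that(2)] le[of "Suc (k \<gamma>)"] le[of "k \<gamma>"] h1[of \<gamma>] h2[of i \<gamma>]
      by (cases "i = k \<gamma>"; cases "i = Suc (k \<gamma>)") auto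
  qed
  \<comment> \<open>Both exchanged entries are at most \<open>\<beta> (Suc (k \<gamma>))\<close> and
    the earlier ones stay, so the first violation keeps its place and \<open>h\<close> is an
    involution.\<close>
  have kh: "k (h \<gamma>) = k \<gamma>" if "\<gamma> \<in> B" for \<gamma>
    unfolding k_def[of "h \<gamma>"]
  proof (rule Least_equality)
    have "\<gamma> (Suc (k \<gamma>)) \<le> \<beta> (Suc (k \<gamma>))" using k[OF that] that by (auto simp: B_def below_def)
    then show "?bad (h \<gamma>) (k \<gamma>)" using k[OF that] h1[of \<gamma>] by simp
    show "k \<gamma> \<le> i" if "?bad (h \<gamma>) i" for i
    proof (rule ccontr)
      assume "\<not> k \<gamma> \<le> i"
      then have "i < k \<gamma>" by simp
      then show False using kmin[of i \<gamma>] h2[of i \<gamma>] that by simp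
    qed
  qed
  have hB: "h \<gamma> \<in> B" if "\<gamma> \<in> B" for \<gamma>
  proof -
    have "(\<Sum>i<N. h \<gamma> i) = (\<Sum>i<N. \<gamma> i)"
      unfolding h_def o_def by (rule sum_permutes_N[OF tp[OF that]])
    then have s: "(\<Sum>i<N. \<beta> i - h \<gamma> i) = \<alpha> L" using that by (simp add: B_def below_def sum_subtractf)
    have "h \<gamma> \<in> extensional {..<N}"
      using that k[OF that] h2[of _ \<gamma>] by (auto simp: B_def below_def extensional_def)
    then have "h \<gamma> \<in> below N \<beta> (\<alpha> L)" using hle[OF that] s by (simp add: below_def)
    moreover have "?bad (h \<gamma>) (k \<gamma>)"
    proof -
      have "\<gamma> (Suc (k \<gamma>)) \<le> \<beta> (Suc (k \<gamma>))" using k[OF that] that by (auto simp: B_def below_def)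
      then show ?thesis using k[OF that] h1[of \<gamma>] by simp
    qed
    ultimately show ?thesis unfolding B_def by blast
  qed
  have z: "(\<Sum>\<gamma>\<in>B. Kc N L \<alpha> \<gamma>) = 0"
  proof (rule sum_involution_zero[where h=h])
    show "finite B" by (simp add: B_def)
    fix \<gamma> assume \<gamma>: "\<gamma> \<in> B"
    show "h \<gamma> \<in> B" by (rule hB[OF \<gamma>])
    show "h (h \<gamma>) = \<gamma>" unfolding h_def[of "h \<gamma>"] kh[OF \<gamma>] unfolding h_def by (simp add: comp_assoc)
    have "k \<gamma> \<noteq> Suc (k \<gamma>)" by simp
    then show "Kc N L \<alpha> (h \<gamma>) = - Kc N L \<alpha> \<gamma>"
      using Kc_permute[OF tp[OF \<gamma>], of L \<alpha> \<gamma>] by (simp add: h_def o_def sign_swap_id)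
  qed
  have "below N \<beta> (\<alpha> L) - B = {\<gamma>. \<gamma> \<in> below N \<beta> (\<alpha> L) \<and> (\<forall>i. Suc i < N \<longrightarrow> \<beta> (Suc i) < \<gamma> i)}"
    by (auto simp: B_def not_le)
  moreover have "(\<Sum>\<gamma>\<in>below N \<beta> (\<alpha> L). Kc N L \<alpha> \<gamma>) = (\<Sum>\<gamma>\<in>below N \<beta> (\<alpha> L) - B. Kc N L \<alpha> \<gamma>) + (\<Sum>\<gamma>\<in>B. Kc N L \<alpha> \<gamma>)"
    by (rule sum.subset_diff) (auto simp: B_def)
  ultimately show ?thesis unfolding Kc_Suc z by simp
qed

section \<open>Semistandard tableaux and horizontal strips\<close>

definition shape :: "nat \<Rightarrow> (nat \<Rightarrow> nat) \<Rightarrow> bool" where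
  "shape N p \<longleftrightarrow> (\<forall>i j. i \<le> j \<longrightarrow> p j \<le> p i) \<and> (\<forall>i\<ge>N. p i = 0)"

lemma shapeD: "shape N p \<Longrightarrow> i \<le> j \<Longrightarrow> p j \<le> p i" "shape N p \<Longrightarrow> N \<le> i \<Longrightarrow> p i = 0"
  by (auto simp: shape_def)

definition scells :: "(nat \<Rightarrow> nat) \<Rightarrow> (nat \<times> nat) set" where
  "scells p = {(i, j). j < p i}"

lemma scells_iff [simp]: "(i, j) \<in> scells p \<longleftrightarrow> j < p i"
  by (simp add: scells_def)

lemma scells_Sigma: "shape N p \<Longrightarrow> scells p = (SIGMA i:{..<N}. {..<p i})"
  using shapeD(2)[of N p] by (auto simp: scells_def) (metis not_less not_less_zero)

lemma finite_scells: "shape N p \<Longrightarrow> finite (scells p)"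
  by (simp add: scells_Sigma)

lemma card_scells: "shape N p \<Longrightarrow> card (scells p) = (\<Sum>i<N. p i)"
  by (simp add: scells_Sigma)

definition tabs :: "(nat \<Rightarrow> nat) \<Rightarrow> (nat \<times> nat \<Rightarrow> nat) \<Rightarrow> bool" where
  "tabs p T \<longleftrightarrow> (\<forall>i j j'. j < j' \<and> j' < p i \<longrightarrow> T (i, j) \<le> T (i, j')) \<and>
     (\<forall>i i' j. i < i' \<and> j < p i \<and> j < p i' \<longrightarrow> T (i, j) < T (i', j))"

definition SS :: "nat \<Rightarrow> (nat \<Rightarrow> int) \<Rightarrow> (nat \<Rightarrow> nat) \<Rightarrow> (nat \<times> nat \<Rightarrow> nat) set" where
  "SS L \<alpha> p = {T \<in> scells p \<rightarrow>\<^sub>E {..<L}. tabs p T \<and> (\<forall>l<L. cnt (scells p) T l = \<alpha> l)}"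

lemma finite_SS: "shape N p \<Longrightarrow> finite (SS L \<alpha> p)"
proof -
  assume "shape N p"
  then have "finite (scells p \<rightarrow>\<^sub>E {..<L})" by (intro finite_PiE finite_scells; simp)
  then show ?thesis by (simp add: SS_def)
qed

lemma initial_segment:
  fixes A :: "nat set"
  assumes "finite A" "\<And>x y. y \<in> A \<Longrightarrow> x \<le> y \<Longrightarrow> x \<in> A"
  shows "A = {..<card A}"
proof (cases "A = {}")
  case False
  have "A = {..Max A}"
  proof (intro equalityI subsetI)
    show "x \<in> {..Max A}" if "x \<in> A" for x using that assms(1) by simp
    show "x \<in> A" if "x \<in> {..Max A}" for x using assms(2)[OF Max_in[OF assms(1) False], of x] that by simp
  qed
  then have "card A = card {..Max A}" by (rule arg_cong)
  then have "card A = Suc (Max A)" by simp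
  then show ?thesis using \<open>A = {..Max A}\<close> by (simp add: lessThan_Suc_atMost)
qed simp

text \<open>Horizontal strips: the interlacing of \<open>p\<close> and \<open>q\<close> says that no
  column loses two cells.\<close>

definition strips :: "nat \<Rightarrow> (nat \<Rightarrow> nat) \<Rightarrow> int \<Rightarrow> (nat \<Rightarrow> nat) set" where
  "strips N p a = {q. (\<forall>i. q i \<le> p i \<and> p (Suc i) \<le> q i) \<and> (\<Sum>i<N. int (p i) - int (q i)) = a}"

lemma strip_shape:
  assumes "shape N p" "q \<in> strips N p a"
  shows "shape N q"
proof -
  have q: "q i \<le> p i" "p (Suc i) \<le> q i" for i using assms(2) by (auto simp: strips_def)
  have "q (Suc i) \<le> q i" for i using q(1)[of "Suc i"] q(2)[of i] by linarith
  then have "q j \<le> q i" if "i \<le> j" for i j by (rule lift_Suc_antimono_le[OF _ that])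
  moreover have "q i = 0" if "N \<le> i" for i using q(1)[of i] shapeD(2)[OF assms(1) that] by simp
  ultimately show ?thesis by (simp add: shape_def)
qed

text \<open>The row lengths of the subshape that carries the letters below \<open>L\<close>.\<close>

definition cutoff :: "nat \<Rightarrow> (nat \<Rightarrow> nat) \<Rightarrow> (nat \<times> nat \<Rightarrow> nat) \<Rightarrow> nat \<Rightarrow> nat" where
  "cutoff L p T i = card {j. j < p i \<and> T (i, j) < L}"

lemma cutoff_iff:
  assumes "tabs p T" "j < p i"
  shows "j < cutoff L p T i \<longleftrightarrow> T (i, j) < L"
proof -
  have "{j. j < p i \<and> T (i, j) < L} = {..<cutoff L p T i}"
    unfolding cutoff_def
  proof (rule initial_segment)
    fix x y assume y: "y \<in> {j. j < p i \<and> T (i, j) < L}" and "x \<le> y"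
    then have "x = y \<or> T (i, x) \<le> T (i, y)" using assms(1) unfolding tabs_def
      by (cases "x = y") auto
    then show "x \<in> {j. j < p i \<and> T (i, j) < L}" using y \<open>x \<le> y\<close> by auto
  qed simp
  then have "j \<in> {j. j < p i \<and> T (i, j) < L} \<longleftrightarrow> j \<in> {..<cutoff L p T i}" by (rule arg_cong)
  then show ?thesis using assms(2) by simp
qed

lemma cutoff_le: "cutoff L p T i \<le> p i"
proof -
  have "cutoff L p T i \<le> card {..<p i}" unfolding cutoff_def by (rule card_mono) auto
  then show ?thesis by simp
qed

lemma cutoff_strip:
  assumes p: "shape N p" and T: "T \<in> SS (Suc L) \<alpha> p"
  shows "cutoff L p T \<in> strips N p (\<alpha> L)"
proof -
  have tb: "tabs p T" and TL: "\<And>i j. j < p i \<Longrightarrow> T (i, j) \<le> L" and c: "cnt (scells p) T L = \<alpha> L"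
    using T by (auto simp: SS_def PiE_iff less_Suc_eq_le)
  let ?q = "cutoff L p T"
  have q1: "?q i \<le> p i" for i by (rule cutoff_le)
  have q2: "p (Suc i) \<le> ?q i" for i
  proof (rule ccontr)
    assume "\<not> p (Suc i) \<le> ?q i"
    then have j: "?q i < p (Suc i)" by simp
    then have j': "?q i < p i" using shapeD(1)[OF p, of i "Suc i"] by simp
    have "T (i, ?q i) < T (Suc i, ?q i)" using tb j j' by (auto simp: tabs_def)
    then have "T (i, ?q i) < L" using TL[OF j] by simp
    then show False using cutoff_iff[OF tb j', of L] by simp
  qed
  have "{x \<in> scells p. T x = L} = (SIGMA i:{..<N}. {?q i..<p i})"
  proof (intro set_eqI)
    fix x :: "nat \<times> nat" obtain i j where x: "x = (i, j)" by fastforce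
    have "i < N" if "j < p i" using that shapeD(2)[OF p, of i] by (metis not_less not_less_zero)
    moreover have "j < p i \<Longrightarrow> T (i, j) = L \<longleftrightarrow> ?q i \<le> j"
      using cutoff_iff[OF tb, of j i L] TL[of j i] by auto
    ultimately show "x \<in> {x \<in> scells p. T x = L} \<longleftrightarrow> x \<in> (SIGMA i:{..<N}. {?q i..<p i})"
      unfolding x by auto
  qed
  then have "cnt (scells p) T L = int (card (SIGMA i:{..<N}. {?q i..<p i}))" unfolding cnt_def by (rule arg_cong)
  also have "\<dots> = (\<Sum>i<N. int (p i) - int (?q i))" using q1 by (simp add: of_nat_diff)
  finally show ?thesis using q1 q2 c by (simp add: strips_def)
qed

text \<open>A tableau is recovered from its letters below \<open>L\<close>, since the cells of the
  strip can only carry \<open>L\<close>; conversely, filling a horizontal strip with the largest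
  letter always gives a semistandard tableau.\<close>

lemma SS_fibre:
  assumes p: "shape N p" and q: "q \<in> strips N p (\<alpha> L)"
  shows "card {T \<in> SS (Suc L) \<alpha> p. cutoff L p T = q} = card (SS L \<alpha> q)"
proof (rule bij_betw_same_card, rule bij_betw_byWitness[where f = "\<lambda>T. restrict T (scells q)"
      and f' = "\<lambda>T. restrict (\<lambda>x. if x \<in> scells q then T x else L) (scells p)"])
  have qp: "q i \<le> p i" "p (Suc i) \<le> q i" for i using q by (auto simp: strips_def)
  have qs: "shape N q" by (rule strip_shape[OF p q])
  have sub: "scells q \<subseteq> scells p" using qp by (auto simp: scells_def intro: less_le_trans)
  have new: "T x = L" if "T \<in> SS (Suc L) \<alpha> p" "cutoff L p T = q" "x \<in> scells p" "x \<notin> scells q" for T x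
  proof -
    obtain i j where x: "x = (i, j)" by fastforce
    have "tabs p T" "T (i, j) < Suc L" using that by (auto simp: SS_def x PiE_iff)
    then show ?thesis using cutoff_iff[of p T j i L] that x by (auto simp: less_Suc_eq)
  qed
  have old: "T x < L" if "T \<in> SS (Suc L) \<alpha> p" "cutoff L p T = q" "x \<in> scells q" for T x
  proof -
    obtain i j where x: "x = (i, j)" by fastforce
    have "j < p i" using qp[of i] that by (simp add: x)
    moreover have "tabs p T" using that by (auto simp: SS_def)
    ultimately show ?thesis using cutoff_iff[of p T j i L] that x by auto
  qed
  show "\<forall>T\<in>{T \<in> SS (Suc L) \<alpha> p. cutoff L p T = q}.
      restrict (\<lambda>x. if x \<in> scells q then restrict T (scells q) x else L) (scells p) = T"
  proof
    fix T assume T: "T \<in> {T \<in> SS (Suc L) \<alpha> p. cutoff L p T = q}"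
    then have "T \<in> extensional (scells p)" by (auto simp: SS_def PiE_iff)
    then show "restrict (\<lambda>x. if x \<in> scells q then restrict T (scells q) x else L) (scells p) = T"
      using new[of T] T by (auto simp: fun_eq_iff extensional_def simp del: scells_iff split_paired_All)
  qed
  show "\<forall>T\<in>SS L \<alpha> q. restrict (restrict (\<lambda>x. if x \<in> scells q then T x else L) (scells p)) (scells q) = T"
  proof
    fix T assume "T \<in> SS L \<alpha> q"
    then have "T \<in> extensional (scells q)" by (auto simp: SS_def PiE_iff)
    then show "restrict (restrict (\<lambda>x. if x \<in> scells q then T x else L) (scells p)) (scells q) = T"
      using sub by (auto simp: fun_eq_iff extensional_def simp del: scells_iff split_paired_All)
  qed
  show "(\<lambda>T. restrict T (scells q)) ` {T \<in> SS (Suc L) \<alpha> p. cutoff L p T = q} \<subseteq> SS L \<alpha> q"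
  proof (rule image_subsetI)
    fix T assume "T \<in> {T \<in> SS (Suc L) \<alpha> p. cutoff L p T = q}"
    then have T: "T \<in> SS (Suc L) \<alpha> p" "cutoff L p T = q" by auto
    have tb: "tabs p T" using T by (simp add: SS_def)
    have "tabs q (restrict T (scells q))"
      unfolding tabs_def
    proof (intro conjI allI impI)
      fix i j j' assume a: "j < j' \<and> j' < q i"
      then have "j < j' \<and> j' < p i" using qp[of i] by linarith
      then have "T (i, j) \<le> T (i, j')" using tb unfolding tabs_def by blast
      then show "restrict T (scells q) (i, j) \<le> restrict T (scells q) (i, j')" using a by simp
    next
      fix i i' j assume a: "i < i' \<and> j < q i \<and> j < q i'"
      then have "i < i' \<and> j < p i \<and> j < p i'" using qp[of i] qp[of i'] by linarith
      then have "T (i, j) < T (i', j)" using tb unfolding tabs_def by blast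
      then show "restrict T (scells q) (i, j) < restrict T (scells q) (i', j)" using a by simp
    qed
    moreover have "cnt (scells q) (restrict T (scells q)) l = \<alpha> l" if "l < L" for l
    proof -
      have "{x \<in> scells q. restrict T (scells q) x = l} = {x \<in> scells p. T x = l}"
        using sub new[OF T] that by auto
      then have "cnt (scells q) (restrict T (scells q)) l = cnt (scells p) T l" by (simp only: cnt_def)
      then show ?thesis using T(1) that by (simp add: SS_def)
    qed
    ultimately show "restrict T (scells q) \<in> SS L \<alpha> q"
      using old[OF T] by (auto simp: SS_def simp del: scells_iff)
  qed
  show "(\<lambda>T. restrict (\<lambda>x. if x \<in> scells q then T x else L) (scells p)) ` SS L \<alpha> q
      \<subseteq> {T \<in> SS (Suc L) \<alpha> p. cutoff L p T = q}"
  proof (rule image_subsetI)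
    fix T assume T: "T \<in> SS L \<alpha> q"
    let ?T = "restrict (\<lambda>x. if x \<in> scells q then T x else L) (scells p)"
    have tb: "tabs q T" and TL: "\<And>x. x \<in> scells q \<Longrightarrow> T x < L" using T by (auto simp: SS_def)
    have v: "?T (i, j) = (if j < q i then T (i, j) else L)" if "j < p i" for i j using that by simp
    have tb': "tabs p ?T"
      unfolding tabs_def
    proof (intro conjI allI impI)
      fix i j j' assume a: "j < j' \<and> j' < p i"
      have "j < q i \<Longrightarrow> j' < q i \<Longrightarrow> T (i, j) \<le> T (i, j')" using tb a unfolding tabs_def by blast
      moreover have "j < q i \<Longrightarrow> T (i, j) < L" by (rule TL) simp
      ultimately show "?T (i, j) \<le> ?T (i, j')" using a v[of j i] v[of j' i] by auto
    next
      fix i i' j assume a: "i < i' \<and> j < p i \<and> j < p i'"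
      have "j < p (Suc i)" using a shapeD(1)[OF p, of "Suc i" i'] by simp
      then have ji: "j < q i" using qp[of i] by simp
      have "j < q i' \<Longrightarrow> T (i, j) < T (i', j)" using tb a ji unfolding tabs_def by blast
      moreover have "T (i, j) < L" by (rule TL) (simp add: ji)
      ultimately show "?T (i, j) < ?T (i', j)" using a ji v[of j i] v[of j i'] by auto
    qed
    have cut: "cutoff L p ?T = q"
    proof
      fix i
      have "{j. j < p i \<and> ?T (i, j) < L} = {..<q i}"
      proof (intro set_eqI)
        fix j
        have "j < q i \<Longrightarrow> T (i, j) < L" by (rule TL) simp
        then show "j \<in> {j. j < p i \<and> ?T (i, j) < L} \<longleftrightarrow> j \<in> {..<q i}"
          using v[of j i] qp[of i] by auto
      qed
      then have "cutoff L p ?T i = card {..<q i}" unfolding cutoff_def by (rule arg_cong)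
      then show "cutoff L p ?T i = q i" by simp
    qed
    have c: "cnt (scells p) ?T l = \<alpha> l" if "l < Suc L" for l
    proof (cases "l = L")
      case True
      have "{x \<in> scells p. ?T x = L} = scells p - scells q" using TL by fastforce
      then have "cnt (scells p) ?T L = int (card (scells p - scells q))" by (simp only: cnt_def)
      also have "\<dots> = int (card (scells p)) - int (card (scells q))"
        using sub finite_scells[OF p] finite_scells[OF qs]
        by (simp add: card_Diff_subset of_nat_diff card_mono)
      also have "\<dots> = \<alpha> L" using q by (simp add: card_scells[OF p] card_scells[OF qs] strips_def sum_subtractf)
      finally show ?thesis using True by simp
    next
      case False
      then have "{x \<in> scells p. ?T x = l} = {x \<in> scells q. T x = l}"
        using sub by auto
      then have "cnt (scells p) ?T l = cnt (scells q) T l" by (simp only: cnt_def)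
      then show ?thesis using T that False by (simp add: SS_def)
    qed
    have "?T \<in> scells p \<rightarrow>\<^sub>E {..<Suc L}" using TL by (auto simp: less_Suc_eq simp del: scells_iff)
    then show "?T \<in> {T \<in> SS (Suc L) \<alpha> p. cutoff L p T = q}"
      using tb' c cut by (simp add: SS_def)
  qed
qed

text \<open>Adding \<open>dl N\<close> turns the weak interlacing of row lengths into the strict
  condition on beads in \<open>Kc_pieri\<close>. For the last row the lower bound is the
  nonnegativity of the bead.\<close>

lemma strips_bij:
  assumes p: "shape N p"
  shows "bij_betw (\<lambda>q. restrict (\<lambda>i. int (q i) + dl N i) {..<N}) (strips N p a)
    {\<gamma> \<in> below N (\<lambda>i. int (p i) + dl N i) a. \<forall>i. Suc i < N \<longrightarrow> int (p (Suc i)) + dl N (Suc i) < \<gamma> i}"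
proof (rule bij_betw_byWitness[where f' = "\<lambda>\<gamma> i. if i < N then nat (\<gamma> i - dl N i) else 0"])
  let ?\<beta> = "\<lambda>i. int (p i) + dl N i"
  let ?G = "{\<gamma> \<in> below N ?\<beta> a. \<forall>i. Suc i < N \<longrightarrow> ?\<beta> (Suc i) < \<gamma> i}"
  let ?r = "\<lambda>q. restrict (\<lambda>i. int (q i) + dl N i) {..<N}"
  have G: "dl N i + int (p (Suc i)) \<le> \<gamma> i" "\<gamma> i \<le> ?\<beta> i" "0 \<le> \<gamma> i - dl N i" if "\<gamma> \<in> ?G" "i < N" for \<gamma> i
  proof -
    show "dl N i + int (p (Suc i)) \<le> \<gamma> i"
    proof (cases "Suc i < N")
      case True
      then have "?\<beta> (Suc i) < \<gamma> i" using that by blast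
      then show ?thesis by (simp add: dl_def)
    next
      case False
      then have "i = N - 1" using that by simp
      then show ?thesis using that shapeD(2)[OF p, of "Suc i"] by (auto simp: dl_def below_def)
    qed
    then show "0 \<le> \<gamma> i - dl N i" by simp
    show "\<gamma> i \<le> ?\<beta> i" using that by (simp add: below_def)
  qed
  show "\<forall>q\<in>strips N p a. (\<lambda>i. if i < N then nat (?r q i - dl N i) else 0) = q"
    using shapeD(2)[OF strip_shape[OF p]] by (auto simp: fun_eq_iff not_less)
  show "\<forall>\<gamma>\<in>?G. restrict (\<lambda>i. int (if i < N then nat (\<gamma> i - dl N i) else 0) + dl N i) {..<N} = \<gamma>"
  proof
    fix \<gamma> assume \<gamma>: "\<gamma> \<in> ?G"
    then have "\<gamma> \<in> extensional {..<N}" by (simp add: below_def)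
    then show "restrict (\<lambda>i. int (if i < N then nat (\<gamma> i - dl N i) else 0) + dl N i) {..<N} = \<gamma>"
      using G(3)[OF \<gamma>] by (auto simp: fun_eq_iff extensional_def)
  qed
  show "(\<lambda>q. ?r q) ` strips N p a \<subseteq> ?G"
  proof (rule image_subsetI)
    fix q assume q: "q \<in> strips N p a"
    then have qp: "q i \<le> p i" "p (Suc i) \<le> q i" for i by (auto simp: strips_def)
    have "(\<Sum>i<N. int (p i) + dl N i - ?r q i) = (\<Sum>i<N. int (p i) - int (q i))"
      by (intro sum.cong refl) simp
    also have "\<dots> = a" using q by (simp add: strips_def)
    finally have 1: "(\<Sum>i<N. int (p i) + dl N i - ?r q i) = a" .
    have "?\<beta> (Suc i) < ?r q i" if "Suc i < N" for i
      using qp(2)[of i] that by (simp add: dl_def)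
    then show "?r q \<in> ?G"
      using qp(1) 1 by (simp add: below_def) (simp add: dl_def)
  qed
  show "(\<lambda>\<gamma> i. if i < N then nat (\<gamma> i - dl N i) else 0) ` ?G \<subseteq> strips N p a"
  proof (rule image_subsetI)
    fix \<gamma> assume \<gamma>: "\<gamma> \<in> ?G"
    let ?q = "\<lambda>i. if i < N then nat (\<gamma> i - dl N i) else 0"
    have "(\<Sum>i<N. int (p i) - int (?q i)) = (\<Sum>i<N. ?\<beta> i - \<gamma> i)"
      using G(3)[OF \<gamma>] by (intro sum.cong refl) simp
    also have "\<dots> = a" using \<gamma> by (simp add: below_def)
    finally have 1: "(\<Sum>i<N. int (p i) - int (?q i)) = a" .
    have "?q i \<le> p i \<and> p (Suc i) \<le> ?q i" for i
    proof (cases "i < N")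
      case True
      then show ?thesis using G[OF \<gamma> True] by simp linarith
    next
      case False
      then show ?thesis using shapeD(2)[OF p, of "Suc i"] by simp
    qed
    then show "?q \<in> strips N p a" using 1 unfolding strips_def by blast
  qed
qed

text \<open>Removing the cells with the largest letter gives the recursion of
  \<open>Kc_pieri\<close>; with no letters left, both sides detect the empty shape.\<close>

theorem card_SS:
  "shape N p \<Longrightarrow> int (card (SS L \<alpha> p)) = Kc N L \<alpha> (\<lambda>i. int (p i) + dl N i)"
proof (induction L arbitrary: p)
  case 0
  let ?\<beta> = "\<lambda>i. int (p i) + dl N i"
  have "alt N ?\<beta> (dl N) = (if \<forall>i<N. ?\<beta> i = dl N i then 1 else 0)"
  proof (rule alt_decreasing)
    show "?\<beta> j < ?\<beta> i" if "i < j" for i j using shapeD(1)[OF 0, of i j] that by (simp add: dl_def)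
  qed (simp add: dl_def)
  moreover have "card (SS 0 \<alpha> p) = (if \<forall>i<N. p i = 0 then 1 else 0)"
  proof (cases "\<forall>i<N. p i = 0")
    case True
    then have "p i = 0" for i using shapeD(2)[OF 0, of i] by (cases "i < N") auto
    then have "scells p = {}" by (auto simp: scells_def)
    then have "SS 0 \<alpha> p = {\<lambda>x. undefined}" using \<open>\<And>i. p i = 0\<close> by (auto simp: SS_def tabs_def)
    then show ?thesis using True by simp
  next
    case False
    then have "scells p \<noteq> {}" by (auto simp: scells_def)
    then have "SS 0 \<alpha> p = {}" by (auto simp: SS_def PiE_iff)
    then show ?thesis using False by simp
  qed
  ultimately show ?case by (simp add: Kc_0)
next
  case (Suc L)
  note p = \<open>shape N p\<close>
  let ?\<beta> = "\<lambda>i. int (p i) + dl N i"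
  let ?G = "{\<gamma> \<in> below N ?\<beta> (\<alpha> L). \<forall>i. Suc i < N \<longrightarrow> ?\<beta> (Suc i) < \<gamma> i}"
  let ?r = "\<lambda>q. restrict (\<lambda>i. int (q i) + dl N i) {..<N}"
  have fin: "finite (strips N p (\<alpha> L))"
    using bij_betw_finite[OF strips_bij[OF p, of "\<alpha> L"]] by simp
  have "card (SS (Suc L) \<alpha> p) = (\<Sum>q\<in>strips N p (\<alpha> L). \<Sum>T\<in>{T \<in> SS (Suc L) \<alpha> p. cutoff L p T = q}. 1)"
    by (subst sum.group[OF finite_SS[OF p] fin]) (use cutoff_strip[OF p] in auto)
  also have "\<dots> = (\<Sum>q\<in>strips N p (\<alpha> L). card (SS L \<alpha> q))"
    using SS_fibre[OF p] by (intro sum.cong refl) simp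
  finally have "int (card (SS (Suc L) \<alpha> p)) = (\<Sum>q\<in>strips N p (\<alpha> L). int (card (SS L \<alpha> q)))" by simp
  also have "\<dots> = (\<Sum>q\<in>strips N p (\<alpha> L). Kc N L \<alpha> (?r q))"
  proof (rule sum.cong[OF refl])
    fix q assume "q \<in> strips N p (\<alpha> L)"
    then have "int (card (SS L \<alpha> q)) = Kc N L \<alpha> (\<lambda>i. int (q i) + dl N i)"
      using Suc.IH strip_shape[OF p] by blast
    also have "\<dots> = Kc N L \<alpha> (?r q)" by (rule Kc_cong) simp_all
    finally show "int (card (SS L \<alpha> q)) = Kc N L \<alpha> (?r q)" .
  qed
  also have "\<dots> = (\<Sum>\<gamma>\<in>?G. Kc N L \<alpha> \<gamma>)"
    by (rule sum.reindex_bij_betw[OF strips_bij[OF p]])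
  also have "\<dots> = Kc N (Suc L) \<alpha> ?\<beta>"
  proof (rule Kc_pieri[symmetric])
    show "?\<beta> (Suc i) < ?\<beta> i" for i using shapeD(1)[OF p, of i "Suc i"] by (simp add: dl_def)
  qed
  finally show ?case .
qed

lemma cells_scells: "cells lam = scells (pt lam)"
  by (auto simp: cells_def pt_nth) (metis not_less not_less_zero pt_beyond, metis not_less not_less_zero pt_beyond pt_nth)

lemma shape_pt: "is_partition lam \<Longrightarrow> length lam \<le> N \<Longrightarrow> shape N (pt lam)"
  by (auto simp: shape_def pt_antimono pt_beyond)

text \<open>A monomial involves finitely many variables, bounded by \<open>L\<close>; its
  coefficient in the Schur function is then a Kostka number, available for any sufficiently large
  number \<open>N\<close> of beads.\<close>

lemma schur_Kc:
  assumes lam: "is_partition lam" "length lam \<le> N" and L: "\<And>i. L \<le> i \<Longrightarrow> lookup \<alpha> i = 0"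
  shows "schur lam \<alpha> = Kc N L (\<lambda>i. int (lookup \<alpha> i)) (bt N lam)"
proof -
  let ?c = "cells lam"
  have "{T \<in> semistandard lam. \<forall>i. card {x \<in> ?c. T x = i} = lookup \<alpha> i} =
      SS L (\<lambda>i. int (lookup \<alpha> i)) (pt lam)" (is "?A = ?B")
  proof (intro equalityI subsetI)
    fix T assume T: "T \<in> ?A"
    then have c: "card {x \<in> ?c. T x = i} = lookup \<alpha> i" for i by blast
    have "T x < L" if "x \<in> ?c" for x
    proof (rule ccontr)
      assume "\<not> T x < L"
      then have "{y \<in> ?c. T y = T x} = {}" using c[of "T x"] L[of "T x"] by simp
      then show False using that by blast
    qed
    then show "T \<in> ?B" using T unfolding SS_def semistandard_def cells_scells
      by (auto simp: tabs_def PiE_iff cnt_def)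
  next
    fix T assume T: "T \<in> ?B"
    have "card {x \<in> ?c. T x = i} = lookup \<alpha> i" for i
    proof (cases "i < L")
      case True
      then show ?thesis using T by (simp add: SS_def cnt_def cells_scells)
    next
      case False
      then have "{x \<in> ?c. T x = i} = {}" using T by (auto simp: SS_def PiE_iff cells_scells)
      then show ?thesis using L[of i] False by simp
    qed
    then show "T \<in> ?A" using T unfolding SS_def semistandard_def cells_scells
      by (auto simp: tabs_def PiE_iff)
  qed
  then show ?thesis using card_SS[OF shape_pt[OF lam]] by (simp add: schur_def bt_def[abs_def])
qed

lemma sum_phi_psi:
  assumes "finite S" "(\<Sum>l<L. \<alpha> l) = int (card S)"
  shows "(\<Sum>p | p permutes S. phi S {..<L} \<alpha> p * psi S N \<beta> p) = fact (card S) * Kc N L \<alpha> \<beta>"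
proof -
  have "(\<Sum>p | p permutes S. phi S {..<L} \<alpha> p * psi S N \<beta> p) =
    (\<Sum>w | w permutes {..<N}. sign w * (\<Sum>p | p permutes S. phi S {..<L} \<alpha> p * phi S {..<N} (\<lambda>i. \<beta> i - dl N (w i)) p))"
    unfolding psi_def sum_distrib_left by (subst sum.swap) (simp add: mult_ac)
  also have "\<dots> = (\<Sum>w | w permutes {..<N}. sign w * (fact (card S) * int (card (Mset {..<L} {..<N} \<alpha> (\<lambda>i. \<beta> i - dl N (w i))))))"
    using assms by (subst sum_phi_phi) simp_all
  finally show ?thesis by (simp add: Kc_def sum_distrib_left mult_ac)
qed

lemma Kc_total:
  assumes "Kc N L \<alpha> \<beta> \<noteq> 0"
  shows "(\<Sum>l<L. \<alpha> l) = (\<Sum>i<N. \<beta> i) - (\<Sum>i<N. dl N i)"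
proof -
  obtain w where w: "w permutes {..<N}" "Mset {..<L} {..<N} \<alpha> (\<lambda>i. \<beta> i - dl N (w i)) \<noteq> {}"
  proof -
    have "\<exists>w\<in>{w. w permutes {..<N}}. sign w * int (card (Mset {..<L} {..<N} \<alpha> (\<lambda>i. \<beta> i - dl N (w i)))) \<noteq> 0"
      using assms unfolding Kc_def by (rule sum.not_neutral_contains_not_neutral) blast
    then show ?thesis using that by force
  qed
  then obtain A where "A \<in> Mset {..<L} {..<N} \<alpha> (\<lambda>i. \<beta> i - dl N (w i))" by blast
  then have "(\<Sum>l<L. \<alpha> l) = (\<Sum>i<N. \<beta> i - dl N (w i))" using Mset_total[of "{..<L}" "{..<N}" A \<alpha>] by simp
  then show ?thesis using sum_permutes_N[OF w(1), of "dl N"] by (simp add: sum_subtractf)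
qed

section \<open>Restriction to a product of two symmetric groups\<close>

definition dsum :: "nat \<Rightarrow> (nat \<Rightarrow> nat) \<Rightarrow> (nat \<Rightarrow> nat) \<Rightarrow> nat \<Rightarrow> nat" where
  "dsum a s t x = (if x < a then s x else a + t (x - a))"

lemma dsum_comp:
  assumes "s' \<in> Sym a"
  shows "dsum a (s \<circ> s') (t \<circ> t') = dsum a s t \<circ> dsum a s' t'"
proof
  show "dsum a (s \<circ> s') (t \<circ> t') x = (dsum a s t \<circ> dsum a s' t') x" for x
    using Sym_less[OF assms, of x] by (simp add: dsum_def)
qed

lemma dsum_id: "dsum a id id = id"
  by (auto simp: dsum_def fun_eq_iff)

lemma dsum_cancel:
  assumes s: "s \<in> Sym a" and t: "t \<in> Sym b"
  shows "dsum a s t \<circ> dsum a (inv s) (inv t) = id" "dsum a (inv s) (inv t) \<circ> dsum a s t = id"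
  using dsum_comp[OF s, of "inv s" "inv t" t] dsum_comp[OF Sym_inv[OF s], of s t "inv t"]
  by (simp_all add: Sym_cancel[OF s] Sym_cancel[OF t] dsum_id)

lemma dsum_Sym:
  assumes s: "s \<in> Sym a" and t: "t \<in> Sym b"
  shows "dsum a s t \<in> Sym (a + b)"
proof -
  have "bij (dsum a s t)" by (rule o_bij[OF dsum_cancel(2,1)[OF s t]])
  moreover have "dsum a s t x = x" if "x \<notin> {..<a + b}" for x
    using t that by (simp add: dsum_def Sym_iff permutes_def)
  ultimately show ?thesis by (auto simp: Sym_iff permutes_def bij_iff)
qed

lemma dsum_inv: "s \<in> Sym a \<Longrightarrow> t \<in> Sym b \<Longrightarrow> inv (dsum a s t) = dsum a (inv s) (inv t)"
  by (rule inv_unique_comp[OF dsum_cancel])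

lemma cnt_dsum: "cnt {..<a + b} f l = cnt {..<a} f l + cnt {..<b::nat} (\<lambda>x. f (a + x)) l"
proof -
  let ?X = "{x \<in> {..<a}. f x = l}" and ?Y = "{x \<in> {..<b}. f (a + x) = l}" and ?Z = "{x \<in> {..<a + b}. f x = l}"
  have e: "?Z = ?X \<union> (\<lambda>x. a + x) ` ?Y"
  proof (intro equalityI subsetI)
    fix x assume x: "x \<in> ?Z"
    show "x \<in> ?X \<union> (\<lambda>x. a + x) ` ?Y"
    proof (cases "x < a")
      case False
      then have "x = a + (x - a)" "x - a \<in> ?Y" using x by auto
      then show ?thesis by blast
    qed (use x in simp)
  qed auto
  have "card ?Z = card ?X + card ((\<lambda>x. a + x) ` ?Y)"
    unfolding e by (rule card_Un_disjoint) auto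
  also have "card ((\<lambda>x. a + x) ` ?Y) = card ?Y"
    by (rule card_image) (simp add: inj_on_def)
  finally show ?thesis by (simp add: cnt_def)
qed

definition boxes :: "nat \<Rightarrow> (nat \<Rightarrow> int) \<Rightarrow> (nat \<Rightarrow> int) set" where
  "boxes L \<gamma> = (\<Pi>\<^sub>E l\<in>{..<L}. {0..\<gamma> l})"

lemma finite_boxes [simp]: "finite (boxes L \<gamma>)"
  unfolding boxes_def by (intro finite_PiE; simp)

lemma boxesD:
  assumes "\<alpha> \<in> boxes L \<gamma>" "l < L"
  shows "0 \<le> \<alpha> l" "\<alpha> l \<le> \<gamma> l"
  using assms by (simp_all add: boxes_def PiE_iff)

text \<open>A word fixed by a block sum is a pair of fixed words. \<open>\<alpha>\<close> is the
  content of the first one, and the box keeps both contents nonnegative.\<close>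

lemma phi_dsum:
  assumes s: "s \<in> Sym a" and t: "t \<in> Sym b"
  shows "phi {..<a + b} {..<L::nat} \<gamma> (dsum a s t) =
    (\<Sum>\<alpha>\<in>boxes L \<gamma>. phi {..<a} {..<L} \<alpha> s * phi {..<b} {..<L} (\<lambda>l. \<gamma> l - \<alpha> l) t)"
proof -
  let ?A = "\<lambda>\<alpha>. {f \<in> fixfun {..<a} {..<L} s. \<forall>l\<in>{..<L}. cnt {..<a} f l = \<alpha> l}"
  let ?B = "\<lambda>\<alpha>. {f \<in> fixfun {..<b} {..<L} t. \<forall>l\<in>{..<L}. cnt {..<b} f l = \<gamma> l - \<alpha> l}"
  let ?Y = "{f \<in> fixfun {..<a + b} {..<L} (dsum a s t). \<forall>l\<in>{..<L}. cnt {..<a + b} f l = \<gamma> l}"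
  let ?fa = "\<lambda>f. restrict f {..<a}" and ?fb = "\<lambda>f. restrict (\<lambda>x. f (a + x)) {..<b}"
  let ?g = "\<lambda>(u, v) x. if x < a then u x else if x < a + b then v (x - a) else undefined"
  have sL: "s x < a" if "x < a" for x using Sym_less[OF s that] .
  have tL: "t x < b" if "x < b" for x using Sym_less[OF t that] .
  have bij: "bij_betw (\<lambda>f. (?fa f, ?fb f)) ?Y (\<Union>\<alpha>\<in>boxes L \<gamma>. ?A \<alpha> \<times> ?B \<alpha>)"
  proof (rule bij_betw_byWitness[where f' = ?g])
    show "\<forall>f\<in>?Y. ?g (?fa f, ?fb f) = f"
      by (auto simp: fixfun_def PiE_iff extensional_def fun_eq_iff)
    show "\<forall>u\<in>(\<Union>\<alpha>\<in>boxes L \<gamma>. ?A \<alpha> \<times> ?B \<alpha>). (?fa (?g u), ?fb (?g u)) = u"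
      by (auto simp: fixfun_def PiE_iff extensional_def fun_eq_iff)
    show "(\<lambda>f. (?fa f, ?fb f)) ` ?Y \<subseteq> (\<Union>\<alpha>\<in>boxes L \<gamma>. ?A \<alpha> \<times> ?B \<alpha>)"
    proof (rule image_subsetI)
      fix f assume f: "f \<in> ?Y"
      then have f1: "f \<in> {..<a + b} \<rightarrow>\<^sub>E {..<L}" and f2: "\<And>x. x < a + b \<Longrightarrow> f (dsum a s t x) = f x"
        by (auto simp: fixfun_def)
      have c1: "cnt {..<a} (?fa f) l = cnt {..<a} f l" for l by (rule cnt_cong) simp
      have c2: "cnt {..<b} (?fb f) l = cnt {..<b} (\<lambda>x. f (a + x)) l" for l by (rule cnt_cong) simp
      have c3: "cnt {..<a} f l + cnt {..<b} (\<lambda>x. f (a + x)) l = \<gamma> l" if "l < L" for l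
        using f that cnt_dsum[of a b f l] by simp
      let ?\<alpha> = "restrict (cnt {..<a} f) {..<L}"
      have "?\<alpha> \<in> boxes L \<gamma>"
        using c3 by (auto simp: boxes_def cnt_def) (smt (verit) of_nat_0_le_iff)
      moreover have "?fa f \<in> ?A ?\<alpha>"
      proof -
        have "f (s x) = f x" if "x < a" for x using f2[of x] that by (simp add: dsum_def)
        then show ?thesis using f1 sL c1 by (auto simp: fixfun_def)
      qed
      moreover have "?fb f \<in> ?B ?\<alpha>"
      proof -
        have "f (a + t x) = f (a + x)" if "x < b" for x using f2[of "a + x"] that by (simp add: dsum_def)
        moreover have "cnt {..<b} (?fb f) l = \<gamma> l - ?\<alpha> l" if "l < L" for l using c2[of l] c3[OF that] that by simp
        ultimately show ?thesis using f1 tL by (auto simp: fixfun_def)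
      qed
      ultimately show "(?fa f, ?fb f) \<in> (\<Union>\<alpha>\<in>boxes L \<gamma>. ?A \<alpha> \<times> ?B \<alpha>)" by blast
    qed
    show "?g ` (\<Union>\<alpha>\<in>boxes L \<gamma>. ?A \<alpha> \<times> ?B \<alpha>) \<subseteq> ?Y"
    proof (rule image_subsetI)
      fix uv assume "uv \<in> (\<Union>\<alpha>\<in>boxes L \<gamma>. ?A \<alpha> \<times> ?B \<alpha>)"
      then obtain u v \<alpha> where uv: "uv = (u, v)" and u: "u \<in> ?A \<alpha>" and v: "v \<in> ?B \<alpha>" by blast
      have c: "cnt {..<a + b} (?g uv) l = \<gamma> l" if "l < L" for l
      proof -
        have "cnt {..<a} (?g uv) l = cnt {..<a} u l" by (rule cnt_cong) (simp add: uv)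
        moreover have "cnt {..<b} (\<lambda>x. ?g uv (a + x)) l = cnt {..<b} v l" by (rule cnt_cong) (simp add: uv)
        ultimately show ?thesis using u v that cnt_dsum[of a b "?g uv" l] by simp
      qed
      have "?g uv (dsum a s t x) = ?g uv x" if "x < a + b" for x
        using u v that sL[of x] tL[of "x - a"] by (auto simp: uv dsum_def fixfun_def)
      moreover have "?g uv \<in> {..<a + b} \<rightarrow>\<^sub>E {..<L}"
        using u v by (auto simp: uv fixfun_def PiE_iff extensional_def)
      ultimately show "?g uv \<in> ?Y" using c by (simp add: fixfun_def)
    qed
  qed
  have "card ?Y = card (\<Union>\<alpha>\<in>boxes L \<gamma>. ?A \<alpha> \<times> ?B \<alpha>)" by (rule bij_betw_same_card[OF bij])
  also have "\<dots> = (\<Sum>\<alpha>\<in>boxes L \<gamma>. card (?A \<alpha> \<times> ?B \<alpha>))"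
  proof (rule card_UN_disjoint)
    show "\<forall>\<alpha>\<in>boxes L \<gamma>. finite (?A \<alpha> \<times> ?B \<alpha>)" by auto
    have "\<alpha> = \<alpha>'" if "\<alpha> \<in> boxes L \<gamma>" "\<alpha>' \<in> boxes L \<gamma>" "f \<in> ?A \<alpha>" "f \<in> ?A \<alpha>'" for \<alpha> \<alpha>' f
      using that by (intro PiE_ext[of \<alpha> "{..<L}" _ \<alpha>']) (auto simp: boxes_def)
    then show "\<forall>\<alpha>\<in>boxes L \<gamma>. \<forall>\<alpha>'\<in>boxes L \<gamma>. \<alpha> \<noteq> \<alpha>' \<longrightarrow> ?A \<alpha> \<times> ?B \<alpha> \<inter> ?A \<alpha>' \<times> ?B \<alpha>' = {}" by blast
  qed simp
  finally show ?thesis by (simp add: phi_def card_cartesian_product)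
qed

lemma sum_bt_self: "lam \<in> partitions_of a \<Longrightarrow> (\<Sum>i<a. bt a lam i) = int a + (\<Sum>i<a. dl a i)"
  using sum_bt[of lam a] partitions_ofD[of lam a] by simp

lemma sum_phi_irr:
  assumes "lam \<in> partitions_of a"
  shows "(\<Sum>p\<in>Sym a. phi {..<a} {..<L} \<alpha> p * irr a lam p) = fact a * Kc a L \<alpha> (bt a lam)"
proof (cases "(\<Sum>l<L. \<alpha> l) = int a")
  case True
  then show ?thesis using sum_phi_psi[of "{..<a}" \<alpha> L a "bt a lam"] by (simp add: Sym_def)
next
  case False
  then have "Kc a L \<alpha> (bt a lam) = 0"
    using Kc_total[of a L \<alpha> "bt a lam"] sum_bt_self[OF assms] by auto
  moreover have "phi {..<a} {..<L} \<alpha> p = 0" for p using False by (intro phi_eq_0) auto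
  ultimately show ?thesis by simp
qed

text \<open>The Littlewood-Richardson coefficient times \<open>a! b!\<close>, see \<open>lr_coeff_LRk\<close>.\<close>

definition LRk :: "nat \<Rightarrow> nat \<Rightarrow> nat list \<Rightarrow> nat list \<Rightarrow> nat list \<Rightarrow> int" where
  "LRk a b kappa lam mu = (\<Sum>s\<in>Sym a. \<Sum>t\<in>Sym b. irr (a + b) kappa (dsum a s t) * irr a lam s * irr b mu t)"

lemma sum_dsum_phi:
  assumes lam: "lam \<in> partitions_of a" and mu: "mu \<in> partitions_of b"
  shows "(\<Sum>s\<in>Sym a. \<Sum>t\<in>Sym b. phi {..<a + b} {..<L} \<gamma> (dsum a s t) * irr a lam s * irr b mu t) =
    fact a * fact b * (\<Sum>\<alpha>\<in>boxes L \<gamma>. Kc a L \<alpha> (bt a lam) * Kc b L (\<lambda>l. \<gamma> l - \<alpha> l) (bt b mu))"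
proof -
  have "(\<Sum>s\<in>Sym a. \<Sum>t\<in>Sym b. phi {..<a + b} {..<L} \<gamma> (dsum a s t) * irr a lam s * irr b mu t) =
    (\<Sum>s\<in>Sym a. \<Sum>t\<in>Sym b. \<Sum>\<alpha>\<in>boxes L \<gamma>.
      (phi {..<a} {..<L} \<alpha> s * irr a lam s) * (phi {..<b} {..<L} (\<lambda>l. \<gamma> l - \<alpha> l) t * irr b mu t))"
    by (rule sum.cong[OF refl], rule sum.cong[OF refl]) (simp add: phi_dsum sum_distrib_left sum_distrib_right mult_ac)
  also have "\<dots> = (\<Sum>\<alpha>\<in>boxes L \<gamma>. \<Sum>s\<in>Sym a. \<Sum>t\<in>Sym b.
      (phi {..<a} {..<L} \<alpha> s * irr a lam s) * (phi {..<b} {..<L} (\<lambda>l. \<gamma> l - \<alpha> l) t * irr b mu t))"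
    by (subst (2) sum.swap, subst sum.swap) (rule refl)
  also have "\<dots> = (\<Sum>\<alpha>\<in>boxes L \<gamma>. (fact a * Kc a L \<alpha> (bt a lam)) * (fact b * Kc b L (\<lambda>l. \<gamma> l - \<alpha> l) (bt b mu)))"
    unfolding sum_product[symmetric] sum_phi_irr[OF lam] sum_phi_irr[OF mu] ..
  finally show ?thesis by (simp add: sum_distrib_left mult_ac)
qed

text \<open>The determinant writes \<open>irr (a + b) kappa\<close> as an integral combination of
  functions \<open>phi\<close>, and for those \<open>sum_dsum_phi\<close> exhibits the
  factor.\<close>

lemma LRk_dvd:
  assumes lam: "lam \<in> partitions_of a" and mu: "mu \<in> partitions_of b"
  shows "fact a * fact b dvd LRk a b kappa lam mu"
proof -
  let ?N = "a + b"
  have "LRk a b kappa lam mu = (\<Sum>s\<in>Sym a. \<Sum>t\<in>Sym b. \<Sum>w | w permutes {..<?N}.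
      sign w * (phi {..<?N} {..<?N} (\<lambda>i. bt ?N kappa i - dl ?N (w i)) (dsum a s t) * irr a lam s * irr b mu t))"
    unfolding LRk_def psi_def[of "{..<?N}"] by (simp add: sum_distrib_left sum_distrib_right mult_ac)
  also have "\<dots> = (\<Sum>w | w permutes {..<?N}. \<Sum>s\<in>Sym a. \<Sum>t\<in>Sym b.
      sign w * (phi {..<?N} {..<?N} (\<lambda>i. bt ?N kappa i - dl ?N (w i)) (dsum a s t) * irr a lam s * irr b mu t))"
    by (subst (2) sum.swap, subst sum.swap) (rule refl)
  also have "\<dots> = (\<Sum>w | w permutes {..<?N}. sign w * (\<Sum>s\<in>Sym a. \<Sum>t\<in>Sym b.
      phi {..<?N} {..<?N} (\<lambda>i. bt ?N kappa i - dl ?N (w i)) (dsum a s t) * irr a lam s * irr b mu t))"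
    by (simp only: sum_distrib_left)
  also have "fact a * fact b dvd \<dots>"
    unfolding sum_dsum_phi[OF lam mu] by (intro dvd_sum dvd_mult dvd_triv_left)
  finally show ?thesis .
qed

text \<open>The kernels of the three characters are pulled back to
  \<open>Sym a \<times> Sym b\<close> and multiplied. The product kernel is invariant under
  translation, so its total is a positive multiple of \<open>LRk\<close>.\<close>

lemma LRk_nonneg:
  assumes lam: "lam \<in> partitions_of a" and mu: "mu \<in> partitions_of b" and kappa: "kappa \<in> partitions_of (a + b)"
  shows "LRk a b kappa lam mu \<ge> 0"
proof -
  let ?G = "Sym a \<times> Sym b"
  let ?F = "\<lambda>s t. irr (a + b) kappa (dsum a s t) * irr a lam s * irr b mu t"
  obtain x y z where x: "gram (Sym (a + b)) (\<lambda>h h'. irr (a + b) kappa (inv h \<circ> h')) x"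
    and y: "gram (Sym a) (\<lambda>h h'. irr a lam (inv h \<circ> h')) y" and z: "gram (Sym b) (\<lambda>h h'. irr b mu (inv h \<circ> h')) z"
    using irr_gram_ex[OF lam] irr_gram_ex[OF mu] irr_gram_ex[OF kappa] by blast
  have x': "gram ?G (\<lambda>g h. irr (a + b) kappa (inv (dsum a (fst g) (snd g)) \<circ> dsum a (fst h) (snd h))) (\<lambda>g. x (dsum a (fst g) (snd g)))"
    by (rule gram_pullback[OF x]) (auto intro: dsum_Sym)
  have y': "gram ?G (\<lambda>g h. irr a lam (inv (fst g) \<circ> fst h)) (\<lambda>g. y (fst g))" by (rule gram_pullback[OF y]) auto
  have z': "gram ?G (\<lambda>g h. irr b mu (inv (snd g) \<circ> snd h)) (\<lambda>g. z (snd g))" by (rule gram_pullback[OF z]) auto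
  have "0 \<le> (\<Sum>g\<in>?G. \<Sum>h\<in>?G. irr (a + b) kappa (inv (dsum a (fst g) (snd g)) \<circ> dsum a (fst h) (snd h)) *
      irr a lam (inv (fst g) \<circ> fst h) * irr b mu (inv (snd g) \<circ> snd h))"
    by (rule gram_sum(1)[OF gram_mult[OF gram_mult[OF x' y'] z']])
  also have "\<dots> = (\<Sum>g\<in>?G. \<Sum>h\<in>?G. ?F (inv (fst g) \<circ> fst h) (inv (snd g) \<circ> snd h))"
  proof (rule sum.cong[OF refl], rule sum.cong[OF refl])
    fix g h assume g: "g \<in> ?G" and h: "h \<in> ?G"
    then have "inv (dsum a (fst g) (snd g)) \<circ> dsum a (fst h) (snd h) = dsum a (inv (fst g) \<circ> fst h) (inv (snd g) \<circ> snd h)"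
      by (auto simp: dsum_inv dsum_comp)
    then show "irr (a + b) kappa (inv (dsum a (fst g) (snd g)) \<circ> dsum a (fst h) (snd h)) *
      irr a lam (inv (fst g) \<circ> fst h) * irr b mu (inv (snd g) \<circ> snd h) = ?F (inv (fst g) \<circ> fst h) (inv (snd g) \<circ> snd h)"
      by simp
  qed
  also have "\<dots> = (\<Sum>g\<in>?G. LRk a b kappa lam mu)"
  proof (rule sum.cong[OF refl])
    fix g assume g: "g \<in> ?G"
    have "(\<Sum>h\<in>?G. ?F (inv (fst g) \<circ> fst h) (inv (snd g) \<circ> snd h)) =
        (\<Sum>s\<in>Sym a. \<Sum>t\<in>Sym b. ?F (inv (fst g) \<circ> s) (inv (snd g) \<circ> t))"
      by (simp add: sum.cartesian_product case_prod_beta)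
    also have "\<dots> = (\<Sum>s\<in>Sym a. \<Sum>t\<in>Sym b. ?F (inv (fst g) \<circ> s) t)"
      using g by (intro sum.cong[OF refl] sum_Sym_left Sym_inv) auto
    also have "\<dots> = (\<Sum>s\<in>Sym a. \<Sum>t\<in>Sym b. ?F s t)"
      using g by (intro sum_Sym_left[where f = "\<lambda>s. \<Sum>t\<in>Sym b. ?F s t"] Sym_inv) auto
    finally show "(\<Sum>h\<in>?G. ?F (inv (fst g) \<circ> fst h) (inv (snd g) \<circ> snd h)) = LRk a b kappa lam mu"
      by (simp add: LRk_def)
  qed
  also have "\<dots> = fact a * (fact b * LRk a b kappa lam mu)" by (simp add: card_cartesian_product card_Sym)
  finally show ?thesis by (rule fact_mult_nonneg[OF fact_mult_nonneg])
qed

text \<open>Young's rule, with the Kostka numbers as multiplicities.\<close>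

lemma phi_expand:
  "p \<in> Sym n \<Longrightarrow> phi {..<n} {..<L} \<gamma> p = (\<Sum>\<kappa>\<in>partitions_of n. Kc n L \<gamma> (bt n \<kappa>) * irr n \<kappa> p)"
proof -
  assume p: "p \<in> Sym n"
  have "fact n * phi {..<n} {..<L} \<gamma> p = (\<Sum>\<kappa>\<in>partitions_of n. (\<Sum>q\<in>Sym n. phi {..<n} {..<L} \<gamma> q * irr n \<kappa> q) * irr n \<kappa> p)"
  proof -
    have "zspan {..<n} n (phi {..<n} {..<L} \<gamma>)" by (intro zspan_phi_gen) auto
    from zspan_expand[OF _ _ this] show ?thesis using p by (simp add: Sym_def)
  qed
  also have "\<dots> = fact n * (\<Sum>\<kappa>\<in>partitions_of n. Kc n L \<gamma> (bt n \<kappa>) * irr n \<kappa> p)"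
    unfolding sum_distrib_left by (intro sum.cong refl) (simp add: sum_phi_irr)
  finally show ?thesis by simp
qed

section \<open>Products of Schur functions\<close>

definition pmf :: "nat \<Rightarrow> (nat \<Rightarrow> int) \<Rightarrow> (nat \<Rightarrow>\<^sub>0 nat)" where
  "pmf L \<alpha> = Poly_Mapping.Abs_poly_mapping (\<lambda>i. if i < L then nat (\<alpha> i) else 0)"

lemma lookup_pmf [simp]: "lookup (pmf L \<alpha>) i = (if i < L then nat (\<alpha> i) else 0)"
proof -
  have "finite {i. (if i < L then nat (\<alpha> i) else 0) \<noteq> 0}"
    by (rule finite_subset[of _ "{..<L}"]) auto
  then show ?thesis unfolding pmf_def by (simp add: lookup_Abs_poly_mapping)
qed

lemma sum_splittings:
  fixes \<gamma> :: "nat \<Rightarrow>\<^sub>0 nat"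
  assumes L: "\<And>i. L \<le> i \<Longrightarrow> lookup \<gamma> i = 0"
  shows "(\<Sum>(\<alpha>, \<beta>) | \<alpha> + \<beta> = \<gamma>. f \<alpha> \<beta>) = (\<Sum>\<alpha>\<in>boxes L (\<lambda>i. int (lookup \<gamma> i)). f (pmf L \<alpha>) (\<gamma> - pmf L \<alpha>))"
proof (rule sum.reindex_bij_witness[where
      i = "\<lambda>\<alpha>. (pmf L \<alpha>, \<gamma> - pmf L \<alpha>)" and j = "\<lambda>(\<alpha>, \<beta>). restrict (\<lambda>i. int (lookup \<alpha> i)) {..<L}"])
  fix x assume "x \<in> {(\<alpha>, \<beta>). \<alpha> + \<beta> = \<gamma>}"
  then obtain \<alpha> \<beta> where x: "x = (\<alpha>, \<beta>)" and \<gamma>: "\<alpha> + \<beta> = \<gamma>" by auto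
  have l: "lookup \<alpha> i + lookup \<beta> i = lookup \<gamma> i" for i
    unfolding \<gamma>[symmetric] by (simp add: lookup_add)
  have 1: "pmf L (restrict (\<lambda>i. int (lookup \<alpha> i)) {..<L}) = \<alpha>"
  proof (rule poly_mapping_eqI)
    show "lookup (pmf L (restrict (\<lambda>i. int (lookup \<alpha> i)) {..<L})) i = lookup \<alpha> i" for i
      using L[of i] l[of i] by (cases "L \<le> i") auto
  qed
  have 2: "\<gamma> - \<alpha> = \<beta>" unfolding \<gamma>[symmetric] by simp
  show "(\<lambda>\<alpha>. (pmf L \<alpha>, \<gamma> - pmf L \<alpha>)) (case x of (\<alpha>, \<beta>) \<Rightarrow> restrict (\<lambda>i. int (lookup \<alpha> i)) {..<L}) = x"
    using 1 2 by (simp add: x)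
  have "int (lookup \<alpha> i) \<le> int (lookup \<gamma> i)" for i using l[of i] by linarith
  then show "(case x of (\<alpha>, \<beta>) \<Rightarrow> restrict (\<lambda>i. int (lookup \<alpha> i)) {..<L}) \<in> boxes L (\<lambda>i. int (lookup \<gamma> i))"
    by (simp add: x boxes_def)
  show "f (pmf L (case x of (\<alpha>, \<beta>) \<Rightarrow> restrict (\<lambda>i. int (lookup \<alpha> i)) {..<L}))
      (\<gamma> - pmf L (case x of (\<alpha>, \<beta>) \<Rightarrow> restrict (\<lambda>i. int (lookup \<alpha> i)) {..<L})) = (case x of (\<alpha>, \<beta>) \<Rightarrow> f \<alpha> \<beta>)"
    using 1 2 by (simp add: x)
next
  fix \<alpha> assume \<alpha>: "\<alpha> \<in> boxes L (\<lambda>i. int (lookup \<gamma> i))"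
  note b = boxesD[OF \<alpha>]
  show "(case (pmf L \<alpha>, \<gamma> - pmf L \<alpha>) of (\<alpha>, \<beta>) \<Rightarrow> restrict (\<lambda>i. int (lookup \<alpha> i)) {..<L}) = \<alpha>"
  proof
    have "\<alpha> i = undefined" if "\<not> i < L" for i using \<alpha> that by (simp add: boxes_def PiE_iff extensional_def)
    then show "(case (pmf L \<alpha>, \<gamma> - pmf L \<alpha>) of (\<alpha>, \<beta>) \<Rightarrow> restrict (\<lambda>i. int (lookup \<alpha> i)) {..<L}) i = \<alpha> i" for i
      using b[of i] by simp
  qed
  have "pmf L \<alpha> + (\<gamma> - pmf L \<alpha>) = \<gamma>"
  proof (rule poly_mapping_eqI)
    show "lookup (pmf L \<alpha> + (\<gamma> - pmf L \<alpha>)) i = lookup \<gamma> i" for i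
      using b[of i] L[of i] by (auto simp: lookup_add lookup_minus)
  qed
  then show "(pmf L \<alpha>, \<gamma> - pmf L \<alpha>) \<in> {(\<alpha>, \<beta>). \<alpha> + \<beta> = \<gamma>}" by simp
qed

text \<open>One sum over \<open>Sym a\<close> and \<open>Sym b\<close>, of \<open>phi\<close> at
  block sums against both characters, is evaluated twice: splitting the words gives products of
  Schur coefficients, and Young's rule gives the coefficients \<open>LRk\<close>.\<close>

theorem series_mult_schur:
  assumes lam: "lam \<in> partitions_of a" and mu: "mu \<in> partitions_of b"
  shows "fact a * fact b * series_mult (schur lam) (schur mu) \<gamma> =
    (\<Sum>\<kappa>\<in>partitions_of (a + b). LRk a b \<kappa> lam mu * schur \<kappa> \<gamma>)"
proof -
  define L where "L = Suc (Max (insert 0 (keys \<gamma>)))"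
  have L: "lookup \<gamma> i = 0" if "L \<le> i" for i
  proof (rule ccontr)
    assume "lookup \<gamma> i \<noteq> 0"
    then have "i \<in> insert 0 (keys \<gamma>)" by (simp add: in_keys_iff)
    then have "i \<le> Max (insert 0 (keys \<gamma>))" by (intro Max_ge) auto
    then show False using that by (simp add: L_def)
  qed
  let ?\<gamma> = "\<lambda>i. int (lookup \<gamma> i)"
  have "series_mult (schur lam) (schur mu) \<gamma> = (\<Sum>\<alpha>\<in>boxes L ?\<gamma>. schur lam (pmf L \<alpha>) * schur mu (\<gamma> - pmf L \<alpha>))"
    unfolding series_mult_def by (rule sum_splittings[OF L])
  also have "\<dots> = (\<Sum>\<alpha>\<in>boxes L ?\<gamma>. Kc a L \<alpha> (bt a lam) * Kc b L (\<lambda>l. ?\<gamma> l - \<alpha> l) (bt b mu))"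
  proof (rule sum.cong[OF refl])
    fix \<alpha> assume "\<alpha> \<in> boxes L ?\<gamma>"
    note b = boxesD[OF this]
    have "schur lam (pmf L \<alpha>) = Kc a L (\<lambda>i. int (lookup (pmf L \<alpha>) i)) (bt a lam)"
      using partitions_ofD[OF lam] by (intro schur_Kc) auto
    also have "\<dots> = Kc a L \<alpha> (bt a lam)" using b by (intro Kc_cong) simp_all
    finally have 1: "schur lam (pmf L \<alpha>) = Kc a L \<alpha> (bt a lam)" .
    have "schur mu (\<gamma> - pmf L \<alpha>) = Kc b L (\<lambda>i. int (lookup (\<gamma> - pmf L \<alpha>) i)) (bt b mu)"
      using partitions_ofD[OF mu] L by (intro schur_Kc) (auto simp: lookup_minus)
    also have "\<dots> = Kc b L (\<lambda>l. ?\<gamma> l - \<alpha> l) (bt b mu)"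
      using b by (intro Kc_cong) (simp_all add: lookup_minus of_nat_diff nat_le_iff)
    finally show "schur lam (pmf L \<alpha>) * schur mu (\<gamma> - pmf L \<alpha>) = Kc a L \<alpha> (bt a lam) * Kc b L (\<lambda>l. ?\<gamma> l - \<alpha> l) (bt b mu)"
      using 1 by simp
  qed
  finally have "fact a * fact b * series_mult (schur lam) (schur mu) \<gamma> =
      (\<Sum>s\<in>Sym a. \<Sum>t\<in>Sym b. phi {..<a + b} {..<L} ?\<gamma> (dsum a s t) * irr a lam s * irr b mu t)"
    by (simp only: sum_dsum_phi[OF lam mu])
  also have "\<dots> = (\<Sum>s\<in>Sym a. \<Sum>t\<in>Sym b. \<Sum>\<kappa>\<in>partitions_of (a + b).
      schur \<kappa> \<gamma> * (irr (a + b) \<kappa> (dsum a s t) * irr a lam s * irr b mu t))"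
  proof (rule sum.cong[OF refl], rule sum.cong[OF refl])
    fix s t assume "s \<in> Sym a" "t \<in> Sym b"
    then have "phi {..<a + b} {..<L} ?\<gamma> (dsum a s t) = (\<Sum>\<kappa>\<in>partitions_of (a + b). Kc (a + b) L ?\<gamma> (bt (a + b) \<kappa>) * irr (a + b) \<kappa> (dsum a s t))"
      by (intro phi_expand dsum_Sym)
    also have "\<dots> = (\<Sum>\<kappa>\<in>partitions_of (a + b). schur \<kappa> \<gamma> * irr (a + b) \<kappa> (dsum a s t))"
    proof (rule sum.cong[OF refl])
      fix \<kappa> assume "\<kappa> \<in> partitions_of (a + b)"
      then have "schur \<kappa> \<gamma> = Kc (a + b) L ?\<gamma> (bt (a + b) \<kappa>)"
        using partitions_ofD L by (intro schur_Kc) auto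
      then show "Kc (a + b) L ?\<gamma> (bt (a + b) \<kappa>) * irr (a + b) \<kappa> (dsum a s t) = schur \<kappa> \<gamma> * irr (a + b) \<kappa> (dsum a s t)" by simp
    qed
    finally show "phi {..<a + b} {..<L} ?\<gamma> (dsum a s t) * irr a lam s * irr b mu t =
        (\<Sum>\<kappa>\<in>partitions_of (a + b). schur \<kappa> \<gamma> * (irr (a + b) \<kappa> (dsum a s t) * irr a lam s * irr b mu t))"
      by (simp add: sum_distrib_right mult.assoc)
  qed
  also have "\<dots> = (\<Sum>\<kappa>\<in>partitions_of (a + b). \<Sum>s\<in>Sym a. \<Sum>t\<in>Sym b.
      schur \<kappa> \<gamma> * (irr (a + b) \<kappa> (dsum a s t) * irr a lam s * irr b mu t))"
    by (subst (2) sum.swap, subst sum.swap) (rule refl)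
  also have "\<dots> = (\<Sum>\<kappa>\<in>partitions_of (a + b). LRk a b \<kappa> lam mu * schur \<kappa> \<gamma>)"
    unfolding LRk_def sum_distrib_right by (simp add: mult_ac)
  finally show ?thesis .
qed

text \<open>In degree \<open>n\<close> the coefficients of Schur functions are pairings of
  irreducible characters with functions \<open>phi\<close>, of which \<open>irr n \<nu>\<close> is
  an integral combination. So the combination in question pairs to 0 with
  \<open>irr n \<nu>\<close>, and orthonormality isolates \<open>d \<nu>\<close>.\<close>

lemma schur_independent:
  assumes K: "finite K" "\<And>\<kappa>. \<kappa> \<in> K \<Longrightarrow> is_partition \<kappa>"
    and z: "\<And>\<gamma>. (\<Sum>\<kappa>\<in>K. d \<kappa> * schur \<kappa> \<gamma>) = 0" and \<nu>: "\<nu> \<in> K"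
  shows "d \<nu> = 0"
proof -
  define n where "n = sum_list \<nu>"
  define K' where "K' = {\<kappa> \<in> K. sum_list \<kappa> = n}"
  have K': "finite K'" "\<And>\<kappa>. \<kappa> \<in> K' \<Longrightarrow> \<kappa> \<in> partitions_of n" using K by (auto simp: K'_def partitions_of_def)
  have \<nu>': "\<nu> \<in> K'" using \<nu> by (simp add: K'_def n_def)
  have Kc0: "(\<Sum>\<kappa>\<in>K'. d \<kappa> * Kc n n \<alpha> (bt n \<kappa>)) = 0"
    if \<alpha>: "\<And>i. i < n \<Longrightarrow> 0 \<le> \<alpha> i" "(\<Sum>i<n. \<alpha> i) = int n" for \<alpha>
  proof -
    have e: "Kc N n (\<lambda>i. int (lookup (pmf n \<alpha>) i)) x = Kc N n \<alpha> x" for N x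
      using \<alpha>(1) by (intro Kc_cong) simp_all
    have "0 = (\<Sum>\<kappa>\<in>K. d \<kappa> * schur \<kappa> (pmf n \<alpha>))" by (simp add: z)
    also have "\<dots> = (\<Sum>\<kappa>\<in>K'. d \<kappa> * schur \<kappa> (pmf n \<alpha>))"
    proof (rule sum.mono_neutral_right)
      show "\<forall>\<kappa>\<in>K - K'. d \<kappa> * schur \<kappa> (pmf n \<alpha>) = 0"
      proof
        fix \<kappa> assume \<kappa>: "\<kappa> \<in> K - K'"
        have "schur \<kappa> (pmf n \<alpha>) = Kc (length \<kappa>) n \<alpha> (bt (length \<kappa>) \<kappa>)"
          using K \<kappa> schur_Kc[of \<kappa> "length \<kappa>" n "pmf n \<alpha>"] by (simp only: e) simp
        also have "\<dots> = 0"
          using Kc_total[of "length \<kappa>" n \<alpha> "bt (length \<kappa>) \<kappa>"] sum_bt[of \<kappa> "length \<kappa>"] \<alpha>(2) \<kappa> by (auto simp: K'_def)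
        finally show "d \<kappa> * schur \<kappa> (pmf n \<alpha>) = 0" by simp
      qed
    qed (use K in \<open>auto simp: K'_def\<close>)
    also have "\<dots> = (\<Sum>\<kappa>\<in>K'. d \<kappa> * Kc n n \<alpha> (bt n \<kappa>))"
    proof (rule sum.cong[OF refl])
      fix \<kappa> assume "\<kappa> \<in> K'"
      then have "\<kappa> \<in> partitions_of n" by (rule K'(2))
      then have "schur \<kappa> (pmf n \<alpha>) = Kc n n \<alpha> (bt n \<kappa>)"
        using schur_Kc[of \<kappa> n n "pmf n \<alpha>"] partitions_ofD[of \<kappa> n] by (simp only: e) simp
      then show "d \<kappa> * schur \<kappa> (pmf n \<alpha>) = d \<kappa> * Kc n n \<alpha> (bt n \<kappa>)" by simp
    qed
    finally show ?thesis by simp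
  qed
  have phi0: "(\<Sum>p\<in>Sym n. phi {..<n} {..<n} \<alpha> p * (\<Sum>\<kappa>\<in>K'. d \<kappa> * irr n \<kappa> p)) = 0" for \<alpha>
  proof (cases "(\<forall>i<n. 0 \<le> \<alpha> i) \<and> (\<Sum>i<n. \<alpha> i) = int n")
    case True
    have "(\<Sum>p\<in>Sym n. phi {..<n} {..<n} \<alpha> p * (\<Sum>\<kappa>\<in>K'. d \<kappa> * irr n \<kappa> p)) =
        (\<Sum>\<kappa>\<in>K'. d \<kappa> * (\<Sum>p\<in>Sym n. phi {..<n} {..<n} \<alpha> p * irr n \<kappa> p))"
      unfolding sum_distrib_left by (subst sum.swap) (simp add: mult_ac)
    also have "\<dots> = (\<Sum>\<kappa>\<in>K'. d \<kappa> * (fact n * Kc n n \<alpha> (bt n \<kappa>)))"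
      by (intro sum.cong refl) (simp add: sum_phi_irr K')
    also have "\<dots> = fact n * (\<Sum>\<kappa>\<in>K'. d \<kappa> * Kc n n \<alpha> (bt n \<kappa>))"
      by (simp add: sum_distrib_left mult_ac)
    also have "\<dots> = 0" using Kc0 True by simp
    finally show ?thesis .
  next
    case False
    then have "phi {..<n} {..<n} \<alpha> p = 0" for p
      using phi_eq_0[of "{..<n}" "{..<n}" \<alpha> p] phi_neg[of _ "{..<n}" \<alpha> "{..<n}" p] by (auto simp: not_le)
    then show ?thesis by simp
  qed
  have "(\<Sum>p\<in>Sym n. irr n \<nu> p * (\<Sum>\<kappa>\<in>K'. d \<kappa> * irr n \<kappa> p)) =
    (\<Sum>w | w permutes {..<n}. sign w * (\<Sum>p\<in>Sym n. phi {..<n} {..<n} (\<lambda>i. bt n \<nu> i - dl n (w i)) p * (\<Sum>\<kappa>\<in>K'. d \<kappa> * irr n \<kappa> p)))"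
    unfolding psi_def[of _ _ "bt n \<nu>"] sum_distrib_right by (subst sum.swap) (simp add: sum_distrib_left mult_ac)
  also have "\<dots> = 0" by (simp add: phi0)
  finally have "0 = (\<Sum>\<kappa>\<in>K'. d \<kappa> * (\<Sum>p\<in>Sym n. irr n \<nu> p * irr n \<kappa> p))"
    unfolding sum_distrib_left by (subst sum.swap) (simp add: mult_ac)
  also have "\<dots> = (\<Sum>\<kappa>\<in>K'. d \<kappa> * (if \<nu> = \<kappa> then fact n else 0))"
    using K'(2) \<nu>' by (intro sum.cong refl) (simp add: irr_orthonormal)
  also have "\<dots> = d \<nu> * fact n" using K'(1) \<nu>' by (simp add: if_distrib cong: if_cong)
  finally show ?thesis by simp
qed

text \<open>\<open>series_mult_schur\<close> together with \<open>LRk_dvd\<close> provides a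
  solution of the definite description in \<open>lr_coeff\<close>, and
  \<open>schur_independent\<close> its uniqueness.\<close>

theorem lr_coeff_LRk:
  assumes lam: "lam \<in> partitions_of a" and mu: "mu \<in> partitions_of b"
  shows "\<nu> \<in> partitions_of (a + b) \<Longrightarrow> fact a * fact b * lr_coeff \<nu> lam mu = LRk a b \<nu> lam mu"
    and "\<nu> \<notin> partitions_of (a + b) \<Longrightarrow> lr_coeff \<nu> lam mu = 0"
proof -
  let ?P = "\<lambda>c :: nat list \<Rightarrow>\<^sub>0 int. keys c \<subseteq> {kappa. is_partition kappa} \<and>
       series_mult (schur lam) (schur mu) =
         (\<lambda>\<gamma>. \<Sum>kappa\<in>keys c. lookup c kappa * schur kappa \<gamma>)"
  define f where "f \<kappa> = (if \<kappa> \<in> partitions_of (a + b) then LRk a b \<kappa> lam mu div (fact a * fact b) else 0)" for \<kappa>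
  define c where "c = Poly_Mapping.Abs_poly_mapping f"
  have "finite {\<kappa>. f \<kappa> \<noteq> 0}" by (rule finite_subset[of _ "partitions_of (a + b)"]) (auto simp: f_def)
  then have c: "lookup c = f" by (simp add: c_def)
  have f: "fact a * fact b * f \<kappa> = LRk a b \<kappa> lam mu" if "\<kappa> \<in> partitions_of (a + b)" for \<kappa>
    using LRk_dvd[OF lam mu] that by (simp add: f_def)
  have keys: "keys c \<subseteq> partitions_of (a + b)" by (auto simp: in_keys_iff c f_def split: if_splits)
  have Pc: "?P c"
  proof
    show "keys c \<subseteq> {kappa. is_partition kappa}" using keys by (auto simp: partitions_of_def)
    show "series_mult (schur lam) (schur mu) = (\<lambda>\<gamma>. \<Sum>kappa\<in>keys c. lookup c kappa * schur kappa \<gamma>)"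
    proof
      fix \<gamma>
      have "(\<Sum>kappa\<in>keys c. lookup c kappa * schur kappa \<gamma>) = (\<Sum>\<kappa>\<in>partitions_of (a + b). f \<kappa> * schur \<kappa> \<gamma>)"
        using keys by (intro sum.mono_neutral_cong_left) (auto simp: in_keys_iff c)
      then have "fact a * fact b * (\<Sum>kappa\<in>keys c. lookup c kappa * schur kappa \<gamma>) =
          (\<Sum>\<kappa>\<in>partitions_of (a + b). (fact a * fact b * f \<kappa>) * schur \<kappa> \<gamma>)"
        by (simp add: sum_distrib_left mult.assoc)
      also have "\<dots> = (\<Sum>\<kappa>\<in>partitions_of (a + b). LRk a b \<kappa> lam mu * schur \<kappa> \<gamma>)"
        by (intro sum.cong refl) (simp only: f)
      also have "\<dots> = fact a * fact b * series_mult (schur lam) (schur mu) \<gamma>"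
        by (rule series_mult_schur[OF lam mu, symmetric])
      finally show "series_mult (schur lam) (schur mu) \<gamma> = (\<Sum>kappa\<in>keys c. lookup c kappa * schur kappa \<gamma>)"
        by simp
    qed
  qed
  have "c' = c" if c': "?P c'" for c'
  proof (rule poly_mapping_eqI)
    fix \<kappa>
    let ?K = "keys c \<union> keys c'"
    let ?d = "\<lambda>\<kappa>. lookup c' \<kappa> - lookup c \<kappa>"
    have ext: "(\<Sum>kappa\<in>keys x. lookup x kappa * schur kappa \<gamma>) = (\<Sum>kappa\<in>?K. lookup x kappa * schur kappa \<gamma>)"
      if "keys x \<subseteq> ?K" for x \<gamma>
      using that by (intro sum.mono_neutral_left) (auto simp: in_keys_iff)
    have "(\<Sum>\<kappa>\<in>?K. ?d \<kappa> * schur \<kappa> \<gamma>) = 0" for \<gamma>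
    proof -
      have "(\<Sum>kappa\<in>?K. lookup c' kappa * schur kappa \<gamma>) = (\<Sum>kappa\<in>?K. lookup c kappa * schur kappa \<gamma>)"
        using fun_cong[OF conjunct2[OF Pc], of \<gamma>] fun_cong[OF conjunct2[OF c'], of \<gamma>] ext[of c \<gamma>] ext[of c' \<gamma>] by simp
      then show ?thesis by (simp add: left_diff_distrib sum_subtractf)
    qed
    then have "?d \<kappa> = 0" if "\<kappa> \<in> ?K"
      using schur_independent[of ?K ?d \<kappa>] that Pc c' by (auto simp: subset_iff)
    then show "lookup c' \<kappa> = lookup c \<kappa>"
      by (cases "\<kappa> \<in> ?K") (auto simp: in_keys_iff)
  qed
  then have "lr_coeff \<nu> lam mu = f \<nu>"
    unfolding lr_coeff_def using the_equality[of ?P c, OF Pc] c by simp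
  then show "\<nu> \<in> partitions_of (a + b) \<Longrightarrow> fact a * fact b * lr_coeff \<nu> lam mu = LRk a b \<nu> lam mu"
    and "\<nu> \<notin> partitions_of (a + b) \<Longrightarrow> lr_coeff \<nu> lam mu = 0"
    using f[of \<nu>] by (simp_all add: f_def)
qed

section \<open>Rim hooks\<close>

lemma cycle_invariant_iff:
  assumes "distinct cs" "cs \<noteq> []"
  shows "(\<forall>x\<in>set cs. f (cycle_of_list cs x) = f x) \<longleftrightarrow> (\<forall>x\<in>set cs. f x = f (hd cs))"
proof
  assume a: "\<forall>x\<in>set cs. f (cycle_of_list cs x) = f x"
  have rot: "map (cycle_of_list cs) cs = rotate1 cs"
    using cyclic_rotation[OF assms(1), of 1] by simp
  have c: "f (cs ! k) = f (cs ! 0)" if "k < length cs" for k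
    using that
  proof (induction k)
    case (Suc k)
    have "cycle_of_list cs (cs ! k) = rotate1 cs ! k"
      using Suc.prems by (simp flip: rot)
    also have "\<dots> = cs ! Suc k" using Suc.prems by (simp add: nth_rotate1)
    finally show ?case using a Suc by (metis Suc_lessD nth_mem)
  qed simp
  show "\<forall>x\<in>set cs. f x = f (hd cs)"
  proof
    fix x assume "x \<in> set cs"
    then obtain k where k: "k < length cs" and x: "x = cs ! k" by (auto simp: in_set_conv_nth)
    show "f x = f (hd cs)" unfolding x hd_conv_nth[OF assms(2)] by (rule c[OF k])
  qed
next
  assume a: "\<forall>x\<in>set cs. f x = f (hd cs)"
  show "\<forall>x\<in>set cs. f (cycle_of_list cs x) = f x"
  proof
    fix x assume x: "x \<in> set cs"
    then have "cycle_of_list cs x \<in> set cs" by (rule iffD2[OF permutes_in_image[OF cycle_permutes]])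
    then have "f (cycle_of_list cs x) = f (hd cs)" by (rule bspec[OF a])
    then show "f (cycle_of_list cs x) = f x" unfolding bspec[OF a x] .
  qed
qed

text \<open>A fixed word is constant on the cycle, which therefore adds its whole length to the
  count of one letter. \<open>H\<close> is left general because the lemma serves both for
  \<open>phi\<close> and for functionals of bead vectors.\<close>

lemma sum_fixfun_cycle:
  fixes H :: "('l \<Rightarrow> int) \<Rightarrow> int"
  assumes cs: "distinct cs" "cs \<noteq> []" "set cs \<inter> I = {}" and I: "finite I" and J: "finite J" and p: "p permutes I"
  shows "(\<Sum>f\<in>fixfun (set cs \<union> I) J (cycle_of_list cs \<circ> p). H (cnt (set cs \<union> I) f)) =
    (\<Sum>i\<in>J. \<Sum>f\<in>fixfun I J p. H (\<lambda>l. cnt I f l + (if l = i then int (length cs) else 0)))"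
proof -
  let ?S = "set cs \<union> I" and ?c = "cycle_of_list cs \<circ> p"
  let ?g = "\<lambda>(i, f) x. if x \<in> set cs then i else f x"
  have hd: "hd cs \<in> set cs" using cs by simp
  have cI: "?c x = p x" if "x \<in> I" for x
  proof -
    have "p x \<in> I" using that p by (simp add: permutes_in_image)
    then have "p x \<notin> set cs" using cs(3) by blast
    then show ?thesis by (simp add: id_outside_supp)
  qed
  have cC: "?c x = cycle_of_list cs x" if "x \<in> set cs" for x
  proof -
    have "x \<notin> I" using that cs(3) by blast
    then show ?thesis using p by (simp add: permutes_def)
  qed
  have fix_iff: "(\<forall>x\<in>?S. f (?c x) = f x) \<longleftrightarrow> (\<forall>x\<in>set cs. f x = f (hd cs)) \<and> (\<forall>x\<in>I. f (p x) = f x)" for f :: "'a \<Rightarrow> 'l"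
  proof -
    have "(\<forall>x\<in>?S. f (?c x) = f x) \<longleftrightarrow> (\<forall>x\<in>set cs. f (cycle_of_list cs x) = f x) \<and> (\<forall>x\<in>I. f (p x) = f x)"
      unfolding ball_Un using cI cC by (simp del: o_apply cong: ball_cong)
    then show ?thesis by (simp only: cycle_invariant_iff[OF cs(1,2)])
  qed
  have cntS: "cnt ?S f = (\<lambda>l. cnt I f l + (if l = f (hd cs) then int (length cs) else 0))"
    if "\<forall>x\<in>set cs. f x = f (hd cs)" for f :: "'a \<Rightarrow> 'l"
  proof
    fix l
    have "card {x \<in> ?S. f x = l} = card {x \<in> set cs. f x = l} + card {x \<in> I. f x = l}"
    proof -
      have "{x \<in> ?S. f x = l} = {x \<in> set cs. f x = l} \<union> {x \<in> I. f x = l}" by blast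
      then show ?thesis using I cs(3) by (subst card_Un_disjoint[symmetric]) auto
    qed
    moreover have "{x \<in> set cs. f x = l} = (if l = f (hd cs) then set cs else {})" using that by auto
    ultimately show "cnt ?S f l = cnt I f l + (if l = f (hd cs) then int (length cs) else 0)"
      by (simp add: cnt_def distinct_card[OF cs(1)])
  qed
  have "(\<Sum>f\<in>fixfun ?S J ?c. H (cnt ?S f)) =
      (\<Sum>(i, f)\<in>J \<times> fixfun I J p. H (\<lambda>l. cnt I f l + (if l = i then int (length cs) else 0)))"
  proof (rule sum.reindex_bij_witness[where i = ?g and j = "\<lambda>f. (f (hd cs), restrict f I)"])
    fix f assume "f \<in> fixfun ?S J ?c"
    then have f1: "f \<in> ?S \<rightarrow>\<^sub>E J" and f2: "\<forall>x\<in>set cs. f x = f (hd cs)" and f3: "\<forall>x\<in>I. f (p x) = f x"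
      using fix_iff[of f] by (auto simp only: fixfun_def mem_Collect_eq)
    show "?g (f (hd cs), restrict f I) = f"
      using f1 f2 by (auto simp: fun_eq_iff PiE_iff extensional_def)
    have "restrict f I \<in> fixfun I J p"
      using f1 f3 p by (auto simp: fixfun_def permutes_in_image)
    then show "(f (hd cs), restrict f I) \<in> J \<times> fixfun I J p" using f1 hd by (auto simp: PiE_iff)
    have "cnt I (restrict f I) l = cnt I f l" for l by (rule cnt_cong) simp
    then show "(case (f (hd cs), restrict f I) of (i, f) \<Rightarrow> H (\<lambda>l. cnt I f l + (if l = i then int (length cs) else 0))) = H (cnt ?S f)"
      by (simp add: cntS[OF f2])
  next
    fix x assume "x \<in> J \<times> fixfun I J p"
    then obtain i f where x: "x = (i, f)" and i: "i \<in> J" and f: "f \<in> fixfun I J p" by auto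
    then have f1: "f \<in> I \<rightarrow>\<^sub>E J" and f2: "\<forall>x\<in>I. f (p x) = f x" by (auto simp: fixfun_def)
    have I': "x \<in> I \<Longrightarrow> x \<notin> set cs" for x using cs(3) by blast
    show "(?g x (hd cs), restrict (?g x) I) = x"
      using hd f1 I' by (auto simp: x fun_eq_iff PiE_iff extensional_def)
    have "\<forall>x'\<in>I. ?g x (p x') = ?g x x'"
      using f2 I' p by (auto simp: x permutes_in_image)
    then have "\<forall>x'\<in>?S. ?g x (?c x') = ?g x x'" unfolding fix_iff using hd by (simp add: x)
    moreover have "?g x \<in> ?S \<rightarrow>\<^sub>E J" using f1 i by (auto simp: x PiE_iff extensional_def)
    ultimately show "?g x \<in> fixfun ?S J ?c" unfolding fixfun_def by blast
  qed
  then show ?thesis by (simp only: sum.cartesian_product)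
qed

lemma phi_sum:
  assumes "finite S" "finite J"
  shows "phi S J \<gamma> p = (\<Sum>f\<in>fixfun S J p. if \<forall>l\<in>J. cnt S f l = \<gamma> l then 1 else 0)"
  using finite_fixfun[OF assms, of p] by (simp add: phi_def sum.If_cases Int_def)

lemma phi_cycle:
  assumes "distinct cs" "cs \<noteq> []" "set cs \<inter> I = {}" "finite I" "finite J" "p permutes I"
  shows "phi (set cs \<union> I) J \<gamma> (cycle_of_list cs \<circ> p) =
    (\<Sum>i\<in>J. phi I J (\<lambda>l. \<gamma> l - (if l = i then int (length cs) else 0)) p)"
proof -
  have "finite (set cs \<union> I)" using assms by simp
  then show ?thesis
    using sum_fixfun_cycle[OF assms, of "\<lambda>c. if \<forall>l\<in>J. c l = \<gamma> l then 1 else 0"]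
    by (simp add: phi_sum assms eq_diff_eq)
qed

text \<open>The Murnaghan-Nakayama rule on beads. The height of a rim hook is hidden in the sign
  that sorting the changed vector would produce.\<close>

lemma psi_cycle:
  assumes "distinct cs" "cs \<noteq> []" "set cs \<inter> I = {}" "finite I" "p permutes I"
  shows "psi (set cs \<union> I) N \<beta> (cycle_of_list cs \<circ> p) =
    (\<Sum>i<N. psi I N (\<beta>(i := \<beta> i - int (length cs))) p)"
proof -
  have "psi (set cs \<union> I) N \<beta> (cycle_of_list cs \<circ> p) = (\<Sum>w | w permutes {..<N}. \<Sum>i<N.
      sign w * phi I {..<N} (\<lambda>l. (\<beta>(i := \<beta> i - int (length cs))) l - dl N (w l)) p)"
    unfolding psi_def
  proof (rule sum.cong[OF refl])
    fix w
    have "phi I {..<N} (\<lambda>l. \<beta> l - dl N (w l) - (if l = i then int (length cs) else 0)) p =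
        phi I {..<N} (\<lambda>l. (\<beta>(i := \<beta> i - int (length cs))) l - dl N (w l)) p" for i
      by (rule phi_cong) simp
    then show "sign w * phi (set cs \<union> I) {..<N} (\<lambda>i. \<beta> i - dl N (w i)) (cycle_of_list cs \<circ> p) =
        (\<Sum>i<N. sign w * phi I {..<N} (\<lambda>l. (\<beta>(i := \<beta> i - int (length cs))) l - dl N (w l)) p)"
      by (subst phi_cycle[OF assms(1-4) _ assms(5)]) (simp_all add: sum_distrib_left)
  qed
  also have "\<dots> = (\<Sum>i<N. psi I N (\<beta>(i := \<beta> i - int (length cs))) p)"
    unfolding psi_def by (rule sum.swap)
  finally show ?thesis .
qed

lemma sign_cycle_of_list:
  "distinct cs \<Longrightarrow> cs \<noteq> [] \<Longrightarrow> sign (cycle_of_list cs) = (-1) ^ (length cs - 1)"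
proof (induction cs rule: cycle_of_list.induct)
  case (1 i j cs)
  have "sign (cycle_of_list (i # j # cs)) = sign (transpose i j) * sign (cycle_of_list (j # cs))"
    unfolding cycle_of_list.simps by (intro sign_compose permutation_swap_id permutation_of_cycle)
  then show ?case using 1 by (simp add: sign_swap_id del: cycle_of_list.simps)
qed (simp_all add: sign_id)

text \<open>Lowering a bead may make an entry of \<open>\<alpha>\<close> negative; both sides are
  then 0.\<close>

lemma psi_orthonormal_gen:
  assumes S: "finite S" and nn: "\<And>i. i < N \<Longrightarrow> \<beta> i \<ge> 0"
    and tot: "(\<Sum>i<N. \<beta> i) = int (card S) + (\<Sum>i<N. dl N i)"
  shows "(\<Sum>p | p permutes S. psi S N \<alpha> p * psi S N \<beta> p) = fact (card S) * alt N \<alpha> \<beta>"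
proof (cases "\<forall>i<N. 0 \<le> \<alpha> i")
  case True
  have "(\<Sum>p | p permutes S. psi S N \<alpha> p * psi S N \<beta> p) = (\<Sum>p | p permutes S. psi S N \<beta> p * psi S N \<alpha> p)"
    by (simp add: mult.commute)
  also have "\<dots> = fact (card S) * alt N \<beta> \<alpha>" by (rule psi_orthonormal[OF S nn _ tot]) (use True in auto)
  finally show ?thesis by (simp only: alt_sym)
next
  case False
  then obtain i where i: "i < N" "\<alpha> i < 0" by auto
  have "alt N \<alpha> \<beta> = 0"
  proof -
    have "\<not> (\<forall>i<N. \<alpha> i = \<beta> (w i))" if "w permutes {..<N}" for w
      using i nn[of "w i"] permutes_less[OF that i(1)] by force
    then show ?thesis unfolding alt_def by (intro sum.neutral) auto
  qed
  then show ?thesis by (simp add: psi_neg[of i N \<alpha>] i)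
qed

section \<open>Adding rim hooks to bead vectors\<close>

lemma alt_adjoint:
  "(\<Sum>i<N. alt N (\<beta>(i := \<beta> i + r)) K) = (\<Sum>i<N. alt N \<beta> (K(i := K i - r)))"
proof -
  have "(\<Sum>i<N. alt N (\<beta>(i := \<beta> i + r)) K) = (\<Sum>w | w permutes {..<N}. \<Sum>i<N.
      sign w * (if \<forall>k<N. (\<beta>(i := \<beta> i + r)) k = K (w k) then 1 else 0))"
    unfolding alt_def by (rule sum.swap)
  also have "\<dots> = (\<Sum>w | w permutes {..<N}. \<Sum>i<N. sign w * (if \<forall>k<N. \<beta> k = (K(i := K i - r)) (w k) then 1 else 0))"
  proof (rule sum.cong[OF refl])
    fix w assume "w \<in> {w. w permutes {..<N}}"
    then have w: "w permutes {..<N}" by simp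
    have "(\<forall>k<N. (\<beta>(i := \<beta> i + r)) k = K (w k)) \<longleftrightarrow> (\<forall>k<N. \<beta> k = (K(w i := K (w i) - r)) (w k))" for i
      using permutes_inj[OF w] by (auto simp: inj_eq)
    then have "(\<Sum>i<N. sign w * (if \<forall>k<N. (\<beta>(i := \<beta> i + r)) k = K (w k) then 1 else 0)) =
        (\<Sum>i<N. sign w * (if \<forall>k<N. \<beta> k = (K(w i := K (w i) - r)) (w k) then 1 else 0))" by simp
    also have "\<dots> = (\<Sum>i<N. sign w * (if \<forall>k<N. \<beta> k = (K(i := K i - r)) (w k) then 1 else 0))"
      by (rule sum_permutes_N[OF w])
    finally show "(\<Sum>i<N. sign w * (if \<forall>k<N. (\<beta>(i := \<beta> i + r)) k = K (w k) then 1 else 0)) =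
        (\<Sum>i<N. sign w * (if \<forall>k<N. \<beta> k = (K(i := K i - r)) (w k) then 1 else 0))" .
  qed
  also have "\<dots> = (\<Sum>i<N. alt N \<beta> (K(i := K i - r)))"
    unfolding alt_def by (rule sum.swap)
  finally show ?thesis .
qed

text \<open>Pairing with a fixed \<open>F\<close> becomes an antisymmetric functional on bead
  vectors. In the application \<open>F\<close> is the square of a staircase character.\<close>

definition Lf :: "nat \<Rightarrow> nat \<Rightarrow> ((nat \<Rightarrow> nat) \<Rightarrow> int) \<Rightarrow> (nat \<Rightarrow> int) \<Rightarrow> int" where
  "Lf n N F \<beta> = (\<Sum>p\<in>Sym n. F p * psi {..<n} N \<beta> p)"

lemma Lf_cong: "(\<And>i. i < N \<Longrightarrow> \<beta> i = \<beta>' i) \<Longrightarrow> Lf n N F \<beta> = Lf n N F \<beta>'"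
  unfolding Lf_def by (intro sum.cong refl arg_cong[where f="times _"] psi_cong)

lemma Lf_permute: "v permutes {..<N} \<Longrightarrow> Lf n N F (\<lambda>i. \<beta> (v i)) = sign v * Lf n N F \<beta>"
proof -
  assume v: "v permutes {..<N}"
  have "psi {..<n} N (\<lambda>i. \<beta> (v i)) p = sign v * psi {..<n} N \<beta> p" if "p \<in> Sym n" for p
    using that by (intro psi_permute v) (simp add: Sym_iff)
  then show ?thesis by (simp add: Lf_def sum_distrib_left mult_ac)
qed

text \<open>The adjoint of the Murnaghan-Nakayama rule: adding \<open>r\<close> to a bead is adding an \<open>r\<close>-rim hook.\<close>

theorem Lf_add_hooks:
  assumes N: "n \<le> N" and F: "zspan {..<n} N F" and r: "r > 0"
    and vanish: "\<And>p. r \<le> n \<Longrightarrow> p permutes {..<n - r} \<Longrightarrow> F (cycle_of_list [n - r..<n] \<circ> p) = 0"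
    and nn: "\<And>i. i < N \<Longrightarrow> 0 \<le> \<beta> i"
  shows "(\<Sum>i<N. Lf n N F (\<beta>(i := \<beta> i + int r))) = 0"
proof -
  obtain z where z: "\<And>p. p permutes {..<n} \<Longrightarrow> F p = (\<Sum>\<kappa>\<in>partitions_of n. z \<kappa> * psi {..<n} N (bt N \<kappa>) p)"
    using F by (auto simp: zspan_def)
  have Lalt: "Lf n N F \<beta>' = fact n * (\<Sum>\<kappa>\<in>partitions_of n. z \<kappa> * alt N \<beta>' (bt N \<kappa>))" for \<beta>'
  proof -
    have "Lf n N F \<beta>' = (\<Sum>p\<in>Sym n. \<Sum>\<kappa>\<in>partitions_of n. z \<kappa> * (psi {..<n} N \<beta>' p * psi {..<n} N (bt N \<kappa>) p))"
      unfolding Lf_def by (intro sum.cong refl) (simp add: z Sym_iff sum_distrib_left sum_distrib_right mult_ac)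
    also have "\<dots> = (\<Sum>\<kappa>\<in>partitions_of n. z \<kappa> * (\<Sum>p | p permutes {..<n}. psi {..<n} N \<beta>' p * psi {..<n} N (bt N \<kappa>) p))"
      by (subst sum.swap) (simp add: sum_distrib_left Sym_def)
    also have "\<dots> = (\<Sum>\<kappa>\<in>partitions_of n. z \<kappa> * (fact n * alt N \<beta>' (bt N \<kappa>)))"
    proof (rule sum.cong[OF refl])
      fix \<kappa> assume \<kappa>: "\<kappa> \<in> partitions_of n"
      have "(\<Sum>p | p permutes {..<n}. psi {..<n} N \<beta>' p * psi {..<n} N (bt N \<kappa>) p) = fact (card {..<n}) * alt N \<beta>' (bt N \<kappa>)"
        using partitions_ofD[OF \<kappa>] N by (intro psi_orthonormal_gen) (auto simp: bt_nonneg sum_bt)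
      then show "z \<kappa> * (\<Sum>p | p permutes {..<n}. psi {..<n} N \<beta>' p * psi {..<n} N (bt N \<kappa>) p) = z \<kappa> * (fact n * alt N \<beta>' (bt N \<kappa>))"
        by simp
    qed
    finally show ?thesis by (simp add: sum_distrib_left mult_ac)
  qed
  let ?K = "\<lambda>\<kappa> i. (bt N \<kappa>)(i := bt N \<kappa> i - int r)"
  have "(\<Sum>i<N. Lf n N F (\<beta>(i := \<beta> i + int r))) =
      fact n * (\<Sum>\<kappa>\<in>partitions_of n. z \<kappa> * (\<Sum>i<N. alt N (\<beta>(i := \<beta> i + int r)) (bt N \<kappa>)))"
    unfolding Lalt sum_distrib_left by (rule sum.swap)
  also have "\<dots> = fact n * (\<Sum>\<kappa>\<in>partitions_of n. z \<kappa> * (\<Sum>i<N. alt N \<beta> (?K \<kappa> i)))"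
    by (simp only: alt_adjoint)
  finally have e: "(\<Sum>i<N. Lf n N F (\<beta>(i := \<beta> i + int r))) = fact n * (\<Sum>\<kappa>\<in>partitions_of n. z \<kappa> * (\<Sum>i<N. alt N \<beta> (?K \<kappa> i)))" .
  have Ktot: "(\<Sum>k<N. ?K \<kappa> i k) = int n - int r + (\<Sum>i<N. dl N i)" if "\<kappa> \<in> partitions_of n" "i < N" for \<kappa> i
  proof -
    have "(\<Sum>k<N. ?K \<kappa> i k) = (\<Sum>k<N. bt N \<kappa> k - (if k = i then int r else 0))"
      by (intro sum.cong refl) simp
    also have "\<dots> = (\<Sum>k<N. bt N \<kappa> k) - int r" using that(2) by (simp add: sum_subtractf)
    finally show ?thesis using sum_bt[of \<kappa> N] partitions_ofD[OF that(1)] N by simp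
  qed
  show ?thesis
  proof (cases "(\<Sum>i<N. \<beta> i) = int n - int r + (\<Sum>i<N. dl N i) \<and> r \<le> n")
    case False
    \<comment> \<open>Unless \<open>\<beta>\<close> has the total that belongs to a partition of
      \<open>n - r\<close>, it is not a rearrangement of the beads of \<open>\<kappa>\<close> with a
      hook removed.\<close>
    have "alt N \<beta> (?K \<kappa> i) = 0" if "\<kappa> \<in> partitions_of n" "i < N" for \<kappa> i
    proof (rule ccontr)
      assume a: "alt N \<beta> (?K \<kappa> i) \<noteq> 0"
      show False
        using False alt_total[OF a] Ktot[OF that] alt_nonneg_total(1)[OF nn a] by linarith
    qed
    then have "(\<Sum>i<N. alt N \<beta> (?K \<kappa> i)) = 0" if "\<kappa> \<in> partitions_of n" for \<kappa>
      using that by (intro sum.neutral) simp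
    then show ?thesis unfolding e by simp
  next
    case True
    let ?I = "{..<n - r}" and ?cs = "[n - r..<n]"
    have I: "set ?cs \<union> ?I = {..<n}" using True by auto
    \<comment> \<open>\<open>alt\<close> is turned back into a pairing on \<open>n - r\<close>
      points. The sum over \<open>i\<close> then becomes \<open>psi\<close> at a permutation with an
      additional \<open>r\<close>-cycle, and the sum over \<open>\<kappa>\<close> a value of
      \<open>F\<close> at it, which vanishes.\<close>
    have alt: "fact (n - r) * alt N \<beta> (?K \<kappa> i) = (\<Sum>p | p permutes ?I. psi ?I N \<beta> p * psi ?I N (?K \<kappa> i) p)" for \<kappa> i
    proof -
      have "(\<Sum>p | p permutes ?I. psi ?I N (?K \<kappa> i) p * psi ?I N \<beta> p) = fact (card ?I) * alt N (?K \<kappa> i) \<beta>"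
        by (rule psi_orthonormal_gen) (use nn True in auto)
      then show ?thesis by (subst alt_sym) (simp add: mult.commute)
    qed
    have "fact (n - r) * (\<Sum>\<kappa>\<in>partitions_of n. z \<kappa> * (\<Sum>i<N. alt N \<beta> (?K \<kappa> i))) =
        (\<Sum>\<kappa>\<in>partitions_of n. z \<kappa> * (\<Sum>i<N. fact (n - r) * alt N \<beta> (?K \<kappa> i)))"
      by (simp add: sum_distrib_left mult_ac)
    also have "\<dots> = (\<Sum>\<kappa>\<in>partitions_of n. z \<kappa> * (\<Sum>i<N. \<Sum>p | p permutes ?I. psi ?I N \<beta> p * psi ?I N (?K \<kappa> i) p))"
      by (simp only: alt)
    also have "\<dots> = (\<Sum>\<kappa>\<in>partitions_of n. \<Sum>p | p permutes ?I. z \<kappa> * (psi ?I N \<beta> p * (\<Sum>i<N. psi ?I N (?K \<kappa> i) p)))"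
      by (rule sum.cong[OF refl], subst sum.swap) (simp add: sum_distrib_left)
    also have "\<dots> = (\<Sum>p | p permutes ?I. \<Sum>\<kappa>\<in>partitions_of n. z \<kappa> * (psi ?I N \<beta> p * (\<Sum>i<N. psi ?I N (?K \<kappa> i) p)))"
      by (rule sum.swap)
    also have "\<dots> = (\<Sum>p | p permutes ?I. 0)"
    proof (rule sum.cong[OF refl])
      fix p assume "p \<in> {p. p permutes ?I}"
      then have p: "p permutes ?I" by simp
      have c: "psi {..<n} N (bt N \<kappa>) (cycle_of_list ?cs \<circ> p) = (\<Sum>i<N. psi ?I N (?K \<kappa> i) p)" for \<kappa>
      proof -
        have "?cs \<noteq> []" "set ?cs \<inter> ?I = {}" using r True by auto
        from psi_cycle[OF _ this _ p, of N "bt N \<kappa>"] show ?thesis using True unfolding I by simp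
      qed
      have "cycle_of_list ?cs \<circ> p permutes {..<n}"
        unfolding I[symmetric]
        by (rule permutes_compose[OF permutes_subset[OF p] permutes_subset[OF cycle_permutes]]) auto
      then have "F (cycle_of_list ?cs \<circ> p) = (\<Sum>\<kappa>\<in>partitions_of n. z \<kappa> * (\<Sum>i<N. psi ?I N (?K \<kappa> i) p))"
        by (simp only: z c)
      then have "(\<Sum>\<kappa>\<in>partitions_of n. z \<kappa> * (psi ?I N \<beta> p * (\<Sum>i<N. psi ?I N (?K \<kappa> i) p))) = psi ?I N \<beta> p * F (cycle_of_list ?cs \<circ> p)"
        by (simp add: sum_distrib_left mult_ac)
      then show "(\<Sum>\<kappa>\<in>partitions_of n. z \<kappa> * (psi ?I N \<beta> p * (\<Sum>i<N. psi ?I N (?K \<kappa> i) p))) = 0"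
        using vanish p True by simp
    qed
    finally have "fact (n - r) * (\<Sum>\<kappa>\<in>partitions_of n. z \<kappa> * (\<Sum>i<N. alt N \<beta> (?K \<kappa> i))) = 0" by simp
    then show ?thesis unfolding e by simp
  qed
qed

section \<open>Staircases and even cycles\<close>

lemma pt_staircase: "pt (staircase m) i = m - i"
proof (cases "i < m")
  case True
  then show ?thesis by (simp add: staircase_def nth_default_nth rev_nth nth_upt del: upt_Suc)
next
  case False
  then show ?thesis by (simp add: staircase_def nth_default_beyond del: upt_Suc)
qed

lemma length_staircase: "length (staircase m) = m"
  by (simp add: staircase_def del: upt_Suc)

lemma staircase_partition: "is_partition (staircase m)"
  by (auto simp: is_partition_def staircase_def sorted_wrt_rev simp del: upt_Suc)

lemma sum_staircase: "2 * sum_list (staircase m) = m * (m + 1)"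
proof -
  have "sum_list (staircase m) = \<Sum>{1..<Suc m}"
    unfolding staircase_def by (simp add: sum_list_distinct_conv_sum_set sum_list_rev del: upt_Suc)
  then show ?thesis using gauss_sum_from_Suc_0[of m, where 'a=nat] by (simp add: atLeastLessThanSuc_atLeastAtMost)
qed

text \<open>With \<open>m\<close> beads the staircase occupies exactly the odd numbers below
  \<open>2 * m\<close>. Lowering a bead by an even number either hits another bead or leaves the
  nonnegative numbers, so every term of \<open>psi_cycle\<close> is 0.\<close>

theorem staircase_even_cycle:
  assumes n: "sum_list (staircase m) = n" and r: "r > 0" "2 * r \<le> n" and p: "p permutes {..<n - 2 * r}"
  shows "irr n (staircase m) (cycle_of_list [n - 2 * r..<n] \<circ> p) = 0"
proof -
  let ?I = "{..<n - 2 * r}" and ?cs = "[n - 2 * r..<n]"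
  let ?b = "bt m (staircase m)"
  have I: "set ?cs \<union> ?I = {..<n}" using r by auto
  have perm: "cycle_of_list ?cs \<circ> p permutes {..<n}"
    unfolding I[symmetric]
    by (rule permutes_compose[OF permutes_subset[OF p] permutes_subset[OF cycle_permutes]]) auto
  have b: "?b i = 2 * (int m - int i) - 1" if "i < m" for i
    using that by (simp add: bt_def pt_staircase dl_def of_nat_diff)
  have z: "psi ?I m (?b(i := ?b i - int (2 * r))) p = 0" if i: "i < m" for i
  proof (cases "i + r < m")
    case True
    show ?thesis
      by (rule psi_repeat[of i m "i + r"]) (use True i r p b[OF i] b[OF True] in auto)
  next
    case False
    then show ?thesis using b[OF i] i by (intro psi_neg[of i]) auto
  qed
  have "psi {..<n} m ?b (cycle_of_list ?cs \<circ> p) = (\<Sum>i<m. psi ?I m (?b(i := ?b i - int (2 * r))) p)"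
  proof -
    have "?cs \<noteq> []" "set ?cs \<inter> ?I = {}" using r by auto
    from psi_cycle[OF _ this _ p, of m ?b] show ?thesis using r unfolding I by simp
  qed
  also have "\<dots> = 0" using z by simp
  finally have 0: "psi {..<n} m ?b (cycle_of_list ?cs \<circ> p) = 0" .
  \<comment> \<open>Both sums are the same Specht character; this passes from \<open>m\<close> beads
    to the \<open>n\<close> beads of \<open>irr\<close>.\<close>
  have "irr_char (staircase m) (cycle_of_list ?cs \<circ> p) = of_int (psi {..<n} m ?b (cycle_of_list ?cs \<circ> p))"
    using perm n staircase_partition by (intro irr_char_psi) (auto simp: length_staircase)
  moreover have "irr_char (staircase m) (cycle_of_list ?cs \<circ> p) = of_int (irr n (staircase m) (cycle_of_list ?cs \<circ> p))"
    using perm n staircase_partition length_le_sum[OF staircase_partition, of m] by (intro irr_char_psi) auto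
  ultimately show ?thesis using 0 by simp
qed

section \<open>Moving hooks between the even and the odd beads\<close>

lemma sum_lessThan_add: "(\<Sum>i<A + B. f i) = (\<Sum>i<A. f i) + (\<Sum>j<B. f (A + j :: nat) :: int)"
  by (induction B) (simp_all add: add.assoc)

text \<open>Even beads \<open>2 x\<close> and odd beads \<open>2 y + 1\<close>: the pair \<open>x\<close>, \<open>y\<close> encodes the 2-quotient.\<close>

definition Lp :: "nat \<Rightarrow> nat \<Rightarrow> nat \<Rightarrow> ((nat \<Rightarrow> nat) \<Rightarrow> int) \<Rightarrow> (nat \<Rightarrow> int) \<Rightarrow> (nat \<Rightarrow> int) \<Rightarrow> int" where
  "Lp n A B F x y = Lf n (A + B) F (\<lambda>i. if i < A then 2 * x i else 2 * y (i - A) + 1)"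

lemma Lp_cong:
  "(\<And>i. i < A \<Longrightarrow> x i = x' i) \<Longrightarrow> (\<And>j. j < B \<Longrightarrow> y j = y' j) \<Longrightarrow> Lp n A B F x y = Lp n A B F x' y'"
  unfolding Lp_def by (rule Lf_cong) auto

lemma Lp_permute1:
  assumes v: "v permutes {..<A}"
  shows "Lp n A B F (\<lambda>i. x (v i)) y = sign v * Lp n A B F x y"
proof -
  have v': "v permutes {..<A + B}" by (rule permutes_subset[OF v]) auto
  let ?b = "\<lambda>i. if i < A then 2 * x i else 2 * y (i - A) + 1"
  have "(\<lambda>i. if i < A then 2 * x (v i) else 2 * y (i - A) + 1) = (\<lambda>i. ?b (v i))"
  proof
    fix i show "(if i < A then 2 * x (v i) else 2 * y (i - A) + 1) = ?b (v i)"
      using permutes_less[OF v, of i] v by (cases "i < A") (auto simp: permutes_def)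
  qed
  then show ?thesis unfolding Lp_def using Lf_permute[OF v', of n F ?b] by simp
qed

lemma Lp_permute2:
  assumes v: "v permutes {..<B}"
  shows "Lp n A B F x (\<lambda>i. y (v i)) = sign v * Lp n A B F x y"
proof -
  let ?v = "dsum A id v"
  let ?b = "\<lambda>i. if i < A then 2 * x i else 2 * y (i - A) + 1"
  have v': "?v permutes {..<A + B}" using dsum_Sym[OF Sym_id, of v B A] v by (simp add: Sym_iff)
  have "(\<lambda>i. if i < A then 2 * x i else 2 * y (v (i - A)) + 1) = (\<lambda>i. ?b (?v i))"
    by (auto simp: dsum_def fun_eq_iff)
  then have "Lp n A B F x (\<lambda>i. y (v i)) = sign ?v * Lp n A B F x y"
    unfolding Lp_def using Lf_permute[OF v', of n F ?b] by simp
  also have "sign ?v = sign v"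
    using v finite_lessThan[of B]
  proof (induction v rule: permutes_induct)
    case id
    then show ?case by (simp only: dsum_id sign_id)
  next
    case (swap i j p)
    have e: "dsum A id (transpose i j \<circ> p) = transpose (A + i) (A + j) \<circ> dsum A id p"
      by (auto simp: dsum_def fun_eq_iff transpose_def)
    have p: "permutation (dsum A id p)"
      using dsum_Sym[OF Sym_id, of p B A] swap permutation_N by (auto simp: Sym_iff)
    have "sign (dsum A id (transpose i j \<circ> p)) = sign (transpose (A + i) (A + j)) * sign (dsum A id p)"
      unfolding e by (rule sign_compose[OF permutation_swap_id p])
    moreover have "sign (transpose i j \<circ> p) = sign (transpose i j) * sign p"
      by (rule sign_compose[OF permutation_swap_id permutation_N[OF \<open>p permutes {..<B}\<close>]])
    ultimately show ?case using swap by (simp only: sign_swap_id add_left_cancel)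
  qed
  finally show ?thesis .
qed

text \<open>Adding \<open>2 * r\<close> preserves the parity of a bead, so the vanishing sum of
  \<open>Lf_add_hooks\<close> splits into one sum over the even and one over the odd beads.\<close>

lemma Lp_hooks:
  assumes n: "n \<le> A + B" and F: "zspan {..<n} (A + B) F" and r: "r > 0"
    and vanish: "\<And>r p. r > 0 \<Longrightarrow> 2 * r \<le> n \<Longrightarrow> p permutes {..<n - 2 * r} \<Longrightarrow> F (cycle_of_list [n - 2 * r..<n] \<circ> p) = 0"
    and nn: "\<And>i. 0 \<le> x i" "\<And>j. 0 \<le> y j"
  shows "(\<Sum>i<A. Lp n A B F (x(i := x i + int r)) y) = - (\<Sum>j<B. Lp n A B F x (y(j := y j + int r)))"
proof -
  let ?b = "\<lambda>i. if i < A then 2 * x i else 2 * y (i - A) + 1"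
  have "(\<Sum>i<A + B. Lf n (A + B) F (?b(i := ?b i + int (2 * r)))) = 0"
    using r nn by (intro Lf_add_hooks n F vanish) auto
  moreover have "Lf n (A + B) F (?b(i := ?b i + int (2 * r))) = Lp n A B F (x(i := x i + int r)) y" if "i < A" for i
    unfolding Lp_def using that by (intro Lf_cong) auto
  moreover have "Lf n (A + B) F (?b(A + j := ?b (A + j) + int (2 * r))) = Lp n A B F x (y(j := y j + int r))" for j
    unfolding Lp_def by (intro Lf_cong) auto
  ultimately show ?thesis unfolding sum_lessThan_add by simp
qed

text \<open>Every \<open>r\<close>-cycle of \<open>\<tau>\<close> moves a \<open>2 r\<close>-hook from the even to the odd beads, at the cost of a sign.\<close>

theorem Lp_cycles:
  fixes T :: "nat set"
  assumes n: "n \<le> A + B" and F: "zspan {..<n} (A + B) F"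
    and vanish: "\<And>r p. r > 0 \<Longrightarrow> 2 * r \<le> n \<Longrightarrow> p permutes {..<n - 2 * r} \<Longrightarrow> F (cycle_of_list [n - 2 * r..<n] \<circ> p) = 0"
    and \<tau>: "cycle_decomp T \<tau>"
    and nn: "\<And>i. 0 \<le> x i" "\<And>j. 0 \<le> y j"
  shows "finite T \<and> \<tau> permutes T \<and> (\<Sum>f\<in>fixfun T {..<A} \<tau>. Lp n A B F (\<lambda>i. x i + cnt T f i) y) =
    (-1) ^ card T * sign \<tau> * (\<Sum>f\<in>fixfun T {..<B} \<tau>. Lp n A B F x (\<lambda>j. y j + cnt T f j))"
  using \<tau> nn
proof (induction arbitrary: x y)
  case empty
  have "fixfun {} J (id :: nat \<Rightarrow> nat) = {\<lambda>x. undefined}" for J :: "nat set" by (auto simp: fixfun_def)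
  moreover have "(id :: nat \<Rightarrow> nat) permutes {}" by (rule permutes_id)
  ultimately show ?case by (simp add: cnt_def sign_id del: id_apply)
next
  case (comp I p cs)
  have I: "finite I" "p permutes I" using comp.IH[of x y] comp.prems by auto
  let ?T = "set cs \<union> I" and ?c = "cycle_of_list cs \<circ> p"
  have perm: "?c permutes ?T"
    by (rule permutes_compose[OF permutes_subset[OF I(2)] permutes_subset[OF cycle_permutes]]) auto
  show ?case
  proof (cases "cs = []")
    case True
    then show ?thesis using comp.IH[of x y] comp.prems by simp
  next
    case False
    define r where "r = length cs"
    have r: "r > 0" using False by (simp add: r_def)
    have "card ?T = r + card I"
      using comp.hyps I by (subst card_Un_disjoint) (auto simp: distinct_card r_def)
    moreover have "sign ?c = (-1) ^ (r - 1) * sign p"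
    proof -
      have "permutation p" using I permutation_permutes by blast
      then have "sign ?c = sign (cycle_of_list cs) * sign p" by (rule sign_compose[OF permutation_of_cycle])
      then show ?thesis using sign_cycle_of_list[of cs] comp.hyps False by (simp add: r_def)
    qed
    \<comment> \<open>The cardinality contributes \<open>(-1) ^ r\<close> and the sign of the cycle
      \<open>(-1) ^ (r - 1)\<close>; together they are the minus sign of
      \<open>Lp_hooks\<close>.\<close>
    moreover have "(-1 :: int) ^ (r + card I) * (-1) ^ (r - 1) = - ((-1) ^ card I)"
    proof -
      obtain r' where "r = Suc r'" using r by (cases r) auto
      then show ?thesis by (simp add: power_add flip: power_mult_distrib)
    qed
    ultimately have sg: "(-1) ^ card ?T * sign ?c = - ((-1) ^ card I * sign p)" by (simp add: mult.assoc[symmetric])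
    have nn1: "0 \<le> (x(i := x i + int r)) k" for i k using comp.prems(1)[of i] comp.prems(1)[of k] by simp
    have nn2: "0 \<le> y k + cnt I f k" for f :: "nat \<Rightarrow> nat" and k using comp.prems(2)[of k] by (simp add: cnt_def)
    have "(\<Sum>f\<in>fixfun ?T {..<A} ?c. Lp n A B F (\<lambda>i. x i + cnt ?T f i) y) =
        (\<Sum>i<A. \<Sum>f\<in>fixfun I {..<A} p. Lp n A B F (\<lambda>l. x l + (cnt I f l + (if l = i then int r else 0))) y)"
      unfolding r_def
      by (rule sum_fixfun_cycle[OF comp.hyps(2) False comp.hyps(3) I(1) finite_lessThan I(2), of "\<lambda>c. Lp n A B F (\<lambda>l. x l + c l) y"])
    also have "\<dots> = (\<Sum>i<A. \<Sum>f\<in>fixfun I {..<A} p. Lp n A B F (\<lambda>l. (x(i := x i + int r)) l + cnt I f l) y)"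
      by (rule sum.cong[OF refl], rule sum.cong[OF refl], rule Lp_cong) auto
    \<comment> \<open>The cycles of \<open>p\<close> are moved first, while the hook of the new
      cycle still sits on the even bead \<open>i\<close>; that hook follows by
      \<open>Lp_hooks\<close>.\<close>
    also have "\<dots> = (\<Sum>i<A. (-1) ^ card I * sign p * (\<Sum>f\<in>fixfun I {..<B} p. Lp n A B F (x(i := x i + int r)) (\<lambda>j. y j + cnt I f j)))"
      by (rule sum.cong[OF refl], rule conjunct2[OF conjunct2[OF comp.IH[OF nn1 comp.prems(2)]]])
    also have "\<dots> = (-1) ^ card I * sign p * (\<Sum>f\<in>fixfun I {..<B} p. \<Sum>i<A. Lp n A B F (x(i := x i + int r)) (\<lambda>j. y j + cnt I f j))"
      unfolding sum_distrib_left[symmetric] by (subst sum.swap) (rule refl)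
    also have "\<dots> = (-1) ^ card I * sign p * (\<Sum>f\<in>fixfun I {..<B} p.
        - (\<Sum>j<B. Lp n A B F x ((\<lambda>j. y j + cnt I f j)(j := (y j + cnt I f j) + int r))))"
      by (intro arg_cong[where f="times _"] sum.cong refl Lp_hooks[OF n F r vanish comp.prems(1) nn2])
    also have "\<dots> = - ((-1) ^ card I * sign p) * (\<Sum>j<B. \<Sum>f\<in>fixfun I {..<B} p.
        Lp n A B F x ((\<lambda>j. y j + cnt I f j)(j := (y j + cnt I f j) + int r)))"
      unfolding sum_negf by (subst sum.swap) simp
    also have "\<dots> = (-1) ^ card ?T * sign ?c * (\<Sum>j<B. \<Sum>f\<in>fixfun I {..<B} p.
        Lp n A B F x (\<lambda>l. y l + (cnt I f l + (if l = j then int r else 0))))"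
      unfolding sg
      by (rule arg_cong[where f="times _"], rule sum.cong[OF refl], rule sum.cong[OF refl], rule Lp_cong) auto
    also have "(\<Sum>j<B. \<Sum>f\<in>fixfun I {..<B} p. Lp n A B F x (\<lambda>l. y l + (cnt I f l + (if l = j then int r else 0)))) =
        (\<Sum>f\<in>fixfun ?T {..<B} ?c. Lp n A B F x (\<lambda>i. y i + cnt ?T f i))"
      unfolding r_def
      by (rule sum_fixfun_cycle[OF comp.hyps(2) False comp.hyps(3) I(1) finite_lessThan I(2), of "\<lambda>c. Lp n A B F x (\<lambda>l. y l + c l)", symmetric])
    finally show ?thesis using I(1) perm by (intro conjI) (simp, assumption+)
  qed
qed

section \<open>Antisymmetric functionals and their expansion in partitions\<close>

lemma sort_perm:
  fixes \<beta> :: "nat \<Rightarrow> int"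
  assumes inj: "inj_on \<beta> {..<N}"
  shows "\<exists>v. v permutes {..<N} \<and> (\<forall>i j. i < j \<longrightarrow> j < N \<longrightarrow> \<beta> (v j) < \<beta> (v i))"
proof -
  define xs where "xs = sorted_list_of_set (\<beta> ` {..<N})"
  have len: "length xs = N" using inj by (simp add: xs_def card_image)
  have set: "set xs = \<beta> ` {..<N}" by (simp add: xs_def)
  have dist: "distinct xs" by (simp add: xs_def)
  define v where "v i = (if i < N then inv_into {..<N} \<beta> (xs ! (N - 1 - i)) else i)" for i
  have mem: "xs ! (N - 1 - i) \<in> \<beta> ` {..<N}" if "i < N" for i
    unfolding set[symmetric] using that len by (intro nth_mem) simp
  have vv: "v i < N \<and> \<beta> (v i) = xs ! (N - 1 - i)" if "i < N" for i
    using inv_into_into[OF mem[OF that]] f_inv_into_f[OF mem[OF that]] that by (simp add: v_def)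
  have dec: "\<beta> (v j) < \<beta> (v i)" if "i < j" "j < N" for i j
  proof -
    have "sorted_wrt (<) xs" by (simp add: xs_def strict_sorted_iff)
    then show ?thesis using vv[of i] vv[of j] that len by (simp add: sorted_wrt_iff_nth_less)
  qed
  have "inj_on v {..<N}" by (rule linorder_inj_onI') (metis dec lessThan_iff less_irrefl)
  moreover have "v ` {..<N} \<subseteq> {..<N}" using vv by auto
  ultimately have "bij_betw v {..<N} {..<N}"
    unfolding bij_betw_def by (intro conjI endo_inj_surj) auto
  then have "v permutes {..<N}" by (rule bij_imp_permutes) (simp add: v_def)
  then show ?thesis using dec by blast
qed

lemma partition_of_beads:
  assumes dec: "\<And>i j. i < j \<Longrightarrow> j < N \<Longrightarrow> \<beta> j < (\<beta> i :: int)" and nn: "\<And>i. i < N \<Longrightarrow> 0 \<le> \<beta> i"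
    and tot: "(\<Sum>i<N. \<beta> i) = int n + (\<Sum>i<N. dl N i)"
  shows "\<exists>\<alpha>\<in>partitions_of n. \<forall>i<N. bt N \<alpha> i = \<beta> i"
proof -
  have low: "dl N i \<le> \<beta> i" if "i < N" for i
  proof -
    have "int k \<le> \<beta> (N - 1 - k)" if "k < N" for k
      using that
    proof (induction k)
      case (Suc k)
      moreover have "N - 1 - Suc k < N - 1 - k" "N - 1 - k < N" using Suc.prems by auto
      ultimately show ?case using dec[of "N - 1 - Suc k" "N - 1 - k"] by simp
    qed (use nn in simp)
    from this[of "N - 1 - i"] show ?thesis using that by (simp add: dl_def of_nat_diff)
  qed
  have gap: "\<beta> j + (int j - int i) \<le> \<beta> i" if "i \<le> j" "j < N" for i j
    using that
  proof (induction j rule: dec_induct)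
    case (step j)
    then show ?case using dec[of j "Suc j"] by simp
  qed simp
  define f where "f i = (if i < N then nat (\<beta> i - dl N i) else 0)" for i
  have "f j \<le> f i" if "i \<le> j" for i j
    using gap[OF that] that by (auto simp: f_def dl_def intro!: nat_mono)
  moreover have "f i = 0" if "N \<le> i" for i using that by (simp add: f_def)
  ultimately obtain \<alpha> where \<alpha>: "is_partition \<alpha>" "\<forall>i. pt \<alpha> i = f i" "length \<alpha> \<le> N"
    using partition_of_fun[of f N] by blast
  have b: "bt N \<alpha> i = \<beta> i" if "i < N" for i
    using low[OF that] that \<alpha>(2) by (simp add: bt_def f_def)
  have "(\<Sum>i<N. bt N \<alpha> i) = (\<Sum>i<N. \<beta> i)" using b by simp
  then have "sum_list \<alpha> = n" using sum_bt[OF \<alpha>(3)] tot by simp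
  then show ?thesis using \<alpha> b by (intro bexI[of _ \<alpha>]) (auto simp: partitions_of_def)
qed

text \<open>An antisymmetric \<open>l\<close> is determined by its values at strictly decreasing
  vectors, which are the beads of partitions. \<open>alt\<close> supplies the sorting sign and
  vanishes on repeated entries.\<close>

lemma alt_expand:
  assumes cong: "\<And>\<beta> \<beta>'. (\<And>i. i < N \<Longrightarrow> \<beta> i = \<beta>' i) \<Longrightarrow> l \<beta> = (l \<beta>' :: int)"
    and anti: "\<And>v \<beta>. v permutes {..<N} \<Longrightarrow> l (\<lambda>i. \<beta> (v i)) = sign v * l \<beta>"
    and N: "n \<le> N" and nn: "\<And>i. i < N \<Longrightarrow> 0 \<le> \<beta> i" and tot: "(\<Sum>i<N. \<beta> i) = int n + (\<Sum>i<N. dl N i)"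
  shows "l \<beta> = (\<Sum>\<alpha>\<in>partitions_of n. l (bt N \<alpha>) * alt N (bt N \<alpha>) \<beta>)"
proof (cases "inj_on \<beta> {..<N}")
  case True
  from sort_perm[OF this] obtain v where v: "v permutes {..<N}"
    and dec: "\<And>i j. i < j \<Longrightarrow> j < N \<Longrightarrow> \<beta> (v j) < \<beta> (v i)" by blast
  have "(\<Sum>i<N. \<beta> (v i)) = int n + (\<Sum>i<N. dl N i)" using tot sum_permutes_N[OF v, of \<beta>] by simp
  from partition_of_beads[OF dec _ this] obtain \<alpha> where \<alpha>: "\<alpha> \<in> partitions_of n" "\<forall>i<N. bt N \<alpha> i = \<beta> (v i)"
    using nn permutes_less[OF v] by blast
  have s: "sign v * sign v = 1" by (simp add: sign_idempotent)
  have "alt N (bt N \<kappa>) \<beta> = (if \<kappa> = \<alpha> then sign v else 0)" if \<kappa>: "\<kappa> \<in> partitions_of n" for \<kappa>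
  proof -
    have "sign v * alt N (bt N \<kappa>) \<beta> = sign v * alt N \<beta> (bt N \<kappa>)" by (simp only: alt_sym)
    also have "\<dots> = alt N (\<lambda>i. \<beta> (v i)) (bt N \<kappa>)" by (rule alt_permute[OF v, symmetric])
    also have "\<dots> = alt N (bt N \<alpha>) (bt N \<kappa>)" using \<alpha>(2) by (intro alt_cong) auto
    also have "\<dots> = (if \<alpha> = \<kappa> then 1 else 0)"
      using partitions_ofD[OF \<alpha>(1)] partitions_ofD[OF \<kappa>] N by (intro alt_bt) auto
    finally have "sign v * (sign v * alt N (bt N \<kappa>) \<beta>) = (if \<kappa> = \<alpha> then sign v else 0)" by auto
    then show ?thesis using s by (simp add: mult.assoc[symmetric])
  qed
  then have "(\<Sum>\<kappa>\<in>partitions_of n. l (bt N \<kappa>) * alt N (bt N \<kappa>) \<beta>) = (\<Sum>\<kappa>\<in>partitions_of n. l (bt N \<kappa>) * (if \<kappa> = \<alpha> then sign v else 0))"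
    by (intro sum.cong refl) simp
  also have "\<dots> = l (bt N \<alpha>) * sign v" using \<alpha>(1) by (simp add: if_distrib cong: if_cong)
  also have "l (bt N \<alpha>) = sign v * l \<beta>" using cong[of "bt N \<alpha>" "\<lambda>i. \<beta> (v i)"] \<alpha>(2) anti[OF v, of \<beta>] by simp
  finally show ?thesis using s by (simp add: mult_ac)
next
  case False
  then obtain i j where ij: "i < N" "j < N" "i \<noteq> j" "\<beta> i = \<beta> j" by (auto simp: inj_on_def)
  let ?t = "transpose i j"
  have t: "?t permutes {..<N}" using ij by (intro permutes_swap_id) auto
  have "(\<lambda>k. \<beta> (?t k)) = \<beta>" using ij by (auto simp: transpose_def fun_eq_iff)
  then have "l \<beta> = sign ?t * l \<beta>" using anti[OF t, of \<beta>] by simp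
  then have "l \<beta> = 0" using ij by (simp add: sign_swap_id)
  moreover have "alt N (bt N \<kappa>) \<beta> = 0" for \<kappa> using alt_repeat[OF ij] by (subst alt_sym)
  ultimately show ?thesis by simp
qed

lemma phi_dsum_fix:
  fixes N :: nat
  assumes s: "s \<in> Sym a" and t: "t \<in> Sym b"
  shows "phi {..<a + b} {..<N} \<gamma> (dsum a s t) = (\<Sum>f\<in>fixfun {..<b} {..<N} t. phi {..<a} {..<N} (\<lambda>l. \<gamma> l - cnt {..<b} f l) s)"
proof -
  have "phi {..<a + b} {..<N} \<gamma> (dsum a s t) = (\<Sum>\<alpha>\<in>boxes N \<gamma>. \<Sum>f\<in>fixfun {..<b} {..<N} t.
      phi {..<a} {..<N} \<alpha> s * (if \<forall>l\<in>{..<N}. cnt {..<b} f l = \<gamma> l - \<alpha> l then 1 else 0))"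
    unfolding phi_dsum[OF s t] by (intro sum.cong refl) (simp add: phi_sum[of "{..<b}"] sum_distrib_left)
  also have "\<dots> = (\<Sum>f\<in>fixfun {..<b} {..<N} t. \<Sum>\<alpha>\<in>boxes N \<gamma>.
      phi {..<a} {..<N} \<alpha> s * (if \<forall>l\<in>{..<N}. cnt {..<b} f l = \<gamma> l - \<alpha> l then 1 else 0))"
    by (rule sum.swap)
  also have "\<dots> = (\<Sum>f\<in>fixfun {..<b} {..<N} t. phi {..<a} {..<N} (\<lambda>l. \<gamma> l - cnt {..<b} f l) s)"
  proof (rule sum.cong[OF refl])
    fix f :: "nat \<Rightarrow> nat"
    let ?c = "restrict (\<lambda>l. \<gamma> l - cnt {..<b} f l) {..<N}"
    have "(\<Sum>\<alpha>\<in>boxes N \<gamma>. phi {..<a} {..<N} \<alpha> s * (if \<forall>l\<in>{..<N}. cnt {..<b} f l = \<gamma> l - \<alpha> l then 1 else 0)) =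
        (\<Sum>\<alpha>\<in>boxes N \<gamma>. if \<alpha> = ?c then phi {..<a} {..<N} ?c s else 0)"
    proof (rule sum.cong[OF refl])
      fix \<alpha> assume \<alpha>: "\<alpha> \<in> boxes N \<gamma>"
      have "(\<forall>l\<in>{..<N}. cnt {..<b} f l = \<gamma> l - \<alpha> l) \<longleftrightarrow> \<alpha> = ?c"
      proof
        assume a: "\<forall>l\<in>{..<N}. cnt {..<b} f l = \<gamma> l - \<alpha> l"
        show "\<alpha> = ?c"
        proof
          fix l show "\<alpha> l = ?c l"
          proof (cases "l < N")
            case False
            then show ?thesis using \<alpha> by (simp add: boxes_def PiE_iff extensional_def)
          qed (use a in simp)
        qed
      qed simp
      then show "phi {..<a} {..<N} \<alpha> s * (if \<forall>l\<in>{..<N}. cnt {..<b} f l = \<gamma> l - \<alpha> l then 1 else 0) =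
          (if \<alpha> = ?c then phi {..<a} {..<N} ?c s else 0)" by simp
    qed
    also have "\<dots> = (if ?c \<in> boxes N \<gamma> then phi {..<a} {..<N} ?c s else 0)" by (simp add: sum.delta)
    also have "\<dots> = phi {..<a} {..<N} ?c s"
    proof (cases "?c \<in> boxes N \<gamma>")
      case False
      have "cnt {..<b} f l \<ge> 0" for l by (simp add: cnt_def)
      then have "\<exists>l<N. ?c l < 0" using False by (auto simp: boxes_def PiE_iff not_le)
      then obtain l where "l < N" "?c l < 0" by blast
      then have "phi {..<a} {..<N} ?c s = 0" by (intro phi_neg[of l]) auto
      then show ?thesis by simp
    qed simp
    also have "\<dots> = phi {..<a} {..<N} (\<lambda>l. \<gamma> l - cnt {..<b} f l) s" by (rule phi_cong) simp
    finally show "(\<Sum>\<alpha>\<in>boxes N \<gamma>. phi {..<a} {..<N} \<alpha> s * (if \<forall>l\<in>{..<N}. cnt {..<b} f l = \<gamma> l - \<alpha> l then 1 else 0)) =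
        phi {..<a} {..<N} (\<lambda>l. \<gamma> l - cnt {..<b} f l) s" .
  qed
  finally show ?thesis .
qed

text \<open>The Murnaghan-Nakayama rule for all cycles of \<open>t\<close> at once: a fixed word
  assigns each cycle to the bead from which its length is subtracted.\<close>

lemma psi_dsum:
  assumes s: "s \<in> Sym a" and t: "t \<in> Sym b"
  shows "psi {..<a + b} N \<beta> (dsum a s t) = (\<Sum>f\<in>fixfun {..<b} {..<N} t. psi {..<a} N (\<lambda>l. \<beta> l - cnt {..<b} f l) s)"
proof -
  have "psi {..<a + b} N \<beta> (dsum a s t) = (\<Sum>w | w permutes {..<N}. \<Sum>f\<in>fixfun {..<b} {..<N} t.
      sign w * phi {..<a} {..<N} (\<lambda>l. \<beta> l - cnt {..<b} f l - dl N (w l)) s)"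
    unfolding psi_def by (intro sum.cong refl) (simp add: phi_dsum_fix[OF s t] sum_distrib_left algebra_simps)
  then show ?thesis unfolding psi_def by (subst (asm) sum.swap)
qed

lemma cnt_bij:
  assumes "inj w"
  shows "cnt S (restrict (\<lambda>s. w (f s)) S) (w l) = cnt S f l"
proof -
  have "{s \<in> S. restrict (\<lambda>s. w (f s)) S s = w l} = {s \<in> S. f s = l}"
    using assms by (auto simp: inj_eq)
  then show ?thesis by (simp only: cnt_def)
qed

lemma sum_fixfun_relabel:
  assumes w: "w permutes J" and p: "p permutes S"
  shows "(\<Sum>f\<in>fixfun S J p. G (cnt S f)) = (\<Sum>f\<in>fixfun S J p. G (\<lambda>l. cnt S f (w l)))"
proof -
  have inj: "inj u" if "u permutes J" for u using that by (rule permutes_inj)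
  have mem: "restrict (\<lambda>s. u (f s)) S \<in> fixfun S J p" if "f \<in> fixfun S J p" "u permutes J" for f u
    using that p by (auto simp: fixfun_def permutes_in_image PiE_iff)
  show ?thesis
  proof (rule sum.reindex_bij_witness[where i = "\<lambda>f. restrict (\<lambda>s. inv w (f s)) S" and j = "\<lambda>f. restrict (\<lambda>s. w (f s)) S"])
    fix f assume f: "f \<in> fixfun S J p"
    then have ext: "f \<in> extensional S" by (simp add: fixfun_def PiE_iff)
    show "restrict (\<lambda>s. inv w (restrict (\<lambda>s. w (f s)) S s)) S = f"
      "restrict (\<lambda>s. w (restrict (\<lambda>s. inv w (f s)) S s)) S = f"
      using ext by (auto simp: fun_eq_iff extensional_def permutes_inverses[OF w])
    show "restrict (\<lambda>s. w (f s)) S \<in> fixfun S J p" "restrict (\<lambda>s. inv w (f s)) S \<in> fixfun S J p"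
      by (rule mem[OF f w] mem[OF f permutes_inv[OF w]])+
    show "G (\<lambda>l. cnt S (restrict (\<lambda>s. w (f s)) S) (w l)) = G (cnt S f)"
      by (simp only: cnt_bij[OF inj[OF w]])
  qed
qed

lemma alt_fix_adjoint:
  assumes t: "t permutes S"
  shows "(\<Sum>f\<in>fixfun S {..<N} t. alt N (\<lambda>i. x i - cnt S f i) y) = (\<Sum>f\<in>fixfun S {..<N} t. alt N x (\<lambda>i. y i + cnt S f i))"
proof -
  have "(\<Sum>f\<in>fixfun S {..<N} t. alt N (\<lambda>i. x i - cnt S f i) y) = (\<Sum>w | w permutes {..<N}. \<Sum>f\<in>fixfun S {..<N} t.
      sign w * (if \<forall>i<N. x i - cnt S f i = y (w i) then 1 else 0))"
    unfolding alt_def by (rule sum.swap)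
  also have "\<dots> = (\<Sum>w | w permutes {..<N}. \<Sum>f\<in>fixfun S {..<N} t.
      sign w * (if \<forall>i<N. x i - cnt S f (w i) = y (w i) then 1 else 0))"
  proof (rule sum.cong[OF refl])
    fix w assume "w \<in> {w. w permutes {..<N}}"
    then have w: "w permutes {..<N}" by simp
    show "(\<Sum>f\<in>fixfun S {..<N} t. sign w * (if \<forall>i<N. x i - cnt S f i = y (w i) then 1 else 0)) =
        (\<Sum>f\<in>fixfun S {..<N} t. sign w * (if \<forall>i<N. x i - cnt S f (w i) = y (w i) then 1 else 0))"
      by (rule sum_fixfun_relabel[OF w t, of "\<lambda>c. sign w * (if \<forall>i<N. x i - c i = y (w i) then 1 else 0)"])
  qed
  also have "\<dots> = (\<Sum>w | w permutes {..<N}. \<Sum>f\<in>fixfun S {..<N} t.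
      sign w * (if \<forall>i<N. x i = y (w i) + cnt S f (w i) then 1 else 0))"
    by (simp only: diff_eq_eq)
  also have "\<dots> = (\<Sum>f\<in>fixfun S {..<N} t. alt N x (\<lambda>i. y i + cnt S f i))"
    unfolding alt_def by (rule sum.swap)
  finally show ?thesis .
qed

text \<open>In terms of symmetric functions, the power sum of the cycle type of \<open>t\<close>
  times the Schur function of \<open>lam\<close> is expanded in Schur functions, with skew
  characters at \<open>t\<close> as coefficients. The sum over fixed words is multiplication by that
  power sum on bead vectors, and \<open>fact a\<close> clears the average over
  \<open>Sym a\<close>.\<close>

theorem fix_expand:
  assumes cong: "\<And>\<beta> \<beta>'. (\<And>i. i < N \<Longrightarrow> \<beta> i = \<beta>' i) \<Longrightarrow> l \<beta> = (l \<beta>' :: int)"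
    and anti: "\<And>v \<beta>. v permutes {..<N} \<Longrightarrow> l (\<lambda>i. \<beta> (v i)) = sign v * l \<beta>"
    and lam: "lam \<in> partitions_of a" and N: "a + b \<le> N" and t: "t \<in> Sym b"
  shows "fact a * (\<Sum>f\<in>fixfun {..<b} {..<N} t. l (\<lambda>i. bt N lam i + cnt {..<b} f i)) =
    (\<Sum>\<alpha>\<in>partitions_of (a + b). l (bt N \<alpha>) * (\<Sum>s\<in>Sym a. psi {..<a + b} N (bt N \<alpha>) (dsum a s t) * psi {..<a} N (bt N lam) s))"
proof -
  let ?X = "fixfun {..<b} {..<N} t"
  have tp: "t permutes {..<b}" using t by (simp add: Sym_iff)
  have "(\<Sum>s\<in>Sym a. psi {..<a + b} N (bt N \<alpha>) (dsum a s t) * psi {..<a} N (bt N lam) s) =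
      fact a * (\<Sum>f\<in>?X. alt N (bt N \<alpha>) (\<lambda>i. bt N lam i + cnt {..<b} f i))" for \<alpha>
  proof -
    have "(\<Sum>s\<in>Sym a. psi {..<a + b} N (bt N \<alpha>) (dsum a s t) * psi {..<a} N (bt N lam) s) =
        (\<Sum>s\<in>Sym a. \<Sum>f\<in>?X. psi {..<a} N (\<lambda>l. bt N \<alpha> l - cnt {..<b} f l) s * psi {..<a} N (bt N lam) s)"
      by (intro sum.cong refl) (simp add: psi_dsum[OF _ t] sum_distrib_right)
    also have "\<dots> = (\<Sum>f\<in>?X. \<Sum>s | s permutes {..<a}. psi {..<a} N (\<lambda>l. bt N \<alpha> l - cnt {..<b} f l) s * psi {..<a} N (bt N lam) s)"
      unfolding Sym_def by (rule sum.swap)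
    also have "\<dots> = (\<Sum>f\<in>?X. fact (card {..<a}) * alt N (\<lambda>l. bt N \<alpha> l - cnt {..<b} f l) (bt N lam))"
      using partitions_ofD[OF lam] N
      by (intro sum.cong refl psi_orthonormal_gen) (auto simp: bt_nonneg sum_bt)
    also have "\<dots> = fact a * (\<Sum>f\<in>?X. alt N (\<lambda>l. bt N \<alpha> l - cnt {..<b} f l) (bt N lam))"
      by (simp add: sum_distrib_left)
    finally show ?thesis by (simp only: alt_fix_adjoint[OF tp])
  qed
  then have "(\<Sum>\<alpha>\<in>partitions_of (a + b). l (bt N \<alpha>) * (\<Sum>s\<in>Sym a. psi {..<a + b} N (bt N \<alpha>) (dsum a s t) * psi {..<a} N (bt N lam) s)) =
      (\<Sum>\<alpha>\<in>partitions_of (a + b). \<Sum>f\<in>?X. fact a * (l (bt N \<alpha>) * alt N (bt N \<alpha>) (\<lambda>i. bt N lam i + cnt {..<b} f i)))"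
    by (simp add: sum_distrib_left mult_ac)
  also have "\<dots> = (\<Sum>f\<in>?X. \<Sum>\<alpha>\<in>partitions_of (a + b). fact a * (l (bt N \<alpha>) * alt N (bt N \<alpha>) (\<lambda>i. bt N lam i + cnt {..<b} f i)))"
    by (rule sum.swap)
  also have "\<dots> = (\<Sum>f\<in>?X. fact a * l (\<lambda>i. bt N lam i + cnt {..<b} f i))"
  proof (rule sum.cong[OF refl])
    fix f assume "f \<in> ?X"
    then have f: "f \<in> {..<b} \<rightarrow> {..<N}" by (auto simp: fixfun_def)
    have "l (\<lambda>i. bt N lam i + cnt {..<b} f i) = (\<Sum>\<alpha>\<in>partitions_of (a + b). l (bt N \<alpha>) * alt N (bt N \<alpha>) (\<lambda>i. bt N lam i + cnt {..<b} f i))"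
    proof (rule alt_expand[OF cong anti N])
      show "0 \<le> bt N lam i + cnt {..<b} f i" if "i < N" for i using bt_nonneg[OF that, of lam] by (simp add: cnt_def)
      show "(\<Sum>i<N. bt N lam i + cnt {..<b} f i) = int (a + b) + (\<Sum>i<N. dl N i)"
        using sum_cnt[OF _ _ f] sum_bt[of lam N] partitions_ofD[OF lam] N by (simp add: sum.distrib)
    qed
    then show "(\<Sum>\<alpha>\<in>partitions_of (a + b). fact a * (l (bt N \<alpha>) * alt N (bt N \<alpha>) (\<lambda>i. bt N lam i + cnt {..<b} f i))) = fact a * l (\<lambda>i. bt N lam i + cnt {..<b} f i)"
      by (simp add: sum_distrib_left)
  qed
  finally show ?thesis by (simp add: sum_distrib_left)
qed

text \<open>The number of beads is immaterial, since both sides are the Specht character of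
  \<open>lam\<close>.\<close>

lemma irr_eq:
  assumes "lam \<in> partitions_of n" "n \<le> N" "p \<in> Sym n"
  shows "psi {..<n} N (bt N lam) p = irr n lam p"
proof -
  have "of_int (psi {..<n} N (bt N lam) p) = (of_int (irr n lam p) :: complex)"
    using irr_char_psi[of lam N n p] irr_char_psi[of lam n n p] partitions_ofD[OF assms(1)] assms by (simp add: Sym_iff)
  then show ?thesis by simp
qed

lemma conjugate_partition:
  assumes lam: "lam \<in> partitions_of n"
  shows "conjugate lam \<in> partitions_of n"
proof -
  note p = partitions_ofD(1)[OF lam]
  have len: "length (conjugate lam) = pt lam 0" by (simp add: conjugate_def)
  have nth: "conjugate lam ! j = pt (conjugate lam) j" if "j < pt lam 0" for j using that by (simp add: pt_nth len)
  have anti: "pt (conjugate lam) j' \<le> pt (conjugate lam) j" if "j \<le> j'" for j j'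
  proof (rule ccontr)
    assume "\<not> pt (conjugate lam) j' \<le> pt (conjugate lam) j"
    then have "pt (conjugate lam) j < pt (conjugate lam) j'" by simp
    then have "j' < pt lam (pt (conjugate lam) j)" using pt_conjugate_iff[OF p] by simp
    then have "j < pt lam (pt (conjugate lam) j)" using that by simp
    then show False using pt_conjugate_iff[OF p] by blast
  qed
  have "0 < pt (conjugate lam) j" if "j < pt lam 0" for j using that pt_conjugate_iff[OF p] by blast
  then have ip: "is_partition (conjugate lam)"
    unfolding is_partition_def sorted_wrt_iff_nth_less using anti nth len
    by (auto simp: in_set_conv_nth)
  have "cells (conjugate lam) = (\<lambda>(i, j). (j, i)) ` cells lam"
    unfolding cells_scells scells_def using pt_conjugate_iff[OF p] by (auto simp: image_iff)
  moreover have "inj_on (\<lambda>(i, j). (j, i)) (cells lam)" by (auto simp: inj_on_def)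
  ultimately have "card (cells (conjugate lam)) = card (cells lam)" by (simp only: card_image)
  then show ?thesis using ip partitions_ofD(2)[OF lam] by (simp add: card_cells partitions_of_def)
qed

lemma pt_le:
  assumes "lam \<in> partitions_of n"
  shows "pt lam i \<le> n"
proof -
  have "pt lam i \<le> pt lam 0" by (rule pt_antimono[OF partitions_ofD(1)[OF assms]]) simp
  also have "\<dots> = length (conjugate lam)" by (simp add: conjugate_def)
  also have "\<dots> \<le> n" by (rule partitions_ofD(3)[OF conjugate_partition[OF assms]])
  finally show ?thesis .
qed

lemma bt_Nil: "bt N [] = dl N"
  by (rule ext) (simp add: bt_def)

lemma Nil_partition: "[] \<in> partitions_of 0"
  by (simp add: partitions_of_def is_partition_def)

text \<open>\<open>Lp_cycles\<close> is applied with the empty partition on the even beads. Averaged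
  over \<open>t\<close> against \<open>irr b mu\<close>, its left side retains only
  \<open>mu\<close> on the even beads. On the right the factor \<open>sign t\<close> turns
  \<open>irr b mu\<close> into the character of \<open>conjugate mu\<close>, and the average becomes
  \<open>LRk\<close>; the factor \<open>(-1) ^ b\<close> remains.\<close>

theorem Lp_transfer:
  assumes n: "n \<le> A + B" and F: "zspan {..<n} (A + B) F"
    and vanish: "\<And>r p. r > 0 \<Longrightarrow> 2 * r \<le> n \<Longrightarrow> p permutes {..<n - 2 * r} \<Longrightarrow> F (cycle_of_list [n - 2 * r..<n] \<circ> p) = 0"
    and lam: "lam \<in> partitions_of a" and mu: "mu \<in> partitions_of b" and A: "b \<le> A" and B: "a + b \<le> B"
  shows "fact a * fact b * Lp n A B F (bt A mu) (bt B lam) =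
    (-1) ^ b * (\<Sum>\<alpha>\<in>partitions_of (a + b). LRk a b \<alpha> lam (conjugate mu) * Lp n A B F (dl A) (bt B \<alpha>))"
proof -
  let ?L = "Lp n A B F"
  let ?fa = "\<lambda>t. \<Sum>f\<in>fixfun {..<b} {..<A} t. ?L (\<lambda>i. bt A [] i + cnt {..<b} f i) (bt B lam)"
  let ?fb = "\<lambda>t. \<Sum>f\<in>fixfun {..<b} {..<B} t. ?L (dl A) (\<lambda>i. bt B lam i + cnt {..<b} f i)"
  have swap: "?fa t = (-1) ^ b * sign t * ?fb t" if t: "t \<in> Sym b" for t
  proof -
    \<comment> \<open>\<open>Lp_cycles\<close> asks for nonnegative entries at every index, but
      \<open>dl A\<close> is negative from \<open>A\<close> on. Cutting off outside the range of
      beads does not change \<open>Lp\<close>.\<close>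
    let ?x = "\<lambda>i. if i < A then dl A i else 0" and ?y = "\<lambda>i. if i < B then bt B lam i else 0"
    have "cycle_decomp {..<b} t" using t by (intro cycle_decomposition) (simp_all add: Sym_iff)
    moreover have "0 \<le> ?x i" "0 \<le> ?y i" for i using bt_nonneg[of i B lam] by (auto simp: dl_def)
    ultimately have "(\<Sum>f\<in>fixfun {..<b} {..<A} t. ?L (\<lambda>i. ?x i + cnt {..<b} f i) ?y) =
      (-1) ^ card {..<b} * sign t * (\<Sum>f\<in>fixfun {..<b} {..<B} t. ?L ?x (\<lambda>j. ?y j + cnt {..<b} f j))"
      by (intro conjunct2[OF conjunct2[OF Lp_cycles[OF n F]]] vanish)
    moreover have "(\<Sum>f\<in>fixfun {..<b} {..<A} t. ?L (\<lambda>i. ?x i + cnt {..<b} f i) ?y) = ?fa t"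
      by (intro sum.cong refl Lp_cong) (auto simp: bt_Nil)
    moreover have "(\<Sum>f\<in>fixfun {..<b} {..<B} t. ?L ?x (\<lambda>j. ?y j + cnt {..<b} f j)) = ?fb t"
      by (intro sum.cong refl Lp_cong) auto
    ultimately show ?thesis by simp
  qed
  have left: "?fa t = (\<Sum>\<alpha>\<in>partitions_of b. ?L (bt A \<alpha>) (bt B lam) * irr b \<alpha> t)" if t: "t \<in> Sym b" for t
  proof -
    have "fact 0 * ?fa t = (\<Sum>\<alpha>\<in>partitions_of (0 + b). ?L (bt A \<alpha>) (bt B lam) *
        (\<Sum>s\<in>Sym 0. psi {..<0 + b} A (bt A \<alpha>) (dsum 0 s t) * psi {..<0} A (bt A []) s))"
    proof (rule fix_expand[where l = "\<lambda>x. ?L x (bt B lam)", OF _ _ Nil_partition _ t])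
      show "?L x (bt B lam) = ?L x' (bt B lam)" if "\<And>i. i < A \<Longrightarrow> x i = x' i" for x x'
        by (rule Lp_cong[OF that]) simp_all
      show "?L (\<lambda>i. x (v i)) (bt B lam) = sign v * ?L x (bt B lam)" if "v permutes {..<A}" for v x
        by (rule Lp_permute1[OF that])
    qed (use A in simp)
    also have "\<dots> = (\<Sum>\<alpha>\<in>partitions_of b. ?L (bt A \<alpha>) (bt B lam) * irr b \<alpha> t)"
    proof (rule sum.cong)
      fix \<alpha> assume \<alpha>: "\<alpha> \<in> partitions_of b"
      have S0: "Sym 0 = {id}" by (auto simp: Sym_def)
      have "phi {..<0::nat} {..<A} \<gamma> id = (if \<forall>i<A. \<gamma> i = 0 then 1 else 0)" for \<gamma>
      proof -
        have "fixfun {..<0} {..<A} (id :: nat \<Rightarrow> nat) = {\<lambda>x. undefined}" by (auto simp: fixfun_def)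
        then show ?thesis by (auto simp: phi_sum cnt_def)
      qed
      then have "psi {..<0::nat} A (dl A) id = alt A (dl A) (dl A)"
        unfolding psi_def alt_def by (intro sum.cong refl) simp
      then have 1: "psi {..<0::nat} A (bt A []) id = 1" by (simp add: bt_Nil alt_dl_dl)
      have "dsum 0 id t = t" by (auto simp: dsum_def)
      then show "?L (bt A \<alpha>) (bt B lam) * (\<Sum>s\<in>Sym 0. psi {..<0 + b} A (bt A \<alpha>) (dsum 0 s t) * psi {..<0} A (bt A []) s) =
          ?L (bt A \<alpha>) (bt B lam) * irr b \<alpha> t"
        using 1 irr_eq[OF \<alpha> A t] unfolding S0 by simp
    qed simp
    finally show ?thesis by simp
  qed
  have right: "fact a * ?fb t = (\<Sum>\<alpha>\<in>partitions_of (a + b). ?L (dl A) (bt B \<alpha>) * (\<Sum>s\<in>Sym a. irr (a + b) \<alpha> (dsum a s t) * irr a lam s))"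
    if t: "t \<in> Sym b" for t
  proof -
    have "fact a * ?fb t = (\<Sum>\<alpha>\<in>partitions_of (a + b). ?L (dl A) (bt B \<alpha>) *
        (\<Sum>s\<in>Sym a. psi {..<a + b} B (bt B \<alpha>) (dsum a s t) * psi {..<a} B (bt B lam) s))"
    proof (rule fix_expand[where l = "\<lambda>y. ?L (dl A) y", OF _ _ lam B t])
      show "?L (dl A) y = ?L (dl A) y'" if "\<And>i. i < B \<Longrightarrow> y i = y' i" for y y'
        by (rule Lp_cong[OF _ that]) simp_all
      show "?L (dl A) (\<lambda>i. y (v i)) = sign v * ?L (dl A) y" if "v permutes {..<B}" for v y
        by (rule Lp_permute2[OF that])
    qed
    also have "\<dots> = (\<Sum>\<alpha>\<in>partitions_of (a + b). ?L (dl A) (bt B \<alpha>) * (\<Sum>s\<in>Sym a. irr (a + b) \<alpha> (dsum a s t) * irr a lam s))"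
    proof (rule sum.cong[OF refl], rule arg_cong[where f="times _"], rule sum.cong[OF refl])
      fix \<alpha> s assume \<alpha>: "\<alpha> \<in> partitions_of (a + b)" and s: "s \<in> Sym a"
      show "psi {..<a + b} B (bt B \<alpha>) (dsum a s t) * psi {..<a} B (bt B lam) s = irr (a + b) \<alpha> (dsum a s t) * irr a lam s"
        using irr_eq[OF \<alpha> B dsum_Sym[OF s t]] irr_eq[OF lam _ s, of B] B by simp
    qed
    finally show ?thesis .
  qed
  have "(\<Sum>t\<in>Sym b. ?fa t * irr b mu t) = (\<Sum>t\<in>Sym b. \<Sum>\<alpha>\<in>partitions_of b. ?L (bt A \<alpha>) (bt B lam) * (irr b \<alpha> t * irr b mu t))"
    by (intro sum.cong refl) (simp add: left sum_distrib_right mult.assoc)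
  also have "\<dots> = (\<Sum>\<alpha>\<in>partitions_of b. ?L (bt A \<alpha>) (bt B lam) * (\<Sum>t\<in>Sym b. irr b \<alpha> t * irr b mu t))"
    by (subst sum.swap) (simp add: sum_distrib_left)
  also have "\<dots> = (\<Sum>\<alpha>\<in>partitions_of b. ?L (bt A \<alpha>) (bt B lam) * (if \<alpha> = mu then fact b else 0))"
    by (intro sum.cong refl) (simp add: irr_orthonormal mu)
  also have "\<dots> = fact b * ?L (bt A mu) (bt B lam)" using mu by (simp add: if_distrib cong: if_cong)
  finally have 1: "(\<Sum>t\<in>Sym b. ?fa t * irr b mu t) = fact b * ?L (bt A mu) (bt B lam)" .
  have "fact a * fact b * ?L (bt A mu) (bt B lam) = (\<Sum>t\<in>Sym b. (-1) ^ b * ((fact a * ?fb t) * (sign t * irr b mu t)))"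
  proof -
    have "fact a * fact b * ?L (bt A mu) (bt B lam) = (\<Sum>t\<in>Sym b. fact a * (?fa t * irr b mu t))"
      unfolding mult.assoc 1[symmetric] by (rule sum_distrib_left)
    also have "\<dots> = (\<Sum>t\<in>Sym b. (-1) ^ b * ((fact a * ?fb t) * (sign t * irr b mu t)))"
    proof (rule sum.cong[OF refl])
      fix t assume t: "t \<in> Sym b"
      show "fact a * (?fa t * irr b mu t) = (-1) ^ b * ((fact a * ?fb t) * (sign t * irr b mu t))"
        unfolding swap[OF t] by (simp only: mult_ac)
    qed
    finally show ?thesis .
  qed
  also have "\<dots> = (\<Sum>t\<in>Sym b. \<Sum>\<alpha>\<in>partitions_of (a + b). \<Sum>s\<in>Sym a.
      (-1) ^ b * (?L (dl A) (bt B \<alpha>) * (irr (a + b) \<alpha> (dsum a s t) * irr a lam s * irr b (conjugate mu) t)))"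
  proof (rule sum.cong[OF refl])
    fix t assume t: "t \<in> Sym b"
    have "irr b (conjugate mu) t = sign t * irr b mu t"
      using partitions_ofD[OF mu] pt_le[OF mu] t by (intro psi_conjugate) (auto simp: Sym_iff)
    then show "(-1) ^ b * ((fact a * ?fb t) * (sign t * irr b mu t)) = (\<Sum>\<alpha>\<in>partitions_of (a + b). \<Sum>s\<in>Sym a.
      (-1) ^ b * (?L (dl A) (bt B \<alpha>) * (irr (a + b) \<alpha> (dsum a s t) * irr a lam s * irr b (conjugate mu) t)))"
      unfolding right[OF t] by (simp add: sum_distrib_left sum_distrib_right mult_ac)
  qed
  also have "\<dots> = (\<Sum>\<alpha>\<in>partitions_of (a + b). \<Sum>s\<in>Sym a. \<Sum>t\<in>Sym b.
      (-1) ^ b * (?L (dl A) (bt B \<alpha>) * (irr (a + b) \<alpha> (dsum a s t) * irr a lam s * irr b (conjugate mu) t)))"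
    by (subst sum.swap, rule sum.cong[OF refl], rule sum.swap)
  also have "\<dots> = (-1) ^ b * (\<Sum>\<alpha>\<in>partitions_of (a + b). LRk a b \<alpha> lam (conjugate mu) * ?L (dl A) (bt B \<alpha>))"
    unfolding LRk_def by (simp add: sum_distrib_left sum_distrib_right mult_ac)
  finally show ?thesis .
qed

section \<open>The beads of a domino extension\<close>

lemma decreasing_eq:
  fixes f g :: "nat \<Rightarrow> int"
  assumes f: "\<And>i j. i < j \<Longrightarrow> j < N \<Longrightarrow> f j < f i" and g: "\<And>i j. i < j \<Longrightarrow> j < N \<Longrightarrow> g j < g i"
    and im: "f ` {..<N} = g ` {..<N}" and i: "i < N"
  shows "f i = g i"
proof -
  have c: "card {x \<in> h ` {..<N}. h i < x} = i"
    if h: "\<And>i j. i < j \<Longrightarrow> j < N \<Longrightarrow> h j < h i" and i: "i < N" for h :: "nat \<Rightarrow> int" and i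
  proof -
    have lt: "h i < h k \<longleftrightarrow> k < i" if "k < N" for k
      using h[of k i] h[of i k] i that by (cases i k rule: linorder_cases) auto
    have "{x \<in> h ` {..<N}. h i < x} = h ` {..<i}" using lt i by auto
    moreover have "inj_on h {..<i}" by (rule linorder_inj_onI') (metis h i lessThan_iff less_irrefl less_trans)
    ultimately show ?thesis by (simp add: card_image)
  qed
  have "f i \<in> g ` {..<N}" using im i by blast
  then obtain k where k: "k < N" "f i = g k" by auto
  then have "k = i" using c[of f i, OF f i] c[of g k, OF g k(1)] im by simp
  then show ?thesis using k by simp
qed

lemma pt_part_sum: "pt (part_sum x y) i = pt x i + pt y i"
proof (cases "max (length x) (length y) \<le> i")
  case True
  then have "length (part_sum x y) \<le> i" "length x \<le> i" "length y \<le> i" by (simp_all add: part_sum_def)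
  then show ?thesis by (simp add: pt_beyond)
next
  case False
  then have l: "i < max (length x) (length y)" by linarith
  then have "i < length (part_sum x y)" by (simp add: part_sum_def)
  then show ?thesis using l by (simp only: nth_default_nth) (simp add: part_sum_def del: less_max_iff_disj)
qed

lemma pt_double_parts: "pt (double_parts x) i = 2 * pt x i"
  by (cases "i < length x") (auto simp: double_parts_def nth_default_nth nth_default_beyond)

lemma is_partition_part_sum:
  assumes "is_partition x" "is_partition y"
  shows "is_partition (part_sum x y)"
proof -
  have len: "length (part_sum x y) = max (length x) (length y)" by (simp add: part_sum_def)
  have nth: "part_sum x y ! i = pt x i + pt y i" if "i < max (length x) (length y)" for i
    using that by (simp add: part_sum_def)
  show ?thesis
    unfolding is_partition_def sorted_wrt_iff_nth_less
  proof (intro conjI allI impI)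
    fix i j assume "i < j" "j < length (part_sum x y)"
    then show "part_sum x y ! j \<le> part_sum x y ! i"
      using nth[of i] nth[of j] pt_antimono[OF assms(1), of i j] pt_antimono[OF assms(2), of i j] by (simp add: len)
  next
    show "0 \<notin> set (part_sum x y)"
    proof
      assume "0 \<in> set (part_sum x y)"
      then obtain i where "i < max (length x) (length y)" "part_sum x y ! i = 0" by (auto simp: in_set_conv_nth len)
      then show False using nth[of i] pt_pos_iff[OF assms(1), of i] pt_pos_iff[OF assms(2), of i] by auto
    qed
  qed
qed

lemma is_partition_double_parts: "is_partition x \<Longrightarrow> is_partition (double_parts x)"
  by (auto simp: is_partition_def double_parts_def sorted_wrt_map elim: sorted_wrt_mono_rel[rotated])

text \<open>The beads of a partition and the beads of its conjugate are complementary.\<close>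

lemma beads_complement:
  fixes p q :: "nat \<Rightarrow> nat"
  assumes conj: "\<And>i c. c < p i \<longleftrightarrow> i < q c" and N: "q 0 \<le> N" and M: "p 0 \<le> M"
  shows "(\<lambda>i. int (p i) + dl N i) ` {..<N} = {0..<int (N + M)} - (\<lambda>c. int N + int c - int (q c)) ` {..<M}"
proof -
  let ?f = "\<lambda>i. int (p i) + dl N i" and ?g = "\<lambda>c. int N + int c - int (q c)"
  have p0: "p i \<le> M" for i using conj[of M i] conj[of M 0] M by arith
  have q0: "q c \<le> N" for c using conj[of c N] conj[of 0 N] N by arith
  \<comment> \<open>If the cell in row \<open>i\<close> and column \<open>c\<close> belongs to the
    shape, the row number exceeds the column number; if not, it is smaller.\<close>
  have disj: "?f i \<noteq> ?g c" for i c
    using conj[of c i] by (cases "c < p i") (simp_all add: dl_def)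
  have pm: "p j \<le> p i" if "i \<le> j" for i j using conj[of "p i" i] conj[of "p i" j] that by arith
  have qm: "q j \<le> q i" if "i \<le> j" for i j using conj[of i "q i"] conj[of j "q i"] that by arith
  have injf: "inj_on ?f {..<N}"
  proof (rule linorder_inj_onI')
    show "?f i \<noteq> ?f j" if "i < j" for i j using pm[of i j] that by (simp add: dl_def)
  qed
  have injg: "inj_on ?g {..<M}"
  proof (rule linorder_inj_onI')
    show "?g i \<noteq> ?g j" if "i < j" for i j using qm[of i j] that by simp
  qed
  have fin: "?f ` {..<N} \<subseteq> {0..<int (N + M)}"
  proof (rule image_subsetI)
    show "?f i \<in> {0..<int (N + M)}" if "i \<in> {..<N}" for i using p0[of i] that by (simp add: dl_def)
  qed
  have gin: "?g ` {..<M} \<subseteq> {0..<int (N + M)}"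
  proof (rule image_subsetI)
    show "?g c \<in> {0..<int (N + M)}" if "c \<in> {..<M}" for c using q0[of c] that by auto
  qed
  have "card (?f ` {..<N} \<union> ?g ` {..<M}) = N + M"
    using disj by (subst card_Un_disjoint) (auto simp: card_image[OF injf] card_image[OF injg] simp del: of_nat_add)
  then have "?f ` {..<N} \<union> ?g ` {..<M} = {0..<int (N + M)}"
    using fin gin by (intro card_subset_eq) auto
  moreover have "?f ` {..<N} \<inter> ?g ` {..<M} = {}" using disj by auto
  ultimately show ?thesis by blast
qed

definition interleave :: "nat \<Rightarrow> (nat \<Rightarrow> int) \<Rightarrow> (nat \<Rightarrow> int) \<Rightarrow> nat \<Rightarrow> int" where
  "interleave A x y i = (if i < A then 2 * x i else 2 * y (i - A) + 1)"

lemma Lp_interleave: "Lp n A B F x y = Lf n (A + B) F (interleave A x y)"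
  unfolding Lp_def interleave_def ..

lemma interleave_image:
  "interleave A x y ` {..<A + B} = (\<lambda>v. 2 * v) ` x ` {..<A} \<union> (\<lambda>v. 2 * v + 1) ` y ` {..<B}" (is "?l = ?r")
proof (intro equalityI subsetI)
  fix v assume "v \<in> ?l"
  then obtain i where i: "i < A + B" "v = interleave A x y i" by auto
  show "v \<in> ?r"
  proof (cases "i < A")
    case False
    then have "i - A < B" using i by simp
    then show ?thesis using i False by (auto simp: interleave_def)
  qed (use i in \<open>auto simp: interleave_def\<close>)
next
  fix v assume "v \<in> ?r"
  then consider i where "i < A" "v = 2 * x i" | j where "j < B" "v = 2 * y j + 1" by auto
  then show "v \<in> ?l"
  proof cases
    case 1
    then have "i < A + B" "v = interleave A x y i" by (simp_all add: interleave_def)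
    then show ?thesis by blast
  next
    case 2
    then have "A + j < A + B" "v = interleave A x y (A + j)" by (simp_all add: interleave_def)
    then show ?thesis by blast
  qed
qed

lemma domino_extension_partition:
  assumes "is_partition lam" "is_partition mu"
  shows "is_partition (domino_extension (staircase j) lam mu)"
proof -
  have c: "is_partition (conjugate x)" if "is_partition x" for x
    using conjugate_partition[of x "sum_list x"] that by (simp add: partitions_of_def)
  then show ?thesis
    unfolding domino_extension_def using assms
    by (intro is_partition_part_sum is_partition_double_parts staircase_partition c)
qed

text \<open>A row with index less than \<open>length lam\<close> has length \<open>j - i\<close>
  before \<open>2 * lam\<close> is added, so its bead is odd and is raised as \<open>lam\<close>
  prescribes. The other beads are found through the complement: column \<open>c\<close> of the shape
  before that addition yields the number \<open>2 * (A + c - m' c)\<close>. Thus the free positions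
  are even, and they are the doubled free positions of \<open>mu\<close>. One inclusion suffices,
  since the left set has \<open>A + B\<close> elements and the right one at most as many.\<close>

theorem domino_extension_beads:
  assumes lam: "is_partition lam" and mu: "is_partition mu" and len: "length lam + pt mu 0 \<le> j + 1" "pt mu 0 \<le> j" "length lam \<le> j"
    and A: "length mu \<le> A" and B: "B = A + j"
  shows "length (domino_extension (staircase j) lam mu) \<le> A + B"
    and "bt (A + B) (domino_extension (staircase j) lam mu) ` {..<A + B} = interleave A (bt A mu) (bt B lam) ` {..<A + B}"
proof -
  let ?N = "A + B"
  let ?kap = "domino_extension (staircase j) lam mu"
  define m' where "m' = pt (conjugate mu)"
  define s where "s = part_sum (staircase j) (double_parts (conjugate mu))"
  define p where "p = pt (conjugate s)"
  define q where "q c = (j - c) + 2 * m' c" for c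
  have cmu: "is_partition (conjugate mu)"
    using conjugate_partition[of mu "sum_list mu"] mu by (simp add: partitions_of_def)
  have s: "is_partition s" unfolding s_def
    by (intro is_partition_part_sum is_partition_double_parts staircase_partition cmu)
  have pts: "pt s = q" by (rule ext) (simp add: s_def q_def m'_def pt_part_sum pt_double_parts pt_staircase)
  have conj: "c < p i \<longleftrightarrow> i < q c" for i c
    using pt_conjugate_iff[OF s, of c i] by (simp add: p_def pts)
  have m': "c < pt mu i \<longleftrightarrow> i < m' c" for i c using pt_conjugate_iff[OF mu, of i c] by (simp add: m'_def)
  have kap: "pt ?kap i = p i + 2 * pt lam i" for i
    by (simp add: domino_extension_def s_def[symmetric] pt_part_sum pt_double_parts p_def)
  have m'A: "m' 0 \<le> A" using m'[of 0 A] A by (simp add: pt_beyond)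
  have m'0: "m' c = 0" if "pt mu 0 \<le> c" for c using m'[of c 0] that by simp
  have q0: "q 0 \<le> ?N" using m'A by (simp add: q_def B)
  have p0: "p 0 \<le> j" using conj[of j 0] m'0[of j] len by (simp add: q_def)
  have top: "p i = j - i" if "i < length lam" for i
  proof -
    have "c < p i \<longleftrightarrow> c < j - i" for c
    proof (cases "c < pt mu 0")
      case True
      then have "0 < m' c" using m'[of c 0] by simp
      moreover have "i + c < j" using that True len by linarith
      ultimately show ?thesis by (simp add: conj q_def less_diff_conv)
    next
      case False
      then show ?thesis by (auto simp: conj q_def m'0)
    qed
    then show ?thesis by (metis linorder_neqE_nat less_irrefl)
  qed
  have pN: "p i = 0" if "?N \<le> i" for i using conj[of 0 i] q0 that by simp
  show length: "length ?kap \<le> ?N"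
  proof (rule ccontr)
    assume "\<not> length ?kap \<le> ?N"
    then have "0 < pt ?kap ?N" using pt_pos_iff[OF domino_extension_partition[OF lam mu]] by simp
    then show False using pN[of ?N] len by (simp add: kap pt_beyond B)
  qed
  have b1: "(\<lambda>i. int (p i) + dl ?N i) ` {..<?N} = {0..<int (?N + j)} - (\<lambda>c. int ?N + int c - int (q c)) ` {..<j}"
    by (rule beads_complement[OF conj q0 p0])
  have b2: "(\<lambda>i. int (pt mu i) + dl A i) ` {..<A} = {0..<int (A + j)} - (\<lambda>c. int A + int c - int (m' c)) ` {..<j}"
    by (rule beads_complement[OF m' m'A len(2)])
  have sub: "bt ?N ?kap ` {..<?N} \<subseteq> interleave A (bt A mu) (bt B lam) ` {..<?N}"
  proof (rule image_subsetI)
    fix i assume "i \<in> {..<?N}"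
    then have i: "i < ?N" by simp
    show "bt ?N ?kap i \<in> interleave A (bt A mu) (bt B lam) ` {..<?N}"
    proof (cases "i < length lam")
      case True
      then have "bt ?N ?kap i = 2 * bt B lam i + 1" using top[OF True] len by (simp add: bt_def kap dl_def B of_nat_diff)
      moreover have "i < B" using True len by (simp add: B)
      ultimately show ?thesis unfolding interleave_image by blast
    next
      case False
      define v where "v = int (p i) + dl ?N i"
      have bv: "bt ?N ?kap i = v" using False by (simp add: bt_def kap v_def pt_beyond)
      have v: "v \<in> {0..<int (?N + j)} - (\<lambda>c. int ?N + int c - int (q c)) ` {..<j}"
        unfolding b1[symmetric] v_def using i by blast
      show ?thesis
      proof (cases "even v")
        case True
        then obtain x where x: "v = 2 * x" by (elim evenE)
        have "x \<in> {0..<int (A + j)}" using v by (auto simp: x B)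
        moreover have "x \<notin> (\<lambda>c. int A + int c - int (m' c)) ` {..<j}"
        proof
          assume "x \<in> (\<lambda>c. int A + int c - int (m' c)) ` {..<j}"
          then obtain c where c: "c < j" "x = int A + int c - int (m' c)" by auto
          then have "v = int ?N + int c - int (q c)" by (simp add: x q_def B of_nat_diff)
          then show False using v c by blast
        qed
        ultimately have "x \<in> bt A mu ` {..<A}" using b2 by (simp add: bt_def[abs_def])
        then show ?thesis unfolding interleave_image bv x by blast
      next
        case odd: False
        then obtain y where y: "v = 2 * y + 1" by (elim oddE)
        have y0: "0 \<le> y" "y < int B" using v by (auto simp: y B)
        \<comment> \<open>An odd bead of a later row lies below the beads of the parts of
          \<open>lam\<close>, so it is the bead of a part 0.\<close>
        have "y < int B - int (length lam)"
        proof (cases "length lam = 0")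
          case False
          define k where "k = length lam - 1"
          have k: "k < length lam" "k < i" using False \<open>\<not> i < length lam\<close> unfolding k_def by linarith+
          have "p i \<le> p k" using conj[of "p k" i] conj[of "p k" k] k by arith
          then have "v < int (p k) + dl ?N k" using k by (simp add: v_def dl_def)
          then show ?thesis using top[OF k(1)] k len by (simp add: y dl_def B of_nat_diff k_def)
        qed (use y0 in simp)
        then have "y = bt B lam (nat (int B - 1 - y))" "nat (int B - 1 - y) < B"
          using y0 by (simp_all add: bt_def dl_def pt_beyond le_nat_iff)
        then show ?thesis unfolding interleave_image bv y by blast
      qed
    qed
  qed
  have "inj_on (bt ?N ?kap) {..<?N}" by (rule bt_inj[OF domino_extension_partition[OF lam mu]])
  then have c: "card (bt ?N ?kap ` {..<?N}) = ?N" by (simp add: card_image)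
  have "card (interleave A (bt A mu) (bt B lam) ` {..<?N}) \<le> ?N"
    using card_image_le[of "{..<?N}" "interleave A (bt A mu) (bt B lam)"] by simp
  then show "bt ?N ?kap ` {..<?N} = interleave A (bt A mu) (bt B lam) ` {..<?N}"
    using sub c by (intro card_seteq) auto
qed

lemma two_sum_dl: "2 * (\<Sum>i<N. dl N i) = int N * (int N - 1)"
proof -
  have "2 * (\<Sum>i<N. c - int i) = 2 * (int N * c) - int N * (int N - 1)" for c
    by (induction N) (simp_all add: algebra_simps)
  from this[of "int N - 1"] show ?thesis by (simp add: dl_def algebra_simps)
qed

lemma interleave_sort:
  assumes im: "bt N kap ` {..<N} = \<beta> ` {..<N}" and kap: "is_partition kap"
  obtains v where "v permutes {..<N}" "\<And>i. i < N \<Longrightarrow> bt N kap i = \<beta> (v i)"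
proof -
  have "card (\<beta> ` {..<N}) = card {..<N}" unfolding im[symmetric] by (rule card_image[OF bt_inj[OF kap]])
  then have "inj_on \<beta> {..<N}" by (intro eq_card_imp_inj_on) auto
  from sort_perm[OF this] obtain v where v: "v permutes {..<N}"
    and dec: "\<And>i j. i < j \<Longrightarrow> j < N \<Longrightarrow> \<beta> (v j) < \<beta> (v i)" by blast
  have "(\<lambda>i. \<beta> (v i)) ` {..<N} = \<beta> ` {..<N}"
    using permutes_image[OF v] by (simp add: image_image[symmetric])
  then have "bt N kap i = \<beta> (v i)" if "i < N" for i
    using decreasing_eq[of N "bt N kap" "\<lambda>i. \<beta> (v i)" i] bt_less[OF kap] dec im that by simp
  then show thesis using that v by blast
qed

section \<open>Kronecker coefficients of domino extensions of a staircase\<close>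

context
  fixes w n A B :: nat
  assumes w: "w \<ge> 1" and n: "n = w * (2 * w + 1)" and A: "A = n" and B: "B = A + (2 * w - 1)"
begin

abbreviation (input) "tau lam mu \<equiv> domino_extension (staircase (2 * w - 1)) lam mu"

lemma w_le_n: "w \<le> n"
  unfolding n by simp

lemma dom_beads:
  assumes lam: "lam \<in> partitions_of a" and mu: "mu \<in> partitions_of b" and ab: "a + b = w"
  shows "length (tau lam mu) \<le> A + B"
    and "bt (A + B) (tau lam mu) ` {..<A + B} = interleave A (bt A mu) (bt B lam) ` {..<A + B}"
proof -
  have "pt mu 0 \<le> b" by (rule pt_le[OF mu])
  moreover have "length lam \<le> a" "length mu \<le> b" using partitions_ofD lam mu by blast+
  ultimately have h: "length lam + pt mu 0 \<le> 2 * w - 1 + 1" "pt mu 0 \<le> 2 * w - 1" "length lam \<le> 2 * w - 1" "length mu \<le> A"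
    using ab w w_le_n A by auto
  from domino_extension_beads[OF partitions_ofD(1)[OF lam] partitions_ofD(1)[OF mu] h B]
  show "length (tau lam mu) \<le> A + B"
    "bt (A + B) (tau lam mu) ` {..<A + B} = interleave A (bt A mu) (bt B lam) ` {..<A + B}" by auto
qed

text \<open>The size is read off from the total of the beads, which is known from
  \<open>dom_beads\<close> without computing any part.\<close>

lemma dom_partition:
  assumes lam: "lam \<in> partitions_of a" and mu: "mu \<in> partitions_of b" and ab: "a + b = w"
  shows "tau lam mu \<in> partitions_of n"
proof -
  let ?N = "A + B" and ?\<beta> = "interleave A (bt A mu) (bt B lam)"
  have p: "is_partition (tau lam mu)"
    by (rule domino_extension_partition[OF partitions_ofD(1)[OF lam] partitions_ofD(1)[OF mu]])
  obtain v where v: "v permutes {..<?N}" "\<And>i. i < ?N \<Longrightarrow> bt ?N (tau lam mu) i = ?\<beta> (v i)"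
    using interleave_sort[OF dom_beads(2)[OF assms] p] by blast
  have "(\<Sum>i<?N. bt ?N (tau lam mu) i) = (\<Sum>i<?N. ?\<beta> (v i))" using v(2) by simp
  also have "\<dots> = (\<Sum>i<?N. ?\<beta> i)" by (rule sum_permutes_N[OF v(1)])
  also have "\<dots> = (\<Sum>i<A. 2 * bt A mu i) + (\<Sum>j<B. 2 * bt B lam j + 1)"
    unfolding sum_lessThan_add by (simp add: interleave_def)
  also have "\<dots> = 2 * (\<Sum>i<A. bt A mu i) + 2 * (\<Sum>j<B. bt B lam j) + int B"
    by (simp add: sum_distrib_left sum.distrib)
  also have "(\<Sum>i<A. bt A mu i) = int b + (\<Sum>i<A. dl A i)"
    using sum_bt[of mu A] partitions_ofD[OF mu] ab w_le_n A by simp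
  also have "(\<Sum>j<B. bt B lam j) = int a + (\<Sum>i<B. dl B i)"
    using sum_bt[of lam B] partitions_ofD[OF lam] ab w_le_n A B by simp
  finally have e: "int (sum_list (tau lam mu)) + (\<Sum>i<?N. dl ?N i) = 2 * (int b + (\<Sum>i<A. dl A i)) + 2 * (int a + (\<Sum>i<B. dl B i)) + int B"
    using sum_bt[OF dom_beads(1)[OF assms]] by simp
  have iB: "int B = int A + (2 * int w - 1)" using w by (simp add: B of_nat_diff)
  have "2 * int (sum_list (tau lam mu)) = 2 * (2 * int w) + 2 * (int A * (int A - 1)) + 2 * (int B * (int B - 1)) + 2 * int B - int ?N * (int ?N - 1)"
  proof -
    \<comment> \<open>Stated for variables, so that the quadratic terms are atoms for linear
      arithmetic.\<close>
    have "2 * S = 2 * (2 * w') + 2 * y + 2 * z + 2 * B' - x"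
      if "S + s1 = 2 * (b' + s2) + 2 * (a' + s3) + B'" "2 * s1 = x" "2 * s2 = y" "2 * s3 = z" "w' = a' + b'"
      for S s1 s2 s3 x y z a' b' w' B' :: int
      using that by presburger
    from this[OF e two_sum_dl two_sum_dl two_sum_dl] show ?thesis using ab by simp
  qed
  also have "\<dots> = 2 * int n" unfolding n of_nat_add iB by (simp add: algebra_simps)
  finally show ?thesis using p by (simp add: partitions_of_def)
qed

text \<open>A single permutation sorts the beads for all \<open>\<alpha>\<close>, so all terms share
  one sign. It exists because \<open>\<alpha>\<close> has at most \<open>w\<close> parts, and the
  \<open>w\<close> highest odd beads lie above all even beads, as \<open>B \<ge> A + w\<close>;
  raising them passes no even bead.\<close>

lemma sorting_perm:
  "\<exists>v. v permutes {..<A + B} \<and>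
    (\<forall>\<alpha>\<in>partitions_of w. \<forall>i<A + B. bt (A + B) (tau \<alpha> []) i = interleave A (dl A) (bt B \<alpha>) (v i))"
proof -
  let ?N = "A + B" and ?\<beta> = "\<lambda>\<alpha>. interleave A (dl A) (bt B \<alpha>)"
  have BA: "A < B" using w by (simp add: B)
  have "inj_on (?\<beta> []) {..<?N}"
  proof (rule inj_onI)
    fix i j assume ij: "i \<in> {..<?N}" "j \<in> {..<?N}" "?\<beta> [] i = ?\<beta> [] j"
    have "even (?\<beta> [] i) \<longleftrightarrow> i < A" for i by (simp add: interleave_def)
    then have "i < A \<longleftrightarrow> j < A" using ij(3) by metis
    then show "i = j" using ij(3) by (cases "i < A") (auto simp: interleave_def dl_def bt_Nil)
  qed
  from sort_perm[OF this] obtain v where v: "v permutes {..<?N}"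
    and dec0: "\<And>i j. i < j \<Longrightarrow> j < ?N \<Longrightarrow> ?\<beta> [] (v j) < ?\<beta> [] (v i)" by blast
  have "bt ?N (tau \<alpha> []) i = ?\<beta> \<alpha> (v i)" if \<alpha>: "\<alpha> \<in> partitions_of w" and i: "i < ?N" for \<alpha> i
  proof (rule decreasing_eq[OF _ _ _ i])
    have a0: "w + 0 = w" by simp
    show "bt ?N (tau \<alpha> []) j < bt ?N (tau \<alpha> []) i" if "i < j" for i j
      by (rule bt_less[OF domino_extension_partition that]) (use \<alpha> partitions_ofD Nil_partition in blast)+
    have mono: "?\<beta> \<alpha> q < ?\<beta> \<alpha> p" if lt: "?\<beta> [] q < ?\<beta> [] p" and pq: "p < ?N" "q < ?N" for p q
    proof (cases "p < A")
      case True
      show ?thesis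
      proof (cases "q < A")
        case False
        have "length \<alpha> \<le> w" using partitions_ofD[OF \<alpha>] by blast
        moreover have "q - A \<ge> w"
          using lt True False pq w by (simp add: interleave_def bt_Nil dl_def B)
        ultimately have "pt \<alpha> (q - A) = 0" by (intro pt_beyond) simp
        then show ?thesis using lt True False by (simp add: interleave_def bt_def)
      qed (use lt True in \<open>simp add: interleave_def\<close>)
    next
      case False
      show ?thesis
      proof (cases "q < A")
        case True
        then show ?thesis using lt False by (simp add: interleave_def bt_def)
      next
        case q: False
        then have "p - A < q - A" using lt False by (simp add: interleave_def bt_Nil dl_def)
        then have "bt B \<alpha> (q - A) < bt B \<alpha> (p - A)" by (rule bt_less[OF partitions_ofD(1)[OF \<alpha>]])
        then show ?thesis using q False by (simp add: interleave_def)
      qed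
    qed
    show "?\<beta> \<alpha> (v j) < ?\<beta> \<alpha> (v i)" if "i < j" "j < ?N" for i j
      using dec0[OF that] that by (intro mono permutes_less[OF v]) auto
    have "bt ?N (tau \<alpha> []) ` {..<?N} = ?\<beta> \<alpha> ` {..<?N}"
      using dom_beads(2)[OF \<alpha> Nil_partition] by (simp add: bt_Nil)
    also have "\<dots> = (\<lambda>i. ?\<beta> \<alpha> (v i)) ` {..<?N}"
      using permutes_image[OF v] by (simp add: image_image[symmetric])
    finally show "bt ?N (tau \<alpha> []) ` {..<?N} = (\<lambda>i. ?\<beta> \<alpha> (v i)) ` {..<?N}" .
  qed
  then show ?thesis using v by blast
qed

text \<open>By \<open>Lp_transfer\<close> the two sides agree up to a product of sorting signs and
  \<open>(-1) ^ b\<close>. This product is not evaluated: all \<open>LRk\<close> and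
  \<open>kron\<close> involved are nonnegative, so comparing absolute values decides.\<close>

theorem kron_domino:
  assumes lam: "lam \<in> partitions_of a" and mu: "mu \<in> partitions_of b" and ab: "a + b = w"
  shows "fact a * fact b * kron n (staircase (2 * w)) (staircase (2 * w)) (tau lam mu) =
    (\<Sum>\<alpha>\<in>partitions_of w. LRk a b \<alpha> lam (conjugate mu) * kron n (staircase (2 * w)) (staircase (2 * w)) (tau \<alpha> []))"
proof -
  let ?N = "A + B"
  define \<rho> where "\<rho> = staircase (2 * w)"
  define F where "F p = irr n \<rho> p * irr n \<rho> p" for p
  let ?g = "\<lambda>\<kappa>. kron n \<rho> \<rho> \<kappa>"
  have sum\<rho>: "sum_list \<rho> = n" using sum_staircase[of "2 * w"] by (simp add: \<rho>_def n algebra_simps)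
  then have \<rho>: "\<rho> \<in> partitions_of n" using staircase_partition by (simp add: partitions_of_def \<rho>_def)
  have nN: "n \<le> ?N" by (simp add: A)
  have F: "zspan {..<n} ?N F" unfolding F_def by (rule zspan_psi_mult) (use nN in auto)
  have vanish: "F (cycle_of_list [n - 2 * r..<n] \<circ> p) = 0" if "r > 0" "2 * r \<le> n" "p permutes {..<n - 2 * r}" for r p
    using staircase_even_cycle[OF sum\<rho>[unfolded \<rho>_def] that] by (simp add: F_def \<rho>_def)
  have g: "Lf n ?N F (bt ?N \<kappa>) = ?g \<kappa>" if "\<kappa> \<in> partitions_of n" for \<kappa>
    unfolding Lf_def kron_def F_def by (intro sum.cong refl) (simp add: irr_eq[OF that nN])
  have g0: "?g \<kappa> \<ge> 0" if "\<kappa> \<in> partitions_of n" for \<kappa> by (rule kron_nonneg[OF \<rho> \<rho> that])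
  obtain v where v: "v permutes {..<?N}"
    and sort: "\<And>\<alpha> i. \<alpha> \<in> partitions_of w \<Longrightarrow> i < ?N \<Longrightarrow> bt ?N (tau \<alpha> []) i = interleave A (dl A) (bt B \<alpha>) (v i)"
    using sorting_perm by blast
  have L\<alpha>: "Lp n A B F (dl A) (bt B \<alpha>) = sign v * ?g (tau \<alpha> [])" if \<alpha>: "\<alpha> \<in> partitions_of w" for \<alpha>
  proof -
    have "?g (tau \<alpha> []) = Lf n ?N F (bt ?N (tau \<alpha> []))"
      using dom_partition[OF \<alpha> Nil_partition] by (simp add: g)
    also have "\<dots> = Lf n ?N F (\<lambda>i. interleave A (dl A) (bt B \<alpha>) (v i))"
      by (rule Lf_cong) (rule sort[OF \<alpha>])
    also have "\<dots> = sign v * Lp n A B F (dl A) (bt B \<alpha>)"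
      unfolding Lp_interleave by (rule Lf_permute[OF v])
    finally show ?thesis by (simp add: mult.assoc[symmetric] sign_idempotent)
  qed
  have p: "is_partition (tau lam mu)"
    by (rule domino_extension_partition[OF partitions_ofD(1)[OF lam] partitions_ofD(1)[OF mu]])
  obtain u where u: "u permutes {..<?N}" "\<And>i. i < ?N \<Longrightarrow> bt ?N (tau lam mu) i = interleave A (bt A mu) (bt B lam) (u i)"
    using interleave_sort[OF dom_beads(2)[OF assms] p] by blast
  have "?g (tau lam mu) = Lf n ?N F (bt ?N (tau lam mu))" by (rule g[OF dom_partition[OF assms], symmetric])
  also have "\<dots> = Lf n ?N F (\<lambda>i. interleave A (bt A mu) (bt B lam) (u i))" by (rule Lf_cong) (rule u(2))
  also have "\<dots> = sign u * Lp n A B F (bt A mu) (bt B lam)" unfolding Lp_interleave by (rule Lf_permute[OF u(1)])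
  finally have Lg: "?g (tau lam mu) = sign u * Lp n A B F (bt A mu) (bt B lam)" .
  let ?S = "\<Sum>\<alpha>\<in>partitions_of w. LRk a b \<alpha> lam (conjugate mu) * ?g (tau \<alpha> [])"
  have "fact a * fact b * ?g (tau lam mu) = sign u * (fact a * fact b * Lp n A B F (bt A mu) (bt B lam))"
    unfolding Lg by (simp only: mult_ac)
  also have "fact a * fact b * Lp n A B F (bt A mu) (bt B lam) =
      (-1) ^ b * (\<Sum>\<alpha>\<in>partitions_of (a + b). LRk a b \<alpha> lam (conjugate mu) * Lp n A B F (dl A) (bt B \<alpha>))"
    by (rule Lp_transfer[OF nN F vanish lam mu]) (use ab w_le_n in \<open>auto simp: A B\<close>)
  also have "(\<Sum>\<alpha>\<in>partitions_of (a + b). LRk a b \<alpha> lam (conjugate mu) * Lp n A B F (dl A) (bt B \<alpha>)) = sign v * ?S"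
    unfolding ab sum_distrib_left by (intro sum.cong refl) (simp add: L\<alpha> mult_ac)
  finally have e: "fact a * fact b * ?g (tau lam mu) = (sign u * ((-1) ^ b * sign v)) * ?S" by (simp add: mult.assoc)
  have "?S \<ge> 0"
  proof (intro sum_nonneg mult_nonneg_nonneg)
    fix \<alpha> assume \<alpha>: "\<alpha> \<in> partitions_of w"
    show "0 \<le> LRk a b \<alpha> lam (conjugate mu)"
      using \<alpha> unfolding ab[symmetric] by (rule LRk_nonneg[OF lam conjugate_partition[OF mu]])
    show "0 \<le> ?g (tau \<alpha> [])" using dom_partition[OF \<alpha> Nil_partition] by (intro g0) simp
  qed
  moreover have "0 \<le> fact a * fact b * ?g (tau lam mu)"
    using g0[OF dom_partition[OF assms]] by simp
  moreover have "\<bar>sign u * ((-1) ^ b * sign v)\<bar> = 1" by (simp add: abs_mult)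
  ultimately have "fact a * fact b * ?g (tau lam mu) = ?S"
    using arg_cong[OF e, of abs] unfolding abs_mult[of "sign u * ((-1) ^ b * sign v)"] by simp
  then show ?thesis by (simp only: \<rho>_def)
qed

end

section \<open>Positivity for the staircase quotient\<close>

text \<open>
  Two tableaux on the same points, \<open>u\<close> numbering the columns of the first: the coefficients of the second
  polytabloid that meet the first one are free of cancellation.
\<close>

locale diagram_pair = D1: diagram n rw1 cl1 a1 b1 + D3: diagram n rw3 cl3 a3 b3
  for n rw1 cl1 a1 b1 rw3 cl3 a3 b3 +
  fixes u :: "nat \<Rightarrow> nat"
  assumes u_col: "x < n \<Longrightarrow> y < n \<Longrightarrow> cl1 x = cl1 y \<Longrightarrow> u x = u y"
    and row1: "x < n \<Longrightarrow> y < n \<Longrightarrow> rw1 x = rw1 y \<Longrightarrow> u x \<le> u y \<Longrightarrow> rw3 y \<le> rw3 x"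
    and col3: "x < n \<Longrightarrow> y < n \<Longrightarrow> cl3 x = cl3 y \<Longrightarrow> rw3 x < rw3 y \<Longrightarrow> u x < u y"
begin

lemma stab_block:
  assumes "s \<in> stab n f"
  shows "card {x \<in> {..<n}. f x = j \<and> P (s x)} = card {x \<in> {..<n}. f x = j \<and> P x}"
proof (rule bij_betw_same_card[of s])
  have s: "s \<in> Sym n" using assms by (simp add: stab_def)
  show "bij_betw s {x \<in> {..<n}. f x = j \<and> P (s x)} {x \<in> {..<n}. f x = j \<and> P x}"
  proof (rule bij_betw_byWitness[where f' = "inv s"])
    show "s ` {x \<in> {..<n}. f x = j \<and> P (s x)} \<subseteq> {x \<in> {..<n}. f x = j \<and> P x}"
      using assms Sym_less[OF s] by (auto simp: stab_def)
    show "inv s ` {x \<in> {..<n}. f x = j \<and> P x} \<subseteq> {x \<in> {..<n}. f x = j \<and> P (s x)}"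
      using subgrpD(4)[OF subgrp_stab assms] Sym_less[OF Sym_inv[OF s]] by (auto simp: stab_def Sym_inv_apply[OF s])
  qed (auto simp: Sym_inv_apply[OF s])
qed

text \<open>Along a row of the first tableau \<open>rw3\<close> weakly decreases as \<open>u\<close>
  grows. So the points with small \<open>u\<close> and the points with small \<open>rw3\<close> are
  disjoint or together cover the row: their overlap is as small as their sizes allow, and a
  rearrangement within the row can only enlarge it.\<close>

lemma rows_le:
  assumes r: "r \<in> stab n rw1"
  shows "card {x \<in> {..<n}. rw3 x \<le> P \<and> u x \<le> U} \<le> card {x \<in> {..<n}. rw3 (r x) \<le> P \<and> u x \<le> U}"
proof -
  have "card {x \<in> {..<n}. rw1 x = i \<and> (rw3 x \<le> P \<and> u x \<le> U)} \<le> card {x \<in> {..<n}. rw1 x = i \<and> (rw3 (r x) \<le> P \<and> u x \<le> U)}" for i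
  proof -
    let ?E = "{x \<in> {..<n}. rw1 x = i}"
    let ?V = "{x \<in> ?E. u x \<le> U}" and ?G = "{x \<in> ?E. rw3 x \<le> P}" and ?H = "{x \<in> ?E. rw3 (r x) \<le> P}"
    have GH: "card ?H = card ?G" using stab_block[OF r, of i "\<lambda>x. rw3 x \<le> P"] by (simp add: conj_assoc)
    have "card (?V \<inter> ?G) \<le> card (?V \<inter> ?H)"
    proof (cases "?V \<inter> ?G = {}")
      case False
      then obtain z where z: "z \<in> ?V" "z \<in> ?G" by blast
      have "?E \<subseteq> ?V \<union> ?G"
      proof
        fix x assume x: "x \<in> ?E"
        show "x \<in> ?V \<union> ?G"
        proof (cases "u x \<le> u z")
          case False
          then have "rw3 x \<le> rw3 z" using row1[of z x] x z by auto
          then show ?thesis using x z by auto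
        qed (use x z in auto)
      qed
      then have "?V \<union> ?G = ?E" by blast
      then have "card ?V + card ?G = card ?E + card (?V \<inter> ?G)" using card_Un_Int[of ?V ?G] by simp
      moreover have "card ?V + card ?H = card (?V \<union> ?H) + card (?V \<inter> ?H)" by (rule card_Un_Int) auto
      moreover have "card (?V \<union> ?H) \<le> card ?E" by (rule card_mono) auto
      ultimately show ?thesis using GH by linarith
    qed simp
    moreover have "?V \<inter> ?G = {x \<in> {..<n}. rw1 x = i \<and> (rw3 x \<le> P \<and> u x \<le> U)}" by blast
    moreover have "?V \<inter> ?H = {x \<in> {..<n}. rw1 x = i \<and> (rw3 (r x) \<le> P \<and> u x \<le> U)}" by blast
    ultimately show ?thesis by (simp only:)
  qed
  then show ?thesis
    unfolding card_by[of _ "\<lambda>x. rw3 x \<le> P \<and> u x \<le> U" rw1] card_by[of _ "\<lambda>x. rw3 (r x) \<le> P \<and> u x \<le> U" rw1]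
    by (rule sum_mono)
qed

text \<open>The opposite extreme: down a column of the second tableau \<open>u\<close> grows with
  \<open>rw3\<close>, so one of the two sets contains the other and their overlap is as large as
  their sizes allow.\<close>

lemma cols_le:
  assumes c: "c \<in> stab n cl3"
  shows "card {x \<in> {..<n}. cl3 x = j \<and> (rw3 (c x) \<le> P \<and> u x \<le> U)} \<le> card {x \<in> {..<n}. cl3 x = j \<and> (rw3 x \<le> P \<and> u x \<le> U)}"
proof -
  let ?E = "{x \<in> {..<n}. cl3 x = j}"
  let ?V = "{x \<in> ?E. u x \<le> U}" and ?G = "{x \<in> ?E. rw3 x \<le> P}" and ?H = "{x \<in> ?E. rw3 (c x) \<le> P}"
  have GH: "card ?H = card ?G" using stab_block[OF c, of j "\<lambda>x. rw3 x \<le> P"] by (simp add: conj_assoc)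
  have "?V \<subseteq> ?G \<or> ?G \<subseteq> ?V"
  proof (rule disjCI)
    assume "\<not> ?G \<subseteq> ?V"
    then obtain z where z: "z \<in> ?G" "z \<notin> ?V" by blast
    show "?V \<subseteq> ?G"
    proof
      fix x assume x: "x \<in> ?V"
      have "\<not> rw3 z < rw3 x" using col3[of z x] x z by auto
      then show "x \<in> ?G" using x z by auto
    qed
  qed
  then have "card (?V \<inter> ?G) = card ?V \<or> card (?V \<inter> ?G) = card ?G"
    by (elim disjE) (simp_all only: Int_absorb1 Int_absorb2 simp_thms)
  moreover have "card (?V \<inter> ?H) \<le> card ?V" by (rule card_mono) auto
  moreover have "card (?V \<inter> ?H) \<le> card ?H" by (rule card_mono) auto
  ultimately have "card (?V \<inter> ?H) \<le> card (?V \<inter> ?G)" using GH by linarith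
  moreover have "?V \<inter> ?G = {x \<in> {..<n}. cl3 x = j \<and> (rw3 x \<le> P \<and> u x \<le> U)}" by blast
  moreover have "?V \<inter> ?H = {x \<in> {..<n}. cl3 x = j \<and> (rw3 (c x) \<le> P \<and> u x \<le> U)}" by blast
  ultimately show ?thesis by (simp only:)
qed

text \<open>\<open>c1\<close> preserves \<open>u\<close> and \<open>r3\<close> preserves
  \<open>rw3\<close>, so the equation makes \<open>rows_le\<close> and \<open>cols_le\<close> speak
  of the same overlaps, bounded from below by one and from above by the other. Equality throughout
  means that \<open>c3\<close> preserves rows as well as columns of the second tableau.\<close>

lemma forced:
  assumes c1: "c1 \<in> stab n cl1" and r1: "r1 \<in> stab n rw1" and c3: "c3 \<in> stab n cl3" and r3: "r3 \<in> stab n rw3"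
    and e: "c1 \<circ> r1 = c3 \<circ> r3"
  shows "c3 = id"
proof -
  let ?A = "\<lambda>P U. {x \<in> {..<n}. rw3 x \<le> P \<and> u x \<le> U}"
  let ?B = "\<lambda>P U. {x \<in> {..<n}. rw3 (inv c3 x) \<le> P \<and> u x \<le> U}"
  let ?Aj = "\<lambda>j P U. {x \<in> {..<n}. cl3 x = j \<and> (rw3 x \<le> P \<and> u x \<le> U)}"
  let ?Bj = "\<lambda>j P U. {x \<in> {..<n}. cl3 x = j \<and> (rw3 (inv c3 x) \<le> P \<and> u x \<le> U)}"
  have S: "c1 \<in> Sym n" "r1 \<in> Sym n" "c3 \<in> Sym n" "r3 \<in> Sym n"
    using c1 r1 c3 r3 by (simp_all add: stab_def)
  have i1: "inv r1 \<in> stab n rw1" and i3: "inv c3 \<in> stab n cl3" and i1c: "inv c1 \<in> stab n cl1" and i3r: "inv r3 \<in> stab n rw3"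
    using r1 c3 c1 r3 subgrpD(4)[OF subgrp_stab] by blast+
  have e': "inv r1 \<circ> inv c1 = inv r3 \<circ> inv c3"
    using e Sym_inv_comp[OF S(1,2)] Sym_inv_comp[OF S(3,4)] by simp
  have lab: "rw3 (inv c3 x) = rw3 (inv r1 (inv c1 x))" if "x < n" for x
  proof -
    have "inv c3 x < n" using that Sym_less[OF Sym_inv[OF S(3)]] by blast
    then have "rw3 (inv r3 (inv c3 x)) = rw3 (inv c3 x)" using i3r by (simp add: stab_def)
    then show ?thesis using fun_cong[OF e', of x] by simp
  qed
  have ge: "card (?A P U) \<le> card (?B P U)" for P U
  proof -
    have "card {x \<in> {..<n}. rw3 (inv r1 x) \<le> P \<and> u x \<le> U} = card (?B P U)"
    proof (rule bij_betw_same_card[of c1])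
      have u1: "u (c1 x) = u x" if "x < n" for x
        using that c1 Sym_less[OF S(1) that] by (intro u_col) (auto simp: stab_def)
      have u2: "u (inv c1 x) = u x" if "x < n" for x
        using that i1c Sym_less[OF Sym_inv[OF S(1)] that] by (intro u_col) (auto simp: stab_def)
      show "bij_betw c1 {x \<in> {..<n}. rw3 (inv r1 x) \<le> P \<and> u x \<le> U} (?B P U)"
      proof (rule bij_betw_byWitness[where f' = "inv c1"])
        show "c1 ` {x \<in> {..<n}. rw3 (inv r1 x) \<le> P \<and> u x \<le> U} \<subseteq> ?B P U"
          using Sym_less[OF S(1)] by (auto simp: lab u1 Sym_inv_apply[OF S(1)])
        show "inv c1 ` (?B P U) \<subseteq> {x \<in> {..<n}. rw3 (inv r1 x) \<le> P \<and> u x \<le> U}"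
          using Sym_less[OF Sym_inv[OF S(1)]] by (auto simp: lab u2)
      qed (auto simp: Sym_inv_apply[OF S(1)])
    qed
    then show ?thesis using rows_le[OF i1, of P U] by simp
  qed
  \<comment> \<open>The lower bound holds for the total and the upper bound in each column, so no
    column can be strict.\<close>
  have eq: "card (?Bj j P U) = card (?Aj j P U)"
    if j: "j \<in> cl3 ` {..<n}" for j P U
  proof (rule ccontr)
    assume "card (?Bj j P U) \<noteq> card (?Aj j P U)"
    then have "card (?Bj j P U) < card (?Aj j P U)"
      using cols_le[OF i3, of j P U] by linarith
    then have "card (?B P U) < card (?A P U)"
      unfolding card_by[of _ "\<lambda>x. rw3 x \<le> P \<and> u x \<le> U" cl3] card_by[of _ "\<lambda>x. rw3 (inv c3 x) \<le> P \<and> u x \<le> U" cl3]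
      using j cols_le[OF i3] by (intro sum_strict_mono_ex1) auto
    then show False using ge[of P U] by linarith
  qed
  \<comment> \<open>With the thresholds taken at \<open>x\<close> itself, equality of the sizes puts
    \<open>x\<close> into the moved set, so no label increases; since the labels keep their total,
    none decreases either.\<close>
  have le: "rw3 (inv c3 x) \<le> rw3 x" if x: "x < n" for x
  proof -
    let ?V = "{y \<in> {..<n}. cl3 y = cl3 x \<and> (rw3 y \<le> rw3 x \<and> u y \<le> u x)}"
    let ?H = "{y \<in> {..<n}. cl3 y = cl3 x \<and> (rw3 (inv c3 y) \<le> rw3 x \<and> u y \<le> u x)}"
    have "?H \<subseteq> ?V"
    proof
      fix y assume y: "y \<in> ?H"
      have "\<not> rw3 x < rw3 y" using col3[of x y] x y by auto
      then show "y \<in> ?V" using y by auto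
    qed
    moreover have "card ?H = card ?V" using x by (intro eq) auto
    ultimately have "?H = ?V" by (intro card_subset_eq) auto
    moreover have "x \<in> ?V" using x by simp
    ultimately show ?thesis by blast
  qed
  have "(\<Sum>x<n. rw3 (inv c3 x)) = (\<Sum>x<n. rw3 x)"
    using sum.permute[of "inv c3" "{..<n}" rw3] Sym_inv[OF S(3)] by (simp add: Sym_iff o_def)
  then have "rw3 (inv c3 x) = rw3 x" if "x < n" for x
    using sum_mono_inv[of "\<lambda>x. rw3 (inv c3 x)" "{..<n}" rw3 x] le that by simp
  then have "inv c3 \<in> stab n rw3" using Sym_inv[OF S(3)] by (simp add: stab_def)
  then have "inv c3 = id" using i3 by (rule D3.stab_RC)
  then show ?thesis using Sym_inv_inv[OF S(3)] by (metis inv_id)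
qed

lemma eps_nonzero:
  assumes g: "g \<in> Sym n" and "D1.eps g \<noteq> 0"
  shows "\<exists>c\<in>stab n cl1. \<exists>r\<in>stab n rw1. g = c \<circ> r"
proof -
  obtain c where c: "c \<in> stab n cl1" "(if inv c \<circ> g \<in> stab n rw1 then sign c else 0) \<noteq> 0"
    using assms(2) unfolding D1.eps_def by (rule sum.not_neutral_contains_not_neutral)
  then have "inv c \<circ> g \<in> stab n rw1" by (auto split: if_splits)
  moreover have "g = c \<circ> (inv c \<circ> g)" using c by (simp add: stab_def Sym_cancel(3)[where n=n])
  ultimately show ?thesis using c by blast
qed

text \<open>By \<open>forced\<close> only \<open>c3 = id\<close> contributes to
  \<open>D3.eps g\<close>, and its sign is 1.\<close>

lemma eps3_nonneg:
  assumes g: "g \<in> Sym n" and "D1.eps g \<noteq> 0"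
  shows "D3.eps g \<ge> 0"
  unfolding D3.eps_def
proof (rule sum_nonneg)
  fix c3 assume c3: "c3 \<in> stab n cl3"
  obtain c1 r1 where cr: "c1 \<in> stab n cl1" "r1 \<in> stab n rw1" "g = c1 \<circ> r1" using eps_nonzero[OF assms] by blast
  show "0 \<le> (if inv c3 \<circ> g \<in> stab n rw3 then sign c3 else 0)"
  proof (cases "inv c3 \<circ> g \<in> stab n rw3")
    case True
    have "c1 \<circ> r1 = c3 \<circ> (inv c3 \<circ> g)" using c3 cr(3) by (simp add: stab_def Sym_cancel(3)[where n=n])
    then have "c3 = id" by (rule forced[OF cr(1,2) c3 True])
    then show ?thesis by (simp add: sign_id)
  qed simp
qed

text \<open>\<open>D1.eps\<close> enters squared, once for each of the two equal characters, so only
  the sign of \<open>D3.eps\<close> counts; the term at \<open>id\<close> is 1.\<close>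

theorem sum_eps_pos: "(\<Sum>g\<in>Sym n. D1.eps g * D1.eps g * D3.eps g) > 0"
proof -
  have nn: "0 \<le> D1.eps g * D1.eps g * D3.eps g" if "g \<in> Sym n" for g
    using eps3_nonneg[OF that] by (cases "D1.eps g = 0") auto
  have "D1.eps id * D1.eps id * D3.eps id \<le> (\<Sum>g\<in>Sym n. D1.eps g * D1.eps g * D3.eps g)"
    using nn by (intro member_le_sum[OF Sym_id]) auto
  then show ?thesis by (simp only: D1.eps_id D3.eps_id)
qed

theorem psi_triple_pos:
  assumes "\<And>i. N \<le> i \<Longrightarrow> a1 i = 0" "\<And>i. N \<le> i \<Longrightarrow> a3 i = 0"
  shows "(\<Sum>p\<in>Sym n. psi {..<n} N (\<lambda>i. int (a1 i) + dl N i) p * psi {..<n} N (\<lambda>i. int (a1 i) + dl N i) p *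
    psi {..<n} N (\<lambda>i. int (a3 i) + dl N i) p) > 0"
proof -
  let ?p1 = "psi {..<n} N (\<lambda>i. int (a1 i) + dl N i)" and ?p3 = "psi {..<n} N (\<lambda>i. int (a3 i) + dl N i)"
  have g1: "gram (Sym n) (\<lambda>h h'. ?p1 (inv h \<circ> h')) (\<lambda>h. D1.eps (inv id \<circ> (inv h \<circ> id)))"
    by (rule D1.psi_gram[OF assms(1) Sym_id Sym_id])
  have g3: "gram (Sym n) (\<lambda>h h'. ?p3 (inv h \<circ> h')) (\<lambda>h. D3.eps (inv id \<circ> (inv h \<circ> id)))"
    by (rule D3.psi_gram[OF assms(2) Sym_id Sym_id])
  have "(\<Sum>h\<in>Sym n. D1.eps (inv h) * D1.eps (inv h) * D3.eps (inv h)) > 0"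
    using sum_eps_pos by (subst sum_Sym_inv)
  then have "(\<Sum>h\<in>Sym n. D1.eps (inv id \<circ> (inv h \<circ> id)) * D1.eps (inv id \<circ> (inv h \<circ> id)) * D3.eps (inv id \<circ> (inv h \<circ> id))) \<noteq> 0"
    by (simp only: inv_id id_o o_id)
  from gram_sum(2)[OF gram_mult[OF gram_mult[OF g1 g1] g3] this]
  have "0 < fact n * (\<Sum>p\<in>Sym n. ?p1 p * ?p1 p * ?p3 p)"
    unfolding sum_Sym_kernel[of "\<lambda>p. ?p1 p * ?p1 p * ?p3 p" n, symmetric] .
  then show ?thesis using fact_gt_zero[of n, where 'a=int] by (simp only: zero_less_mult_iff) linarith
qed

end

section \<open>An explicit pair of tableaux\<close>

text \<open>
  The row \<open>rowf k i u\<close> of the second tableau that receives the entry in row \<open>i\<close> of the \<open>u\<close>-th column of the staircase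
  (the column with entries \<open>i \<le> u\<close>): the first \<open>k\<^sup>2\<close> columns are copied, and the last \<open>k\<close> columns are compressed by a
  factor of up to three at the top.
\<close>

definition rowf :: "nat \<Rightarrow> nat \<Rightarrow> nat \<Rightarrow> nat" where
  "rowf k i u = (if u < k * k \<or> k + (u + 1 - k * k) * (u + 1 - k * k) \<le> i then i
     else max (i div 3) (i - (2 * (u + 1 - k * k) - 1)))"

text \<open>How many entries column \<open>u\<close> of the staircase contributes to row
  \<open>p\<close> of the second tableau.\<close>

definition Dp :: "nat \<Rightarrow> nat \<Rightarrow> nat \<Rightarrow> nat" where
  "Dp k p u = card {i. i \<le> u \<and> rowf k i u = p}"

lemma rowf_le: "rowf k i u \<le> i"
proof -
  have "i div 3 \<le> i" "i - (2 * (u + 1 - k * k) - 1) \<le> i" by simp_all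
  then have "max (i div 3) (i - (2 * (u + 1 - k * k) - 1)) \<le> i" by (rule max.boundedI)
  then show ?thesis unfolding rowf_def by simp
qed

text \<open>Later columns are compressed at least as strongly. This becomes the condition
  \<open>row1\<close> of \<open>diagram_pair\<close>.\<close>

lemma rowf_anti:
  assumes le: "u \<le> u'"
  shows "rowf k i u' \<le> rowf k i u"
proof (cases "u < k * k \<or> k + (u + 1 - k * k) * (u + 1 - k * k) \<le> i")
  case True
  then have "rowf k i u = i" by (simp only: rowf_def if_True)
  then show ?thesis using rowf_le[of k i u'] by (simp only:)
next
  case False
  have "(u + 1 - k * k) * (u + 1 - k * k) \<le> (u' + 1 - k * k) * (u' + 1 - k * k)"
    using le by (intro mult_mono) auto
  then have f: "\<not> (u' < k * k \<or> k + (u' + 1 - k * k) * (u' + 1 - k * k) \<le> i)" using False le by linarith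
  have "max (i div 3) (i - (2 * (u' + 1 - k * k) - 1)) \<le> max (i div 3) (i - (2 * (u + 1 - k * k) - 1))"
    using le by (intro max.mono diff_le_mono2 diff_le_mono mult_le_mono2 add_le_mono1) auto
  then show ?thesis unfolding rowf_def using False f by (simp only: if_False)
qed

lemma Dp_early: "u < k * k \<Longrightarrow> Dp k p u = (if p \<le> u then 1 else 0)"
proof -
  assume "u < k * k"
  then have "{i. i \<le> u \<and> rowf k i u = p} = (if p \<le> u then {p} else {})" by (auto simp: rowf_def)
  then show ?thesis by (simp add: Dp_def)
qed

lemma rowf_late:
  "rowf k i (k * k + t) = (if k + t * t + 2 * t + 1 \<le> i then i else if i < 3 * t + 2 then i div 3 else i - (2 * t + 1))"
proof -
  have e: "k * k + t + 1 - k * k = t + 1" "2 * (t + 1) - 1 = 2 * t + 1" "k + (t + 1) * (t + 1) = k + t * t + 2 * t + 1"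
    by simp_all
  have "max (i div 3) (i - (2 * t + 1)) = (if i < 3 * t + 2 then i div 3 else i - (2 * t + 1))"
  proof (cases "i < 3 * t + 2")
    case True
    then have "i - (2 * t + 1) \<le> i div 3" by presburger
    then show ?thesis unfolding if_P[OF True] by (rule max_absorb1)
  next
    case False
    have "3 * (i div 3) \<le> i" by simp
    with False have "i div 3 + (2 * t + 1) \<le> i" by linarith
    then have "i div 3 \<le> i - (2 * t + 1)" by (rule add_le_imp_le_diff)
    then show ?thesis unfolding if_not_P[OF False] by (rule max_absorb2)
  qed
  moreover have "\<not> k * k + t < k * k" by simp
  ultimately show ?thesis unfolding rowf_def e by (simp only: simp_thms)
qed

lemma late_bounds:
  assumes "t < (k :: nat)"
  shows "k + t * t + t \<le> k * k" "t \<le> t * t"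
proof -
  obtain d where "k = t + 1 + d" using assms by (metis less_iff_Suc_add add_Suc_right add.commute plus_1_eq_Suc add.assoc)
  then show "k + t * t + t \<le> k * k" by (simp add: algebra_simps)
  show "t \<le> t * t" by (cases t) auto
qed

text \<open>Compared with one entry per row, three entries in each row before \<open>t\<close> and
  two in row \<open>t\<close> are a gain of \<open>2 * t + 1\<close>, and as many rows from
  \<open>k + t * t\<close> on receive nothing. For \<open>t < k\<close> these gaps tile the rows
  from \<open>k\<close> up to \<open>k + k * k\<close>, because consecutive odd numbers add up to
  squares; so each of these rows is skipped exactly once.\<close>

lemma Dp_late:
  assumes t: "t < k"
  shows "Dp k p (k * k + t) = (if p < t then 3 else if p = t then 2 else if p < k + t * t then 1
    else if p < k + t * t + 2 * t + 1 then 0 else if p \<le> k * k + t then 1 else 0)"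
proof -
  define s where "s = t * t"
  define q where "q = k * k"
  have b: "k + s + t \<le> q" "t \<le> s" using late_bounds[OF t] by (simp_all add: s_def q_def)
  have mem: "i \<in> {i. i \<le> k * k + t \<and> rowf k i (k * k + t) = p} \<longleftrightarrow>
      i \<le> q + t \<and> (if k + s + 2 * t + 1 \<le> i then i = p else if i < 3 * t + 2 then 3 * p \<le> i \<and> i \<le> 3 * p + 2 else i = p + (2 * t + 1))" for i
  proof -
    have "i div 3 = p \<longleftrightarrow> 3 * p \<le> i \<and> i \<le> 3 * p + 2" by presburger
    moreover have "\<not> i < 3 * t + 2 \<Longrightarrow> i - (2 * t + 1) = p \<longleftrightarrow> i = p + (2 * t + 1)" by linarith
    ultimately show ?thesis
      unfolding mem_Collect_eq rowf_late unfolding s_def[symmetric] q_def[symmetric] by (simp only: split: if_split) blast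
  qed
  have "{i. i \<le> k * k + t \<and> rowf k i (k * k + t) = p} = (if p < t then {3 * p, 3 * p + 1, 3 * p + 2}
    else if p = t then {3 * t, 3 * t + 1} else if p < k + s then {p + 2 * t + 1}
    else if p < k + s + 2 * t + 1 then {} else if p \<le> q + t then {p} else {})"
    (is "?S = ?R")
  proof (rule set_eqI)
    fix i
    consider "p < t" | "p = t" | "t < p" "p < k + s" | "t < p" "k + s \<le> p" "p < k + s + 2 * t + 1"
      | "t < p" "k + s \<le> p" "k + s + 2 * t + 1 \<le> p" using t by linarith
    then show "i \<in> ?S \<longleftrightarrow> i \<in> ?R"
      unfolding mem using b t by cases (cases "k + s + 2 * t + 1 \<le> i"; cases "i < 3 * t + 2"; auto)+
  qed
  then show ?thesis unfolding Dp_def s_def[symmetric] q_def[symmetric] by simp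
qed

text \<open>The length that row \<open>p\<close> of the second tableau has reached after the columns
  below \<open>x\<close> are placed.\<close>

definition Mp :: "nat \<Rightarrow> nat \<Rightarrow> nat \<Rightarrow> nat" where
  "Mp k p x = (\<Sum>u<x. Dp k p u)"

lemma Mp_early: "x \<le> k * k \<Longrightarrow> Mp k p x = x - p"
proof (induction x)
  case (Suc x)
  then show ?case using Dp_early[of x k p] by (simp add: Mp_def Suc_diff_le)
qed (simp add: Mp_def)

lemma Mp_late_small:
  assumes p: "p < k"
  shows "t \<le> k \<Longrightarrow> Mp k p (k * k + t) = k * k + t - p + (if p < t then 2 * (t - p) - 1 else 0)"
proof (induction t)
  case 0
  then show ?case using Mp_early[of "k * k" k p] by simp
next
  case (Suc t)
  have "p < k * k" using p le_square[of k] by linarith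
  then show ?case using Suc Dp_late[of t k p] p by (auto simp: Mp_def)
qed

lemma Mp_late_large:
  assumes p: "k \<le> p"
  shows "t \<le> k \<Longrightarrow> Mp k p (k * k + t) = k * k + t - p - (if p < k + t * t then 1 else 0)"
proof (induction t)
  case 0
  then show ?case using Mp_early[of "k * k" k p] p by simp
next
  case (Suc t)
  then have t: "t < k" by simp
  have "Mp k p (k * k + Suc t) = Mp k p (k * k + t) + Dp k p (k * k + t)" by (simp add: Mp_def)
  also have "\<dots> = k * k + Suc t - p - (if p < k + t * t + 2 * t + 1 then 1 else 0)"
    using Suc.IH t Dp_late[OF t, of p] late_bounds[OF t] p by auto
  finally show ?case by (simp add: algebra_simps)
qed

text \<open>This interlacing says that the entries coming from one column form a horizontal strip.
  It is the source of \<open>col3\<close>, the strict growth of \<open>u\<close> down the columns of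
  the second tableau.\<close>

lemma Mp_strip:
  assumes x: "x < k * k + k"
  shows "Mp k (Suc p) (Suc x) \<le> Mp k p x"
proof (cases "Suc x \<le> k * k")
  case True
  then show ?thesis using Mp_early[of "Suc x" k "Suc p"] Mp_early[of x k p] by simp
next
  case False
  define t where "t = x - k * k"
  have xt: "x = k * k + t" and t: "t < k" using False x by (simp_all add: t_def)
  have sx: "Suc x = k * k + Suc t" by (simp add: xt)
  consider "Suc p < k" | "Suc p = k" | "k \<le> p" by linarith
  then show ?thesis
  proof cases
    case 1
    then show ?thesis unfolding sx unfolding xt using t Mp_late_small[of "Suc p" k "Suc t"] Mp_late_small[of p k t] by auto
  next
    case 2
    then show ?thesis unfolding sx unfolding xt using t Mp_late_large[of k "Suc p" "Suc t"] Mp_late_small[of p k t] by auto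
  next
    case 3
    have "t * t \<le> Suc t * Suc t" by (intro mult_mono) auto
    then have "p < k + t * t \<Longrightarrow> Suc p < k + Suc t * Suc t" by simp
    then show ?thesis unfolding sx unfolding xt using 3 t Mp_late_large[of k "Suc p" "Suc t"] Mp_late_large[of k p t]
      by (auto simp del: mult_Suc mult_Suc_right)
  qed
qed

lemma Mp_mono: "x \<le> y \<Longrightarrow> Mp k p x \<le> Mp k p y"
  unfolding Mp_def by (rule sum_mono2) auto

lemma Mp_strips:
  assumes x: "x < k * k + k"
  shows "p < q \<Longrightarrow> Mp k q (Suc x) \<le> Mp k p x"
proof (induction q)
  case (Suc q)
  show ?case
  proof (cases "p = q")
    case True
    then show ?thesis using Mp_strip[OF x] by simp
  next
    case False
    then have "Mp k q (Suc x) \<le> Mp k p x" using Suc by simp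
    moreover have "Mp k (Suc q) (Suc x) \<le> Mp k q x" by (rule Mp_strip[OF x])
    moreover have "Mp k q x \<le> Mp k q (Suc x)" by (rule Mp_mono) simp
    ultimately show ?thesis by linarith
  qed
qed simp

text \<open>Copying all columns would give row \<open>p\<close> the length
  \<open>k * k + k - p\<close>. A row \<open>p < k\<close> gains 1 at \<open>t = p\<close> and 2 at
  each later \<open>t\<close>, in all \<open>2 * (k - p) - 1\<close>; each nonempty row from
  \<open>k\<close> on loses 1.\<close>

lemma Mp_total:
  "Mp k p (k * k + k) = (k * k + k - 1 - p) + 2 * (k - p)"
proof (cases "p < k")
  case True
  have "k \<le> k * k" by (rule le_square)
  then show ?thesis using Mp_late_small[OF True, of k] True by simp
next
  case False
  then show ?thesis using Mp_late_large[of k p k] by auto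
qed

lemma rank_bij:
  fixes key :: "'a \<Rightarrow> nat"
  assumes fin: "finite Y" and inj: "inj_on key Y"
  shows "bij_betw (\<lambda>y. card {z \<in> Y. key z < key y}) Y {..<card Y}"
proof -
  let ?r = "\<lambda>y. card {z \<in> Y. key z < key y}"
  have lt: "?r y < ?r y'" if "y \<in> Y" "y' \<in> Y" "key y < key y'" for y y'
  proof (rule psubset_card_mono)
    show "{z \<in> Y. key z < key y} \<subset> {z \<in> Y. key z < key y'}" using that by auto
  qed (use fin in simp)
  have "inj_on ?r Y"
  proof (rule inj_onI)
    fix y y' assume y: "y \<in> Y" "y' \<in> Y" "?r y = ?r y'"
    then have "key y = key y'" using lt[of y y'] lt[of y' y] by (cases "key y" "key y'" rule: linorder_cases) auto
    then show "y = y'" using inj y by (auto simp: inj_on_def)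
  qed
  moreover have "?r ` Y \<subseteq> {..<card Y}"
  proof
    fix x assume "x \<in> ?r ` Y"
    then obtain y where y: "y \<in> Y" "x = ?r y" by blast
    have "{z \<in> Y. key z < key y} \<subset> Y" using y(1) by auto
    then show "x \<in> {..<card Y}" using psubset_card_mono[OF fin] y(2) by simp
  qed
  ultimately show ?thesis
    unfolding bij_betw_def by (intro conjI card_subset_eq) (simp_all add: card_image)
qed

text \<open>The first tableau is arbitrary, with \<open>u\<close> numbering its columns from the
  right, so that column \<open>u\<close> has \<open>u + 1\<close> entries. The second tableau has
  the rows \<open>R3\<close>, each sorted by \<open>u\<close> first; its row lengths come from
  \<open>Mp_total\<close> and its column condition from \<open>Mp_strips\<close>.\<close>

theorem staircase_triple_pos:
  assumes k: "k \<ge> 1" and m: "m = k * k + k" and n: "sum_list (staircase m) = n"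
    and \<nu>: "\<nu> \<in> partitions_of n" "\<And>p. pt \<nu> p = (m - 1 - p) + 2 * (k - p)"
  shows "kron n (staircase m) (staircase m) \<nu> > 0"
proof -
  let ?\<rho> = "staircase m"
  have \<rho>: "?\<rho> \<in> partitions_of n" using n staircase_partition by (simp add: partitions_of_def)
  obtain t where "t \<in> tableaux ?\<rho>" using tableaux_nonempty by blast
  then interpret T: tableau ?\<rho> t using staircase_partition by unfold_locales
  let ?rw = "T.rw" and ?cl = "T.cl"
  define b1 where "b1 j = length (filter (\<lambda>p. j < p) ?\<rho>)" for j
  have D1: "diagram n ?rw ?cl (pt ?\<rho>) b1" using T.diagram_axioms unfolding n b1_def[abs_def] .
  interpret D1: diagram n ?rw ?cl "pt ?\<rho>" b1 by (rule D1)
  define u where "u x = m - 1 - ?cl x" for x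
  have pos: "?rw x \<le> u x \<and> u x < m \<and> ?cl x = m - 1 - u x" if "x < n" for x
  proof -
    have "?cl x < pt ?\<rho> (?rw x)" using D1.mem[of "?rw x" "?cl x"] that by blast
    then show ?thesis by (auto simp: pt_staircase u_def)
  qed
  have ex: "\<exists>x<n. ?rw x = i \<and> u x = v" if "i \<le> v" "v < m" for i v
  proof -
    have "m - 1 - v < pt ?\<rho> i" using that by (simp add: pt_staircase)
    then obtain x where "x < n" "?rw x = i" "?cl x = m - 1 - v" using D1.mem by blast
    then show ?thesis using that by (intro exI[of _ x]) (auto simp: u_def)
  qed
  have uniq: "x = y" if "x < n" "y < n" "?rw x = ?rw y" "u x = u y" for x y
    using D1.inj[OF that(1-3)] pos[OF that(1)] pos[OF that(2)] that(4) by simp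
  define R3 where "R3 x = rowf k (?rw x) (u x)" for x
  \<comment> \<open>Lexicographic order by \<open>u\<close> and then by the row in the staircase,
    packed into one number; the row is less than \<open>m\<close>.\<close>
  define key where "key x = u x * m + ?rw x" for x
  define C3 where "C3 x = card {y \<in> {y \<in> {..<n}. R3 y = R3 x}. key y < key x}" for x
  have key_less: "key x < key y" if "u x < u y" "x < n" for x y
  proof -
    have "key x < Suc (u x) * m" using pos[OF that(2)] by (simp add: key_def)
    also have "\<dots> \<le> u y * m" using that by (intro mult_right_mono) auto
    finally show ?thesis by (simp add: key_def)
  qed
  have key_inj: "inj_on key {..<n}"
  proof (rule inj_onI)
    fix x y assume xy: "x \<in> {..<n}" "y \<in> {..<n}" "key x = key y"
    then have "u x = u y" using key_less[of x y] key_less[of y x] by (cases "u x" "u y" rule: linorder_cases) auto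
    then have "?rw x = ?rw y" using xy by (simp add: key_def)
    with xy \<open>u x = u y\<close> show "x = y" using uniq[of x y] by simp
  qed
  have cardD: "card {x \<in> {..<n}. R3 x = p \<and> u x = v} = Dp k p v" if v: "v < m" for p v
  proof -
    let ?A = "{x \<in> {..<n}. R3 x = p \<and> u x = v}" and ?I = "{i. i \<le> v \<and> rowf k i v = p}"
    have "bij_betw ?rw ?A ?I"
    proof (rule bij_betw_imageI)
      show "inj_on ?rw ?A" by (rule inj_onI, rule uniq) auto
      show "?rw ` ?A = ?I"
      proof (intro equalityI subsetI)
        fix i assume "i \<in> ?rw ` ?A"
        then obtain x where "x < n" "R3 x = p" "u x = v" "i = ?rw x" by auto
        then show "i \<in> ?I" using pos[of x] by (auto simp: R3_def)
      next
        fix i assume i: "i \<in> ?I"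
        then obtain x where "x < n" "?rw x = i" "u x = v" using ex[of i v] v by auto
        then show "i \<in> ?rw ` ?A" using i by (intro image_eqI[of _ _ x]) (auto simp: R3_def)
      qed
    qed
    then show ?thesis by (simp add: Dp_def bij_betw_same_card)
  qed
  have cardM: "card {x \<in> {..<n}. R3 x = p \<and> u x < U} = Mp k p U" if U: "U \<le> m" for p U
  proof -
    have "card {x \<in> {..<n}. R3 x = p \<and> u x < U} = card (\<Union>v<U. {x \<in> {..<n}. R3 x = p \<and> u x = v})"
      by (rule arg_cong[where f=card]) auto
    also have "\<dots> = (\<Sum>v<U. card {x \<in> {..<n}. R3 x = p \<and> u x = v})" by (rule card_UN_disjoint) auto
    also have "\<dots> = Mp k p U" unfolding Mp_def using U by (intro sum.cong refl cardD) simp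
    finally show ?thesis .
  qed
  have row: "card {x \<in> {..<n}. R3 x = p} = pt \<nu> p" for p
  proof -
    have "{x \<in> {..<n}. R3 x = p} = {x \<in> {..<n}. R3 x = p \<and> u x < m}" using pos by blast
    then show ?thesis using cardM[of m p] Mp_total[of k p] \<nu>(2)[of p] m by simp
  qed
  have C3: "bij_betw C3 {x \<in> {..<n}. R3 x = p} {..<pt \<nu> p}" for p
  proof -
    have "bij_betw (\<lambda>y. card {z \<in> {x \<in> {..<n}. R3 x = p}. key z < key y}) {x \<in> {..<n}. R3 x = p} {..<card {x \<in> {..<n}. R3 x = p}}"
      by (rule rank_bij) (auto intro: inj_on_subset[OF key_inj])
    then show ?thesis unfolding row
      by (rule bij_betw_cong[THEN iffD1, rotated]) (simp add: C3_def)
  qed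
  have \<nu>p: "is_partition \<nu>" using partitions_ofD[OF \<nu>(1)] by blast
  have D3: "diagram n R3 C3 (pt \<nu>) (\<lambda>j. length (filter (\<lambda>p. j < p) \<nu>))"
  proof
    show "x = y" if "x < n" "y < n" "R3 x = R3 y" "C3 x = C3 y" for x y
      using C3[of "R3 y"] that by (auto simp: bij_betw_def inj_on_def)
    show "(\<exists>x<n. R3 x = i \<and> C3 x = j) \<longleftrightarrow> j < pt \<nu> i" for i j
    proof -
      have "(\<exists>x<n. R3 x = i \<and> C3 x = j) \<longleftrightarrow> j \<in> C3 ` {x \<in> {..<n}. R3 x = i}" by auto
      also have "\<dots> \<longleftrightarrow> j < pt \<nu> i" using C3[of i] by (simp add: bij_betw_def)
      finally show ?thesis .
    qed
    show "j < pt \<nu> i \<longleftrightarrow> i < length (filter (\<lambda>p. j < p) \<nu>)" for i j by (rule lt_pt_iff[OF \<nu>p])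
  qed
  interpret P: diagram_pair n ?rw ?cl "pt ?\<rho>" b1 R3 C3 "pt \<nu>" "\<lambda>j. length (filter (\<lambda>p. j < p) \<nu>)" u
  proof (rule diagram_pair.intro[OF D1 D3], unfold_locales)
    show "u x = u y" if "?cl x = ?cl y" for x y using that by (simp add: u_def)
    show "R3 y \<le> R3 x" if "x < n" "y < n" "?rw x = ?rw y" "u x \<le> u y" for x y
      using rowf_anti[OF that(4), of k "?rw y"] that(3) by (simp add: R3_def)
    \<comment> \<open>Were \<open>u x\<close> at least \<open>u y\<close>, all entries in the row of
      \<open>x\<close> with smaller \<open>u\<close> than \<open>y\<close> would precede
      \<open>x\<close>, while the position of \<open>y\<close> is less than the number of entries of
      its row with \<open>u\<close> at most \<open>u y\<close>. The strip inequality then gives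
      \<open>C3 y < C3 x\<close>.\<close>
    show "u x < u y" if x: "x < n" and y: "y < n" and c: "C3 x = C3 y" and r: "R3 x < R3 y" for x y
    proof (rule ccontr)
      assume uu: "\<not> u x < u y"
      have "card {z \<in> {..<n}. R3 z = R3 x \<and> u z < u y} \<le> C3 x"
        unfolding C3_def by (rule card_mono) (use uu key_less[of _ x] in auto)
      then have 1: "Mp k (R3 x) (u y) \<le> C3 x" using cardM[of "u y" "R3 x"] pos[OF y] by simp
      have "card (insert y {z \<in> {z \<in> {..<n}. R3 z = R3 y}. key z < key y}) \<le> card {z \<in> {..<n}. R3 z = R3 y \<and> u z < Suc (u y)}"
      proof (rule card_mono)
        have "u z \<le> u y" if "key z < key y" for z
        proof (rule ccontr)
          assume "\<not> u z \<le> u y"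
          then have "key y < key z" using y by (intro key_less) auto
          then show False using that by simp
        qed
        then show "insert y {z \<in> {z \<in> {..<n}. R3 z = R3 y}. key z < key y} \<subseteq> {z \<in> {..<n}. R3 z = R3 y \<and> u z < Suc (u y)}"
          using y by (auto simp: less_Suc_eq_le)
      qed simp
      then have "Suc (C3 y) \<le> Mp k (R3 y) (Suc (u y))"
        using cardM[of "Suc (u y)" "R3 y"] pos[OF y] by (simp add: C3_def)
      moreover have "Mp k (R3 y) (Suc (u y)) \<le> Mp k (R3 x) (u y)"
        using pos[OF y] r m by (intro Mp_strips) auto
      ultimately show False using 1 c by simp
    qed
  qed
  have z1: "pt ?\<rho> i = 0" "pt \<nu> i = 0" if "n \<le> i" for i
    using partitions_ofD[OF \<rho>] partitions_ofD[OF \<nu>(1)] that by (simp_all add: pt_beyond)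
  from P.psi_triple_pos[of n, OF z1] show ?thesis by (simp add: kron_def bt_def[abs_def])
qed

section \<open>The lower bound for the Kronecker coefficient\<close>

lemma pt_domino_extension_Nil: "pt (domino_extension (staircase j) lam []) i = (j - i) + 2 * pt lam i"
proof -
  let ?s = "part_sum (staircase j) (double_parts (conjugate []))"
  have N: "conjugate [] = []" by (simp add: conjugate_def)
  have s: "is_partition ?s"
    by (intro is_partition_part_sum is_partition_double_parts staircase_partition) (simp add: N is_partition_def)
  have pts: "pt ?s c = j - c" for c by (simp add: N pt_part_sum pt_double_parts pt_staircase)
  have "c < pt (conjugate ?s) i \<longleftrightarrow> c < j - i" for c
    using pt_conjugate_iff[OF s, of c i] by (auto simp: pts)
  then have "pt (conjugate ?s) i = j - i" by (metis linorder_neqE_nat less_irrefl)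
  then show ?thesis by (simp add: domino_extension_def pt_part_sum pt_double_parts)
qed

theorem theorem5p11:
  fixes k w n :: nat and \<tau> lam \<mu> :: "nat list"
  assumes "k \<ge> 1"
    and "w = k * (k + 1) div 2"
    and "n = w * (2 * w + 1)"
    and "\<tau> = staircase (2 * w - 1)"
    and "is_partition lam" and "is_partition \<mu>"
    and "lr_coeff (staircase k) lam (conjugate \<mu>) > 0"
  shows "int (kronecker n (staircase (2 * w)) (staircase (2 * w)) (domino_extension \<tau> lam \<mu>))
           \<ge> lr_coeff (staircase k) lam (conjugate \<mu>)
         \<and> lr_coeff (staircase k) lam (conjugate \<mu>) > 0"
proof -
  define a b where "a = sum_list lam" and "b = sum_list \<mu>"
  have lam: "lam \<in> partitions_of a" and mu: "\<mu> \<in> partitions_of b"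
    using assms(5,6) by (simp_all add: partitions_of_def a_def b_def)
  note cmu = conjugate_partition[OF mu]
  let ?\<rho> = "staircase (2 * w)" and ?lr = "\<lambda>\<alpha>. lr_coeff \<alpha> lam (conjugate \<mu>)"
  let ?g = "\<lambda>\<kappa>. int (kronecker n ?\<rho> ?\<rho> \<kappa>)"
  have w2: "2 * w = k * k + k" unfolding assms(2) by (subst dvd_mult_div_cancel) auto
  have w1: "w \<ge> 1" using w2 assms(1) by (cases w) auto
  have sk: "sum_list (staircase k) = w" using sum_staircase[of k] w2 by simp
  \<comment> \<open>A positive coefficient forces matching sizes, since \<open>lr_coeff\<close> is 0
    otherwise.\<close>
  have "staircase k \<in> partitions_of (a + b)"
    using lr_coeff_LRk(2)[OF lam cmu, of "staircase k"] assms(7) by force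
  then have ab: "a + b = w" using sk by (simp add: partitions_of_def)
  have \<rho>: "?\<rho> \<in> partitions_of n"
    using sum_staircase[of "2 * w"] staircase_partition by (simp add: partitions_of_def assms(3) algebra_simps)
  have P: "domino_extension \<tau> lam' mu' \<in> partitions_of n"
    if "lam' \<in> partitions_of a'" "mu' \<in> partitions_of b'" "a' + b' = w" for lam' mu' a' b'
    unfolding assms(4) by (rule dom_partition[OF w1 assms(3) refl refl that])
  have g: "kron n ?\<rho> ?\<rho> \<kappa> = fact n * ?g \<kappa>" if "\<kappa> \<in> partitions_of n" for \<kappa>
    by (rule kronecker_kron[OF \<rho> \<rho> that, symmetric])
  have lr: "LRk a b \<alpha> lam (conjugate \<mu>) = fact a * fact b * ?lr \<alpha>" and lr0: "0 \<le> ?lr \<alpha>"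
    if "\<alpha> \<in> partitions_of w" for \<alpha>
  proof -
    have \<alpha>: "\<alpha> \<in> partitions_of (a + b)" using that ab by simp
    show e: "LRk a b \<alpha> lam (conjugate \<mu>) = fact a * fact b * ?lr \<alpha>"
      by (rule lr_coeff_LRk(1)[OF lam cmu \<alpha>, symmetric])
    have "0 \<le> fact a * (fact b * ?lr \<alpha>)"
      using LRk_nonneg[OF lam cmu \<alpha>] unfolding e by (simp only: mult.assoc)
    then show "0 \<le> ?lr \<alpha>" by (rule fact_mult_nonneg[OF fact_mult_nonneg])
  qed
  have "(fact a * fact b * fact n) * ?g (domino_extension \<tau> lam \<mu>) =
      fact a * fact b * kron n ?\<rho> ?\<rho> (domino_extension \<tau> lam \<mu>)"
    by (simp add: g[OF P[OF lam mu ab]])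
  also have "\<dots> = (\<Sum>\<alpha>\<in>partitions_of w. LRk a b \<alpha> lam (conjugate \<mu>) * kron n ?\<rho> ?\<rho> (domino_extension \<tau> \<alpha> []))"
    unfolding assms(4) by (rule kron_domino[OF w1 assms(3) refl refl lam mu ab])
  also have "\<dots> = (fact a * fact b * fact n) * (\<Sum>\<alpha>\<in>partitions_of w. ?lr \<alpha> * ?g (domino_extension \<tau> \<alpha> []))"
    unfolding sum_distrib_left
  proof (rule sum.cong[OF refl])
    fix \<alpha> assume \<alpha>: "\<alpha> \<in> partitions_of w"
    show "LRk a b \<alpha> lam (conjugate \<mu>) * kron n ?\<rho> ?\<rho> (domino_extension \<tau> \<alpha> []) =
        fact a * fact b * fact n * (?lr \<alpha> * ?g (domino_extension \<tau> \<alpha> []))"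
      unfolding lr[OF \<alpha>] g[OF P[OF \<alpha> Nil_partition add_0_right]] by (simp only: mult_ac)
  qed
  finally have eq: "?g (domino_extension \<tau> lam \<mu>) = (\<Sum>\<alpha>\<in>partitions_of w. ?lr \<alpha> * ?g (domino_extension \<tau> \<alpha> []))"
    by simp
  have skw: "staircase k \<in> partitions_of w" using sk staircase_partition by (simp add: partitions_of_def)
  have "kron n ?\<rho> ?\<rho> (domino_extension \<tau> (staircase k) []) > 0"
  proof (rule staircase_triple_pos[OF assms(1) w2])
    show "domino_extension \<tau> (staircase k) [] \<in> partitions_of n" by (rule P[OF skw Nil_partition]) simp
    show "pt (domino_extension \<tau> (staircase k) []) p = (2 * w - 1 - p) + 2 * (k - p)" for p
      by (simp add: assms(4) pt_domino_extension_Nil pt_staircase)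
  qed (use \<rho> in \<open>simp add: partitions_of_def\<close>)
  then have "0 < fact n * ?g (domino_extension \<tau> (staircase k) [])"
    by (simp only: g[OF P[OF skw Nil_partition add_0_right]])
  then have g1: "1 \<le> ?g (domino_extension \<tau> (staircase k) [])"
    by (cases "kronecker n ?\<rho> ?\<rho> (domino_extension \<tau> (staircase k) [])") simp_all
  \<comment> \<open>All terms of the sum \<open>eq\<close> are nonnegative, so the one for
    \<open>staircase k\<close>, whose Kronecker factor is at least 1, already gives the
    bound.\<close>
  have "?lr (staircase k) * 1 \<le> ?lr (staircase k) * ?g (domino_extension \<tau> (staircase k) [])"
    by (rule mult_left_mono[OF g1 lr0[OF skw]])
  also have "\<dots> \<le> (\<Sum>\<alpha>\<in>partitions_of w. ?lr \<alpha> * ?g (domino_extension \<tau> \<alpha> []))"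
    by (rule member_le_sum[OF skw]) (auto intro: mult_nonneg_nonneg lr0)
  finally show ?thesis using assms(7) eq by simp
qed

end
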